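(* Let $\Omega\subset\mathbb{R}^N$ be open and bounded, and let $A:\Omega\times\mathbb{R}\times\mathbb{R}^N\to\mathbb{R}^N$, $(x,u,\xi)\mapsto A(x,u,\xi)$, be a (time-independent) Caratheodory vector field for which there are constants $\Lambda,C>0$ and nonnegative $\tilde b,\tilde c\in L^1(\Omega)$ such that for a.e. $x\in\Omega$, all $u,u_1,u_2\in\mathbb{R}$, all $\xi,\eta\in\mathbb{R}^N$ and all $i\in\{1,\dots,N\}$: $$|A_i(x,u,\xi)|\leq\Lambda\Big(\sum_{k=1}^N|\xi_k|^{p_k}+\tilde b(x)\Big)^{\frac{p_i-1}{p_i}},$$ $$|A_i(x,u_1,\xi)-A_i(x,u_2,\xi)|\leq C|u_1-u_2|\Big(\tilde c(x)+\sum_{k=1}^N|\xi_k|^{p_k}\Big)^{\frac{p_i-1}{p_i}},$$ $$\big(A(x,u,\xi)-A(x,u,\eta)\big)\cdot(\xi-\eta)\geq0.$$ Let $w$ be a solution to the Cauchy-Dirichlet problem with initial data $w_0$, nonnegative boundary data $g$ and right-hand side $f_2\in L^{\frac{\alpha+1}{\alpha}}(\Omega)$. Let $v$ be a solution to the Cauchy-Dirichlet problem with initial data $v_0\leq w_0$, vanishing boundary data (i.e. $v\in L^{\bf p}(0,T;\overline W^{1,{\bf p}}_{\rm o}(\Omega))$), and right-hand side $f_1\in L^{\frac{\alpha+1}{\alpha}}(\Omega)$ with $f_1\leq f_2$. Then $v\leq w$ (a.e.) on $\Omega_T$.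
   Context: Parameters: $N\ge1$, $T>0$, $\alpha>0$, ${\bf p}=(p_1,\dots,p_N)$ with all $p_j>1$. $\Omega_T:=\Omega\times(0,T)$; $\nabla,\partial_j$ are weak spatial derivatives; $|u|^{\alpha-1}u:=0$ when $u=0$. The right-hand sides $f_1,f_2$ are independent of time. Caratheodory: $x\mapsto A(x,u,\xi)$ is measurable for every $(u,\xi)$ and $(u,\xi)\mapsto A(x,u,\xi)$ is continuous for a.e. $x\in\Omega$. Spaces: $W^{1,{\bf p}}(\Omega):=\{v\in W^{1,1}(\Omega): \partial_i v\in L^{p_i}(\Omega),\ i=1,\dots,N\}$. $\overline W^{1,{\bf p}}_{\rm o}(\Omega)$ is the closure of $C^\infty_{\rm o}(\Omega)$ (smooth compactly supported functions) in $W^{1,{\bf p}}(\Omega)$ with respect to the norm $\|u\|_{L^1(\Omega)}+\sum_{j=1}^N\|\partial_j u\|_{L^{p_j}(\Omega)}$. $L^{\bf p}(0,T;W^{1,{\bf p}}(\Omega)):=\{v\in L^1(0,T;W^{1,1}(\Omega)): \partial_i v\in L^{p_i}(\Omega_T)\}$. $L^{\bf p}(0,T;\overline W^{1,{\bf p}}_{\rm o}(\Omega))$ is the space of (equivalence classes of) measurable functions $u:(0,T)\to\overline W^{1,{\bf p}}_{\rm o}(\Omega)$ with $u\in L^1(0,T;L^1(\Omega))$ and $\partial_k u\in L^{p_k}(0,T;L^{p_k}(\Omega))$ for all $k$; its elements are identified with functions on $\Omega_T$. Solution of the Cauchy-Dirichlet problem with initial data $u_0\in L^{\alpha+1}(\Omega)$,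 boundary data $g\in L^{\bf p}(0,T;W^{1,{\bf p}}(\Omega))$ and right-hand side $f$, i.e. of $\partial_t(|u|^{\alpha-1}u)-\nabla\cdot A(x,u,\nabla u)=f$ in $\Omega_T$, $u(x,0)=u_0(x)$, $u=g$ on $\partial\Omega\times(0,T)$: a function $u\in L^{\bf p}(0,T;W^{1,{\bf p}}(\Omega))\cap C([0,T];L^{\alpha+1}(\Omega))$ such that (1) $\iint_{\Omega_T}A(x,u,\nabla u)\cdot\nabla\varphi-|u|^{\alpha-1}u\,\partial_t\varphi\,dx\,dt=\iint_{\Omega_T}f\varphi\,dx\,dt$ for all $\varphi\in C^\infty_{\rm o}(\Omega_T)$; (2) $u(t)\to u_0$ in $L^{\alpha+1}(\Omega)$ as $t\to0$; (3) $u\in g+L^{\bf p}(0,T;\overline W^{1,{\bf p}}_{\rm o}(\Omega))$. Nonnegative boundary data means $g\ge0$ a.e. in $\Omega_T$. *)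

theory Defs
  imports "HOL-Analysis.Analysis"
begin

text \<open>
  Elements of Lebesgue and Sobolev spaces are represented by functions on the whole type; only
  their values on the underlying set matter, and membership in these spaces is invariant under
  changes on null sets. Points of the space-time cylinder are pairs \<open>(x, t)\<close>.
\<close>

definition Lp :: "'a::euclidean_space set \<Rightarrow> real \<Rightarrow> ('a \<Rightarrow> real) set" where
  "Lp S q = {f. f \<in> borel_measurable (lebesgue_on S) \<and>
                integrable (lebesgue_on S) (\<lambda>x. \<bar>f x\<bar> powr q)}"

definition Lp_norm :: "'a::euclidean_space set \<Rightarrow> real \<Rightarrow> ('a \<Rightarrow> real) \<Rightarrow> real" where
  "Lp_norm S q f = (integral\<^sup>L (lebesgue_on S) (\<lambda>x. \<bar>f x\<bar> powr q)) powr (1 / q)"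

definition dir_deriv :: "'a::euclidean_space \<Rightarrow> ('a \<Rightarrow> real) \<Rightarrow> 'a \<Rightarrow> real" where
  "dir_deriv b f x = frechet_derivative f (at x) b"

primrec Ck :: "nat \<Rightarrow> ('a::euclidean_space \<Rightarrow> real) \<Rightarrow> bool" where
  "Ck 0 f \<longleftrightarrow> continuous_on UNIV f"
| "Ck (Suc k) f \<longleftrightarrow> (\<forall>x. f differentiable (at x)) \<and> (\<forall>b. Ck k (dir_deriv b f))"

text \<open>Functions in \<open>C\<^sub>o\<^sup>\<infinity>(U)\<close> are extended by zero to the whole space.\<close>

definition test_functions :: "'a::euclidean_space set \<Rightarrow> ('a \<Rightarrow> real) set" where
  "test_functions U = {\<phi>. (\<forall>k. Ck k \<phi>) \<and>
     compact (closure {x. \<phi> x \<noteq> 0}) \<and> closure {x. \<phi> x \<noteq> 0} \<subseteq> U}"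

definition locally_integrable :: "'a::euclidean_space set \<Rightarrow> ('a \<Rightarrow> real) \<Rightarrow> bool" where
  "locally_integrable U f \<longleftrightarrow> (\<forall>K. compact K \<and> K \<subseteq> U \<longrightarrow> set_integrable lebesgue K f)"

definition has_weak_deriv ::
    "'a::euclidean_space set \<Rightarrow> 'a \<Rightarrow> ('a \<Rightarrow> real) \<Rightarrow> ('a \<Rightarrow> real) \<Rightarrow> bool" where
  "has_weak_deriv U b f d \<longleftrightarrow> locally_integrable U f \<and> locally_integrable U d \<and>
     (\<forall>\<phi>\<in>test_functions U.
        integral\<^sup>L (lebesgue_on U) (\<lambda>x. f x * dir_deriv b \<phi> x) =
        - integral\<^sup>L (lebesgue_on U) (\<lambda>x. d x * \<phi> x))"

definition weakly_differentiable ::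
    "'a::euclidean_space set \<Rightarrow> 'a \<Rightarrow> ('a \<Rightarrow> real) \<Rightarrow> bool" where
  "weakly_differentiable U b f \<longleftrightarrow> (\<exists>d. has_weak_deriv U b f d)"

text \<open>On an open set the weak derivative is unique up to null sets; this picks a representative.\<close>

definition weak_deriv ::
    "'a::euclidean_space set \<Rightarrow> 'a \<Rightarrow> ('a \<Rightarrow> real) \<Rightarrow> 'a \<Rightarrow> real" where
  "weak_deriv U b f = (SOME d. has_weak_deriv U b f d)"

definition W11 :: "(real^'n) set \<Rightarrow> (real^'n \<Rightarrow> real) set" where
  "W11 \<Omega> = {v \<in> Lp \<Omega> 1. \<forall>i. weakly_differentiable \<Omega> (axis i 1) v \<and>
                               weak_deriv \<Omega> (axis i 1) v \<in> Lp \<Omega> 1}"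

definition W1p :: "(real^'n) set \<Rightarrow> ('n \<Rightarrow> real) \<Rightarrow> (real^'n \<Rightarrow> real) set" where
  "W1p \<Omega> p = {v \<in> W11 \<Omega>. \<forall>i. weak_deriv \<Omega> (axis i 1) v \<in> Lp \<Omega> (p i)}"

definition W1p_norm :: "(real^'n) set \<Rightarrow> ('n \<Rightarrow> real) \<Rightarrow> (real^'n \<Rightarrow> real) \<Rightarrow> real" where
  "W1p_norm \<Omega> p v = Lp_norm \<Omega> 1 v + (\<Sum>j\<in>UNIV. Lp_norm \<Omega> (p j) (weak_deriv \<Omega> (axis j 1) v))"

definition W1p_o :: "(real^'n) set \<Rightarrow> ('n \<Rightarrow> real) \<Rightarrow> (real^'n \<Rightarrow> real) set" where
  "W1p_o \<Omega> p = {v \<in> W1p \<Omega> p.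
     \<forall>\<epsilon>>0. \<exists>\<phi>\<in>test_functions \<Omega>. W1p_norm \<Omega> p (\<lambda>x. v x - \<phi> x) < \<epsilon>}"

text \<open>
  \<open>X\<close> is a space of functions with norm \<open>nrm\<close>; measurability of a curve in \<open>X\<close> is strong (Bochner)
  measurability, i.e. being an almost everywhere limit of simple functions.
\<close>

definition strongly_measurable ::
    "real set \<Rightarrow> ('a \<Rightarrow> real) set \<Rightarrow> (('a \<Rightarrow> real) \<Rightarrow> real) \<Rightarrow> (real \<Rightarrow> 'a \<Rightarrow> real) \<Rightarrow> bool" where
  "strongly_measurable I X nrm u \<longleftrightarrow>
     (\<exists>s. (\<forall>k::nat. simple_function (lebesgue_on I) (s k) \<and> (\<forall>t\<in>I. s k t \<in> X)) \<and>
          (AE t in lebesgue_on I. u t \<in> X \<and> (\<lambda>k. nrm (\<lambda>x. s k t x - u t x)) \<longlonglongrightarrow> 0))"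

definition bochner_Lp ::
    "real set \<Rightarrow> real \<Rightarrow> ('a \<Rightarrow> real) set \<Rightarrow> (('a \<Rightarrow> real) \<Rightarrow> real) \<Rightarrow> (real \<Rightarrow> 'a \<Rightarrow> real) set" where
  "bochner_Lp I q X nrm = {u. strongly_measurable I X nrm u \<and>
                              integrable (lebesgue_on I) (\<lambda>t. nrm (u t) powr q)}"

definition slice :: "('a \<times> real \<Rightarrow> real) \<Rightarrow> real \<Rightarrow> 'a \<Rightarrow> real" where
  "slice v t x = v (x, t)"

abbreviation cylinder :: "(real^'n) set \<Rightarrow> real \<Rightarrow> ((real^'n) \<times> real) set" where
  "cylinder \<Omega> T \<equiv> \<Omega> \<times> {0<..<T}"

abbreviation weak_partial ::
    "(real^'n) set \<Rightarrow> real \<Rightarrow> 'n \<Rightarrow> ((real^'n) \<times> real \<Rightarrow> real) \<Rightarrow> (real^'n) \<times> real \<Rightarrow> real" where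
  "weak_partial \<Omega> T i \<equiv> weak_deriv (cylinder \<Omega> T) (axis i 1, 0)"

text \<open>
  \<open>L\<^sup>p(0,T;W\<^sup>1\<^sup>,\<^sup>p(\<Omega>))\<close> and \<open>L\<^sup>p(0,T;W\<^sub>o\<^sup>1\<^sup>,\<^sup>p(\<Omega>))\<close> consist here of functions on the cylinder, a curve being
  identified with the jointly measurable function whose time slices it describes. The condition
  \<open>\<partial>\<^sub>i v \<in> L\<^sup>p(\<Omega>\<^sub>T)\<close> in the first space refers to the weak derivative on the open cylinder.
\<close>

definition Lp_W1p ::
    "(real^'n) set \<Rightarrow> real \<Rightarrow> ('n \<Rightarrow> real) \<Rightarrow> ((real^'n) \<times> real \<Rightarrow> real) set" where
  "Lp_W1p \<Omega> T p = {v \<in> borel_measurable (lebesgue_on (cylinder \<Omega> T)).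
     slice v \<in> bochner_Lp {0<..<T} 1 (W11 \<Omega>) (W1p_norm \<Omega> (\<lambda>_. 1)) \<and>
     (\<forall>i. weakly_differentiable (cylinder \<Omega> T) (axis i 1, 0) v \<and>
          weak_partial \<Omega> T i v \<in> Lp (cylinder \<Omega> T) (p i))}"

definition Lp_W1p_o ::
    "(real^'n) set \<Rightarrow> real \<Rightarrow> ('n \<Rightarrow> real) \<Rightarrow> ((real^'n) \<times> real \<Rightarrow> real) set" where
  "Lp_W1p_o \<Omega> T p = {v \<in> borel_measurable (lebesgue_on (cylinder \<Omega> T)).
     strongly_measurable {0<..<T} (W1p_o \<Omega> p) (W1p_norm \<Omega> p) (slice v) \<and>
     slice v \<in> bochner_Lp {0<..<T} 1 (Lp \<Omega> 1) (Lp_norm \<Omega> 1) \<and>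
     (\<forall>k. (\<lambda>t. weak_deriv \<Omega> (axis k 1) (slice v t))
            \<in> bochner_Lp {0<..<T} (p k) (Lp \<Omega> (p k)) (Lp_norm \<Omega> (p k)))}"

definition C_Lp :: "(real^'n) set \<Rightarrow> real \<Rightarrow> real \<Rightarrow> (real \<Rightarrow> real^'n \<Rightarrow> real) set" where
  "C_Lp \<Omega> T q = {U. \<forall>t\<in>{0..T}. U t \<in> Lp \<Omega> q \<and>
     ((\<lambda>s. Lp_norm \<Omega> q (\<lambda>x. U s x - U t x)) \<longlongrightarrow> 0) (at t within {0..T})}"

definition caratheodory ::
    "(real^'n) set \<Rightarrow> (real^'n \<Rightarrow> real \<Rightarrow> real^'n \<Rightarrow> real^'n) \<Rightarrow> bool" where
  "caratheodory \<Omega> A \<longleftrightarrow>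
     (\<forall>u \<xi>. (\<lambda>x. A x u \<xi>) \<in> borel_measurable (lebesgue_on \<Omega>)) \<and>
     (AE x in lebesgue_on \<Omega>. continuous_on UNIV (\<lambda>(u, \<xi>). A x u \<xi>))"

definition weak_grad ::
    "(real^'n) set \<Rightarrow> real \<Rightarrow> ((real^'n) \<times> real \<Rightarrow> real) \<Rightarrow> (real^'n) \<times> real \<Rightarrow> real^'n" where
  "weak_grad \<Omega> T u z = (\<chi> i. weak_partial \<Omega> T i u z)"

definition space_grad :: "((real^'n) \<times> real \<Rightarrow> real) \<Rightarrow> (real^'n) \<times> real \<Rightarrow> real^'n" where
  "space_grad \<phi> z = (\<chi> i. dir_deriv (axis i 1, 0) \<phi> z)"

definition time_deriv :: "((real^'n) \<times> real \<Rightarrow> real) \<Rightarrow> (real^'n) \<times> real \<Rightarrow> real" where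
  "time_deriv = dir_deriv (0, 1)"

text \<open>
  \<open>cd_solution \<Omega> T \<alpha> p A f g u\<^sub>0 u\<close>: \<open>u\<close> solves the problem with right-hand side \<open>f\<close>, lateral boundary
  data \<open>g\<close> and initial data \<open>u\<^sub>0\<close>. Since \<open>u\<close> is a function on the cylinder, determined only up to
  null sets, \<open>u \<in> C([0,T];L\<^sup>\<alpha>\<^sup>+\<^sup>1(\<Omega>))\<close> means that it has a representative \<open>U\<close> which is a continuous
  curve, and the initial condition refers to that curve. As \<open>0 powr a = 0\<close> and the power is
  multiplied by \<open>u\<close>, the convention \<open>|u|\<^sup>\<alpha>\<^sup>-\<^sup>1u = 0\<close> for \<open>u = 0\<close> holds automatically.
\<close>

definition cd_solution ::
    "(real^'n) set \<Rightarrow> real \<Rightarrow> real \<Rightarrow> ('n \<Rightarrow> real) \<Rightarrow> (real^'n \<Rightarrow> real \<Rightarrow> real^'n \<Rightarrow> real^'n) \<Rightarrow>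
     (real^'n \<Rightarrow> real) \<Rightarrow> ((real^'n) \<times> real \<Rightarrow> real) \<Rightarrow> (real^'n \<Rightarrow> real) \<Rightarrow>
     ((real^'n) \<times> real \<Rightarrow> real) \<Rightarrow> bool" where
  "cd_solution \<Omega> T \<alpha> p A f g u\<^sub>0 u \<longleftrightarrow>
     u \<in> Lp_W1p \<Omega> T p \<and>
     (\<exists>U\<in>C_Lp \<Omega> T (\<alpha> + 1).
        (AE t in lebesgue_on {0<..<T}. AE x in lebesgue_on \<Omega>. u (x, t) = U t x) \<and>
        ((\<lambda>t. Lp_norm \<Omega> (\<alpha> + 1) (\<lambda>x. U t x - u\<^sub>0 x)) \<longlongrightarrow> 0) (at_right 0)) \<and>
     (\<forall>\<phi>\<in>test_functions (cylinder \<Omega> T).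
        integral\<^sup>L (lebesgue_on (cylinder \<Omega> T))
          (\<lambda>z. A (fst z) (u z) (weak_grad \<Omega> T u z) \<bullet> space_grad \<phi> z
               - \<bar>u z\<bar> powr (\<alpha> - 1) * u z * time_deriv \<phi> z) =
        integral\<^sup>L (lebesgue_on (cylinder \<Omega> T)) (\<lambda>z. f (fst z) * \<phi> z)) \<and>
     (\<lambda>z. u z - g z) \<in> Lp_W1p_o \<Omega> T p"

end

theory Submission
  imports Defs
begin

text \<open>
The proof doubles the time variable, in the manner of Kruzhkov. Neither solution has a time
derivative that is a function, and \<open>A(x,v,.) - A(x,w,.)\<close> is only small where \<open>v - w\<close> is small, so the
difference of the two equations cannot be tested with a function of \<open>v - w\<close> at equal times. Instead
\<open>v\<close> is taken at \<open>(x,t)\<close>, \<open>w\<close> at \<open>(x,s)\<close>, and both equations are tested with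
\<open>step ((v(x,t) - w(x,s)) / \<delta>)\<close>, a smooth approximation of the indicator of \<open>{v(x,t) > w(x,s)}\<close>:
the equation of \<open>v\<close> for fixed \<open>s\<close>, that of \<open>w\<close> for fixed \<open>t\<close> and with the opposite sign.

These functions are admissible at almost every pair of times because \<open>v\<close> and \<open>w - g\<close> are limits of
test functions and \<open>g \<ge> 0\<close>: if a test function \<open>\<psi>\<close> approximates \<open>v - (w - g)\<close>, then \<open>\<psi> - g \<le> 0\<close> off the
support of \<open>\<psi>\<close>, so \<open>step\<close> vanishes there, also after \<open>g\<close> has been mollified
(\<open>truncation_step\<close>, \<open>approximable_truncation\<close>).

Write \<open>y\<close> for \<open>|u|\<^sup>\<alpha>\<^sup>-\<^sup>1u\<close>. While \<open>k = y(x,s)\<close> of the other solution is frozen, the parabolic term is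
controlled by the convex function \<open>truncated_part\<close> of \<open>y\<close>, whose derivative is the test function.
Convexity bounds difference quotients in time, so only the equation integrated over \<open>(t-h,t]\<close> is
used and the chain rule costs nothing but an inequality (\<open>chain_rule_inequality\<close>). Adding both
inequalities, integrated against \<open>\<kappa>(t) \<kappa>(s)\<close>, leaves the elliptic term
\<open>(A(x,v,\<nabla>v) - A(x,w,\<nabla>w)) \<bullet> (\<nabla>v - \<nabla>w) step'((v-w)/\<delta>) / \<delta>\<close>. As \<open>A\<close> is independent of time both fluxes
belong to the same field; monotonicity and the Lipschitz condition bound this from below by a
fixed integrable function times \<open>step'((v-w)/\<delta>) |v-w|/\<delta>\<close>, which is bounded and lives on
\<open>{0 < v - w < \<delta>}\<close>. These sets shrink to the empty set, so the term vanishes as \<open>\<delta> \<rightarrow> 0\<close> by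
dominated convergence; the sources have the right sign. The outcome (\<open>doubling_limit\<close>) is
\<open>0 \<le> \<integral> max (y\<^sub>v(x,t) - y\<^sub>w(x,s)) 0 * (\<kappa>'(t) \<kappa>(s) + \<kappa>(t) \<kappa>'(s))\<close>.

With \<open>\<kappa>\<close> a bump at \<open>r\<close> the right-hand side is minus the derivative in \<open>r\<close> of a double average of
\<open>max (y\<^sub>v - y\<^sub>w) 0\<close>. Narrowing the bump shows that \<open>r \<mapsto> \<integral> max (y\<^sub>v(.,r) - y\<^sub>w(.,r)) 0\<close> is nonincreasing;
it starts at \<open>0\<close> since \<open>v\<^sub>0 \<le> w\<^sub>0\<close>, hence it is \<open>0\<close> (\<open>comparison_from_doubling\<close>).

The last ingredient is \<open>solution_data\<close>, which turns a solution into Borel functions on the whole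
space that vanish off the cylinder, so that all integrals are over \<open>lborel\<close> and Fubini applies.
\<close>

abbreviation Borel :: "('a::topological_space => 'b::topological_space) set" where
  "Borel \<equiv> borel_measurable borel"

section \<open>Smooth functions\<close>

lemma dir_deriv_eqI: "(f has_derivative f') (at x) ==> dir_deriv b f x = f' b"
  unfolding dir_deriv_def by (simp flip: frechet_derivative_at)

text \<open>\<open>Ck\<close> is phrased through directional Frechet derivatives; this introduction rule lets each closure property supply the derivative it knows.\<close>
lemma Ck_SucI:
  assumes "\<And>x. (f has_derivative F x) (at x)" and "\<And>b. Ck k (\<lambda>x. F x b)"
  shows "Ck (Suc k) f"
proof -
  have "dir_deriv b f = (\<lambda>x. F x b)" for b using dir_deriv_eqI[OF assms(1)] by auto
  then show ?thesis using assms by (auto simp: differentiable_def)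
qed

lemma Ck_has_derivative:
  assumes "Ck (Suc k) f" shows "(f has_derivative (\<lambda>b. dir_deriv b f x)) (at x)"
  using assms unfolding dir_deriv_def by (simp add: frechet_derivative_works[symmetric])

lemma Ck_dir_deriv: "Ck (Suc k) f ==> Ck k (dir_deriv b f)" by simp

lemma Ck_SucD: "Ck (Suc k) f ==> Ck k f"
proof (induction k arbitrary: f)
  case 0
  then have "f differentiable (at x)" for x by simp
  then show ?case
    by (metis Ck.simps(1) continuous_at_imp_continuous_on differentiable_imp_continuous_within)
next
  case (Suc k) then show ?case by simp
qed

lemma Ck_le: "Ck n f ==> k \<le> n ==> Ck k f"
  by (induction n) (auto simp: le_Suc_eq dest: Ck_SucD simp del: Ck.simps)

lemma Ck_const: "Ck k (\<lambda>x. c)"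
proof (induction k arbitrary: c)
  case (Suc k) show ?case by (rule Ck_SucI[where F="\<lambda>x h. 0"]) (auto intro: Suc)
qed simp

lemma Ck_add: "Ck k f ==> Ck k g ==> Ck k (\<lambda>x. f x + g x)"
proof (induction k arbitrary: f g)
  case 0 then show ?case by (auto intro: continuous_intros)
next
  case (Suc k)
  show ?case
    by (rule Ck_SucI, rule has_derivative_add[OF Suc.prems[THEN Ck_has_derivative]])
       (intro Suc.IH Suc.prems[THEN Ck_dir_deriv])
qed

lemma Ck_mult: "Ck k f ==> Ck k g ==> Ck k (\<lambda>x. f x * g x)"
proof (induction k arbitrary: f g)
  case 0 then show ?case by (auto intro: continuous_intros)
next
  case (Suc k)
  show ?case
    by (rule Ck_SucI, rule has_derivative_mult[OF Suc.prems[THEN Ck_has_derivative]])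
       (intro Ck_add Suc.IH Suc.prems[THEN Ck_dir_deriv] Suc.prems[THEN Ck_SucD])
qed

lemma Ck_uminus: "Ck k f ==> Ck k (\<lambda>x. - f x)"
  using Ck_mult[OF Ck_const[of k "-1"]] by simp

lemma Ck_diff: "Ck k f ==> Ck k g ==> Ck k (\<lambda>x. f x - g x)"
  using Ck_add[OF _ Ck_uminus] by fastforce

lemma Ck_sum: "(\<And>i. i \<in> I ==> Ck k (f i)) ==> Ck k (\<lambda>x. \<Sum>i\<in>I. f i x)"
  by (induction I rule: infinite_finite_induct) (auto intro: Ck_const Ck_add)

lemma Ck_affine:
  fixes f :: "'a::euclidean_space => real" and L :: "'b::euclidean_space => 'a"
  assumes L: "bounded_linear L"
  shows "Ck k f ==> Ck k (\<lambda>x. f (c + L x))"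
proof (induction k arbitrary: f)
  case 0
  have "continuous_on UNIV (\<lambda>x. c + L x)" by (intro continuous_intros linear_continuous_on L)
  then show ?case using 0 continuous_on_compose2[of UNIV f UNIV] by simp
next
  case (Suc k)
  have "((\<lambda>x. c + L x) has_derivative L) (at x)" for x
    by (auto intro!: derivative_eq_intros bounded_linear_imp_has_derivative L)
  from has_derivative_compose[OF this Ck_has_derivative[OF Suc.prems]]
  show ?case by (rule Ck_SucI) (intro Suc.IH Suc.prems[THEN Ck_dir_deriv])
qed

lemma dir_deriv_affine:
  fixes f :: "'a::euclidean_space => real" and L :: "'b::euclidean_space => 'a"
  assumes L: "bounded_linear L" and f: "Ck (Suc 0) f"
  shows "dir_deriv b (\<lambda>x. f (c + L x)) x = dir_deriv (L b) f (c + L x)"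
proof -
  have "((\<lambda>x. c + L x) has_derivative L) (at x)" for x
    by (auto intro!: derivative_eq_intros bounded_linear_imp_has_derivative L)
  from has_derivative_compose[OF this Ck_has_derivative[OF f]] show ?thesis by (rule dir_deriv_eqI)
qed

lemma Ck_bounded_linear:
  fixes L :: "'a::euclidean_space => real"
  assumes L: "bounded_linear L" shows "Ck k L"
proof (cases k)
  case 0 then show ?thesis by (simp add: linear_continuous_on L)
next
  case (Suc m)
  show ?thesis unfolding Suc
    by (rule Ck_SucI[OF bounded_linear_imp_has_derivative[OF L]]) (rule Ck_const)
qed

lemma dir_deriv_real_scale:
  fixes h :: "real => real"
  assumes "Ck (Suc 0) h" shows "dir_deriv c h y = c * dir_deriv 1 h y"
  using linear_simps(5)[OF has_derivative_bounded_linear[OF Ck_has_derivative[OF assms, of y]], of c 1]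
  by simp

lemma Ck_compose: "Ck k h ==> Ck k f ==> Ck k (\<lambda>x. h (f x :: real))"
proof (induction k arbitrary: h f)
  case 0 then show ?case by (auto intro: continuous_on_compose2)
next
  case (Suc k)
  have chain: "((\<lambda>x. h (f x)) has_derivative (\<lambda>b. dir_deriv (dir_deriv b f x) h (f x))) (at x)" for x
    using has_derivative_compose[OF Ck_has_derivative[OF Suc.prems(2)] Ck_has_derivative[OF Suc.prems(1)]] .
  have "Ck (Suc 0) h" using Suc.prems(1) by (rule Ck_le) simp
  then have "((\<lambda>x. h (f x)) has_derivative (\<lambda>b. dir_deriv b f x * dir_deriv 1 h (f x))) (at x)" for x
    by (intro has_derivative_eq_rhs[OF chain] ext) (rule dir_deriv_real_scale)
  then show ?case
    by (rule Ck_SucI)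
       (rule Ck_mult[OF Ck_dir_deriv[OF Suc.prems(2)]
          Suc.IH[OF Ck_dir_deriv[OF Suc.prems(1)] Ck_SucD[OF Suc.prems(2)]]])
qed

lemma dir_deriv_real:
  fixes h :: "real => real"
  assumes "Ck (Suc 0) h" shows "(h has_real_derivative dir_deriv 1 h x) (at x)"
  unfolding has_field_derivative_def
  by (rule has_derivative_eq_rhs[OF Ck_has_derivative[OF assms]])
     (rule ext, rule trans[OF dir_deriv_real_scale[OF assms] mult.commute])

text \<open>The derivative of \<open>1/f\<close> is \<open>- f' (1/f)\<^sup>2\<close>, so the induction hypothesis applies to \<open>1/f\<close> itself.\<close>
lemma Ck_inverse: "Ck k f ==> (\<And>x. f x \<noteq> 0) ==> Ck k (\<lambda>x. inverse (f x))"
proof (induction k arbitrary: f)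
  case 0 then show ?case by (auto intro: continuous_intros)
next
  case (Suc k)
  have "((\<lambda>x. inverse (f x)) has_derivative (\<lambda>b. - (inverse (f x) * dir_deriv b f x * inverse (f x)))) (at x)" for x
    using Deriv.has_derivative_inverse[OF Suc.prems(2) Ck_has_derivative[OF Suc.prems(1)]] .
  then show ?case
    by (rule Ck_SucI)
       (intro Ck_uminus Ck_mult Suc.IH Suc.prems(1)[THEN Ck_dir_deriv] Suc.prems(1)[THEN Ck_SucD] Suc.prems(2))
qed

text \<open>The family \<open>x\<^sup>-\<^sup>m exp (-1/x)\<close> is closed under differentiation up to linear combinations, which makes smoothness of all its members one induction.\<close>
definition flat :: "nat => real => real" where
  "flat m x = (if x > 0 then (1 / x) ^ m * exp (- 1 / x) else 0)"

lemma flat_nonneg: "flat m x \<ge> 0" and flat_pos_iff: "flat m x > 0 \<longleftrightarrow> x > 0"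
  by (auto simp: flat_def)

lemma flat_tendsto_0: "(flat m \<longlongrightarrow> 0) (at 0)"
proof -
  have 1: "((\<lambda>x::real. (1 / x) ^ m * exp (- 1 / x)) \<longlongrightarrow> 0) (at_right 0)"
  proof -
    have "((\<lambda>y::real. y ^ m / exp y) \<longlongrightarrow> 0) at_top" by (rule tendsto_power_div_exp_0)
    then have "((\<lambda>x::real. (inverse x) ^ m / exp (inverse x)) \<longlongrightarrow> 0) (at_right 0)"
      by (rule filterlim_compose[OF _ filterlim_inverse_at_top_right])
    then show ?thesis by (simp add: exp_minus field_simps)
  qed
  have r: "(flat m \<longlongrightarrow> 0) (at_right 0)"
    by (rule Lim_transform_eventually[OF 1])
       (auto simp: flat_def eventually_at_right_less intro: eventually_mono[OF eventually_at_right_less])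
  have "(flat m \<longlongrightarrow> 0) (at_left 0)"
    by (rule Lim_transform_eventually[OF tendsto_const])
       (auto simp: flat_def intro!: eventually_at_leftI[of "-1"])
  with r show ?thesis by (simp add: filterlim_split_at)
qed

lemma flat_has_derivative:
  "(flat m has_real_derivative (- real m * flat (Suc m) x + flat (Suc (Suc m)) x)) (at x)"
proof -
  consider "x > 0" | "x < 0" | "x = 0" by linarith
  then show ?thesis
  proof cases
    case 1
    have "((\<lambda>x. 1 / x) has_real_derivative - ((1 / x)\<^sup>2)) (at x)"
      using 1 by (auto intro!: derivative_eq_intros simp: power2_eq_square)
    from DERIV_mult[OF DERIV_power[OF this, of m] DERIV_chain2[OF DERIV_exp DERIV_minus[OF this]]]
    have "((\<lambda>x. (1 / x) ^ m * exp (- (1 / x))) has_real_derivative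
        real m * (- ((1 / x)\<^sup>2) * (1 / x) ^ (m - Suc 0)) * exp (- (1 / x)) +
        exp (- (1 / x)) * - (- ((1 / x)\<^sup>2)) * (1 / x) ^ m) (at x)" .
    moreover have "real m * (- (r\<^sup>2) * r ^ (m - Suc 0)) * E + E * - (- (r\<^sup>2)) * r ^ m
        = - real m * (r ^ Suc m * E) + r ^ Suc (Suc m) * E" for r E :: real
      by (cases m) (auto simp: power2_eq_square algebra_simps)
    ultimately have "((\<lambda>x. (1 / x) ^ m * exp (- 1 / x)) has_real_derivative
        (- real m * flat (Suc m) x + flat (Suc (Suc m)) x)) (at x)"
      using 1 by (simp only: flat_def if_True minus_divide_left)
    then show ?thesis
      by (rule has_field_derivative_transform_within_open[where S="{0<..}"]) (use 1 in \<open>auto simp: flat_def\<close>)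
  next
    case 2
    have "((\<lambda>x. 0) has_real_derivative (- real m * flat (Suc m) x + flat (Suc (Suc m)) x)) (at x)"
      using 2 by (auto simp: flat_def)
    then show ?thesis
      by (rule has_field_derivative_transform_within_open[where S="{..<0}"]) (use 2 in \<open>auto simp: flat_def\<close>)
  next
    case 3
    have "(\<lambda>y. (flat m y - flat m 0) / (y - 0)) = flat (Suc m)" by (auto simp: flat_def fun_eq_iff)
    moreover have "- real m * flat (Suc m) x + flat (Suc (Suc m)) x = 0" using 3 by (simp add: flat_def)
    ultimately show ?thesis
      unfolding has_field_derivative_iff using flat_tendsto_0[of "Suc m"] 3 by simp
  qed
qed

lemma Ck_flat: "Ck k (flat m)"
proof (induction k arbitrary: m)
  case 0
  show ?case using flat_has_derivative
    by (metis Ck.simps(1) DERIV_isCont continuous_at_imp_continuous_on)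
next
  case (Suc k)
  show ?case
    by (rule Ck_SucI, rule has_derivative_eq_rhs[OF flat_has_derivative[unfolded has_field_derivative_def]])
       (rule refl, intro Ck_mult Ck_add Ck_const Suc)
qed

text \<open>A smooth monotone transition from \<open>0\<close> on the negative axis to \<open>1\<close> beyond \<open>1\<close>; all truncations and time cut-offs are rescalings of it.\<close>
definition step :: "real => real" where
  "step s = flat 0 s / (flat 0 s + flat 0 (1 - s))"

abbreviation step' :: "real => real" where "step' \<equiv> dir_deriv 1 step"

lemma step_denominator_pos: "flat 0 s + flat 0 (1 - s) > 0"
  using flat_nonneg[of 0 s] flat_nonneg[of 0 "1 - s"] flat_pos_iff[of 0 s] flat_pos_iff[of 0 "1 - s"]
  by linarith

lemma Ck_step: "Ck k step"
proof -
  have "bounded_linear (\<lambda>s::real. - s)" by (intro bounded_linear_minus bounded_linear_ident)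
  from Ck_affine[OF this Ck_flat, where c=1] have 1: "Ck k (\<lambda>s. flat 0 (1 - s))" for k by simp
  have "flat 0 s + flat 0 (1 - s) \<noteq> 0" for s using step_denominator_pos[of s] by simp
  from Ck_mult[OF Ck_flat[of k 0] Ck_inverse[OF Ck_add[OF Ck_flat[of k 0] 1] this]]
  show ?thesis by (simp add: step_def[abs_def] divide_inverse)
qed

lemma step_nonneg: "step s \<ge> 0" and step_le_1: "step s \<le> 1"
  and step_eq_0: "s \<le> 0 ==> step s = 0" and step_eq_1: "s \<ge> 1 ==> step s = 1"
  using step_denominator_pos[of s] flat_nonneg[of 0 s] flat_nonneg[of 0 "1 - s"]
  by (auto simp: step_def flat_def)

lemma step_has_derivative: "(step has_real_derivative step' s) (at s)"
  by (intro dir_deriv_real Ck_step)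

lemma step'_continuous: "continuous_on UNIV step'"
  using Ck_dir_deriv[OF Ck_step, of 0] by simp

text \<open>All these points are global extrema of \<open>step\<close>.\<close>
lemma step'_eq_0: assumes "s \<le> 0 \<or> s \<ge> 1" shows "step' s = 0"
  using assms
proof
  assume "s \<le> 0"
  then show ?thesis
    by (intro DERIV_local_min[OF step_has_derivative, of 1]) (auto simp: step_eq_0 step_nonneg)
next
  assume "s \<ge> 1"
  then show ?thesis
    by (intro DERIV_local_max[OF step_has_derivative, of 1]) (auto simp: step_eq_1 step_le_1)
qed

lemma step'_nonneg: "step' s \<ge> 0"
proof -
  let ?d = "flat 0 s + flat 0 (1 - s)"
  have f': "(flat 0 has_real_derivative flat 2 x) (at x)" for x
    using flat_has_derivative[of 0 x] by (simp add: numeral_2_eq_2)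
  have "((\<lambda>s. flat 0 (1 - s)) has_real_derivative flat 2 (1 - s) * (0 - 1)) (at s)"
    by (intro DERIV_chain2[OF f'] derivative_intros)
  from DERIV_divide[OF f' DERIV_add[OF f' this]] step_denominator_pos[of s]
  have "(step has_real_derivative
      (flat 2 s * ?d - flat 0 s * (flat 2 s + flat 2 (1 - s) * (0 - 1))) / (?d * ?d)) (at s)"
    by (simp add: step_def[abs_def])
  then have "step' s = (flat 2 s * ?d - flat 0 s * (flat 2 s + flat 2 (1 - s) * (0 - 1))) / (?d * ?d)"
    using DERIV_unique[OF step_has_derivative] by blast
  also have "\<dots> = (flat 2 s * flat 0 (1 - s) + flat 0 s * flat 2 (1 - s)) / (?d * ?d)"
    by (simp add: algebra_simps)
  also have "\<dots> \<ge> 0" by (intro divide_nonneg_nonneg add_nonneg_nonneg mult_nonneg_nonneg flat_nonneg)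
  finally show ?thesis .
qed

lemma step'_bounded: obtains L where "L > 0" "\<And>s. step' s \<le> L"
proof -
  have "compact (step' ` {0..1})"
    by (intro compact_continuous_image continuous_on_subset[OF step'_continuous]) auto
  then obtain L where L: "\<And>s. s \<in> {0..1} ==> norm (step' s) \<le> L"
    by (meson bounded_iff compact_imp_bounded imageI)
  have "step' s \<le> max L 1" for s
    using L[of s] step'_eq_0[of s] by (cases "s \<in> {0..1}") auto
  then show ?thesis by (intro that[of "max L 1"]) auto
qed

lemma step_mono: "s \<le> t ==> step s \<le> step t"
  by (rule DERIV_nonneg_imp_nondecreasing) (auto intro: step_has_derivative step'_nonneg)

section \<open>Test functions\<close>

lemma test_functionI:
  assumes "\<And>k. Ck k \<phi>" "compact K" "K \<subseteq> U" "\<And>x. x \<notin> K ==> \<phi> x = 0"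
  shows "\<phi> \<in> test_functions U"
proof -
  have "closure {x. \<phi> x \<noteq> 0} \<subseteq> K" using assms by (intro closure_minimal) (auto intro: compact_imp_closed)
  moreover from this have "compact (closure {x. \<phi> x \<noteq> 0})"
    using \<open>compact K\<close> by (metis closed_closure compact_Int_closed inf.absorb2)
  ultimately show ?thesis using assms by (auto simp: test_functions_def)
qed

lemma test_function_support:
  assumes "\<phi> \<in> test_functions U"
  obtains K where "compact K" "K \<subseteq> U" "\<And>x. x \<notin> K ==> \<phi> x = 0" "\<And>b x. x \<notin> K ==> dir_deriv b \<phi> x = 0"
proof (rule that[of "closure {x. \<phi> x \<noteq> 0}"])
  fix b x assume x: "x \<notin> closure {x. \<phi> x \<noteq> 0}"
  have "(\<phi> has_derivative (\<lambda>h. 0)) (at x)"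
  proof (rule has_derivative_transform_within_open)
    show "((\<lambda>x. 0) has_derivative (\<lambda>h. 0)) (at x)" by simp
    show "open (- closure {x. \<phi> x \<noteq> 0})" by auto
    show "x \<in> - closure {x. \<phi> x \<noteq> 0}" using x by simp
    show "0 = \<phi> y" if "y \<in> - closure {x. \<phi> x \<noteq> 0}" for y
      using that closure_subset[of "{x. \<phi> x \<noteq> 0}"] by auto
  qed
  then show "dir_deriv b \<phi> x = 0" by (rule dir_deriv_eqI)
qed (use assms closure_subset[of "{x. \<phi> x \<noteq> 0}"] in \<open>auto simp: test_functions_def\<close>)

lemma test_function_Ck: "\<phi> \<in> test_functions U ==> Ck k \<phi>"
  by (auto simp: test_functions_def)

lemma test_function_dir_deriv: "\<phi> \<in> test_functions U ==> dir_deriv b \<phi> \<in> test_functions U"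
  using test_function_support[of \<phi> U] test_functionI[of "dir_deriv b \<phi>" _ U]
    Ck_dir_deriv[OF test_function_Ck[of \<phi> U]] by metis

lemma test_function_diff: "\<phi> \<in> test_functions U ==> \<psi> \<in> test_functions U ==> (\<lambda>x. \<phi> x - \<psi> x) \<in> test_functions U"
proof -
  assume \<phi>: "\<phi> \<in> test_functions U" and \<psi>: "\<psi> \<in> test_functions U"
  obtain K L where "compact K" "K \<subseteq> U" "compact L" "L \<subseteq> U"
      "\<And>x. x \<notin> K ==> \<phi> x = 0" "\<And>x. x \<notin> L ==> \<psi> x = 0"
    using \<phi> \<psi> test_function_support by metis
  then show ?thesis
    by (intro test_functionI[where K="K \<union> L"] Ck_diff test_function_Ck[OF \<phi>] test_function_Ck[OF \<psi>]) auto
qed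

lemma dir_deriv_diff:
  assumes "Ck (Suc 0) f" "Ck (Suc 0) g"
  shows "dir_deriv b (\<lambda>x. f x - g x) x = dir_deriv b f x - dir_deriv b g x"
  by (rule dir_deriv_eqI has_derivative_diff Ck_has_derivative assms)+

lemma test_function_continuous: "\<phi> \<in> test_functions U ==> continuous_on UNIV \<phi>"
  using test_function_Ck[of \<phi> U 0] by simp

lemma test_function_borel: "\<phi> \<in> test_functions U ==> \<phi> \<in> Borel"
  by (intro borel_measurable_continuous_onI test_function_continuous)

lemma continuous_compact_support_bounded:
  fixes f :: "'a::euclidean_space => real"
  assumes "continuous_on UNIV f" "compact K" "\<And>x. x \<notin> K ==> f x = 0"
  obtains B where "B > 0" "\<And>x. \<bar>f x\<bar> \<le> B"
proof -
  have "compact (f ` K)" by (intro compact_continuous_image continuous_on_subset[OF assms(1)] assms) auto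
  then obtain L where L: "\<And>s. s \<in> K ==> norm (f s) \<le> L"
    by (meson bounded_iff compact_imp_bounded imageI)
  have "\<bar>f s\<bar> \<le> max L 1" for s using L[of s] assms(3)[of s] by (cases "s \<in> K") auto
  then show ?thesis by (intro that[of "max L 1"]) auto
qed

lemma test_function_bounded:
  assumes "\<phi> \<in> test_functions U" obtains B where "B > 0" "\<And>x. \<bar>\<phi> x\<bar> \<le> B"
  using assms test_function_support continuous_compact_support_bounded test_function_continuous by metis

lemma continuous_compact_support_integrable:
  fixes f :: "'a::euclidean_space => real"
  assumes "continuous_on UNIV f" "compact K" "\<And>x. x \<notin> K ==> f x = 0"
  shows "integrable lborel f"
proof -
  have "integrable lborel (\<lambda>x. indicator K x *\<^sub>R f x)"
    by (rule borel_integrable_compact) (auto intro: assms continuous_on_subset)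
  moreover have "(\<lambda>x. indicator K x *\<^sub>R f x) = f" using assms(3) by (auto simp: indicator_def fun_eq_iff)
  ultimately show ?thesis by simp
qed

lemma test_function_integrable: "\<phi> \<in> test_functions U ==> integrable lborel \<phi>"
  by (meson test_function_support continuous_compact_support_integrable test_function_continuous)

text \<open>Tensor products of test functions in space and in time are test functions on the cylinder; they separate the variables in the weak equation.\<close>
lemma test_function_product:
  assumes \<phi>: "\<phi> \<in> test_functions U" and \<eta>: "\<eta> \<in> test_functions V"
  shows "(\<lambda>z. \<phi> (fst z) * \<eta> (snd z)) \<in> test_functions (U \<times> V)"
    and "dir_deriv (b, 0) (\<lambda>z. \<phi> (fst z) * \<eta> (snd z)) (x, t) = dir_deriv b \<phi> x * \<eta> t"
    and "dir_deriv (0, c) (\<lambda>z. \<phi> (fst z) * \<eta> (snd z)) (x, t) = \<phi> x * dir_deriv c \<eta> t"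
proof -
  note smooth = test_function_Ck[OF \<phi>] test_function_Ck[OF \<eta>]
  have f: "Ck k (\<lambda>z::'a \<times> 'b. \<phi> (fst z))" for k
    using Ck_affine[OF bounded_linear_fst smooth(1), where c=0] by simp
  have s: "Ck k (\<lambda>z::'a \<times> 'b. \<eta> (snd z))" for k
    using Ck_affine[OF bounded_linear_snd smooth(2), where c=0] by simp
  obtain K L where "compact K" "K \<subseteq> U" "compact L" "L \<subseteq> V"
      and supp: "\<And>x. x \<notin> K ==> \<phi> x = 0" "\<And>x. x \<notin> L ==> \<eta> x = 0"
    using \<phi> \<eta> test_function_support by metis
  moreover have "\<phi> (fst z) * \<eta> (snd z) = 0" if "z \<notin> K \<times> L" for z
    using supp that by (cases z) (metis mem_Sigma_iff mult_zero_left mult_zero_right fst_conv snd_conv)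
  ultimately show "(\<lambda>z. \<phi> (fst z) * \<eta> (snd z)) \<in> test_functions (U \<times> V)"
    by (intro test_functionI[where K="K \<times> L"] Ck_mult f s compact_Times) auto
  have d: "((\<lambda>z. \<phi> (fst z) * \<eta> (snd z)) has_derivative
      (\<lambda>h. \<phi> x * dir_deriv (snd h) \<eta> t + dir_deriv (fst h) \<phi> x * \<eta> t)) (at (x, t))"
    using has_derivative_mult[OF has_derivative_compose[OF has_derivative_fst[OF has_derivative_ident] Ck_has_derivative[OF smooth(1)]]
      has_derivative_compose[OF has_derivative_snd[OF has_derivative_ident] Ck_has_derivative[OF smooth(2)]], of "(x, t)"] by simp
  have 0: "dir_deriv 0 \<phi> x = 0" "dir_deriv 0 \<eta> t = 0"
    using linear_simps(3)[OF has_derivative_bounded_linear[OF Ck_has_derivative[OF smooth(1)]]]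
      linear_simps(3)[OF has_derivative_bounded_linear[OF Ck_has_derivative[OF smooth(2)]]] by auto
  show "dir_deriv (b, 0) (\<lambda>z. \<phi> (fst z) * \<eta> (snd z)) (x, t) = dir_deriv b \<phi> x * \<eta> t"
    "dir_deriv (0, c) (\<lambda>z. \<phi> (fst z) * \<eta> (snd z)) (x, t) = \<phi> x * dir_deriv c \<eta> t"
    using dir_deriv_eqI[OF d, of "(b, 0)"] dir_deriv_eqI[OF d, of "(0, c)"] 0 by auto
qed

section \<open>Mollifiers\<close>

definition bump :: "'a::euclidean_space => real" where "bump x = flat 0 (1 - x \<bullet> x)"

lemma Ck_bump: "Ck k (bump :: 'a::euclidean_space => real)"
proof -
  have "(\<lambda>x::'a. x \<bullet> x) = (\<lambda>x. \<Sum>i\<in>Basis. (x \<bullet> i) * (x \<bullet> i))"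
    by (rule ext) (rule euclidean_inner)
  then have "Ck k (\<lambda>x::'a. x \<bullet> x)"
    by (simp only:) (intro Ck_sum Ck_mult Ck_bounded_linear bounded_linear_inner_left)
  then show ?thesis unfolding bump_def[abs_def] by (intro Ck_compose[OF Ck_flat] Ck_diff Ck_const)
qed

definition mollifier :: "real => 'a::euclidean_space => real" where
  "mollifier e x = bump (x /\<^sub>R e) / (LBINT y. bump ((y::'a) /\<^sub>R e))"

lemma Ck_bump_scale: "Ck k (\<lambda>x::'a::euclidean_space. bump (x /\<^sub>R e))"
  using Ck_affine[OF bounded_linear_scaleR_right Ck_bump, where c=0] by simp

lemma Ck_mollifier: "Ck k (mollifier e)"
  unfolding mollifier_def[abs_def] divide_inverse by (intro Ck_mult Ck_const Ck_bump_scale)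

lemma bump_scale_support:
  assumes "e > 0" "x \<notin> cball 0 e" shows "bump ((x::'a::euclidean_space) /\<^sub>R e) = 0"
proof -
  have "norm (x /\<^sub>R e) \<ge> 1" using assms by (simp add: field_simps)
  then have "(norm (x /\<^sub>R e))\<^sup>2 \<ge> 1" by (rule one_le_power)
  then show ?thesis unfolding bump_def flat_def power2_norm_eq_inner by auto
qed

lemma bump_scale_integrable:
  assumes "e > 0" shows "integrable lborel (\<lambda>x::'a::euclidean_space. bump (x /\<^sub>R e))"
proof (rule continuous_compact_support_integrable[of _ "cball 0 e"])
  show "continuous_on UNIV (\<lambda>x::'a. bump (x /\<^sub>R e))" using Ck_bump_scale[of 0 e] by simp
qed (use assms bump_scale_support in auto)

lemma bump_scale_integral_pos:
  assumes "e > 0" shows "(LBINT y. bump ((y::'a::euclidean_space) /\<^sub>R e)) > 0"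
proof -
  let ?f = "\<lambda>y::'a. bump (y /\<^sub>R e)"
  have nonneg: "?f y \<ge> 0" for y by (simp add: bump_def flat_nonneg)
  have "(LBINT y. ?f y) \<noteq> 0"
  proof
    assume "(LBINT y. ?f y) = 0"
    then have "AE y in lborel. ?f y = 0"
      using integral_nonneg_eq_0_iff_AE[OF bump_scale_integrable[OF assms]] nonneg by auto
    then have "AE y in lborel. y \<notin> ball (0::'a) e"
    proof eventually_elim
      case (elim y)
      from elim have "(norm (y /\<^sub>R e))\<^sup>2 \<ge> 1"
        unfolding bump_def flat_def power2_norm_eq_inner by (auto split: if_splits)
      then have "norm (y /\<^sub>R e) \<ge> 1" by (smt (verit) norm_ge_zero power2_eq_1_iff power_mono_iff one_power2 zero_less_numeral)
      then show ?case using assms by (simp add: field_simps)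
    qed
    then have "ball (0::'a) e \<in> null_sets lborel" by (simp add: AE_iff_null_sets)
    then have "negligible (ball (0::'a) e)" by (simp add: negligible_iff_null_sets null_sets_completionI)
    then show False using open_not_negligible[of "ball (0::'a) e"] assms by simp
  qed
  then show ?thesis using integral_nonneg_AE[of ?f lborel] nonneg by (simp add: order_less_le)
qed

lemma mollifier_nonneg: "mollifier e x \<ge> 0"
  unfolding mollifier_def bump_def
  by (intro divide_nonneg_nonneg flat_nonneg Bochner_Integration.integral_nonneg)

lemma mollifier_support: "e > 0 ==> x \<notin> cball 0 e ==> mollifier e x = 0"
  unfolding mollifier_def using bump_scale_support by auto

lemma mollifier_integral: "e > 0 ==> (LBINT x. mollifier e (x::'a::euclidean_space)) = 1"
  using bump_scale_integral_pos[of e, where 'a='a] by (simp add: mollifier_def[abs_def])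

lemma mollifier_integrable: "e > 0 ==> integrable lborel (mollifier e)"
  unfolding mollifier_def[abs_def] by (intro integrable_divide impI bump_scale_integrable)

lemma mollifier_test_function:
  assumes "e > 0" "cball x e \<subseteq> U" shows "(\<lambda>y. mollifier e (x - y)) \<in> test_functions U"
proof (rule test_functionI[of _ "cball x e"])
  have "bounded_linear (\<lambda>y::'a. - y)" by (intro bounded_linear_minus bounded_linear_ident)
  from Ck_affine[OF this Ck_mollifier, where c=x] show "Ck k (\<lambda>y. mollifier e (x - y))" for k by simp
  show "mollifier e (x - y) = 0" if "y \<notin> cball x e" for y
    using that mollifier_support[of e "x - y"] assms by (auto simp: dist_norm norm_minus_commute)
qed (use assms in auto)

section \<open>Integrable powers\<close>

definition powr_integrable :: "'a measure => real => ('a => real) => bool" where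
  "powr_integrable M q f \<longleftrightarrow> f \<in> borel_measurable M \<and> integrable M (\<lambda>x. \<bar>f x\<bar> powr q)"

lemma powr_sum_le:
  fixes a b :: real assumes "q \<ge> 0"
  shows "\<bar>a + b\<bar> powr q \<le> 2 powr q * (\<bar>a\<bar> powr q + \<bar>b\<bar> powr q)"
proof -
  have "\<bar>a + b\<bar> powr q \<le> (2 * max \<bar>a\<bar> \<bar>b\<bar>) powr q" using assms by (intro powr_mono2) auto
  also have "\<dots> = 2 powr q * max \<bar>a\<bar> \<bar>b\<bar> powr q" by (intro powr_mult)
  also have "\<dots> \<le> 2 powr q * (\<bar>a\<bar> powr q + \<bar>b\<bar> powr q)"
    by (intro mult_left_mono) (auto simp: max_def)
  finally show ?thesis .
qed

lemma powr_integrable_borel: "powr_integrable M q f ==> f \<in> borel_measurable M"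
  and powr_integrable_integrable: "powr_integrable M q f ==> integrable M (\<lambda>x. \<bar>f x\<bar> powr q)"
  by (auto simp: powr_integrable_def)

lemma powr_integrable_le:
  assumes "powr_integrable M q f" "g \<in> borel_measurable M" "AE x in M. \<bar>g x\<bar> \<le> c * \<bar>f x\<bar>" "q \<ge> 0" "c \<ge> 0"
  shows "powr_integrable M q g"
  unfolding powr_integrable_def
proof (intro conjI assms(2))
  have "AE x in M. norm (\<bar>g x\<bar> powr q) \<le> norm (c powr q * \<bar>f x\<bar> powr q)"
    using assms(3)
  proof eventually_elim
    case (elim x)
    have "\<bar>g x\<bar> powr q \<le> (c * \<bar>f x\<bar>) powr q" using elim assms by (intro powr_mono2) auto
    then show ?case using assms by (simp add: powr_mult)
  qed
  then show "integrable M (\<lambda>x. \<bar>g x\<bar> powr q)"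
    using assms(1,2) powr_integrable_borel[OF assms(1)]
    by (intro Bochner_Integration.integrable_bound[OF integrable_mult_right[where c="c powr q",
        OF powr_integrable_integrable[OF assms(1)]]]) auto
qed

lemma powr_integrable_add:
  assumes "powr_integrable M q f" "powr_integrable M q g" "q \<ge> 0"
  shows "powr_integrable M q (\<lambda>x. f x + g x)"
  unfolding powr_integrable_def
proof (intro conjI)
  have [measurable]: "f \<in> borel_measurable M" "g \<in> borel_measurable M"
    using assms powr_integrable_borel by auto
  show "(\<lambda>x. f x + g x) \<in> borel_measurable M" by measurable
  show "integrable M (\<lambda>x. \<bar>f x + g x\<bar> powr q)"
  proof (rule Bochner_Integration.integrable_bound)
    show "integrable M (\<lambda>x. 2 powr q * (\<bar>f x\<bar> powr q + \<bar>g x\<bar> powr q))"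
      using assms by (intro integrable_mult_right Bochner_Integration.integrable_add powr_integrable_integrable)
  qed (use powr_sum_le[OF \<open>q \<ge> 0\<close>] in auto)
qed

lemma powr_integrable_cmult:
  "powr_integrable M q f ==> powr_integrable M q (\<lambda>x. c * f x)"
  by (auto simp: powr_integrable_def powr_mult abs_mult)

lemma powr_integrable_uminus: "powr_integrable M q f ==> powr_integrable M q (\<lambda>x. - f x)"
  by (auto simp: powr_integrable_def)

lemma powr_integrable_diff:
  assumes "powr_integrable M q f" "powr_integrable M q g" "q \<ge> 0"
  shows "powr_integrable M q (\<lambda>x. f x - g x)"
  using powr_integrable_add[OF assms(1) powr_integrable_uminus[OF assms(2)]] assms(3) by simp

lemma powr_integrable_bounded_mult:
  assumes "powr_integrable M q f" "h \<in> borel_measurable M" "\<And>x. \<bar>h x\<bar> \<le> B" "q \<ge> 0"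
  shows "powr_integrable M q (\<lambda>x. h x * f x)"
proof (rule powr_integrable_le[OF assms(1), where c=B])
  have [measurable]: "f \<in> borel_measurable M" using assms powr_integrable_borel by auto
  show "(\<lambda>x. h x * f x) \<in> borel_measurable M" using assms(2) by measurable
  show "AE x in M. \<bar>h x * f x\<bar> \<le> B * \<bar>f x\<bar>" using assms(3) by (auto simp: abs_mult intro!: mult_right_mono)
  show "0 \<le> B" using assms(3)[of undefined] by linarith
qed (use assms in auto)

lemma powr_integrable_1: "powr_integrable M 1 f \<longleftrightarrow> integrable M f"
proof
  assume "powr_integrable M 1 f" then show "integrable M f"
    using integrable_abs_cancel[of M f] by (auto simp: powr_integrable_def)
qed (auto simp: powr_integrable_def)

text \<open>The free scale \<open>l\<close> replaces Hoelder's inequality in limit arguments: one factor gets an arbitrarily small weight.\<close>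
lemma scaled_young:
  fixes a b l :: real
  assumes "p > 1" "q > 1" "1/p + 1/q = 1" "l > 0"
  shows "\<bar>a * b\<bar> \<le> l powr q * \<bar>a\<bar> powr q + (1 / l) powr p * \<bar>b\<bar> powr p"
proof -
  have le: "x powr p / p \<le> x powr p" "x powr q / q \<le> x powr q" for x :: real
    using assms by (auto simp: divide_le_eq mult_le_cancel_left1)
  have "\<bar>a * b\<bar> = ((1 / l) * \<bar>b\<bar>) * (l * \<bar>a\<bar>)" using assms by (simp add: abs_mult)
  also have "\<dots> \<le> ((1 / l) * \<bar>b\<bar>) powr p / p + (l * \<bar>a\<bar>) powr q / q"
    using assms by (intro Youngs_inequality) auto
  also have "\<dots> \<le> ((1 / l) * \<bar>b\<bar>) powr p + (l * \<bar>a\<bar>) powr q" using le by (intro add_mono) auto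
  also have "\<dots> = l powr q * \<bar>a\<bar> powr q + (1 / l) powr p * \<bar>b\<bar> powr p"
    by (simp only: powr_mult)
  finally show ?thesis .
qed

lemma young:
  fixes a b :: real
  assumes "p > 1" "q > 1" "1/p + 1/q = 1"
  shows "\<bar>a * b\<bar> \<le> \<bar>a\<bar> powr q + \<bar>b\<bar> powr p"
  using scaled_young[OF assms, of 1 a b] by simp

lemma integrable_dual_product:
  assumes "p > 1" "q > 1" "1/p + 1/q = 1" "powr_integrable M q a" "powr_integrable M p b"
  shows "integrable M (\<lambda>x. a x * b x)"
proof (rule Bochner_Integration.integrable_bound)
  show "integrable M (\<lambda>x. \<bar>a x\<bar> powr q + \<bar>b x\<bar> powr p)"
    using assms by (intro Bochner_Integration.integrable_add powr_integrable_integrable)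
  show "(\<lambda>x. a x * b x) \<in> borel_measurable M"
    using assms by (intro borel_measurable_times powr_integrable_borel)
  show "AE x in M. norm (a x * b x) \<le> norm (\<bar>a x\<bar> powr q + \<bar>b x\<bar> powr p)"
    using young[OF assms(1-3)] by auto
qed

text \<open>Choose the scale in Young's inequality small for the fixed factor; the other factor tends to zero in the \<open>p\<close>-th mean.\<close>
lemma dual_product_tendsto_0:
  assumes pq: "p > 1" "q > 1" "1/p + 1/q = 1" and a: "powr_integrable M q a"
    and b: "\<forall>\<^sub>F n in F. powr_integrable M p (b n)"
    and lim: "((\<lambda>n. \<integral>x. \<bar>b n x\<bar> powr p \<partial>M) \<longlongrightarrow> 0) F"
  shows "((\<lambda>n. \<integral>x. \<bar>a x * b n x\<bar> \<partial>M) \<longlongrightarrow> 0) F"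
proof (rule tendstoI)
  fix e :: real assume "e > 0"
  define I where "I = (\<integral>x. \<bar>a x\<bar> powr q \<partial>M)"
  have "I \<ge> 0" unfolding I_def by simp
  define l where "l = (e / (2 * (I + 1))) powr (1 / q)"
  have "l > 0" using \<open>e > 0\<close> \<open>I \<ge> 0\<close> by (simp add: l_def)
  have lq: "l powr q = e / (2 * (I + 1))" using pq \<open>e > 0\<close> \<open>I \<ge> 0\<close> by (simp add: l_def powr_powr)
  have lI: "l powr q * I < e / 2" unfolding lq using \<open>e > 0\<close> \<open>I \<ge> 0\<close> by (simp add: field_simps)
  have ev: "\<forall>\<^sub>F n in F. (\<integral>x. \<bar>b n x\<bar> powr p \<partial>M) < e / 2 / (1 / l) powr p"
    using \<open>e > 0\<close> \<open>l > 0\<close> by (intro order_tendstoD(2)[OF lim]) auto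
  show "\<forall>\<^sub>F n in F. dist (\<integral>x. \<bar>a x * b n x\<bar> \<partial>M) 0 < e"
    using b ev
  proof eventually_elim
    case (elim n)
    have "(\<integral>x. \<bar>a x * b n x\<bar> \<partial>M) \<le> (\<integral>x. l powr q * \<bar>a x\<bar> powr q + (1 / l) powr p * \<bar>b n x\<bar> powr p \<partial>M)"
      using scaled_young[OF pq \<open>l > 0\<close>] elim a
      by (intro integral_mono integrable_abs integrable_dual_product[OF pq] Bochner_Integration.integrable_add
        integrable_mult_right powr_integrable_integrable) auto
    also have "\<dots> = l powr q * I + (1 / l) powr p * (\<integral>x. \<bar>b n x\<bar> powr p \<partial>M)"
      unfolding I_def using elim a by (subst Bochner_Integration.integral_add) (auto simp: powr_integrable_def)
    also have "\<dots> < e / 2 + e / 2"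
      using elim \<open>l > 0\<close> by (intro add_strict_mono lI) (simp add: field_simps)
    finally show ?case by simp
  qed
qed

lemma abs_le_1_plus_powr: "q \<ge> 1 ==> \<bar>x::real\<bar> \<le> 1 + \<bar>x\<bar> powr q"
proof (cases "\<bar>x\<bar> \<le> 1")
  case False assume "q \<ge> 1"
  then have "\<bar>x\<bar> powr 1 \<le> \<bar>x\<bar> powr q" using False by (intro powr_mono) auto
  then show ?thesis by simp
qed (use powr_ge_zero[of "\<bar>x\<bar>" q] in linarith)

text \<open>Jensen's inequality for a probability density \<open>w\<close>, obtained by integrating Young's inequality with the mean \<open>c\<close> in place of the second factor.\<close>
lemma weighted_power_mean:
  fixes X w :: "'a => real"
  assumes q: "q \<ge> 1" and [measurable]: "X \<in> borel_measurable M" and w: "integrable M w" "\<And>x. w x \<ge> 0" "(\<integral>x. w x \<partial>M) = 1"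
    and Xw: "integrable M (\<lambda>x. \<bar>X x\<bar> powr q * w x)"
  shows "integrable M (\<lambda>x. X x * w x)" "\<bar>\<integral>x. X x * w x \<partial>M\<bar> powr q \<le> (\<integral>x. \<bar>X x\<bar> powr q * w x \<partial>M)"
proof -
  show i: "integrable M (\<lambda>x. X x * w x)"
  proof (rule Bochner_Integration.integrable_bound)
    show "integrable M (\<lambda>x. w x + \<bar>X x\<bar> powr q * w x)" using w Xw by auto
    have "norm (X x * w x) \<le> norm (w x + \<bar>X x\<bar> powr q * w x)" for x
      using mult_right_mono[OF abs_le_1_plus_powr[OF q, of "X x"] w(2)[of x]] w(2)[of x]
      by (simp add: abs_mult distrib_right)
    then show "AE x in M. norm (X x * w x) \<le> norm (w x + \<bar>X x\<bar> powr q * w x)" by simp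
  qed (use w in measurable)
  define c where "c = (\<integral>x. \<bar>X x\<bar> * w x \<partial>M)"
  have c: "\<bar>\<integral>x. X x * w x \<partial>M\<bar> \<le> c"
    unfolding c_def using integral_abs_bound[of M "\<lambda>x. X x * w x"] w(2) by (simp add: abs_mult)
  have "c \<ge> 0" using c by linarith
  have i': "integrable M (\<lambda>x. \<bar>X x\<bar> * w x)" using integrable_abs[OF i] w(2) by (simp add: abs_mult)
  have "c powr q \<le> (\<integral>x. \<bar>X x\<bar> powr q * w x \<partial>M)"
  proof (cases "q = 1 \<or> c = 0")
    case False
    then have "q > 1" "c > 0" using q \<open>c \<ge> 0\<close> by auto
    define p where "p = q / (q - 1)"
    have p: "p > 1" "1 / q + 1 / p = 1" "p * (q - 1) = q"
      using \<open>q > 1\<close> by (auto simp: p_def field_simps)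
    have "c powr q = c powr (q - 1) * c" using \<open>c > 0\<close> by (simp add: powr_diff)
    also have "\<dots> = (\<integral>x. c powr (q - 1) * (\<bar>X x\<bar> * w x) \<partial>M)" by (simp add: c_def)
    also have "\<dots> \<le> (\<integral>x. (1 / q) * (\<bar>X x\<bar> powr q * w x) + (c powr q / p) * w x \<partial>M)"
    proof (intro integral_mono integrable_mult_right i' Bochner_Integration.integrable_add Xw w)
      fix x
      have "\<bar>X x\<bar> * c powr (q - 1) \<le> \<bar>X x\<bar> powr q / q + (c powr (q - 1)) powr p / p"
        using \<open>q > 1\<close> p by (intro Youngs_inequality) auto
      also have "(c powr (q - 1)) powr p = c powr q" using p by (simp add: powr_powr mult.commute)
      finally have "\<bar>X x\<bar> * c powr (q - 1) * w x \<le> (\<bar>X x\<bar> powr q / q + c powr q / p) * w x"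
        by (intro mult_right_mono w)
      then show "c powr (q - 1) * (\<bar>X x\<bar> * w x) \<le> (1 / q) * (\<bar>X x\<bar> powr q * w x) + (c powr q / p) * w x"
        by (simp add: algebra_simps)
    qed
    also have "\<dots> = (1 / q) * (\<integral>x. \<bar>X x\<bar> powr q * w x \<partial>M) + (1 / p) * c powr q"
      using Xw w by (subst Bochner_Integration.integral_add) auto
    finally have "(1 - 1 / p) * c powr q \<le> (1 / q) * (\<integral>x. \<bar>X x\<bar> powr q * w x \<partial>M)"
      by (simp add: algebra_simps)
    moreover have "1 - 1 / p = 1 / q" using p by simp
    ultimately show ?thesis using \<open>q > 1\<close> by (simp add: divide_le_cancel)
  next
    case True
    then show ?thesis using \<open>c \<ge> 0\<close> w(2) q by (auto simp: c_def intro!: Bochner_Integration.integral_nonneg)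
  qed
  then show "\<bar>\<integral>x. X x * w x \<partial>M\<bar> powr q \<le> (\<integral>x. \<bar>X x\<bar> powr q * w x \<partial>M)"
    using powr_mono2[OF _ _ c, of q] q by linarith
qed

section \<open>Continuity of translations\<close>

lemma
  fixes f :: "'a::euclidean_space => real"
  assumes [measurable]: "f \<in> Borel"
  shows integral_translate: "(LBINT x. f (x + y)) = (LBINT x. f x)"
    and integrable_translate: "integrable lborel (\<lambda>x. f (x + y)) \<longleftrightarrow> integrable lborel f"
proof -
  have d: "distr lborel borel (\<lambda>x. x + y) = lborel" using lborel_distr_plus[of y] by (simp only: add.commute[of _ y])
  show "(LBINT x. f (x + y)) = (LBINT x. f x)"
    by (subst (2) d[symmetric], subst integral_distr) auto
  show "integrable lborel (\<lambda>x. f (x + y)) \<longleftrightarrow> integrable lborel f"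
    by (subst (2) d[symmetric], subst integrable_distr_eq) auto
qed

lemma
  fixes f :: "'a::euclidean_space => real"
  assumes [measurable]: "f \<in> Borel"
  shows integral_reflect: "(LBINT y. f (x - y)) = (LBINT y. f y)"
    and integrable_reflect: "integrable lborel (\<lambda>y. f (x - y)) \<longleftrightarrow> integrable lborel f"
proof -
  have d: "distr lborel borel (\<lambda>y::'a. x - y) = lborel"
    by (subst lborel_affine[of "-1" x]) (auto simp: density_1 power_abs)
  show "(LBINT y. f (x - y)) = (LBINT y. f y)"
    by (subst (2) d[symmetric], subst integral_distr) auto
  show "integrable lborel (\<lambda>y. f (x - y)) \<longleftrightarrow> integrable lborel f"
    by (subst (2) d[symmetric], subst integrable_distr_eq) auto
qed

text \<open>The set of functions with continuous translations is closed in the mean, because translation is an isometry.\<close>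
lemma translation_L1_approx:
  fixes f :: "'a::euclidean_space => real"
  assumes f: "integrable lborel f"
    and approx: "\<And>e. e > 0 ==> \<exists>g. integrable lborel g \<and>
      ((\<lambda>y. LBINT x. \<bar>g (x + y) - g x\<bar>) \<longlongrightarrow> 0) (at 0) \<and> (LBINT x. \<bar>f x - g x\<bar>) < e"
  shows "((\<lambda>y. LBINT x. \<bar>f (x + y) - f x\<bar>) \<longlongrightarrow> 0) (at 0)"
proof (rule tendstoI)
  fix e :: real assume "e > 0"
  then obtain g where g: "integrable lborel g" and lim: "((\<lambda>y. LBINT x. \<bar>g (x + y) - g x\<bar>) \<longlongrightarrow> 0) (at 0)"
    and fg: "(LBINT x. \<bar>f x - g x\<bar>) < e / 3"
    using approx[of "e / 3"] by auto
  note [measurable] = borel_measurable_integrable[OF f] borel_measurable_integrable[OF g]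
  have t: "integrable lborel (\<lambda>x. f (x + y))" "integrable lborel (\<lambda>x. g (x + y))" for y
    using f g by (simp_all add: integrable_translate)
  have "\<forall>\<^sub>F y in at 0. (LBINT x. \<bar>g (x + y) - g x\<bar>) < e / 3"
    using order_tendstoD(2)[OF lim, of "e / 3"] \<open>e > 0\<close> by simp
  then show "\<forall>\<^sub>F y in at 0. dist (LBINT x. \<bar>f (x + y) - f x\<bar>) 0 < e"
  proof eventually_elim
    case (elim y)
    have "(LBINT x. \<bar>f (x + y) - f x\<bar>)
        \<le> (LBINT x. \<bar>f (x + y) - g (x + y)\<bar> + \<bar>g (x + y) - g x\<bar> + \<bar>f x - g x\<bar>)"
      using f g t by (intro integral_mono) auto
    also have "\<dots> = (LBINT x. \<bar>f (x + y) - g (x + y)\<bar>) + (LBINT x. \<bar>g (x + y) - g x\<bar>) + (LBINT x. \<bar>f x - g x\<bar>)"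
      using f g t by simp
    also have "(LBINT x. \<bar>f (x + y) - g (x + y)\<bar>) = (LBINT x. \<bar>f x - g x\<bar>)"
      using integral_translate[of "\<lambda>x. \<bar>f x - g x\<bar>" y] by simp
    finally show ?case using elim fg by simp
  qed
qed

text \<open>For an indicator \<open>|a - b| = a + b - 2ab\<close>, and \<open>1\<^sub>U(x) 1\<^sub>U(x + y) \<rightarrow> 1\<^sub>U(x)\<close> pointwise since \<open>U\<close> is open.\<close>
lemma translation_L1_open:
  fixes U :: "'a::euclidean_space set"
  assumes "open U" and fin: "emeasure lborel U < \<infinity>"
  shows "((\<lambda>y. LBINT x. \<bar>indicator U (x + y) - indicator U x :: real\<bar>) \<longlongrightarrow> 0) (at 0)"
  unfolding tendsto_at_iff_sequentially
proof (intro allI impI)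
  fix Y :: "nat => 'a" assume Y: "Y \<longlonglongrightarrow> 0"
  have [measurable]: "U \<in> sets borel" using assms by auto
  let ?i = "indicator U :: 'a => real"
  have i: "integrable lborel ?i" using fin by auto
  have it: "integrable lborel (\<lambda>x. ?i (x + y))" for y using i by (subst integrable_translate) auto
  have ip: "integrable lborel (\<lambda>x. ?i x * ?i (x + y))" for y
    by (rule Bochner_Integration.integrable_bound[OF i]) (auto simp: indicator_def)
  have "(\<lambda>n. LBINT x. ?i x * ?i (x + Y n)) \<longlonglongrightarrow> (LBINT x. ?i x)"
  proof (rule integral_dominated_convergence[where w="?i"])
    show "AE x in lborel. (\<lambda>n. ?i x * ?i (x + Y n)) \<longlonglongrightarrow> ?i x"
    proof (intro AE_I2)
      fix x show "(\<lambda>n. ?i x * ?i (x + Y n)) \<longlonglongrightarrow> ?i x"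
      proof (cases "x \<in> U")
        case True
        have "(\<lambda>n. x + Y n) \<longlonglongrightarrow> x" using tendsto_add[OF tendsto_const Y, of x] by simp
        then have "\<forall>\<^sub>F n in sequentially. x + Y n \<in> U" using True \<open>open U\<close> by (simp add: topological_tendstoD)
        then have "\<forall>\<^sub>F n in sequentially. ?i x = ?i x * ?i (x + Y n)" by eventually_elim (use True in auto)
        then show ?thesis by (rule Lim_transform_eventually[OF tendsto_const])
      qed auto
    qed
  qed (use i in \<open>auto simp: indicator_def\<close>)
  from tendsto_diff[OF tendsto_const[of "2 * (LBINT x. ?i x)"] tendsto_mult_left[OF this, of 2]]
  have "(\<lambda>n. 2 * (LBINT x. ?i x) - 2 * (LBINT x. ?i x * ?i (x + Y n))) \<longlonglongrightarrow> 0" by simp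
  moreover have "(LBINT x. \<bar>?i (x + y) - ?i x\<bar>) = 2 * (LBINT x. ?i x) - 2 * (LBINT x. ?i x * ?i (x + y))" for y
  proof -
    have "(LBINT x. \<bar>?i (x + y) - ?i x\<bar>) = (LBINT x. ?i (x + y) + ?i x - 2 * (?i x * ?i (x + y)))"
      by (rule Bochner_Integration.integral_cong) (auto simp: indicator_def)
    also have "\<dots> = (LBINT x. ?i (x + y)) + (LBINT x. ?i x) - 2 * (LBINT x. ?i x * ?i (x + y))"
      using i it[of y] ip[of y] by simp
    also have "(LBINT x. ?i (x + y)) = (LBINT x. ?i x)" by (rule integral_translate) simp
    finally show ?thesis by simp
  qed
  ultimately show "((\<lambda>y. LBINT x. \<bar>?i (x + y) - ?i x\<bar>) \<circ> Y) \<longlonglongrightarrow> 0" by (simp add: o_def)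
qed

text \<open>Induction over integrable functions: measurable sets are approximated from outside by open sets, and the property passes to sums and limits in the mean.\<close>
lemma translation_L1:
  fixes f :: "'a::euclidean_space => real"
  assumes "integrable lborel f"
  shows "((\<lambda>y. LBINT x. \<bar>f (x + y) - f x\<bar>) \<longlongrightarrow> 0) (at 0)"
  using assms
proof (induction rule: integrable_induct)
  case (base A c)
  then have A: "A \<in> sets borel" "emeasure lborel A < \<infinity>" by auto
  have i: "integrable lborel (indicator A :: 'a => real)" using A by simp
  have "((\<lambda>y. LBINT x. \<bar>indicator A (x + y) - indicator A x :: real\<bar>) \<longlongrightarrow> 0) (at 0)"
  proof (rule translation_L1_approx[OF i])
    fix e :: real assume "e > 0"
    then obtain U where U: "open U" "A \<subseteq> U" "emeasure lborel (U - A) < e"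
      using outer_regular_lborel[OF A(1)] by blast
    have [measurable]: "U \<in> sets borel" "A \<in> sets borel" using U A by auto
    have "emeasure lborel U \<le> emeasure lborel A + emeasure lborel (U - A)"
      using U(2) emeasure_subadditive[of A lborel "U - A"] by (simp add: Un_absorb1)
    also have "\<dots> < \<infinity>" using A U(3) by (simp add: ennreal_add_less_top order.strict_trans)
    finally have fin: "emeasure lborel U < \<infinity>" .
    have "(LBINT x. \<bar>indicator A x - indicator U x :: real\<bar>) = (LBINT x. indicator (U - A) x)"
      using U by (intro Bochner_Integration.integral_cong) (auto simp: indicator_def)
    also have "\<dots> = measure lborel (U - A)" by simp
    also have "emeasure lborel (U - A) = ennreal (measure lborel (U - A))"
      using U(3) by (intro emeasure_eq_ennreal_measure) auto
    then have "measure lborel (U - A) < e" using U(3) \<open>e > 0\<close> by (simp add: ennreal_less_iff)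
    finally show "\<exists>g. integrable lborel g \<and> ((\<lambda>y. LBINT x. \<bar>g (x + y) - g x\<bar>) \<longlongrightarrow> 0) (at 0) \<and>
        (LBINT x. \<bar>indicator A x - g x\<bar>) < e"
      using fin by (intro exI[of _ "indicator U"] conjI translation_L1_open U) auto
  qed
  note lim = this
  have "(LBINT x. \<bar>c\<bar> * \<bar>indicat_real A (x + y) - indicat_real A x\<bar>)
      = (LBINT x. \<bar>indicator A (x + y) *\<^sub>R c - indicator A x *\<^sub>R c\<bar>)" for y
    by (intro Bochner_Integration.integral_cong) (auto simp: indicator_def)
  with tendsto_mult_left[OF lim, of "\<bar>c\<bar>"] show ?case by simp
next
  case (add f g)
  note [measurable] = borel_measurable_integrable[OF add(1)] borel_measurable_integrable[OF add(2)]
  have t: "integrable lborel (\<lambda>x. f (x + y))" "integrable lborel (\<lambda>x. g (x + y))" for y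
    using add by (simp_all add: integrable_translate)
  show ?case
  proof (rule Lim_null_comparison[OF always_eventually tendsto_add_zero[OF add(3,4)]], intro allI)
    fix y
    have "(LBINT x. \<bar>f (x + y) + g (x + y) - (f x + g x)\<bar>) \<le> (LBINT x. \<bar>f (x + y) - f x\<bar> + \<bar>g (x + y) - g x\<bar>)"
      using add t by (intro integral_mono) auto
    then show "norm (LBINT x. \<bar>f (x + y) + g (x + y) - (f x + g x)\<bar>)
        \<le> (LBINT x. \<bar>f (x + y) - f x\<bar>) + (LBINT x. \<bar>g (x + y) - g x\<bar>)"
      using add t by simp
  qed
next
  case (lim f s)
  show ?case
  proof (rule translation_L1_approx[OF lim(4)])
    fix e :: real assume "e > 0"
    have "(\<lambda>n. LBINT x. \<bar>f x - s n x\<bar>) \<longlonglongrightarrow> (\<integral>x. 0 \<partial>(lborel :: 'a measure))"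
    proof (rule integral_dominated_convergence[where w="\<lambda>x. 3 * \<bar>f x\<bar>"])
      show "AE x in lborel. (\<lambda>n. \<bar>f x - s n x\<bar>) \<longlonglongrightarrow> 0"
      proof (intro AE_I2 tendsto_rabs_zero)
        fix x :: 'a
        have "(\<lambda>n. s n x) \<longlonglongrightarrow> f x" using lim(2) by simp
        from tendsto_diff[OF tendsto_const this, of "f x"] show "(\<lambda>n. f x - s n x) \<longlonglongrightarrow> 0" by simp
      qed
      show "AE x in lborel. norm \<bar>f x - s n x\<bar> \<le> 3 * \<bar>f x\<bar>" for n
        using lim(3)[of _ n] by (intro AE_I2) (smt (verit) UNIV_I real_norm_def space_lborel)
    qed (use lim in auto)
    then have "\<forall>\<^sub>F n in sequentially. (LBINT x. \<bar>f x - s n x\<bar>) < e"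
      using \<open>e > 0\<close> by (intro order_tendstoD(2)) auto
    then obtain n where "(LBINT x. \<bar>f x - s n x\<bar>) < e" by (auto simp: eventually_sequentially)
    then show "\<exists>g. integrable lborel g \<and> ((\<lambda>y. LBINT x. \<bar>g (x + y) - g x\<bar>) \<longlongrightarrow> 0) (at 0) \<and>
        (LBINT x. \<bar>f x - g x\<bar>) < e"
      using lim(1,5) by (intro exI[of _ "s n"]) auto
  qed
qed

text \<open>A bounded truncation \<open>h\<close> of \<open>f\<close> is integrable and its translations converge in \<open>L\<^sup>1\<close>; boundedness upgrades this to the power \<open>q\<close>.\<close>
lemma translation_powr:
  fixes f :: "'a::euclidean_space => real"
  assumes q: "q \<ge> 1" and f: "powr_integrable lborel q f"
  shows "((\<lambda>y. LBINT x. \<bar>f (x + y) - f x\<bar> powr q) \<longlongrightarrow> 0) (at 0)"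
proof (rule tendstoI)
  fix e :: real assume "e > 0"
  note [measurable] = powr_integrable_borel[OF f]
  define h where "h n x = (if \<bar>f x\<bar> \<le> real n \<and> norm x \<le> real n then f x else 0)" for n :: nat and x
  have [measurable]: "h n \<in> Borel" for n unfolding h_def[abs_def] by measurable
  have h_le: "\<bar>h n x\<bar> \<le> real n" for n x by (auto simp: h_def)
  have hi: "integrable lborel (h n)" for n
  proof (rule Bochner_Integration.integrable_bound)
    show "integrable lborel (\<lambda>x. real n * indicator (cball (0::'a) (real n)) x)"
      using emeasure_lborel_cball_finite[of "0::'a" "real n"] by (intro integrable_mult_right) simp
    show "AE x in lborel. norm (h n x) \<le> norm (real n * indicator (cball 0 (real n)) x :: real)"
      using h_le by (auto simp: h_def indicator_def)
  qed simp
  define K where "K = (2 powr q * 2 powr q :: real)"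
  have K: "K > 0" by (simp add: K_def)
  have "(\<lambda>n. LBINT x. \<bar>f x - h n x\<bar> powr q) \<longlonglongrightarrow> (\<integral>x. 0 \<partial>(lborel::'a measure))"
  proof (rule integral_dominated_convergence[where w="\<lambda>x. \<bar>f x\<bar> powr q"])
    show "AE x in lborel. (\<lambda>n. \<bar>f x - h n x\<bar> powr q) \<longlonglongrightarrow> 0"
    proof (intro AE_I2)
      fix x
      obtain N :: nat where N: "max \<bar>f x\<bar> (norm x) \<le> real N" using real_arch_simple by blast
      have "\<forall>\<^sub>F n in sequentially. 0 = \<bar>f x - h n x\<bar> powr q"
        using eventually_ge_at_top[of N] by eventually_elim (use N in \<open>auto simp: h_def\<close>)
      then show "(\<lambda>n. \<bar>f x - h n x\<bar> powr q) \<longlonglongrightarrow> 0" by (rule Lim_transform_eventually[OF tendsto_const])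
    qed
    show "AE x in lborel. norm (\<bar>f x - h n x\<bar> powr q) \<le> \<bar>f x\<bar> powr q" for n by (auto simp: h_def)
  qed (use f in \<open>auto simp: powr_integrable_def\<close>)
  then have "\<forall>\<^sub>F n in sequentially. (LBINT x. \<bar>f x - h n x\<bar> powr q) < e / (4 * K)"
    using \<open>e > 0\<close> K by (intro order_tendstoD(2)) auto
  then obtain n where n: "(LBINT x. \<bar>f x - h n x\<bar> powr q) < e / (4 * K)" by (auto simp: eventually_sequentially)
  define m where "m = (2 * real n + 1) powr (q - 1)"
  have "m > 0" by (auto simp: m_def)
  have hq: "\<bar>h n x - h n y\<bar> powr q \<le> m * \<bar>h n x - h n y\<bar>" for x y
  proof (cases "h n x = h n y")
    case False
    then have "\<bar>h n x - h n y\<bar> powr q = \<bar>h n x - h n y\<bar> powr (q - 1) * \<bar>h n x - h n y\<bar>"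
      by (simp add: powr_diff)
    also have "\<bar>h n x - h n y\<bar> powr (q - 1) \<le> m"
      unfolding m_def using q h_le[of n x] h_le[of n y] by (intro powr_mono2) auto
    finally show ?thesis by (simp add: mult_right_mono)
  qed auto
  have fh: "powr_integrable lborel q (\<lambda>x. f x - h n x)"
    using f by (rule powr_integrable_le[where c=1]) (use q in \<open>auto simp: h_def\<close>)
  then have i1: "integrable lborel (\<lambda>x. \<bar>f x - h n x\<bar> powr q)" by (rule powr_integrable_integrable)
  have "integrable lborel (\<lambda>x. \<bar>f (x + y) - h n (x + y)\<bar> powr q)" for y
    using i1 integrable_translate[of "\<lambda>x. \<bar>f x - h n x\<bar> powr q" y] by simp
  note i2 = this
  have "integrable lborel (\<lambda>x. h n (x + y))" for y using hi integrable_translate[of "h n" y] by simp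
  then have i3: "integrable lborel (\<lambda>x. \<bar>h n (x + y) - h n x\<bar>)" for y using hi by auto
  have "\<forall>\<^sub>F y in at 0. (LBINT x. \<bar>h n (x + y) - h n x\<bar>) < e / (4 * K * m)"
    using \<open>e > 0\<close> K \<open>m > 0\<close> by (intro order_tendstoD(2)[OF translation_L1[OF hi]]) auto
  then show "\<forall>\<^sub>F y in at 0. dist (LBINT x. \<bar>f (x + y) - f x\<bar> powr q) 0 < e"
  proof eventually_elim
    case (elim y)
    have pt: "\<bar>f (x + y) - f x\<bar> powr q
        \<le> K * (\<bar>f (x + y) - h n (x + y)\<bar> powr q + m * \<bar>h n (x + y) - h n x\<bar> + \<bar>f x - h n x\<bar> powr q)" for x
    proof -
      let ?a = "f (x + y) - h n (x + y)" and ?b = "h n (x + y) - h n x" and ?c = "f x - h n x"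
      have 2: "1 \<le> 2 powr q" using q by (simp add: ge_one_powr_ge_zero)
      have "\<bar>?a + (?b + - ?c)\<bar> powr q \<le> 2 powr q * (\<bar>?a\<bar> powr q + \<bar>?b + - ?c\<bar> powr q)"
        using q by (intro powr_sum_le) auto
      also have "\<dots> \<le> 2 powr q * (2 powr q * \<bar>?a\<bar> powr q + 2 powr q * (\<bar>?b\<bar> powr q + \<bar>- ?c\<bar> powr q))"
        using q powr_sum_le[of q ?b "- ?c"] mult_right_mono[OF 2, of "\<bar>?a\<bar> powr q"]
        by (intro mult_left_mono add_mono) auto
      also have "\<dots> = K * (\<bar>?a\<bar> powr q + \<bar>?b\<bar> powr q + \<bar>?c\<bar> powr q)"
        unfolding abs_minus_cancel K_def by (simp add: algebra_simps)
      also have "\<dots> \<le> K * (\<bar>?a\<bar> powr q + m * \<bar>?b\<bar> + \<bar>?c\<bar> powr q)"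
        using K hq by (intro mult_left_mono add_mono) auto
      finally show ?thesis by (simp add: algebra_simps)
    qed
    have "(LBINT x. \<bar>f (x + y) - f x\<bar> powr q)
        \<le> (LBINT x. K * (\<bar>f (x + y) - h n (x + y)\<bar> powr q + m * \<bar>h n (x + y) - h n x\<bar> + \<bar>f x - h n x\<bar> powr q))"
      by (rule Bochner_Integration.integral_mono_AE', intro integrable_mult_right Bochner_Integration.integrable_add i1 i2 i3)
         (use pt order_trans[OF powr_ge_zero pt] in auto)
    also have "\<dots> = K * ((LBINT x. \<bar>f (x + y) - h n (x + y)\<bar> powr q) + m * (LBINT x. \<bar>h n (x + y) - h n x\<bar>)
        + (LBINT x. \<bar>f x - h n x\<bar> powr q))"
      using i1 i2[of y] i3[of y] by simp
    also have "(LBINT x. \<bar>f (x + y) - h n (x + y)\<bar> powr q) = (LBINT x. \<bar>f x - h n x\<bar> powr q)"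
      using integral_translate[of "\<lambda>x. \<bar>f x - h n x\<bar> powr q" y] by simp
    also have "K * ((LBINT x. \<bar>f x - h n x\<bar> powr q) + m * (LBINT x. \<bar>h n (x + y) - h n x\<bar>)
        + (LBINT x. \<bar>f x - h n x\<bar> powr q)) < K * (e / (4 * K) + m * (e / (4 * K * m)) + e / (4 * K))"
      using K \<open>m > 0\<close> n elim by (intro mult_strict_left_mono add_strict_mono) auto
    also have "\<dots> \<le> e" using K \<open>m > 0\<close> \<open>e > 0\<close> by (simp add: field_simps)
    finally show ?case by simp
  qed
qed

section \<open>Convolution\<close>

text \<open>Differentiation under the integral sign with an integrable Lipschitz constant as dominating function.\<close>
lemma has_derivative_integral:
  fixes K :: "'a::euclidean_space => 'z => real"
  assumes int: "\<And>x. integrable M (K x)"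
    and D: "\<And>z. z \<in> space M ==> ((\<lambda>x. K x z) has_derivative (\<lambda>h. \<Sum>b\<in>Basis. (h \<bullet> b) * k b z)) (at x0)"
    and k: "\<And>b. b \<in> Basis ==> integrable M (k b)"
    and Lip: "\<And>x z. z \<in> space M ==> \<bar>K x z - K x0 z\<bar> \<le> G z * norm (x - x0)" and G: "integrable M G"
  shows "((\<lambda>x. \<integral>z. K x z \<partial>M) has_derivative (\<lambda>h. \<Sum>b\<in>Basis. (h \<bullet> b) * (\<integral>z. k b z \<partial>M))) (at x0)"
  unfolding has_derivative_at
proof
  show "bounded_linear (\<lambda>h. \<Sum>b\<in>Basis. (h \<bullet> b) * (\<integral>z. k b z \<partial>M))"
    by (intro bounded_linear_sum bounded_linear_mult_const bounded_linear_inner_left)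
  show "(\<lambda>h. norm ((\<integral>z. K (x0 + h) z \<partial>M) - (\<integral>z. K x0 z \<partial>M) - (\<Sum>b\<in>Basis. (h \<bullet> b) * (\<integral>z. k b z \<partial>M))) / norm h) \<midarrow>0\<rightarrow> 0"
    unfolding tendsto_at_iff_sequentially
  proof (intro allI impI)
    fix H :: "nat => 'a" assume H: "\<forall>i. H i \<in> UNIV - {0}" "H \<longlonglongrightarrow> 0"
    define r where "r n z = (K (x0 + H n) z - K x0 z - (\<Sum>b\<in>Basis. (H n \<bullet> b) * k b z)) / norm (H n)" for n z
    have Hn: "norm (H n) > 0" for n using H by auto
    have "(\<lambda>n. \<integral>z. r n z \<partial>M) \<longlonglongrightarrow> (\<integral>z. 0 \<partial>M)"
    proof (rule integral_dominated_convergence[where w="\<lambda>z. \<bar>G z\<bar> + (\<Sum>b\<in>Basis. \<bar>k b z\<bar>)"])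
      show "r n \<in> borel_measurable M" for n
        unfolding r_def[abs_def] using int k
        by (intro borel_measurable_divide borel_measurable_diff borel_measurable_sum borel_measurable_times borel_measurable_const) auto
      show "integrable M (\<lambda>z. \<bar>G z\<bar> + (\<Sum>b\<in>Basis. \<bar>k b z\<bar>))"
        using G k by auto
      show "AE z in M. (\<lambda>n. r n z) \<longlonglongrightarrow> 0"
      proof (intro AE_I2)
        fix z assume z: "z \<in> space M"
        have "(\<lambda>h. norm (K (x0 + h) z - K x0 z - (\<Sum>b\<in>Basis. (h \<bullet> b) * k b z)) / norm h) \<midarrow>0\<rightarrow> 0"
          using D[OF z] unfolding has_derivative_at by simp
        then have "(\<lambda>n. norm (r n z)) \<longlonglongrightarrow> 0"
          unfolding tendsto_at_iff_sequentially using H by (simp add: o_def r_def)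
        then show "(\<lambda>n. r n z) \<longlonglongrightarrow> 0" by (rule tendsto_norm_zero_cancel)
      qed
      show "AE z in M. norm (r n z) \<le> \<bar>G z\<bar> + (\<Sum>b\<in>Basis. \<bar>k b z\<bar>)" for n
      proof (intro AE_I2)
        fix z assume z: "z \<in> space M"
        have "\<bar>K (x0 + H n) z - K x0 z - (\<Sum>b\<in>Basis. (H n \<bullet> b) * k b z)\<bar>
            \<le> \<bar>K (x0 + H n) z - K x0 z\<bar> + \<bar>\<Sum>b\<in>Basis. (H n \<bullet> b) * k b z\<bar>" by linarith
        also have "\<bar>K (x0 + H n) z - K x0 z\<bar> \<le> \<bar>G z\<bar> * norm (H n)"
          using order_trans[OF Lip[OF z, of "x0 + H n"] mult_right_mono[OF abs_ge_self norm_ge_zero]] by simp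
        also have "\<bar>\<Sum>b\<in>Basis. (H n \<bullet> b) * k b z\<bar> \<le> (\<Sum>b\<in>Basis. norm (H n) * \<bar>k b z\<bar>)"
          by (intro order_trans[OF sum_abs] sum_mono)
             (auto simp: abs_mult intro!: mult_right_mono Basis_le_norm)
        finally show "norm (r n z) \<le> \<bar>G z\<bar> + (\<Sum>b\<in>Basis. \<bar>k b z\<bar>)"
          using Hn[of n] by (simp add: r_def divide_le_eq algebra_simps sum_distrib_left)
      qed
    qed auto
    moreover have "(\<integral>z. r n z \<partial>M) = ((\<integral>z. K (x0 + H n) z \<partial>M) - (\<integral>z. K x0 z \<partial>M) - (\<Sum>b\<in>Basis. (H n \<bullet> b) * (\<integral>z. k b z \<partial>M))) / norm (H n)" for n
      using int k by (simp add: r_def)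
    ultimately have "(\<lambda>n. norm (((\<integral>z. K (x0 + H n) z \<partial>M) - (\<integral>z. K x0 z \<partial>M) - (\<Sum>b\<in>Basis. (H n \<bullet> b) * (\<integral>z. k b z \<partial>M))) / norm (H n))) \<longlonglongrightarrow> 0"
      by (intro tendsto_norm_zero) simp
    then show "((\<lambda>h. norm ((\<integral>z. K (x0 + h) z \<partial>M) - (\<integral>z. K x0 z \<partial>M) - (\<Sum>b\<in>Basis. (h \<bullet> b) * (\<integral>z. k b z \<partial>M))) / norm h) \<circ> H) \<longlonglongrightarrow> 0"
      by (simp add: o_def)
  qed
qed

lemma dir_deriv_basis:
  fixes f :: "'a::euclidean_space => real"
  assumes "Ck (Suc 0) f"
  shows "dir_deriv h f x = (\<Sum>b\<in>Basis. (h \<bullet> b) * dir_deriv b f x)"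
proof -
  have l: "linear (\<lambda>h. dir_deriv h f x)"
    using has_derivative_bounded_linear[OF Ck_has_derivative[OF assms]] by (rule bounded_linear.linear)
  have "dir_deriv (\<Sum>b\<in>Basis. (h \<bullet> b) *\<^sub>R b) f x = (\<Sum>b\<in>Basis. (h \<bullet> b) * dir_deriv b f x)"
    by (simp add: linear_sum[OF l] linear_scale[OF l])
  then show ?thesis by (simp add: euclidean_representation)
qed

lemma test_function_lipschitz:
  fixes \<phi> :: "'a::euclidean_space => real"
  assumes \<phi>: "\<phi> \<in> test_functions U"
  obtains B where "B > 0" "\<And>x y. \<bar>\<phi> x - \<phi> y\<bar> \<le> B * norm (x - y)"
proof -
  have "\<exists>B>0. \<forall>x. \<bar>dir_deriv b \<phi> x\<bar> \<le> B" for b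
    using test_function_bounded[OF test_function_dir_deriv[OF \<phi>]] by metis
  then obtain B where B: "\<And>b. B b > 0" "\<And>b x. \<bar>dir_deriv b \<phi> x\<bar> \<le> B b" by metis
  have "norm (\<phi> x - \<phi> y) \<le> (\<Sum>b\<in>Basis. B b) * norm (x - y)" for x y
  proof (rule differentiable_bound[of UNIV])
    show "(\<phi> has_derivative (\<lambda>h. dir_deriv h \<phi> x)) (at x within UNIV)" for x
      using Ck_has_derivative[OF test_function_Ck[OF \<phi>]] by simp
    show "onorm (\<lambda>h. dir_deriv h \<phi> x) \<le> (\<Sum>b\<in>Basis. B b)" for x
    proof (rule onorm_bound)
      fix h
      have "norm (dir_deriv h \<phi> x) = \<bar>\<Sum>b\<in>Basis. (h \<bullet> b) * dir_deriv b \<phi> x\<bar>"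
        by (subst dir_deriv_basis[OF test_function_Ck[OF \<phi>], where h=h]) simp
      also have "\<dots> \<le> (\<Sum>b\<in>Basis. norm h * B b)"
        by (intro order_trans[OF sum_abs] sum_mono)
           (auto simp: abs_mult intro!: mult_mono Basis_le_norm B)
      finally show "norm (dir_deriv h \<phi> x) \<le> (\<Sum>b\<in>Basis. B b) * norm h"
        by (simp add: sum_distrib_left mult.commute)
    qed (intro sum_nonneg less_imp_le B)
  qed auto
  moreover have "(\<Sum>b\<in>(Basis::'a set). B b) > 0" using B(1) nonempty_Basis by (intro sum_pos) auto
  ultimately show ?thesis by (intro that[of "\<Sum>b\<in>(Basis::'a set). B b"]) auto
qed

definition convolve :: "('a::euclidean_space => real) => ('a => real) => 'a => real" where
  "convolve \<rho> f x = (LBINT y. f y * \<rho> (x - y))"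

lemma convolve_integrable:
  assumes \<rho>: "\<rho> \<in> test_functions U" and f: "integrable lborel f"
  shows "integrable lborel (\<lambda>y. f y * \<rho> (x - y))"
proof -
  obtain B where B: "\<And>x. \<bar>\<rho> x\<bar> \<le> B" using test_function_bounded[OF \<rho>] by metis
  note [measurable] = test_function_borel[OF \<rho>]
  show ?thesis
  proof (rule Bochner_Integration.integrable_bound)
    show "integrable lborel (\<lambda>y. B * \<bar>f y\<bar>)" using f by auto
    show "AE y in lborel. norm (f y * \<rho> (x - y)) \<le> norm (B * \<bar>f y\<bar>)"
      using mult_left_mono[OF B abs_ge_zero] order_trans[OF abs_ge_zero B]
      by (intro AE_I2) (simp add: abs_mult mult.commute)
  qed (use f in measurable)
qed

lemma convolve_has_derivative:
  assumes \<rho>: "\<rho> \<in> test_functions U" and f: "integrable lborel f"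
  shows "(convolve \<rho> f has_derivative (\<lambda>h. \<Sum>b\<in>Basis. (h \<bullet> b) * convolve (dir_deriv b \<rho>) f x)) (at x)"
proof -
  obtain B where B: "\<And>x y. \<bar>\<rho> x - \<rho> y\<bar> \<le> B * norm (x - y)" using test_function_lipschitz[OF \<rho>] by metis
  have "((\<lambda>x. LBINT y. f y * \<rho> (x - y)) has_derivative
      (\<lambda>h. \<Sum>b\<in>Basis. (h \<bullet> b) * (LBINT y. f y * dir_deriv b \<rho> (x - y)))) (at x)"
  proof (rule has_derivative_integral)
    fix y
    have "((\<lambda>x. x - y) has_derivative (\<lambda>h. h)) (at x)" by (auto intro!: derivative_eq_intros)
    from has_derivative_mult_right[OF has_derivative_compose[OF this Ck_has_derivative[OF test_function_Ck[OF \<rho>]]], of "f y"]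
    have "((\<lambda>x. f y * \<rho> (x - y)) has_derivative (\<lambda>h. f y * dir_deriv h \<rho> (x - y))) (at x)" .
    moreover have "f y * dir_deriv h \<rho> (x - y) = (\<Sum>b\<in>Basis. (h \<bullet> b) * (f y * dir_deriv b \<rho> (x - y)))" for h
      by (subst dir_deriv_basis[OF test_function_Ck[OF \<rho>], where h=h]) (simp add: sum_distrib_left mult_ac)
    ultimately show "((\<lambda>x. f y * \<rho> (x - y)) has_derivative (\<lambda>h. \<Sum>b\<in>Basis. (h \<bullet> b) * (f y * dir_deriv b \<rho> (x - y)))) (at x)"
      by (rule has_derivative_eq_rhs[OF _ ext])
    fix x'
    show "\<bar>f y * \<rho> (x' - y) - f y * \<rho> (x - y)\<bar> \<le> \<bar>f y\<bar> * B * norm (x' - x)"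
      using mult_left_mono[OF B[of "x' - y" "x - y"], of "\<bar>f y\<bar>"]
      by (simp add: abs_mult mult.assoc flip: right_diff_distrib)
  qed (use f in \<open>auto intro!: convolve_integrable[OF _ f] \<rho> test_function_dir_deriv\<close>)
  then show ?thesis unfolding convolve_def[abs_def] .
qed

lemma dir_deriv_convolve:
  assumes \<rho>: "\<rho> \<in> test_functions U" and f: "integrable lborel f"
  shows "dir_deriv h (convolve \<rho> f) x = convolve (dir_deriv h \<rho>) f x"
proof -
  have "dir_deriv h (convolve \<rho> f) x = (\<Sum>b\<in>Basis. (h \<bullet> b) * convolve (dir_deriv b \<rho>) f x)"
    by (rule dir_deriv_eqI[OF convolve_has_derivative[OF assms]])
  also have "\<dots> = (LBINT y. (\<Sum>b\<in>Basis. (h \<bullet> b) * (f y * dir_deriv b \<rho> (x - y))))"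
    unfolding convolve_def
    by (subst Bochner_Integration.integral_sum)
       (auto intro!: integrable_mult_right convolve_integrable[OF _ f] test_function_dir_deriv \<rho>)
  also have "\<dots> = convolve (dir_deriv h \<rho>) f x" unfolding convolve_def
    by (subst dir_deriv_basis[OF test_function_Ck[OF \<rho>], where h=h]) (simp add: sum_distrib_left mult_ac)
  finally show ?thesis .
qed

text \<open>All derivatives fall on the test function; the difference quotients are dominated through its Lipschitz constant.\<close>
lemma Ck_convolve:
  assumes f: "integrable lborel f"
  shows "\<rho> \<in> test_functions U ==> Ck k (convolve \<rho> f)"
proof (induction k arbitrary: \<rho>)
  case 0
  then show ?case
    using has_derivative_continuous[OF convolve_has_derivative[OF 0 f]] by (simp add: continuous_at_imp_continuous_on)
next
  case (Suc k)
  have "dir_deriv b (convolve \<rho> f) = convolve (dir_deriv b \<rho>) f" for b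
    using dir_deriv_convolve[OF Suc.prems f] by auto
  then show ?case using Suc.IH[OF test_function_dir_deriv[OF Suc.prems]] convolve_has_derivative[OF Suc.prems f]
    by (auto simp: differentiable_def)
qed

lemma mollifier_test_function_UNIV: "e > 0 ==> mollifier e \<in> test_functions UNIV"
  by (rule test_functionI[of _ "cball 0 e"]) (auto intro: Ck_mollifier mollifier_support)

text \<open>Jensen's inequality bounds the error by an average of translation errors, which are uniformly small near zero.\<close>
lemma mollify_converges:
  fixes f :: "'a::euclidean_space => real"
  assumes q: "q \<ge> 1" and f: "powr_integrable lborel q f" and f1: "integrable lborel f" and "\<epsilon> > 0"
  shows "\<forall>\<^sub>F e in at_right 0. powr_integrable lborel q (\<lambda>x. convolve (mollifier e) f x - f x) \<and>
      (LBINT x. \<bar>convolve (mollifier e) f x - f x\<bar> powr q) < \<epsilon>"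
proof -
  note [measurable] = powr_integrable_borel[OF f]
  have "\<forall>\<^sub>F y in at 0. (LBINT x. \<bar>f (x + y) - f x\<bar> powr q) < \<epsilon> / 2"
    using \<open>\<epsilon> > 0\<close> by (intro order_tendstoD(2)[OF translation_powr[OF q f]]) auto
  then obtain d where d: "d > 0" "\<And>y. y \<noteq> 0 ==> norm y < d ==> (LBINT x. \<bar>f (x + y) - f x\<bar> powr q) < \<epsilon> / 2"
    unfolding eventually_at by (auto simp: dist_norm)
  have dy: "(LBINT x. \<bar>f (x + y) - f x\<bar> powr q) \<le> \<epsilon> / 2" if "norm y < d" for y
    using d(2)[OF _ that] \<open>\<epsilon> > 0\<close> by (cases "y = 0") auto
  show ?thesis
  proof (rule eventually_at_rightI[OF _ \<open>d > 0\<close>])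
    fix e assume "e \<in> {0<..<d}"
    then have e: "e > 0" "e < d" by auto
    note [measurable] = borel_measurable_integrable[OF mollifier_integrable[OF e(1), where 'a='a]]
    let ?m = "mollifier e :: 'a => real"
    have m: "integrable lborel ?m" "\<And>x. ?m x \<ge> 0" "(LBINT x. ?m x) = 1"
      using mollifier_integrable[OF e(1)] mollifier_nonneg mollifier_integral[OF e(1)] by auto
    have ci: "integrable lborel (\<lambda>y. f (x - y) * ?m y)" for x
      using convolve_integrable[OF mollifier_test_function_UNIV[OF e(1)] f1, of x]
        integrable_reflect[of "\<lambda>y. f (x - y) * ?m y" x] by simp
    have c: "convolve ?m f x - f x = (LBINT y. (f (x - y) - f x) * ?m y)" for x
    proof -
      have "convolve ?m f x = (LBINT y. f (x - y) * ?m y)"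
        unfolding convolve_def using integral_reflect[of "\<lambda>y. f (x - y) * ?m y" x] by simp
      then show ?thesis using ci[of x] m by (simp add: left_diff_distrib)
    qed
    have [measurable]: "convolve ?m f \<in> Borel"
      using Ck_convolve[OF f1 mollifier_test_function_UNIV[OF e(1)], of 0] by (simp add: borel_measurable_continuous_onI)
    have jensen: "ennreal (\<bar>convolve ?m f x - f x\<bar> powr q) \<le> (\<integral>\<^sup>+y. ennreal (\<bar>f (x - y) - f x\<bar> powr q * ?m y) \<partial>lborel)" for x
    proof (cases "(\<integral>\<^sup>+y. ennreal (\<bar>f (x - y) - f x\<bar> powr q * ?m y) \<partial>lborel) < \<infinity>")
      case True
      then have i: "integrable lborel (\<lambda>y. \<bar>f (x - y) - f x\<bar> powr q * ?m y)"
        using m(2) by (intro integrableI_bounded) auto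
      have "\<bar>convolve ?m f x - f x\<bar> powr q \<le> (LBINT y. \<bar>f (x - y) - f x\<bar> powr q * ?m y)"
        unfolding c by (rule weighted_power_mean(2)[OF q _ m i]) measurable
      also have "ennreal \<dots> = (\<integral>\<^sup>+y. ennreal (\<bar>f (x - y) - f x\<bar> powr q * ?m y) \<partial>lborel)"
        using m(2) by (intro nn_integral_eq_integral[symmetric] i) auto
      finally show ?thesis by (simp add: ennreal_leI)
    next
      case False
      then show ?thesis by (simp add: infinity_ennreal_def less_top[symmetric])
    qed
    have "(\<integral>\<^sup>+x. ennreal (\<bar>convolve ?m f x - f x\<bar> powr q) \<partial>lborel)
        \<le> (\<integral>\<^sup>+x. (\<integral>\<^sup>+y. ennreal (\<bar>f (x - y) - f x\<bar> powr q * ?m y) \<partial>lborel) \<partial>lborel)"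
      by (intro nn_integral_mono jensen)
    also have "\<dots> = (\<integral>\<^sup>+y. (\<integral>\<^sup>+x. ennreal (\<bar>f (x - y) - f x\<bar> powr q * ?m y) \<partial>lborel) \<partial>lborel)"
      by (rule lborel_pair.Fubini') measurable
    also have "\<dots> \<le> (\<integral>\<^sup>+y. ennreal (\<epsilon> / 2) * ennreal (?m y) \<partial>lborel)"
    proof (rule nn_integral_mono)
      fix y :: 'a
      show "(\<integral>\<^sup>+x. ennreal (\<bar>f (x - y) - f x\<bar> powr q * ?m y) \<partial>lborel) \<le> ennreal (\<epsilon> / 2) * ennreal (?m y)"
      proof (cases "y \<in> cball 0 e")
        case True
        have "powr_integrable lborel q (\<lambda>x. f (x - y))"
          using f integrable_translate[of "\<lambda>x. \<bar>f x\<bar> powr q" "- y"] by (auto simp: powr_integrable_def)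
        then have "powr_integrable lborel q (\<lambda>x. f (x - y) - f x)" using f q by (intro powr_integrable_diff) auto
        then have i: "integrable lborel (\<lambda>x. \<bar>f (x - y) - f x\<bar> powr q)" by (rule powr_integrable_integrable)
        have "(\<integral>\<^sup>+x. ennreal (\<bar>f (x - y) - f x\<bar> powr q * ?m y) \<partial>lborel)
            = (\<integral>\<^sup>+x. ennreal (\<bar>f (x - y) - f x\<bar> powr q) \<partial>lborel) * ennreal (?m y)"
          using m(2) by (subst nn_integral_multc[symmetric]) (auto simp: ennreal_mult)
        also have "(\<integral>\<^sup>+x. ennreal (\<bar>f (x - y) - f x\<bar> powr q) \<partial>lborel) = ennreal (LBINT x. \<bar>f (x - y) - f x\<bar> powr q)"
          by (intro nn_integral_eq_integral i) auto
        also have "\<dots> \<le> ennreal (\<epsilon> / 2)"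
          using dy[of "- y"] True e by (intro ennreal_leI) auto
        finally show ?thesis by (simp add: mult_right_mono)
      next
        case False
        then have "?m y = 0" by (rule mollifier_support[OF e(1)])
        then show ?thesis by simp
      qed
    qed
    also have "\<dots> = ennreal (\<epsilon> / 2) * ennreal (LBINT y. ?m y)"
      using m by (subst nn_integral_cmult) (auto simp: nn_integral_eq_integral)
    finally have *: "(\<integral>\<^sup>+x. ennreal (\<bar>convolve ?m f x - f x\<bar> powr q) \<partial>lborel) \<le> ennreal (\<epsilon> / 2)" using m by simp
    then have i: "integrable lborel (\<lambda>x. \<bar>convolve ?m f x - f x\<bar> powr q)"
      by (intro integrableI_bounded) (auto simp: order.strict_trans1)
    moreover have "(LBINT x. \<bar>convolve ?m f x - f x\<bar> powr q) \<le> \<epsilon> / 2"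
      using * \<open>\<epsilon> > 0\<close> by (subst (asm) nn_integral_eq_integral[OF i]) auto
    ultimately show "powr_integrable lborel q (\<lambda>x. convolve ?m f x - f x) \<and>
        (LBINT x. \<bar>convolve ?m f x - f x\<bar> powr q) < \<epsilon>"
      using \<open>\<epsilon> > 0\<close> by (auto simp: powr_integrable_def)
  qed
qed

section \<open>Borel representatives\<close>

lemma AE_lebesgue_on:
  "S \<in> sets borel ==> (AE x in lebesgue_on S. P x) \<longleftrightarrow> (AE x\<in>S in lborel. P x)"
  by (subst AE_restrict_space_iff) (auto simp: AE_completion_iff)

text \<open>Extension by zero makes every later integral one over the whole space.\<close>
lemma borel_representative:
  fixes f :: "'a::euclidean_space => real"
  assumes "f \<in> borel_measurable (lebesgue_on S)" and [measurable]: "S \<in> sets borel"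
  obtains f' where "f' \<in> Borel" "\<And>x. x \<notin> S ==> f' x = 0" "AE x\<in>S in lborel. f x = f' x"
proof -
  have "(\<lambda>x. if x \<in> S then f x else 0) \<in> borel_measurable lebesgue"
    using assms by (subst borel_measurable_if) auto
  then obtain g where g[measurable]: "g \<in> borel_measurable lborel" and eq: "AE x in lborel. (if x \<in> S then f x else 0) = g x"
    using completion_ex_borel_measurable_real by blast
  show ?thesis
  proof (rule that[of "\<lambda>x. if x \<in> S then g x else 0"])
    show "AE x\<in>S in lborel. f x = (if x \<in> S then g x else 0)" using eq by eventually_elim auto
  qed (use g in \<open>auto simp: measurable_lborel1\<close>)
qed

lemma
  fixes f f' :: "'a::euclidean_space => real"
  assumes [measurable]: "f' \<in> Borel" and S[measurable]: "S \<in> sets borel"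
    and eq: "AE x\<in>S in lborel. f x = f' x"
  shows borel_measurable_lebesgue_on_AE: "f \<in> borel_measurable (lebesgue_on S)"
    and integrable_lebesgue_on_AE: "integrable (lebesgue_on S) f \<longleftrightarrow> integrable lborel (\<lambda>x. indicator S x * f' x)"
    and integral_lebesgue_on_AE: "integral\<^sup>L (lebesgue_on S) f = integral\<^sup>L lborel (\<lambda>x. indicator S x * f' x)"
proof -
  have m: "(\<lambda>x. indicator S x * f' x) \<in> borel_measurable lebesgue" by (rule measurable_completion) simp
  have eq': "AE x in lebesgue. indicator S x * f' x = (if x \<in> S then f x else 0)"
    by (rule AE_completion, use eq in eventually_elim) auto
  have m': "(\<lambda>x. if x \<in> S then f x else 0) \<in> borel_measurable lebesgue"
    using borel_measurable_AE[OF m eq'] .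
  have if_eq: "(\<lambda>x. if x \<in> S then f x else 0) = (\<lambda>x. indicator S x *\<^sub>R f x)" by (auto simp: indicator_def fun_eq_iff)
  show "f \<in> borel_measurable (lebesgue_on S)" using m' by (subst (asm) borel_measurable_if) auto
  have "integrable (lebesgue_on S) f \<longleftrightarrow> integrable lebesgue (\<lambda>x. if x \<in> S then f x else 0)"
    unfolding if_eq by (rule integrable_restrict_space) simp
  also have "\<dots> \<longleftrightarrow> integrable lebesgue (\<lambda>x. indicator S x * f' x)"
    using eq' by (intro integrable_cong_AE m m') auto
  also have "\<dots> \<longleftrightarrow> integrable lborel (\<lambda>x. indicator S x * f' x)" by (rule integrable_completion) simp
  finally show "integrable (lebesgue_on S) f \<longleftrightarrow> integrable lborel (\<lambda>x. indicator S x * f' x)" .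
  have "integral\<^sup>L (lebesgue_on S) f = integral\<^sup>L lebesgue (\<lambda>x. if x \<in> S then f x else 0)"
    unfolding if_eq by (rule integral_restrict_space) simp
  also have "\<dots> = integral\<^sup>L lebesgue (\<lambda>x. indicator S x * f' x)"
    using eq' by (intro integral_cong_AE m m') auto
  also have "\<dots> = integral\<^sup>L lborel (\<lambda>x. indicator S x * f' x)" by (rule integral_completion) simp
  finally show "integral\<^sup>L (lebesgue_on S) f = integral\<^sup>L lborel (\<lambda>x. indicator S x * f' x)" .
qed

section \<open>The fundamental lemma of the calculus of variations\<close>

definition locally_integrable_on :: "('a::euclidean_space => real) => 'a set => bool" where
  "locally_integrable_on f U \<longleftrightarrow> (\<forall>K. compact K --> K \<subseteq> U --> integrable lborel (\<lambda>x. indicator K x * f x))"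

lemma locally_integrable_onD:
  "locally_integrable_on f U ==> compact K ==> K \<subseteq> U ==> integrable lborel (\<lambda>x. indicator K x * f x)"
  by (auto simp: locally_integrable_on_def)

lemma integrable_test_product:
  assumes f: "locally_integrable_on f U" and \<phi>: "\<phi> \<in> test_functions U"
  shows "integrable lborel (\<lambda>x. f x * \<phi> x)"
proof -
  obtain K where K: "compact K" "K \<subseteq> U" "\<And>x. x \<notin> K ==> \<phi> x = 0" using test_function_support[OF \<phi>] by metis
  obtain B where B: "\<And>x. \<bar>\<phi> x\<bar> \<le> B" using test_function_bounded[OF \<phi>] by metis
  note i = locally_integrable_onD[OF f K(1,2)]
  note [measurable] = test_function_borel[OF \<phi>] borel_measurable_integrable[OF i]
  have "integrable lborel (\<lambda>x. (indicator K x * f x) * \<phi> x)"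
  proof (rule Bochner_Integration.integrable_bound)
    show "integrable lborel (\<lambda>x. \<bar>indicator K x * f x\<bar> * B)" using i by auto
    show "AE x in lborel. norm ((indicator K x * f x) * \<phi> x) \<le> norm (\<bar>indicator K x * f x\<bar> * B)"
      using B order_trans[OF abs_ge_zero B] by (intro AE_I2) (auto simp: abs_mult intro!: mult_left_mono)
  qed measurable
  moreover have "(\<lambda>x. (indicator K x * f x) * \<phi> x) = (\<lambda>x. f x * \<phi> x)"
  proof
    show "(indicator K x * f x) * \<phi> x = f x * \<phi> x" for x using K(3)[of x] by (cases "x \<in> K") auto
  qed
  ultimately show ?thesis by simp
qed

text \<open>Convolutions of \<open>e\<close> with mollifiers vanish at the points of a dense set, hence everywhere by continuity, and they converge to \<open>e\<close> in the mean.\<close>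
lemma AE_zero_ball:
  fixes e :: "'a::euclidean_space => real"
  assumes e: "locally_integrable_on e U" and cb: "cball x0 (2 * r) \<subseteq> U" "r > 0"
    and dense: "\<And>X. open X ==> X \<noteq> {} ==> \<exists>d\<in>D. d \<in> X"
    and zero: "\<And>n q. q \<in> D ==> cball q (1 / Suc n) \<subseteq> U ==> (LBINT y. e y * mollifier (1 / Suc n) (q - y)) = 0"
  shows "AE x in lborel. x \<in> ball x0 r --> e x = 0"
proof -
  define F where "F x = indicator (cball x0 (2 * r)) x * e x" for x
  have F: "integrable lborel F" unfolding F_def[abs_def] by (rule locally_integrable_onD[OF e _ cb(1)]) simp
  have conv0: "convolve (mollifier (1 / Suc n)) F q = 0" if n: "1 / Suc n < r" and q: "q \<in> ball x0 r" for n q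
  proof (rule ccontr)
    let ?c = "convolve (mollifier (1 / Suc n)) F"
    assume "?c q \<noteq> 0"
    have "continuous_on UNIV ?c"
      using Ck_convolve[OF F mollifier_test_function_UNIV, of "1 / Suc n" 0] by simp
    then have "open (?c -` (- {0}))" by (intro open_vimage) auto
    then have "open (?c -` (- {0}) \<inter> ball x0 r)" by auto
    moreover have "?c -` (- {0}) \<inter> ball x0 r \<noteq> {}" using \<open>?c q \<noteq> 0\<close> q by auto
    ultimately obtain d where d: "d \<in> D" "?c d \<noteq> 0" "d \<in> ball x0 r" using dense by blast
    have sub: "cball d (1 / Suc n) \<subseteq> cball x0 (2 * r)"
      using d(3) n by (intro subset_trans[OF cball_subset_cball_iff[THEN iffD2] order_refl]) (auto simp: dist_commute)
    have "?c d = (LBINT y. e y * mollifier (1 / Suc n) (d - y))"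
      unfolding convolve_def
    proof (intro Bochner_Integration.integral_cong refl)
      fix y
      show "F y * mollifier (1 / Suc n) (d - y) = e y * mollifier (1 / Suc n) (d - y)"
      proof (cases "y \<in> cball x0 (2 * r)")
        case False
        then have "d - y \<notin> cball 0 (1 / Suc n)" using sub by (auto simp: dist_norm norm_minus_commute)
        then show ?thesis using mollifier_support[of "1 / Suc n" "d - y"] by simp
      qed (simp add: F_def)
    qed
    also have "\<dots> = 0" using zero[OF d(1)] sub cb by blast
    finally show False using d by simp
  qed
  have le: "(LBINT x. indicator (ball x0 r) x * \<bar>F x\<bar>) \<le> \<epsilon>" if \<epsilon>: "\<epsilon> > 0" for \<epsilon>
  proof -
    have F1: "powr_integrable lborel 1 F" using F by (simp add: powr_integrable_1)
    obtain d where d: "d > 0" "\<And>e. 0 < e ==> e < d ==> integrable lborel (\<lambda>x. convolve (mollifier e) F x - F x) \<and>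
        (LBINT x. \<bar>convolve (mollifier e) F x - F x\<bar>) < \<epsilon>"
      using mollify_converges[OF _ F1 F \<epsilon>] unfolding powr_integrable_1 eventually_at_right_field by auto
    obtain n where n: "1 / Suc n < min d r" using d(1) \<open>r > 0\<close> nat_approx_posE[of "min d r"]
      by (metis inverse_eq_divide min_less_iff_conj)
    note c = d(2)[of "1 / Suc n"]
    have "(LBINT x. indicator (ball x0 r) x * \<bar>F x\<bar>) \<le> (LBINT x. \<bar>convolve (mollifier (1 / Suc n)) F x - F x\<bar>)"
      by (rule Bochner_Integration.integral_mono_AE')
         (use c n conv0[of n] in \<open>auto simp: indicator_def\<close>)
    then show ?thesis using c n by simp
  qed
  have i: "integrable lborel (\<lambda>x. indicator (ball x0 r) x * \<bar>F x\<bar>)"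
    using integrable_mult_indicator[of "ball x0 r" lborel "\<lambda>x. \<bar>F x\<bar>"] F by auto
  have "(LBINT x. indicator (ball x0 r) x * \<bar>F x\<bar>) \<ge> 0" by (auto intro!: Bochner_Integration.integral_nonneg)
  then have "(LBINT x. indicator (ball x0 r) x * \<bar>F x\<bar>) = 0"
    using le by (meson dense_ge order_antisym)
  then have "AE x in lborel. indicator (ball x0 r) x * \<bar>F x\<bar> = 0"
    using integral_nonneg_eq_0_iff_AE[OF i] by auto
  then show ?thesis
  proof eventually_elim
    case (elim x)
    have "ball x0 r \<subseteq> cball x0 (2 * r)" using \<open>r > 0\<close> by (auto simp: less_imp_le intro: order_trans)
    then show ?case using elim by (auto simp: F_def indicator_def split: if_splits)
  qed
qed

text \<open>A countable family of test functions suffices in the fundamental lemma. This matters for slices: the exceptional null sets of times, one per test function, can be united.\<close>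
theorem countable_test_functions:
  fixes U :: "'a::euclidean_space set"
  assumes "open U"
  obtains \<D> where "countable \<D>" "\<D> \<subseteq> test_functions U"
    "\<And>e. locally_integrable_on e U ==> (\<And>\<phi>. \<phi> \<in> \<D> ==> (LBINT y. e y * \<phi> y) = 0) ==> AE x\<in>U in lborel. e x = 0"
proof -
  obtain D :: "'a set" where D: "countable D" "\<And>X. open X ==> X \<noteq> {} ==> \<exists>d\<in>D. d \<in> X"
    by (rule countable_dense_setE) blast
  define \<D> where "\<D> = (\<lambda>(n, q) y. mollifier (1 / Suc n) (q - y)) ` {(n, q). q \<in> D \<and> cball q (1 / Suc n) \<subseteq> U}"
  show ?thesis
  proof (rule that)
    have "countable (UNIV \<times> D :: (nat \<times> 'a) set)" using D by auto
    then have "countable {(n::nat, q). q \<in> D \<and> cball q (1 / Suc n) \<subseteq> U}" by (rule countable_subset[rotated]) auto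
    then show "countable \<D>" unfolding \<D>_def by (rule countable_image)
    show "\<D> \<subseteq> test_functions U" unfolding \<D>_def by (auto intro!: mollifier_test_function)
    fix e assume e: "locally_integrable_on e U" and z: "\<And>\<phi>. \<phi> \<in> \<D> ==> (LBINT y. e y * \<phi> y) = 0"
    have "\<exists>r>0. cball x (2 * r) \<subseteq> U" if "x \<in> U" for x
    proof -
      obtain s where "s > 0" "cball x s \<subseteq> U" using open_contains_cball[of U] assms \<open>x \<in> U\<close> by blast
      then show ?thesis by (intro exI[of _ "s / 2"]) auto
    qed
    then obtain r where r: "\<And>x. x \<in> U ==> r x > 0" "\<And>x. x \<in> U ==> cball x (2 * r x) \<subseteq> U" by metis
    obtain \<F> where \<F>: "\<F> \<subseteq> (\<lambda>x. ball x (r x)) ` U" "countable \<F>" "\<Union>\<F> = \<Union>((\<lambda>x. ball x (r x)) ` U)"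
      using Lindelof[of "(\<lambda>x. ball x (r x)) ` U"] by auto
    have "AE x in lborel. x \<in> B --> e x = 0" if B: "B \<in> \<F>" for B
    proof -
      obtain x where x: "x \<in> U" "B = ball x (r x)" using \<F>(1) B by blast
      show ?thesis unfolding x(2)
        by (rule AE_zero_ball[OF e r(2) r(1) D(2)]) (use x(1) z in \<open>auto simp: \<D>_def\<close>)
    qed
    then have "AE x in lborel. \<forall>B\<in>\<F>. x \<in> B --> e x = 0" using \<F>(2) by (subst AE_ball_countable) auto
    then show "AE x\<in>U in lborel. e x = 0"
    proof eventually_elim
      case (elim x)
      then show ?case using \<F>(3) r(1) by (metis UN_iff UnionE centre_in_ball)
    qed
  qed
qed

section \<open>Weak derivatives\<close>

lemma test_function_integral_dir_deriv:
  fixes \<phi> :: "'a::euclidean_space => real"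
  assumes \<phi>: "\<phi> \<in> test_functions U"
  shows "(LBINT x. dir_deriv b \<phi> x) = 0"
proof -
  obtain K where K: "compact K" "\<And>x. x \<notin> K ==> \<phi> x = 0" "\<And>b x. x \<notin> K ==> dir_deriv b \<phi> x = 0"
    using test_function_support[OF \<phi>] by metis
  then obtain R where R: "K \<subseteq> ball 0 R" "R > 0" using compact_imp_bounded[THEN bounded_subset_ballD] by metis
  define f where "f = (indicator (cball 0 (R + 1)) :: 'a => real)"
  have f: "integrable lborel f"
    using emeasure_lborel_cball_finite[of "0::'a" "R + 1"] unfolding f_def by simp
  note [measurable] = test_function_borel[OF \<phi>] test_function_borel[OF test_function_dir_deriv[OF \<phi>]]
  have shift: "(LBINT y. f y * \<psi> (x - y)) = (LBINT y. \<psi> y)"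
    if x: "norm x < 1" and [measurable]: "\<psi> \<in> Borel" and \<psi>: "\<And>x. x \<notin> K ==> \<psi> x = 0" for x \<psi>
  proof -
    have "(LBINT y. f y * \<psi> (x - y)) = (LBINT y. \<psi> (x - y))"
    proof (intro Bochner_Integration.integral_cong refl)
      fix y
      show "f y * \<psi> (x - y) = \<psi> (x - y)"
      proof (cases "norm y \<le> R + 1")
        case False
        then have "norm (x - y) \<ge> R" using x norm_triangle_ineq2[of y x] by (simp add: norm_minus_commute)
        then have "x - y \<notin> K" using R by auto
        then show ?thesis using \<psi> by simp
      qed (simp add: f_def)
    qed
    then show ?thesis by (simp add: integral_reflect)
  qed
  have "((\<lambda>x. LBINT y. \<phi> y) has_derivative (\<lambda>h. 0)) (at 0)" by simp
  then have "(convolve \<phi> f has_derivative (\<lambda>h. 0)) (at 0)"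
    by (rule has_derivative_transform_within_open[of _ _ _ _ "ball 0 1"])
       (use shift[of _ \<phi>] K in \<open>auto simp: convolve_def\<close>)
  then have "0 = convolve (dir_deriv b \<phi>) f 0" using dir_deriv_convolve[OF \<phi> f, of b 0] dir_deriv_eqI by fastforce
  also have "\<dots> = (LBINT y. dir_deriv b \<phi> y)"
    unfolding convolve_def using K by (intro shift) auto
  finally show ?thesis by simp
qed

lemma test_function_mult: "\<phi> \<in> test_functions U ==> \<psi> \<in> test_functions V ==> (\<lambda>x. \<phi> x * \<psi> x) \<in> test_functions U"
proof -
  assume \<phi>: "\<phi> \<in> test_functions U" and \<psi>: "\<psi> \<in> test_functions V"
  obtain K where "compact K" "K \<subseteq> U" "\<And>x. x \<notin> K ==> \<phi> x = 0" using \<phi> test_function_support by metis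
  then show ?thesis
    by (intro test_functionI[where K=K] Ck_mult test_function_Ck[OF \<phi>] test_function_Ck[OF \<psi>]) auto
qed

lemma test_function_by_parts:
  assumes \<phi>: "\<phi> \<in> test_functions U" and \<psi>: "\<psi> \<in> test_functions U"
  shows "(LBINT x. \<phi> x * dir_deriv b \<psi> x) = - (LBINT x. dir_deriv b \<phi> x * \<psi> x)"
proof -
  have "dir_deriv b (\<lambda>x. \<phi> x * \<psi> x) x = \<phi> x * dir_deriv b \<psi> x + dir_deriv b \<phi> x * \<psi> x" for x
    by (rule dir_deriv_eqI[OF has_derivative_mult]) (intro Ck_has_derivative test_function_Ck[OF \<phi>] test_function_Ck[OF \<psi>])+
  then have "0 = (LBINT x. \<phi> x * dir_deriv b \<psi> x + dir_deriv b \<phi> x * \<psi> x)"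
    using test_function_integral_dir_deriv[OF test_function_mult[OF \<phi> \<psi>], of b] by simp
  also have "\<dots> = (LBINT x. \<phi> x * dir_deriv b \<psi> x) + (LBINT x. dir_deriv b \<phi> x * \<psi> x)"
    using test_function_integrable[OF test_function_mult[OF \<phi> test_function_dir_deriv[OF \<psi>]]]
      test_function_integrable[OF test_function_mult[OF test_function_dir_deriv[OF \<phi>] \<psi>]] by simp
  finally show ?thesis by simp
qed

lemma test_function_locally_integrable:
  assumes \<phi>: "\<phi> \<in> test_functions V" shows "locally_integrable_on \<phi> U"
  unfolding locally_integrable_on_def
  using integrable_mult_indicator[OF _ test_function_integrable[OF \<phi>]] by (auto simp: compact_imp_closed)

text \<open>The weak derivative relation for Borel functions on the whole space, in terms of \<open>lborel\<close> only.\<close>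
definition weak_pair :: "'a::euclidean_space set => 'a => ('a => real) => ('a => real) => bool" where
  "weak_pair U b f d \<longleftrightarrow> locally_integrable_on f U \<and> locally_integrable_on d U \<and>
     (\<forall>\<phi>\<in>test_functions U. (LBINT x. f x * dir_deriv b \<phi> x) = - (LBINT x. d x * \<phi> x))"

lemma weak_pair_test: "\<phi> \<in> test_functions U ==> weak_pair U b \<phi> (dir_deriv b \<phi>)"
  unfolding weak_pair_def
  by (auto intro: test_function_locally_integrable test_function_dir_deriv test_function_by_parts)

lemma weak_pair_diff:
  assumes f: "weak_pair U b f d" and g: "weak_pair U b g e"
  shows "weak_pair U b (\<lambda>x. f x - g x) (\<lambda>x. d x - e x)"
proof -
  have [simp]: "locally_integrable_on f U" "locally_integrable_on d U" "locally_integrable_on g U" "locally_integrable_on e U"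
    using f g by (auto simp: weak_pair_def)
  have "locally_integrable_on (\<lambda>x. f x - g x) U" "locally_integrable_on (\<lambda>x. d x - e x) U"
    using f g unfolding weak_pair_def locally_integrable_on_def by (auto simp: right_diff_distrib)
  moreover have "(LBINT x. (f x - g x) * dir_deriv b \<phi> x) = - (LBINT x. (d x - e x) * \<phi> x)" if \<phi>: "\<phi> \<in> test_functions U" for \<phi>
    using f g \<phi> integrable_test_product[OF _ \<phi>] integrable_test_product[OF _ test_function_dir_deriv[OF \<phi>, of b]]
    by (simp add: left_diff_distrib weak_pair_def)
  ultimately show ?thesis by (simp add: weak_pair_def)
qed

text \<open>The difference of two candidates annihilates all test functions.\<close>
lemma weak_pair_unique:
  assumes "open U" "weak_pair U b f d" "weak_pair U b f e"
  shows "AE x\<in>U in lborel. d x = e x"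
proof -
  obtain \<D> where \<D>: "\<D> \<subseteq> test_functions U"
    "\<And>e. locally_integrable_on e U ==> (\<And>\<phi>. \<phi> \<in> \<D> ==> (LBINT y. e y * \<phi> y) = 0) ==> AE x\<in>U in lborel. e x = 0"
    using countable_test_functions[OF \<open>open U\<close>] by metis
  have d: "weak_pair U b (\<lambda>x. f x - f x) (\<lambda>x. d x - e x)" by (intro weak_pair_diff assms)
  have "AE x\<in>U in lborel. d x - e x = 0"
    using d \<D>(1) by (intro \<D>(2)) (auto simp: weak_pair_def)
  then show ?thesis by simp
qed

lemma has_weak_deriv_iff:
  fixes f f' d d' :: "'a::euclidean_space => real"
  assumes U: "open U" and [measurable]: "f' \<in> Borel" "d' \<in> Borel"
    and f: "AE x\<in>U in lborel. f x = f' x" and d: "AE x\<in>U in lborel. d x = d' x"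
  shows "has_weak_deriv U b f d \<longleftrightarrow> weak_pair U b f' d'"
proof -
  have [measurable]: "U \<in> sets borel" using U by simp
  have loc: "locally_integrable U f \<longleftrightarrow> locally_integrable_on f' U"
    if [measurable]: "f' \<in> Borel" and f: "AE x\<in>U in lborel. f x = f' x" for f f' :: "'a => real"
  proof -
    have "set_integrable lebesgue K f \<longleftrightarrow> integrable lborel (\<lambda>x. indicator K x * f' x)" if K: "compact K" "K \<subseteq> U" for K
    proof -
      have [measurable]: "K \<in> sets borel" using K by (simp add: compact_imp_closed)
      have "set_integrable lebesgue K f \<longleftrightarrow> integrable (lebesgue_on K) f"
        unfolding set_integrable_def by (rule integrable_restrict_space[symmetric]) simp
      also have "\<dots> \<longleftrightarrow> integrable lborel (\<lambda>x. indicator K x * f' x)"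
        by (rule integrable_lebesgue_on_AE) (use f K in \<open>auto elim!: eventually_mono\<close>)
      finally show ?thesis .
    qed
    then show ?thesis by (auto simp: locally_integrable_def locally_integrable_on_def)
  qed
  have int: "integral\<^sup>L (lebesgue_on U) (\<lambda>x. f x * \<phi> x) = (LBINT x. f' x * \<phi> x)"
    if [measurable]: "f' \<in> Borel" and f: "AE x\<in>U in lborel. f x = f' x" and \<phi>: "\<phi> \<in> test_functions U" for f f' \<phi> :: "'a => real"
  proof -
    note [measurable] = test_function_borel[OF \<phi>]
    have "integral\<^sup>L (lebesgue_on U) (\<lambda>x. f x * \<phi> x) = (LBINT x. indicator U x * (f' x * \<phi> x))"
      by (rule integral_lebesgue_on_AE) (use f in \<open>auto elim!: eventually_mono\<close>)
    also have "\<dots> = (LBINT x. f' x * \<phi> x)"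
    proof -
      obtain K where "K \<subseteq> U" "\<And>x. x \<notin> K ==> \<phi> x = 0" using test_function_support[OF \<phi>] by metis
      then show ?thesis by (intro Bochner_Integration.integral_cong) (auto simp: indicator_def subset_iff)
    qed
    finally show ?thesis .
  qed
  note [simp] = loc[OF assms(2) f] loc[OF assms(3) d] int[OF assms(2) f test_function_dir_deriv] int[OF assms(3) d]
  show ?thesis
    unfolding has_weak_deriv_def weak_pair_def by (intro conj_cong ball_cong refl) simp_all
qed

section \<open>Sections of functions on a product\<close>

lemma fst_borel_measurable [measurable]:
    "(fst :: 'a::euclidean_space \<times> 'b::euclidean_space => 'a) \<in> Borel"
  and snd_borel_measurable [measurable]:
    "(snd :: 'a::euclidean_space \<times> 'b::euclidean_space => 'b) \<in> Borel"
  by (auto intro!: borel_measurable_continuous_onI continuous_intros)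

lemma
  fixes f :: "'a::euclidean_space \<times> 'b::euclidean_space => real"
  assumes f: "integrable lborel f"
  shows AE_integrable_section: "AE t in lborel. integrable lborel (\<lambda>x. f (x, t))"
    and integrable_section_integral: "integrable lborel (\<lambda>t. LBINT x. f (x, t))"
    and integral_sections: "(LBINT z. f z) = (LBINT t. (LBINT x. f (x, t)))"
    and AE_integrable_section': "AE x in lborel. integrable lborel (\<lambda>t. f (x, t))"
    and integrable_section_integral': "integrable lborel (\<lambda>x. LBINT t. f (x, t))"
    and integral_sections': "(LBINT z. f z) = (LBINT x. (LBINT t. f (x, t)))"
proof -
  have f': "integrable (lborel \<Otimes>\<^sub>M lborel) f" using f by (simp add: lborel_prod)
  have fs: "integrable (lborel \<Otimes>\<^sub>M lborel) (\<lambda>(t, x). f (x, t))"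
    using lborel_pair.integrable_product_swap[OF f'] by simp
  show "AE t in lborel. integrable lborel (\<lambda>x. f (x, t))"
    using lborel_pair.AE_integrable_fst'[OF fs] by simp
  show "integrable lborel (\<lambda>t. LBINT x. f (x, t))"
    using lborel_pair.integrable_fst'[OF fs] by simp
  show 1: "AE x in lborel. integrable lborel (\<lambda>t. f (x, t))"
    using lborel_pair.AE_integrable_fst'[OF f'] by simp
  show 2: "integrable lborel (\<lambda>x. LBINT t. f (x, t))"
    using lborel_pair.integrable_fst'[OF f'] by simp
  show 3: "(LBINT z. f z) = (LBINT x. (LBINT t. f (x, t)))"
    using lborel_pair.integral_fst'[OF f'] by (simp add: lborel_prod)
  show "(LBINT z. f z) = (LBINT t. (LBINT x. f (x, t)))"
    using lborel_pair.Fubini_integral[of "\<lambda>x t. f (x, t)"] f' 3 by simp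
qed

lemma AE_section:
  fixes P :: "'a::euclidean_space \<times> 'b::euclidean_space => bool"
  assumes "AE z in lborel. P z"
  shows "AE t in lborel. AE x in lborel. P (x, t)" "AE x in lborel. AE t in lborel. P (x, t)"
proof -
  have P: "AE z in (lborel \<Otimes>\<^sub>M lborel). P z" using assms by (simp only: lborel_prod)
  show "AE x in lborel. AE t in lborel. P (x, t)" using lborel_pair.AE_pair[OF P] by simp
  have "AE z in (lborel \<Otimes>\<^sub>M lborel). P (snd z, fst z)"
  proof -
    have "AE z in distr (lborel \<Otimes>\<^sub>M lborel) (lborel \<Otimes>\<^sub>M lborel) (\<lambda>(x, y). (y, x)). P z"
      using P lborel_pair.distr_pair_swap by metis
    then obtain N where N: "{z. \<not> P z} \<subseteq> N" "N \<in> null_sets (distr (lborel \<Otimes>\<^sub>M lborel) (lborel \<Otimes>\<^sub>M lborel) (\<lambda>(x, y). (y, x)))"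
      by (auto simp: eventually_ae_filter space_pair_measure)
    then have "(\<lambda>(x, y). (y, x)) -` N \<in> null_sets (lborel \<Otimes>\<^sub>M lborel)"
      by (subst (asm) null_sets_distr_iff) (auto simp: space_pair_measure)
    then show ?thesis by (rule AE_I') (use N(1) in auto)
  qed
  from lborel_pair.AE_pair[OF this] show "AE t in lborel. AE x in lborel. P (x, t)" by simp
qed

lemma borel_measurable_section:
  assumes "f \<in> borel_measurable (borel :: ('a::euclidean_space \<times> 'b::euclidean_space) measure)"
  shows "(\<lambda>x. f (x, t)) \<in> Borel" "(\<lambda>t. f (x, t)) \<in> Borel"
  using assms by (auto intro: measurable_compose[rotated, OF assms])

lemma bounded_support_integrable:
  fixes f :: "'a::euclidean_space => real"
  assumes "powr_integrable lborel q f" "q \<ge> 1" "bounded S" "\<And>x. x \<notin> S ==> f x = 0"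
  shows "integrable lborel f"
proof -
  note [measurable] = powr_integrable_borel[OF assms(1)]
  obtain R where R: "S \<subseteq> cball 0 R" using \<open>bounded S\<close> by (metis bounded_subset_ballD ball_subset_cball subset_trans)
  have i: "integrable lborel (indicator (cball (0::'a) R) :: 'a => real)"
    using emeasure_lborel_cball_finite[of "0::'a" R] by simp
  show ?thesis
  proof (rule Bochner_Integration.integrable_bound)
    show "integrable lborel (\<lambda>x. indicator (cball 0 R) x + \<bar>f x\<bar> powr q)"
      using i powr_integrable_integrable[OF assms(1)] by auto
    show "AE x in lborel. norm (f x) \<le> norm (indicator (cball 0 R) x + \<bar>f x\<bar> powr q)"
    proof (intro AE_I2)
      fix x show "norm (f x) \<le> norm (indicator (cball 0 R) x + \<bar>f x\<bar> powr q)"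
        using abs_le_1_plus_powr[OF \<open>q \<ge> 1\<close>, of "f x"] subsetD[OF R, of x] assms(4)[of x] by (cases "x \<in> S") auto
    qed
  qed simp
qed

section \<open>Slices of weak derivatives\<close>

lemma locally_integrable_measurable:
  fixes d :: "'a::euclidean_space => real"
  assumes "open U" "locally_integrable U d"
  shows "d \<in> borel_measurable (lebesgue_on U)"
proof -
  obtain C :: "nat => 'a set" where C: "\<And>n. compact (C n)" "\<And>n. C n \<subseteq> U" "\<And>n. C n \<subseteq> interior (C (Suc n))" "\<Union>(range C) = U"
    using open_Union_compact_subsets[OF \<open>open U\<close>] by metis
  have mono: "C m \<subseteq> C n" if "m \<le> n" for m n
    by (rule lift_Suc_mono_le[OF _ that]) (rule subset_trans[OF C(3) interior_subset])
  have "(\<lambda>x. indicator (C n) x *\<^sub>R d x) \<in> borel_measurable lebesgue" for n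
    using assms(2) C(1,2) by (auto simp: locally_integrable_def set_integrable_def)
  moreover have "(\<lambda>n. indicator (C n) x *\<^sub>R d x) \<longlonglongrightarrow> (if x \<in> U then d x else 0)" for x
  proof (cases "x \<in> U")
    case True
    then obtain m where "x \<in> C m" using C(4) by auto
    have "\<forall>\<^sub>F n in sequentially. d x = indicator (C n) x *\<^sub>R d x"
      using eventually_ge_at_top[of m]
    proof eventually_elim
      case (elim n)
      then have "x \<in> C n" using mono \<open>x \<in> C m\<close> by blast
      then show ?case by simp
    qed
    then show ?thesis using True by (auto intro: Lim_transform_eventually[OF tendsto_const])
  next
    case False
    then have "indicator (C n) x *\<^sub>R d x = 0" for n using C(2) by (auto simp: indicator_def)
    then have "(\<lambda>n. indicator (C n) x *\<^sub>R d x) = (\<lambda>n. 0)" by blast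
    then show ?thesis using False by (simp only: if_False) simp
  qed
  ultimately have "(\<lambda>x. if x \<in> U then d x else 0) \<in> borel_measurable lebesgue"
    by (rule borel_measurable_LIMSEQ_metric)
  then show ?thesis using \<open>open U\<close> by (subst (asm) borel_measurable_if) auto
qed

lemma weak_deriv_AE:
  fixes f f' d' :: "'a::euclidean_space => real"
  assumes U: "open U" and [measurable]: "f' \<in> Borel" "d' \<in> Borel"
    and f: "AE x\<in>U in lborel. f x = f' x" and w: "weak_pair U b f' d'"
  shows "AE x\<in>U in lborel. weak_deriv U b f x = d' x"
proof -
  have "has_weak_deriv U b f d'" using w f by (subst has_weak_deriv_iff[OF U]) auto
  then have h: "has_weak_deriv U b f (weak_deriv U b f)" unfolding weak_deriv_def by (rule someI[of "has_weak_deriv U b f"])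
  then have "weak_deriv U b f \<in> borel_measurable (lebesgue_on U)"
    using U by (intro locally_integrable_measurable) (auto simp: has_weak_deriv_def)
  then obtain e where e: "e \<in> Borel" "AE x\<in>U in lborel. weak_deriv U b f x = e x"
    using borel_representative U by (metis borel_open)
  have "weak_pair U b f' e" using h f e by (subst (asm) has_weak_deriv_iff[OF U]) auto
  from weak_pair_unique[OF U this w] e(2) show ?thesis by eventually_elim auto
qed

text \<open>A weak space derivative on the cylinder is one on almost every time slice. Testing with products gives, for each fixed space test function, the slice identity at almost every time; countably many such functions identify the slice derivative, whose existence is assumed.\<close>
lemma weak_pair_section:
  fixes f d :: "'a::euclidean_space \<times> real => real"
  assumes U: "open U" and [measurable]: "f \<in> Borel" "d \<in> Borel"
    and w: "weak_pair (U \<times> {a<..<b}) (e, 0) f d" and d: "integrable lborel d"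
    and ex: "AE t\<in>{a<..<b} in lborel. (\<exists>D. weak_pair U e (\<lambda>x. f (x, t)) D)"
  shows "AE t\<in>{a<..<b} in lborel. weak_pair U e (\<lambda>x. f (x, t)) (\<lambda>x. d (x, t))"
proof -
  obtain \<D> where \<D>: "countable \<D>" "\<D> \<subseteq> test_functions U"
    "\<And>e. locally_integrable_on e U ==> (\<And>\<phi>. \<phi> \<in> \<D> ==> (LBINT y. e y * \<phi> y) = 0) ==> AE x\<in>U in lborel. e x = 0"
    using countable_test_functions[OF U] by metis
  have "AE t\<in>{a<..<b} in lborel. (LBINT x. f (x, t) * dir_deriv e \<phi> x + d (x, t) * \<phi> x) = 0" if \<phi>: "\<phi> \<in> \<D>" for \<phi>
  proof -
    have \<phi>: "\<phi> \<in> test_functions U" using \<phi> \<D> by auto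
    note [measurable] = test_function_borel[OF \<phi>] test_function_borel[OF test_function_dir_deriv[OF \<phi>]]
    define F where "F z = f z * dir_deriv e \<phi> (fst z) + d z * \<phi> (fst z)" for z
    have [measurable]: "F \<in> Borel" unfolding F_def[abs_def] by measurable
    have Fi: "integrable lborel (\<lambda>z. F z * \<eta> (snd z))" and F0: "(LBINT z. F z * \<eta> (snd z)) = 0"
      if \<eta>: "\<eta> \<in> test_functions {a<..<b}" for \<eta>
    proof -
      note t = test_function_product[OF \<phi> \<eta>]
      have i1: "integrable lborel (\<lambda>z. f z * dir_deriv (e, 0) (\<lambda>z. \<phi> (fst z) * \<eta> (snd z)) z)"
        using w by (intro integrable_test_product[OF _ test_function_dir_deriv[OF t(1)]]) (simp add: weak_pair_def)
      have i2: "integrable lborel (\<lambda>z. d z * (\<phi> (fst z) * \<eta> (snd z)))"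
        using w by (intro integrable_test_product[OF _ t(1)]) (simp add: weak_pair_def)
      have eq: "(\<lambda>z. F z * \<eta> (snd z)) = (\<lambda>z. f z * dir_deriv (e, 0) (\<lambda>z. \<phi> (fst z) * \<eta> (snd z)) z + d z * (\<phi> (fst z) * \<eta> (snd z)))"
      proof
        fix z :: "'a \<times> real"
        show "F z * \<eta> (snd z) = f z * dir_deriv (e, 0) (\<lambda>z. \<phi> (fst z) * \<eta> (snd z)) z + d z * (\<phi> (fst z) * \<eta> (snd z))"
          using t(2)[of e "fst z" "snd z"] by (simp add: F_def algebra_simps)
      qed
      show "integrable lborel (\<lambda>z. F z * \<eta> (snd z))" unfolding eq using i1 i2 by (rule Bochner_Integration.integrable_add)
      show "(LBINT z. F z * \<eta> (snd z)) = 0"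
        unfolding eq using i1 i2 w t(1) by (simp add: weak_pair_def)
    qed
    define m where "m t = (LBINT x. F (x, t))" for t
    obtain \<E> where \<E>: "\<E> \<subseteq> test_functions {a<..<b}"
      "\<And>e. locally_integrable_on e {a<..<b} ==> (\<And>\<phi>. \<phi> \<in> \<E> ==> (LBINT y. e y * \<phi> y) = 0) ==> AE x\<in>{a<..<b} in lborel. e x = 0"
      using countable_test_functions[of "{a<..<b}"] by (metis open_greaterThanLessThan)
    have "AE t\<in>{a<..<b} in lborel. m t = 0"
    proof (rule \<E>(2))
      show "locally_integrable_on m {a<..<b}" unfolding locally_integrable_on_def
      proof (intro allI impI)
        fix K :: "real set" assume K: "compact K" "K \<subseteq> {a<..<b}"
        obtain L where L: "compact L" "L \<subseteq> U" "\<And>x. x \<notin> L ==> \<phi> x = 0" "\<And>b x. x \<notin> L ==> dir_deriv b \<phi> x = 0"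
          using test_function_support[OF \<phi>] by metis
        obtain B where B: "\<And>x. \<bar>\<phi> x\<bar> \<le> B" using test_function_bounded[OF \<phi>] by metis
        obtain B' where B': "\<And>x. \<bar>dir_deriv e \<phi> x\<bar> \<le> B'" using test_function_bounded[OF test_function_dir_deriv[OF \<phi>]] by metis
        have LK: "compact (L \<times> K)" "L \<times> K \<subseteq> U \<times> {a<..<b}" using L K by (auto intro: compact_Times)
        have [measurable]: "L \<times> K \<in> sets borel" "K \<in> sets borel" using LK K by (auto intro: compact_imp_closed borel_closed)
        have i: "integrable lborel (\<lambda>z. indicator (L \<times> K) z * f z)" "integrable lborel (\<lambda>z. indicator (L \<times> K) z * d z)"
          using w LK by (auto simp: weak_pair_def intro: locally_integrable_onD)
        have "integrable lborel (\<lambda>z. indicator K (snd z) * F z)"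
        proof (rule Bochner_Integration.integrable_bound)
          show "integrable lborel (\<lambda>z. B' * \<bar>indicator (L \<times> K) z * f z\<bar> + B * \<bar>indicator (L \<times> K) z * d z\<bar>)" using i by auto
          show "(\<lambda>z. indicator K (snd z) * F z) \<in> borel_measurable lborel" by measurable
          show "AE z in lborel. norm (indicator K (snd z) * F z) \<le> norm (B' * \<bar>indicator (L \<times> K) z * f z\<bar> + B * \<bar>indicator (L \<times> K) z * d z\<bar>)"
          proof (intro AE_I2)
            fix z :: "'a \<times> real"
            have "\<bar>F z\<bar> \<le> B' * \<bar>f z\<bar> + B * \<bar>d z\<bar>"
              unfolding F_def
              using mult_left_mono[OF B'[of "fst z"] abs_ge_zero[of "f z"]] mult_left_mono[OF B[of "fst z"] abs_ge_zero[of "d z"]]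
                abs_triangle_ineq[of "f z * dir_deriv e \<phi> (fst z)" "d z * \<phi> (fst z)"]
              by (simp add: abs_mult mult.commute)
            moreover have "F z = 0" if "fst z \<notin> L" using that L by (simp add: F_def)
            ultimately show "norm (indicator K (snd z) * F z) \<le> norm (B' * \<bar>indicator (L \<times> K) z * f z\<bar> + B * \<bar>indicator (L \<times> K) z * d z\<bar>)"
              by (cases z) (auto simp: indicator_def)
          qed
        qed
        from integrable_section_integral[OF this] show "integrable lborel (\<lambda>t. indicator K t * m t)"
          by (simp add: m_def)
      qed
      show "(LBINT t. m t * \<eta> t) = 0" if "\<eta> \<in> \<E>" for \<eta>
        using integral_sections[OF Fi, of \<eta>] F0[of \<eta>] that \<E>(1) by (auto simp: m_def)
    qed
    then show ?thesis by (simp add: m_def F_def)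
  qed
  then have z: "AE t in lborel. \<forall>\<phi>\<in>\<D>. t \<in> {a<..<b} --> (LBINT x. f (x, t) * dir_deriv e \<phi> x + d (x, t) * \<phi> x) = 0"
    using \<D>(1) by (subst AE_ball_countable) auto
  show ?thesis using z ex AE_integrable_section[OF d]
  proof eventually_elim
    case (elim t)
    show ?case
    proof
      assume t: "t \<in> {a<..<b}"
      then obtain D where D: "weak_pair U e (\<lambda>x. f (x, t)) D" using elim by auto
      have dl: "locally_integrable_on (\<lambda>x. d (x, t)) U" unfolding locally_integrable_on_def
        using integrable_mult_indicator[OF _ elim(3)] by (auto simp: compact_imp_closed)
      have Dl: "locally_integrable_on D U" and fl: "locally_integrable_on (\<lambda>x. f (x, t)) U"
        using D by (auto simp: weak_pair_def)
      have "AE x\<in>U in lborel. D x - d (x, t) = 0"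
      proof (rule \<D>(3))
        show "locally_integrable_on (\<lambda>x. D x - d (x, t)) U"
          using Dl dl by (auto simp: locally_integrable_on_def right_diff_distrib)
        show "(LBINT x. (D x - d (x, t)) * \<phi> x) = 0" if "\<phi> \<in> \<D>" for \<phi>
        proof -
          have \<phi>: "\<phi> \<in> test_functions U" using that \<D> by auto
          note i = integrable_test_product[OF Dl \<phi>] integrable_test_product[OF dl \<phi>]
            integrable_test_product[OF fl test_function_dir_deriv[OF \<phi>, of e]]
          have "(LBINT x. f (x, t) * dir_deriv e \<phi> x) + (LBINT x. d (x, t) * \<phi> x) = 0"
            using elim(1) that t i by (subst Bochner_Integration.integral_add[symmetric]) auto
          moreover have "(LBINT x. f (x, t) * dir_deriv e \<phi> x) = - (LBINT x. D x * \<phi> x)"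
            using D \<phi> by (simp add: weak_pair_def)
          ultimately show ?thesis using i by (simp add: left_diff_distrib)
        qed
      qed
      then have eq: "AE x\<in>U in lborel. D x = d (x, t)" by simp
      have "(LBINT x. D x * \<phi> x) = (LBINT x. d (x, t) * \<phi> x)" if \<phi>: "\<phi> \<in> test_functions U" for \<phi>
      proof (rule integral_cong_AE)
        show "(\<lambda>x. D x * \<phi> x) \<in> borel_measurable lborel" "(\<lambda>x. d (x, t) * \<phi> x) \<in> borel_measurable lborel"
          using integrable_test_product[OF Dl \<phi>] integrable_test_product[OF dl \<phi>] by auto
        obtain K where "K \<subseteq> U" "\<And>x. x \<notin> K ==> \<phi> x = 0" using test_function_support[OF \<phi>] by metis
        then show "AE x in lborel. D x * \<phi> x = d (x, t) * \<phi> x" using eq by (auto elim!: eventually_mono)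
      qed
      then show "weak_pair U e (\<lambda>x. f (x, t)) (\<lambda>x. d (x, t))"
        using D dl by (simp add: weak_pair_def)
    qed
  qed
qed

lemma
  fixes f :: "'a::euclidean_space => real"
  assumes [measurable]: "f' \<in> Borel" "S \<in> sets borel" and z: "\<And>x. x \<notin> S ==> f' x = 0"
    and eq: "AE x\<in>S in lborel. f x = f' x"
  shows Lp_iff: "f \<in> Lp S q \<longleftrightarrow> powr_integrable lborel q f'"
    and Lp_norm_eq: "Lp_norm S q f = (LBINT x. \<bar>f' x\<bar> powr q) powr (1 / q)"
proof -
  have eq': "AE x\<in>S in lborel. \<bar>f x\<bar> powr q = \<bar>f' x\<bar> powr q" using eq by eventually_elim auto
  have i: "(\<lambda>x. indicator S x * \<bar>f' x\<bar> powr q) = (\<lambda>x. \<bar>f' x\<bar> powr q)" using z by (auto simp: indicator_def fun_eq_iff)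
  have m: "(\<lambda>x. \<bar>f' x\<bar> powr q) \<in> Borel" by measurable
  show "f \<in> Lp S q \<longleftrightarrow> powr_integrable lborel q f'"
    using borel_measurable_lebesgue_on_AE[OF assms(1,2) eq] integrable_lebesgue_on_AE[OF m assms(2) eq']
    by (simp add: Lp_def powr_integrable_def i)
  show "Lp_norm S q f = (LBINT x. \<bar>f' x\<bar> powr q) powr (1 / q)"
    using integral_lebesgue_on_AE[OF m assms(2) eq'] by (simp add: Lp_norm_def i)
qed

text \<open>Membership in the closure of the test functions, stated for a function and its gradient as separate Borel objects.\<close>
definition approximable ::
    "(real^'n) set => ('n => real) => (real^'n => real) => ('n => real^'n => real) => bool" where
  "approximable \<Omega> p z d \<longleftrightarrow> integrable lborel z \<and> (\<forall>i. powr_integrable lborel (p i) (d i)) \<and>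
     (\<exists>\<psi>. (\<forall>k::nat. \<psi> k \<in> test_functions \<Omega>) \<and>
       ((\<lambda>k. LBINT x. \<bar>\<psi> k x - z x\<bar>) \<longlonglongrightarrow> 0) \<and>
       (\<forall>i. (\<lambda>k. LBINT x. \<bar>dir_deriv (axis i 1) (\<psi> k) x - d i x\<bar> powr p i) \<longlonglongrightarrow> 0))"

text \<open>Norm balls of radius \<open>1/(k+1)\<close> around \<open>v\<close> contain test functions; each term of the norm tends to zero.\<close>
lemma W1p_o_approximable:
  fixes \<Omega> :: "(real^'n) set"
  assumes \<Omega>: "open \<Omega>" and p: "\<And>i. p i > 1" and v: "v \<in> W1p_o \<Omega> p"
    and v'[measurable]: "v' \<in> Borel" and vz: "\<And>x. x \<notin> \<Omega> ==> v' x = 0"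
    and eq: "AE x\<in>\<Omega> in lborel. v x = v' x"
    and d[measurable]: "\<And>i. d i \<in> Borel" and dz: "\<And>i x. x \<notin> \<Omega> ==> d i x = 0"
    and w: "\<And>i. weak_pair \<Omega> (axis i 1) v' (d i)"
  shows "approximable \<Omega> p v' d"
proof -
  have [measurable]: "\<Omega> \<in> sets borel" using \<Omega> by simp
  have "v \<in> Lp \<Omega> 1" using v by (simp add: W1p_o_def W1p_def W11_def)
  then have v1: "integrable lborel v'"
    using Lp_iff[OF v' _ vz eq] by (simp add: powr_integrable_1)
  have dq: "powr_integrable lborel (p i) (d i)" for i
  proof -
    have "weak_deriv \<Omega> (axis i 1) v \<in> Lp \<Omega> (p i)" using v by (simp add: W1p_o_def W1p_def)
    then show ?thesis using Lp_iff[OF d _ dz weak_deriv_AE[OF \<Omega> v' d eq w]] by simp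
  qed
  have "\<exists>\<phi>\<in>test_functions \<Omega>. (LBINT x. \<bar>\<phi> x - v' x\<bar>) < 1 / Suc k \<and>
      (\<forall>i. (LBINT x. \<bar>dir_deriv (axis i 1) \<phi> x - d i x\<bar> powr p i) < 1 / Suc k)" for k
  proof -
    have "\<exists>\<phi>\<in>test_functions \<Omega>. W1p_norm \<Omega> p (\<lambda>x. v x - \<phi> x) < 1 / Suc k" using v by (simp add: W1p_o_def)
    then obtain \<phi> where \<phi>: "\<phi> \<in> test_functions \<Omega>" and n: "W1p_norm \<Omega> p (\<lambda>x. v x - \<phi> x) < 1 / Suc k" by blast
    note [measurable] = test_function_borel[OF \<phi>] test_function_borel[OF test_function_dir_deriv[OF \<phi>]]
    obtain K where "K \<subseteq> \<Omega>" "\<And>x. x \<notin> K ==> \<phi> x = 0" "\<And>b x. x \<notin> K ==> dir_deriv b \<phi> x = 0"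
      using test_function_support[OF \<phi>] by metis
    then have z: "x \<notin> \<Omega> ==> \<phi> x = 0" "x \<notin> \<Omega> ==> dir_deriv b \<phi> x = 0" for b x by blast+
    have eq2: "AE x\<in>\<Omega> in lborel. v x - \<phi> x = v' x - \<phi> x" using eq by eventually_elim auto
    have l1: "Lp_norm \<Omega> 1 (\<lambda>x. v x - \<phi> x) = (LBINT x. \<bar>\<phi> x - v' x\<bar>)"
      by (subst Lp_norm_eq[OF _ _ _ eq2]) (auto simp: vz z abs_minus_commute)
    have lp: "Lp_norm \<Omega> (p i) (weak_deriv \<Omega> (axis i 1) (\<lambda>x. v x - \<phi> x))
        = (LBINT x. \<bar>dir_deriv (axis i 1) \<phi> x - d i x\<bar> powr p i) powr (1 / p i)" for i
    proof -
      have "AE x\<in>\<Omega> in lborel. weak_deriv \<Omega> (axis i 1) (\<lambda>x. v x - \<phi> x) x = d i x - dir_deriv (axis i 1) \<phi> x"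
        by (rule weak_deriv_AE[OF \<Omega> _ _ eq2 weak_pair_diff[OF w weak_pair_test[OF \<phi>]]]) measurable
      from Lp_norm_eq[OF _ _ _ this] show ?thesis using dz z by (simp add: abs_minus_commute)
    qed
    have nn: "Lp_norm \<Omega> q f \<ge> 0" for q f by (simp add: Lp_norm_def)
    have s: "(\<Sum>j\<in>UNIV. Lp_norm \<Omega> (p j) (weak_deriv \<Omega> (axis j 1) (\<lambda>x. v x - \<phi> x))) \<ge> 0"
      by (intro sum_nonneg nn)
    have "Lp_norm \<Omega> 1 (\<lambda>x. v x - \<phi> x) < 1 / Suc k" using n s by (simp add: W1p_norm_def)
    then have 1: "(LBINT x. \<bar>\<phi> x - v' x\<bar>) < 1 / Suc k" by (simp add: l1)
    moreover have "(LBINT x. \<bar>dir_deriv (axis i 1) \<phi> x - d i x\<bar> powr p i) < 1 / Suc k" for i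
    proof -
      let ?I = "LBINT x. \<bar>dir_deriv (axis i 1) \<phi> x - d i x\<bar> powr p i"
      have "Lp_norm \<Omega> (p i) (weak_deriv \<Omega> (axis i 1) (\<lambda>x. v x - \<phi> x))
          \<le> (\<Sum>j\<in>UNIV. Lp_norm \<Omega> (p j) (weak_deriv \<Omega> (axis j 1) (\<lambda>x. v x - \<phi> x)))"
        by (rule member_le_sum) (auto simp: nn)
      then have "?I powr (1 / p i) < 1 / Suc k"
        using n nn[of 1 "\<lambda>x. v x - \<phi> x"] by (simp add: W1p_norm_def lp)
      then have "(?I powr (1 / p i)) powr p i < (1 / Suc k) powr p i"
        using p[of i] by (intro powr_less_mono2) auto
      moreover have "(?I powr (1 / p i)) powr p i = ?I"
        using p[of i] by (simp add: powr_powr)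
      moreover have "(1 / real (Suc k)) powr p i \<le> (1 / real (Suc k)) powr 1"
        using p[of i] by (intro powr_mono') auto
      ultimately show ?thesis by simp
    qed
    ultimately show ?thesis using \<phi> by blast
  qed
  then have "\<forall>k. \<exists>\<phi>. \<phi> \<in> test_functions \<Omega> \<and> (LBINT x. \<bar>\<phi> x - v' x\<bar>) < 1 / Suc k \<and>
      (\<forall>i. (LBINT x. \<bar>dir_deriv (axis i 1) \<phi> x - d i x\<bar> powr p i) < 1 / Suc k)"
    unfolding Bex_def by (rule allI)
  from choice[OF this] obtain \<psi> where "\<forall>k. \<psi> k \<in> test_functions \<Omega> \<and> (LBINT x. \<bar>\<psi> k x - v' x\<bar>) < 1 / Suc k \<and>
      (\<forall>i. (LBINT x. \<bar>dir_deriv (axis i 1) (\<psi> k) x - d i x\<bar> powr p i) < 1 / Suc k)" by (rule exE)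
  then have \<psi>: "\<And>k. \<psi> k \<in> test_functions \<Omega>" "\<And>k. (LBINT x. \<bar>\<psi> k x - v' x\<bar>) < 1 / Suc k"
      "\<And>k i. (LBINT x. \<bar>dir_deriv (axis i 1) (\<psi> k) x - d i x\<bar> powr p i) < 1 / Suc k"
    by simp_all
  have l: "(\<lambda>k. 1 / real (Suc k)) \<longlonglongrightarrow> 0" using LIMSEQ_inverse_real_of_nat by (simp add: inverse_eq_divide)
  have 1: "(\<lambda>k. LBINT x. \<bar>\<psi> k x - v' x\<bar>) \<longlonglongrightarrow> 0"
    by (rule tendsto_sandwich[OF _ _ tendsto_const l]) (auto intro!: always_eventually less_imp_le[OF \<psi>(2)] simp del: of_nat_Suc)
  have 2: "(\<lambda>k. LBINT x. \<bar>dir_deriv (axis i 1) (\<psi> k) x - d i x\<bar> powr p i) \<longlonglongrightarrow> 0" for i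
    by (rule tendsto_sandwich[OF _ _ tendsto_const l]) (auto intro!: always_eventually less_imp_le[OF \<psi>(3)] simp del: of_nat_Suc)
  show ?thesis unfolding approximable_def
    by (intro conjI allI exI[of _ \<psi>] v1 dq \<psi>(1) 1 2)
qed

text \<open>\<open>u'\<close> and \<open>d\<close> are Borel versions, zero off the cylinder, of \<open>u\<close> and of its spatial gradient that represent the gradient on almost every time slice as well.\<close>
definition slice_representative ::
    "(real^'n) set => real => ('n => real) => ((real^'n) \<times> real => real) =>
     ((real^'n) \<times> real => real) => ('n => (real^'n) \<times> real => real) => bool" where
  "slice_representative \<Omega> T p u u' d \<longleftrightarrow>
     u' \<in> Borel \<and> (\<forall>z. z \<notin> cylinder \<Omega> T --> u' z = 0) \<and>
     (AE z\<in>cylinder \<Omega> T in lborel. u z = u' z) \<and>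
     (\<forall>i. powr_integrable lborel (p i) (d i) \<and> (\<forall>z. z \<notin> cylinder \<Omega> T --> d i z = 0) \<and>
        (AE z\<in>cylinder \<Omega> T in lborel. weak_partial \<Omega> T i u z = d i z)) \<and>
     (AE t\<in>{0<..<T} in lborel. (AE x\<in>\<Omega> in lborel. u (x, t) = u' (x, t)) \<and>
        (\<forall>i. weak_pair \<Omega> (axis i 1) (\<lambda>x. u' (x, t)) (\<lambda>x. d i (x, t))))"

text \<open>The gradient on the cylinder and the gradients of the slices are related by \<open>weak_pair_section\<close>.\<close>
lemma Lp_W1p_representative:
  fixes \<Omega> :: "(real^'n) set"
  assumes \<Omega>: "open \<Omega>" "bounded \<Omega>" and p: "\<And>i. p i > 1" and u: "u \<in> Lp_W1p \<Omega> T p"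
  obtains u' d where "slice_representative \<Omega> T p u u' d"
proof -
  let ?Q = "cylinder \<Omega> T"
  have Q: "open ?Q" using \<Omega> by (simp add: open_Times)
  have [measurable]: "?Q \<in> sets borel" using Q by simp
  have "u \<in> borel_measurable (lebesgue_on ?Q)" using u by (simp add: Lp_W1p_def)
  then obtain u' where u'[measurable]: "u' \<in> Borel" and uz: "\<And>z. z \<notin> ?Q ==> u' z = 0"
    and ueq: "AE z\<in>?Q in lborel. u z = u' z" by (rule borel_representative) auto
  have "\<exists>d. d \<in> Borel \<and> (\<forall>z. z \<notin> ?Q --> d z = 0) \<and>
      (AE z\<in>?Q in lborel. weak_partial \<Omega> T i u z = d z)" for i
  proof -
    have "weak_partial \<Omega> T i u \<in> borel_measurable (lebesgue_on ?Q)" using u by (simp add: Lp_W1p_def Lp_def)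
    then obtain d where "d \<in> Borel" "\<And>z. z \<notin> ?Q ==> d z = 0"
      "AE z\<in>?Q in lborel. weak_partial \<Omega> T i u z = d z" by (rule borel_representative) auto
    then show ?thesis by (intro exI[of _ d]) simp
  qed
  then have "\<exists>d. \<forall>i. d i \<in> Borel \<and> (\<forall>z. z \<notin> ?Q --> d i z = 0) \<and>
      (AE z\<in>?Q in lborel. weak_partial \<Omega> T i u z = d i z)" by (intro choice allI)
  then obtain d where D: "\<forall>i. d i \<in> Borel \<and> (\<forall>z. z \<notin> ?Q --> d i z = 0) \<and>
      (AE z\<in>?Q in lborel. weak_partial \<Omega> T i u z = d i z)" by (rule exE)
  have d[measurable]: "\<And>i. d i \<in> Borel" and dz: "\<And>i z. z \<notin> ?Q ==> d i z = 0"
    and deq: "\<And>i. AE z\<in>?Q in lborel. weak_partial \<Omega> T i u z = d i z"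
    using D by blast+
  have dq: "powr_integrable lborel (p i) (d i)" for i
    using u Lp_iff[OF d _ dz deq] by (simp add: Lp_W1p_def)
  have di: "integrable lborel (d i)" for i
    by (rule bounded_support_integrable[OF dq _ _ dz]) (use p[of i] \<Omega> in \<open>auto intro: bounded_Times\<close>)
  have wp: "weak_pair ?Q (axis i 1, 0) u' (d i)" for i
  proof -
    have "\<exists>D. has_weak_deriv ?Q (axis i 1, 0) u D" using u by (simp add: Lp_W1p_def weakly_differentiable_def)
    then have "has_weak_deriv ?Q (axis i 1, 0) u (weak_partial \<Omega> T i u)" unfolding weak_deriv_def by (rule someI_ex)
    then show ?thesis using ueq deq by (subst (asm) has_weak_deriv_iff[OF Q]) auto
  qed
  have us: "AE t in lborel. AE x in lborel. (x, t) \<in> ?Q --> u (x, t) = u' (x, t)" by (rule AE_section[OF ueq])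
  have "AE t in lebesgue_on {0<..<T}. slice u t \<in> W11 \<Omega>"
    using u by (auto simp: Lp_W1p_def bochner_Lp_def strongly_measurable_def)
  then have W: "AE t\<in>{0<..<T} in lborel. slice u t \<in> W11 \<Omega>" by (simp add: AE_lebesgue_on)
  have ex: "AE t\<in>{0<..<T} in lborel. (\<exists>D. weak_pair \<Omega> (axis i 1) (\<lambda>x. u' (x, t)) D)" for i
    using us W
  proof eventually_elim
    case (elim t)
    show ?case
    proof
      assume t: "t \<in> {0<..<T}"
      then obtain D where D: "has_weak_deriv \<Omega> (axis i 1) (slice u t) D"
        using elim by (auto simp: W11_def weakly_differentiable_def)
      then have "D \<in> borel_measurable (lebesgue_on \<Omega>)"
        using \<Omega> by (intro locally_integrable_measurable) (auto simp: has_weak_deriv_def)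
      then obtain D' where D': "D' \<in> Borel" "AE x\<in>\<Omega> in lborel. D x = D' x"
        using borel_representative \<Omega> by (metis borel_open)
      have "AE x\<in>\<Omega> in lborel. slice u t x = u' (x, t)" using elim(1) t by (auto simp: slice_def)
      then have "weak_pair \<Omega> (axis i 1) (\<lambda>x. u' (x, t)) D'"
        using has_weak_deriv_iff[OF \<Omega>(1) borel_measurable_section(1)[OF u'] D'(1) _ D'(2)] D by blast
      then show "\<exists>D. weak_pair \<Omega> (axis i 1) (\<lambda>x. u' (x, t)) D" by blast
    qed
  qed
  have "AE t\<in>{0<..<T} in lborel. weak_pair \<Omega> (axis i 1) (\<lambda>x. u' (x, t)) (\<lambda>x. d i (x, t))" for i
    by (rule weak_pair_section[OF \<Omega>(1) u' d wp di ex])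
  then have "AE t in lborel. \<forall>i\<in>UNIV. t \<in> {0<..<T} --> weak_pair \<Omega> (axis i 1) (\<lambda>x. u' (x, t)) (\<lambda>x. d i (x, t))"
    by (intro AE_finite_allI) auto
  then have "AE t\<in>{0<..<T} in lborel. (AE x\<in>\<Omega> in lborel. u (x, t) = u' (x, t)) \<and>
        (\<forall>i. weak_pair \<Omega> (axis i 1) (\<lambda>x. u' (x, t)) (\<lambda>x. d i (x, t)))"
    using us by eventually_elim auto
  then have "slice_representative \<Omega> T p u u' d"
    unfolding slice_representative_def using u' uz ueq dq dz deq by blast
  then show thesis by (rule that)
qed

lemma slice_representative_approximable:
  fixes \<Omega> :: "(real^'n) set"
  assumes \<Omega>: "open \<Omega>" and p: "\<And>i. p i > 1" and u: "slice_representative \<Omega> T p u u' du"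
    and g: "slice_representative \<Omega> T p g g' dg" and o: "(\<lambda>z. u z - g z) \<in> Lp_W1p_o \<Omega> T p"
  shows "AE t\<in>{0<..<T} in lborel. approximable \<Omega> p (\<lambda>x. u' (x, t) - g' (x, t)) (\<lambda>i x. du i (x, t) - dg i (x, t))"
proof -
  have "AE t in lebesgue_on {0<..<T}. slice (\<lambda>z. u z - g z) t \<in> W1p_o \<Omega> p"
    using o by (auto simp: Lp_W1p_o_def strongly_measurable_def)
  then have W: "AE t\<in>{0<..<T} in lborel. slice (\<lambda>z. u z - g z) t \<in> W1p_o \<Omega> p" by (simp add: AE_lebesgue_on)
  have m: "u' \<in> Borel" "g' \<in> Borel" "\<And>i. du i \<in> Borel" "\<And>i. dg i \<in> Borel"
    using u g by (auto simp: slice_representative_def powr_integrable_def)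
  note [measurable] = m[THEN borel_measurable_section(1)]
  have "AE t\<in>{0<..<T} in lborel. (AE x\<in>\<Omega> in lborel. u (x, t) = u' (x, t)) \<and>
        (\<forall>i. weak_pair \<Omega> (axis i 1) (\<lambda>x. u' (x, t)) (\<lambda>x. du i (x, t)))"
    "AE t\<in>{0<..<T} in lborel. (AE x\<in>\<Omega> in lborel. g (x, t) = g' (x, t)) \<and>
        (\<forall>i. weak_pair \<Omega> (axis i 1) (\<lambda>x. g' (x, t)) (\<lambda>x. dg i (x, t)))"
    using u g by (auto simp: slice_representative_def)
  with W show ?thesis
  proof eventually_elim
    case (elim t)
    show ?case
    proof
      assume t: "t \<in> {0<..<T}"
      have e: "AE x\<in>\<Omega> in lborel. u (x, t) = u' (x, t)" "AE x\<in>\<Omega> in lborel. g (x, t) = g' (x, t)"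
        using elim t by auto
      show "approximable \<Omega> p (\<lambda>x. u' (x, t) - g' (x, t)) (\<lambda>i x. du i (x, t) - dg i (x, t))"
      proof (rule W1p_o_approximable[OF \<Omega> p])
        show "slice (\<lambda>z. u z - g z) t \<in> W1p_o \<Omega> p" using elim t by auto
        show "AE x\<in>\<Omega> in lborel. slice (\<lambda>z. u z - g z) t x = u' (x, t) - g' (x, t)"
          using e by eventually_elim (auto simp: slice_def)
        show "weak_pair \<Omega> (axis i 1) (\<lambda>x. u' (x, t) - g' (x, t)) (\<lambda>x. du i (x, t) - dg i (x, t))" for i
          using elim t by (intro weak_pair_diff) auto
      qed (use u g in \<open>auto simp: slice_representative_def\<close>)
    qed
  qed
qed

section \<open>Admissible truncations\<close>

text \<open>Functions that may be inserted into the equation: the bound \<open>1\<close> on the approximating test functions permits passing to the limit in products with merely integrable functions.\<close>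
definition bounded_approximable ::
    "(real^'n) set => ('n => real) => (real^'n => real) => ('n => real^'n => real) => bool" where
  "bounded_approximable \<Omega> p z d \<longleftrightarrow> z \<in> Borel \<and> (\<forall>i. powr_integrable lborel (p i) (d i)) \<and>
     (\<exists>\<psi>. (\<forall>k::nat. \<psi> k \<in> test_functions \<Omega>) \<and> (\<forall>k x. \<bar>\<psi> k x\<bar> \<le> 1) \<and>
       (AE x in lborel. (\<lambda>k. \<psi> k x) \<longlonglongrightarrow> z x) \<and>
       (\<forall>i. (\<lambda>k. LBINT x. \<bar>dir_deriv (axis i 1) (\<psi> k) x - d i x\<bar> powr p i) \<longlonglongrightarrow> 0))"

lemma step'_borel [measurable]: "step' \<in> Borel"
  by (rule borel_measurable_continuous_onI[OF step'_continuous])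

lemma step_borel [measurable]: "step \<in> Borel"
  using Ck_step[of 0] by (simp add: borel_measurable_continuous_onI)

text \<open>Split \<open>h D - h\<^sub>0 D\<^sub>0 = h (D - D\<^sub>0) + (h - h\<^sub>0) D\<^sub>0\<close>; the last term is handled by dominated convergence.\<close>
lemma Lp_tendsto_product:
  fixes h :: "nat => 'a => real"
  assumes p: "p > 1" and h[measurable]: "\<And>k. h k \<in> borel_measurable M" "h0 \<in> borel_measurable M"
    and hb: "\<And>k x. \<bar>h k x\<bar> \<le> B" "\<And>x. \<bar>h0 x\<bar> \<le> B" and hl: "AE x in M. (\<lambda>k. h k x) \<longlonglongrightarrow> h0 x"
    and D: "\<And>k. powr_integrable M p (D k)" "powr_integrable M p D0"
    and Dl: "(\<lambda>k. \<integral>x. \<bar>D k x - D0 x\<bar> powr p \<partial>M) \<longlonglongrightarrow> 0"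
  shows "(\<lambda>k. \<integral>x. \<bar>h k x * D k x - h0 x * D0 x\<bar> powr p \<partial>M) \<longlonglongrightarrow> 0"
proof -
  note [measurable] = powr_integrable_borel[OF D(1)] powr_integrable_borel[OF D(2)]
  have B: "B \<ge> 0" using hb(2)[of undefined] by linarith
  have DD: "powr_integrable M p (\<lambda>x. D k x - D0 x)" for k using p by (intro powr_integrable_diff D) auto
  have 1: "powr_integrable M p (\<lambda>x. h k x * (D k x - D0 x))" for k
    using p hb by (intro powr_integrable_bounded_mult[OF DD]) auto
  have 2: "powr_integrable M p (\<lambda>x. (h k x - h0 x) * D0 x)" for k
  proof (rule powr_integrable_bounded_mult[OF D(2)])
    show "\<bar>h k x - h0 x\<bar> \<le> 2 * B" for x using hb(1)[of k x] hb(2)[of x] by linarith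
  qed (use p in auto)
  have l2: "(\<lambda>k. \<integral>x. \<bar>(h k x - h0 x) * D0 x\<bar> powr p \<partial>M) \<longlonglongrightarrow> (\<integral>x. 0 \<partial>M)"
  proof (rule integral_dominated_convergence[where w="\<lambda>x. (2 * B) powr p * \<bar>D0 x\<bar> powr p"])
    show "integrable M (\<lambda>x. (2 * B) powr p * \<bar>D0 x\<bar> powr p)"
      using powr_integrable_integrable[OF D(2)] by auto
    show "AE x in M. (\<lambda>k. \<bar>(h k x - h0 x) * D0 x\<bar> powr p) \<longlonglongrightarrow> 0"
      using hl
    proof eventually_elim
      case (elim x)
      from tendsto_mult_right[OF tendsto_diff[OF elim tendsto_const[of "h0 x"]], of "D0 x"]
      have "(\<lambda>k. \<bar>(h k x - h0 x) * D0 x\<bar>) \<longlonglongrightarrow> 0" by (intro tendsto_rabs_zero) simp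
      from tendsto_powr'[OF this tendsto_const[of p]] show ?case using p by simp
    qed
    show "AE x in M. norm (\<bar>(h k x - h0 x) * D0 x\<bar> powr p) \<le> (2 * B) powr p * \<bar>D0 x\<bar> powr p" for k
    proof (intro AE_I2)
      fix x
      have "\<bar>h k x - h0 x\<bar> \<le> 2 * B" using hb(1)[of k x] hb(2)[of x] by linarith
      then have "\<bar>h k x - h0 x\<bar> powr p \<le> (2 * B) powr p" using p by (intro powr_mono2) auto
      then show "norm (\<bar>(h k x - h0 x) * D0 x\<bar> powr p) \<le> (2 * B) powr p * \<bar>D0 x\<bar> powr p"
        by (simp add: abs_mult powr_mult mult_right_mono)
    qed
  qed auto
  have bd: "(\<integral>x. \<bar>h k x * D k x - h0 x * D0 x\<bar> powr p \<partial>M)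
      \<le> 2 powr p * (B powr p * (\<integral>x. \<bar>D k x - D0 x\<bar> powr p \<partial>M) + (\<integral>x. \<bar>(h k x - h0 x) * D0 x\<bar> powr p \<partial>M))" for k
  proof -
    have "(\<integral>x. \<bar>h k x * D k x - h0 x * D0 x\<bar> powr p \<partial>M)
        \<le> (\<integral>x. 2 powr p * (B powr p * \<bar>D k x - D0 x\<bar> powr p + \<bar>(h k x - h0 x) * D0 x\<bar> powr p) \<partial>M)"
    proof (rule Bochner_Integration.integral_mono_AE')
      show "integrable M (\<lambda>x. 2 powr p * (B powr p * \<bar>D k x - D0 x\<bar> powr p + \<bar>(h k x - h0 x) * D0 x\<bar> powr p))"
        using powr_integrable_integrable[OF DD] powr_integrable_integrable[OF 2] by auto
      show "AE x in M. \<bar>h k x * D k x - h0 x * D0 x\<bar> powr p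
          \<le> 2 powr p * (B powr p * \<bar>D k x - D0 x\<bar> powr p + \<bar>(h k x - h0 x) * D0 x\<bar> powr p)"
      proof (intro AE_I2)
        fix x
        have eq: "h k x * D k x - h0 x * D0 x = h k x * (D k x - D0 x) + (h k x - h0 x) * D0 x"
          by (simp add: algebra_simps)
        have "\<bar>h k x * D k x - h0 x * D0 x\<bar> powr p
            \<le> 2 powr p * (\<bar>h k x * (D k x - D0 x)\<bar> powr p + \<bar>(h k x - h0 x) * D0 x\<bar> powr p)"
          unfolding eq using p by (intro powr_sum_le) auto
        also have "\<bar>h k x * (D k x - D0 x)\<bar> powr p \<le> B powr p * \<bar>D k x - D0 x\<bar> powr p"
          unfolding abs_mult powr_mult using p hb(1) by (intro mult_right_mono powr_mono2) auto
        finally show "\<bar>h k x * D k x - h0 x * D0 x\<bar> powr p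
            \<le> 2 powr p * (B powr p * \<bar>D k x - D0 x\<bar> powr p + \<bar>(h k x - h0 x) * D0 x\<bar> powr p)" by simp
      qed
    qed auto
    also have "\<dots> = 2 powr p * (B powr p * (\<integral>x. \<bar>D k x - D0 x\<bar> powr p \<partial>M) + (\<integral>x. \<bar>(h k x - h0 x) * D0 x\<bar> powr p \<partial>M))"
      using powr_integrable_integrable[OF DD] powr_integrable_integrable[OF 2] by simp
    finally show ?thesis .
  qed
  have "(\<lambda>k. 2 powr p * (B powr p * (\<integral>x. \<bar>D k x - D0 x\<bar> powr p \<partial>M) + (\<integral>x. \<bar>(h k x - h0 x) * D0 x\<bar> powr p \<partial>M))) \<longlonglongrightarrow> 2 powr p * (B powr p * 0 + (\<integral>x. 0 \<partial>M))"
    by (intro tendsto_intros Dl l2)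
  then have lim: "(\<lambda>k. 2 powr p * (B powr p * (\<integral>x. \<bar>D k x - D0 x\<bar> powr p \<partial>M) + (\<integral>x. \<bar>(h k x - h0 x) * D0 x\<bar> powr p \<partial>M))) \<longlonglongrightarrow> 0" by simp
  show ?thesis
    by (rule tendsto_sandwich[OF _ _ tendsto_const lim]) (auto intro!: always_eventually bd)
qed

lemma test_function_powr_integrable:
  assumes \<phi>: "\<phi> \<in> test_functions U" and q: "q > 0" shows "powr_integrable lborel q \<phi>"
  unfolding powr_integrable_def
proof
  obtain K where "compact K" "\<And>x. x \<notin> K ==> \<phi> x = 0" using test_function_support[OF \<phi>] by metis
  then show "integrable lborel (\<lambda>x. \<bar>\<phi> x\<bar> powr q)"
    using q by (intro continuous_compact_support_integrable[of _ K] continuous_on_powr' continuous_intros test_function_continuous[OF \<phi>]) auto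
qed (use test_function_borel[OF \<phi>] in simp)

text \<open>Near the compact set \<open>L\<close> mollification commutes with weak differentiation, because the translated mollifier is an admissible test function.\<close>
lemma mollified_derivative:
  fixes g e :: "'a::euclidean_space => real"
  assumes w: "weak_pair \<Omega> b g e" and L: "compact L" "L \<subseteq> \<Omega>" and \<epsilon>: "\<epsilon> > 0" "cball x \<epsilon> \<subseteq> L"
  shows "dir_deriv b (convolve (mollifier \<epsilon>) (\<lambda>x. indicator L x * g x)) x
       = convolve (mollifier \<epsilon>) (\<lambda>x. indicator L x * e x) x"
proof -
  let ?\<rho> = "mollifier \<epsilon> :: 'a => real" and ?\<phi> = "\<lambda>y. mollifier \<epsilon> (x - y)"
  have g: "integrable lborel (\<lambda>x. indicator L x * g x)" using w L by (auto simp: weak_pair_def intro: locally_integrable_onD)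
  have t: "?\<phi> \<in> test_functions \<Omega>" using \<epsilon> L by (intro mollifier_test_function) auto
  have s: "?\<phi> y = 0" if "y \<notin> L" for y
  proof -
    have "x - y \<notin> cball 0 \<epsilon>" using that \<epsilon>(2) by (auto simp: dist_norm norm_minus_commute)
    then show ?thesis by (rule mollifier_support[OF \<epsilon>(1)])
  qed
  have bl: "bounded_linear (\<lambda>y::'a. - y)" by (intro bounded_linear_minus bounded_linear_ident)
  have dd: "dir_deriv b ?\<phi> y = - dir_deriv b ?\<rho> (x - y)" for y
  proof -
    have "dir_deriv b ?\<phi> y = dir_deriv (- b) ?\<rho> (x - y)"
      using dir_deriv_affine[OF bl Ck_mollifier, of b \<epsilon> x y] by simp
    also have "\<dots> = - dir_deriv b ?\<rho> (x - y)"
      using linear_simps(4)[OF has_derivative_bounded_linear[OF Ck_has_derivative[OF Ck_mollifier]], of b] by simp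
    finally show ?thesis .
  qed
  have s': "dir_deriv b ?\<rho> (x - y) = 0" if "y \<notin> L" for y
  proof -
    have "(?\<phi> has_derivative (\<lambda>h. 0)) (at y)"
    proof (rule has_derivative_transform_within_open)
      show "((\<lambda>y. 0) has_derivative (\<lambda>h. 0)) (at y)" by simp
      show "open (- L)" using L(1) by (simp add: compact_imp_closed open_Compl)
    qed (use that s in auto)
    then show ?thesis using dd[of y] dir_deriv_eqI by fastforce
  qed
  have "dir_deriv b (convolve ?\<rho> (\<lambda>x. indicator L x * g x)) x = (LBINT y. (indicator L y * g y) * dir_deriv b ?\<rho> (x - y))"
    by (simp add: dir_deriv_convolve[OF mollifier_test_function_UNIV[OF \<epsilon>(1)] g] convolve_def)
  also have "\<dots> = (LBINT y. - (g y * dir_deriv b ?\<phi> y))"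
    using s' by (intro Bochner_Integration.integral_cong) (auto simp: dd indicator_def)
  also have "\<dots> = (LBINT y. e y * ?\<phi> y)" using w t by (simp add: weak_pair_def)
  also have "\<dots> = convolve ?\<rho> (\<lambda>x. indicator L x * e x) x"
    unfolding convolve_def using s by (intro Bochner_Integration.integral_cong) (auto simp: indicator_def)
  finally show ?thesis .
qed

lemma step_lipschitz:
  obtains L where "L > 0" "\<And>s. \<bar>step' s\<bar> \<le> L" "\<And>s t. \<bar>step s - step t\<bar> \<le> L * \<bar>s - t\<bar>"
proof -
  obtain L where L: "L > 0" "\<And>s. step' s \<le> L" using step'_bounded by blast
  have "norm (step s - step t) \<le> L * norm (s - t)" for s t
  proof (rule field_differentiable_bound[of UNIV step step'])
    show "(step has_field_derivative step' z) (at z within UNIV)" for z using step_has_derivative by simp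
    show "norm (step' z) \<le> L" for z using L(2) step'_nonneg[of z] by simp
  qed auto
  then show ?thesis using L step'_nonneg by (intro that[of L]) (auto simp: abs_le_iff)
qed

text \<open>With \<open>\<gamma>\<close> a mollification of \<open>g\<close>, \<open>step ((\<psi> - \<gamma>) / \<delta>)\<close> is a test function: off the support \<open>K\<close> of \<open>\<psi>\<close> its argument is \<open>- \<gamma>/\<delta> \<le> 0\<close>. The functions \<open>Z\<close> and \<open>D\<close> use \<open>\<gamma>\<close> on \<open>K\<close> only and the original \<open>g\<close> elsewhere, so that they are close to \<open>\<psi> - g\<close> and its gradient on the whole space although \<open>g\<close> can be mollified only in the interior.\<close>
lemma truncation_step:
  fixes \<Omega> :: "(real^'n) set"
  assumes \<Omega>: "open \<Omega>" and p: "\<And>i. p i > 1" and \<psi>: "\<psi> \<in> test_functions \<Omega>"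
    and g: "integrable lborel g" "AE x in lborel. g x \<ge> 0"
    and e: "\<And>i. powr_integrable lborel (p i) (e i)" and w: "\<And>i. weak_pair \<Omega> (axis i 1) g (e i)"
    and \<theta>: "\<theta> > 0" and \<delta>: "\<delta> > 0"
  shows "\<exists>\<phi> Z D. \<phi> \<in> test_functions \<Omega> \<and> (\<forall>x. \<bar>\<phi> x\<bar> \<le> 1) \<and> Z \<in> Borel \<and>
      (AE x in lborel. \<phi> x = step (Z x / \<delta>)) \<and>
      (\<forall>i. powr_integrable lborel (p i) (D i) \<and> (AE x in lborel. dir_deriv (axis i 1) \<phi> x = step' (Z x / \<delta>) / \<delta> * D i x) \<and>
        (LBINT x. \<bar>D i x - (dir_deriv (axis i 1) \<psi> x - e i x)\<bar> powr p i) < \<theta>) \<and>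
      integrable lborel (\<lambda>x. Z x - (\<psi> x - g x)) \<and> (LBINT x. \<bar>Z x - (\<psi> x - g x)\<bar>) < \<theta>"
proof -
  obtain K where K: "compact K" "K \<subseteq> \<Omega>" "\<And>x. x \<notin> K ==> \<psi> x = 0" "\<And>b x. x \<notin> K ==> dir_deriv b \<psi> x = 0"
    using test_function_support[OF \<psi>] by metis
  obtain r where r: "r > 0" "(\<Union>x\<in>K. cball x r) \<subseteq> \<Omega>"
    using compact_subset_open_imp_cball_epsilon_subset[OF K(1) \<Omega> K(2)] by blast
  \<comment> \<open>A compact neighbourhood of the support inside the domain: mollifying at a scale below the radius uses \<open>g\<close> only there.\<close>
  define L where "L = {x + y | x y. x \<in> K \<and> y \<in> cball 0 r}"
  have L: "compact L" unfolding L_def by (rule compact_sums[OF K(1)]) simp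
  have KL: "cball x r \<subseteq> L" if "x \<in> K" for x
  proof
    fix y assume "y \<in> cball x r"
    then show "y \<in> L" unfolding L_def using that
      by (intro CollectI exI[of _ x] exI[of _ "y - x"]) (auto simp: dist_norm norm_minus_commute)
  qed
  have K_sub: "x \<in> K ==> x \<in> L" for x using KL[of x] r(1) by (auto simp: subset_iff)
  have LO: "L \<subseteq> \<Omega>" using r(2) by (force simp: L_def dist_norm)
  have [measurable]: "L \<in> sets borel" "K \<in> sets borel" using L K by (auto simp: compact_imp_closed)
  note [measurable] = borel_measurable_integrable[OF g(1)] powr_integrable_borel[OF e] test_function_borel[OF \<psi>]
    test_function_borel[OF test_function_dir_deriv[OF \<psi>]]
  define G where "G x = indicator L x * g x" for x
  define E where "E i x = indicator L x * e i x" for i x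
  have G: "integrable lborel G" using integrable_mult_indicator[OF _ g(1), of L] by (simp add: G_def[abs_def])
  have E: "powr_integrable lborel (p i) (E i)" for i
    unfolding E_def[abs_def] using p[of i] by (intro powr_integrable_bounded_mult[OF e, where B=1]) (auto simp: indicator_def)
  have E1: "integrable lborel (E i)" for i
    by (rule bounded_support_integrable[OF E _ compact_imp_bounded[OF L]]) (use p[of i] in \<open>auto simp: E_def\<close>)
  have "\<forall>\<^sub>F \<epsilon> in at_right 0. \<epsilon> \<in> {0<..<r} \<and>
      (powr_integrable lborel 1 (\<lambda>x. convolve (mollifier \<epsilon>) G x - G x) \<and> (LBINT x. \<bar>convolve (mollifier \<epsilon>) G x - G x\<bar> powr 1) < \<theta>) \<and>
      (\<forall>i. powr_integrable lborel (p i) (\<lambda>x. convolve (mollifier \<epsilon>) (E i) x - E i x) \<and>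
        (LBINT x. \<bar>convolve (mollifier \<epsilon>) (E i) x - E i x\<bar> powr p i) < \<theta>)"
    using p G E E1 \<theta> r(1)
    by (intro eventually_conj eventually_all_finite mollify_converges eventually_at_right_real)
       (auto simp: less_imp_le powr_integrable_1)
  from eventually_happens'[OF trivial_limit_at_right_real this] obtain \<epsilon> where H: "\<epsilon> \<in> {0<..<r} \<and>
      (powr_integrable lborel 1 (\<lambda>x. convolve (mollifier \<epsilon>) G x - G x) \<and> (LBINT x. \<bar>convolve (mollifier \<epsilon>) G x - G x\<bar> powr 1) < \<theta>) \<and>
      (\<forall>i. powr_integrable lborel (p i) (\<lambda>x. convolve (mollifier \<epsilon>) (E i) x - E i x) \<and>
        (LBINT x. \<bar>convolve (mollifier \<epsilon>) (E i) x - E i x\<bar> powr p i) < \<theta>)" by (rule exE)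
  have \<epsilon>: "0 < \<epsilon>" "\<epsilon> < r" and Gc: "integrable lborel (\<lambda>x. convolve (mollifier \<epsilon>) G x - G x)"
      "(LBINT x. \<bar>convolve (mollifier \<epsilon>) G x - G x\<bar>) < \<theta>"
    using H by (simp_all add: powr_integrable_1)
  have Ec: "\<And>i. powr_integrable lborel (p i) (\<lambda>x. convolve (mollifier \<epsilon>) (E i) x - E i x)"
      "\<And>i. (LBINT x. \<bar>convolve (mollifier \<epsilon>) (E i) x - E i x\<bar> powr p i) < \<theta>"
    using H by blast+
  let ?\<rho> = "mollifier \<epsilon> :: real^'n => real"
  define \<gamma> where "\<gamma> = convolve ?\<rho> G"
  note \<rho> = mollifier_test_function_UNIV[OF \<epsilon>(1), where 'a="real^'n"]
  have \<gamma>_Ck: "Ck k \<gamma>" for k unfolding \<gamma>_def by (rule Ck_convolve[OF G \<rho>])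
  have [measurable]: "\<gamma> \<in> Borel" using \<gamma>_Ck[of 0] by (simp add: borel_measurable_continuous_onI)
  have cE[measurable]: "convolve ?\<rho> (E i) \<in> Borel" for i
    using Ck_convolve[OF E1 \<rho>, of 0] by (simp add: borel_measurable_continuous_onI)
  have \<gamma>_nonneg: "\<gamma> x \<ge> 0" for x unfolding \<gamma>_def convolve_def
    by (rule integral_nonneg_AE, use g(2) in eventually_elim) (simp add: G_def mollifier_nonneg)
  have \<gamma>_deriv: "dir_deriv (axis i 1) \<gamma> x = convolve ?\<rho> (E i) x" if "x \<in> K" for i x
    unfolding \<gamma>_def G_def[abs_def] E_def[abs_def]
    using KL[OF that] \<epsilon> by (intro mollified_derivative[OF w L LO]) (auto intro: order_trans[OF subset_cball])
  define \<phi> where "\<phi> x = step ((\<psi> x - \<gamma> x) / \<delta>)" for x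
  define Z where "Z x = (if x \<in> K then \<psi> x - \<gamma> x else \<psi> x - g x)" for x
  define D where "D i x = (if x \<in> K then dir_deriv (axis i 1) \<psi> x - convolve ?\<rho> (E i) x else dir_deriv (axis i 1) \<psi> x - e i x)" for i x
  have [measurable]: "Z \<in> Borel" "D i \<in> Borel" for i
    unfolding Z_def[abs_def] D_def[abs_def] by measurable
  have \<phi>_Ck: "Ck k \<phi>" for k
    unfolding \<phi>_def[abs_def] divide_inverse
    by (intro Ck_compose[OF Ck_step] Ck_mult Ck_diff Ck_const test_function_Ck[OF \<psi>] \<gamma>_Ck)
  have \<phi>0: "\<phi> x = 0" if "x \<notin> K" for x
    unfolding \<phi>_def using K(3)[OF that] \<gamma>_nonneg[of x] \<delta> by (intro step_eq_0) (simp add: divide_le_0_iff)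
  have \<phi>_test: "\<phi> \<in> test_functions \<Omega>" by (rule test_functionI[OF \<phi>_Ck K(1,2) \<phi>0])
  have \<phi>_deriv: "dir_deriv b \<phi> x = step' ((\<psi> x - \<gamma> x) / \<delta>) / \<delta> * (dir_deriv b \<psi> x - dir_deriv b \<gamma> x)" for b x
  proof -
    have "((\<lambda>x. (\<psi> x - \<gamma> x) * (1 / \<delta>)) has_derivative (\<lambda>b. (dir_deriv b \<psi> x - dir_deriv b \<gamma> x) * (1 / \<delta>))) (at x)"
      by (intro has_derivative_mult_left has_derivative_diff Ck_has_derivative test_function_Ck[OF \<psi>] \<gamma>_Ck)
    from dir_deriv_eqI[OF DERIV_compose_FDERIV[OF step_has_derivative this], of b] show ?thesis
      by (simp add: \<phi>_def[abs_def])
  qed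
  have Zle0: "AE x in lborel. x \<notin> K --> Z x / \<delta> \<le> 0"
    using g(2) by eventually_elim (use \<delta> K(3) in \<open>auto simp: Z_def divide_le_0_iff\<close>)
  have "AE x in lborel. \<phi> x = step (Z x / \<delta>)"
    using Zle0
  proof eventually_elim
    case (elim x)
    then show ?case using \<phi>0[of x] by (cases "x \<in> K") (auto simp: step_eq_0, simp add: \<phi>_def Z_def)
  qed
  moreover have "AE x in lborel. dir_deriv (axis i 1) \<phi> x = step' (Z x / \<delta>) / \<delta> * D i x" for i
    using Zle0
  proof eventually_elim
    case (elim x)
    show ?case
    proof (cases "x \<in> K")
      case True
      then show ?thesis by (simp add: \<phi>_deriv \<gamma>_deriv Z_def D_def)
    next
      case False
      have "(\<psi> x - \<gamma> x) / \<delta> \<le> 0" using K(3)[OF False] \<gamma>_nonneg[of x] \<delta> by (simp add: divide_le_0_iff)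
      then show ?thesis using elim False by (simp add: \<phi>_deriv step'_eq_0)
    qed
  qed
  moreover have D_diff: "D i x - (dir_deriv (axis i 1) \<psi> x - e i x) = - (indicator K x * (convolve ?\<rho> (E i) x - E i x))" for i x
    using K_sub[of x] by (auto simp: D_def E_def indicator_def)
  moreover have DI: "powr_integrable lborel (p i) (\<lambda>x. D i x - (dir_deriv (axis i 1) \<psi> x - e i x))" for i
    unfolding D_diff using p[of i]
    by (intro powr_integrable_uminus powr_integrable_bounded_mult[OF Ec(1), where B=1]) (auto simp: indicator_def)
  moreover have "powr_integrable lborel (p i) (D i)" for i
  proof -
    have "powr_integrable lborel (p i) (\<lambda>x. (D i x - (dir_deriv (axis i 1) \<psi> x - e i x)) + (dir_deriv (axis i 1) \<psi> x - e i x))"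
      using p[of i] by (intro powr_integrable_add powr_integrable_diff DI e test_function_powr_integrable[OF test_function_dir_deriv[OF \<psi>]]) auto
    then show ?thesis by simp
  qed
  moreover have "(LBINT x. \<bar>D i x - (dir_deriv (axis i 1) \<psi> x - e i x)\<bar> powr p i) < \<theta>" for i
  proof -
    have "(LBINT x. \<bar>D i x - (dir_deriv (axis i 1) \<psi> x - e i x)\<bar> powr p i) \<le> (LBINT x. \<bar>convolve ?\<rho> (E i) x - E i x\<bar> powr p i)"
      by (rule Bochner_Integration.integral_mono_AE'[OF powr_integrable_integrable[OF Ec(1)]])
         (auto simp: D_diff indicator_def)
    then show ?thesis using Ec(2)[of i] by linarith
  qed
  moreover have Z_diff: "Z x - (\<psi> x - g x) = - (indicator K x * (convolve ?\<rho> G x - G x))" for x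
    using K_sub[of x] by (auto simp: Z_def G_def \<gamma>_def indicator_def)
  moreover have "integrable lborel (\<lambda>x. Z x - (\<psi> x - g x))"
    unfolding Z_diff using integrable_mult_indicator[OF _ Gc(1), of K] by auto
  moreover have "(LBINT x. \<bar>Z x - (\<psi> x - g x)\<bar>) < \<theta>"
  proof -
    have "(LBINT x. \<bar>Z x - (\<psi> x - g x)\<bar>) \<le> (LBINT x. \<bar>convolve ?\<rho> G x - G x\<bar>)"
      by (rule Bochner_Integration.integral_mono_AE') (use Gc in \<open>auto simp: Z_diff indicator_def\<close>)
    then show ?thesis using Gc(2) by linarith
  qed
  moreover have "\<bar>\<phi> x\<bar> \<le> 1" for x using step_nonneg step_le_1 by (simp add: \<phi>_def)
  ultimately show ?thesis using \<phi>_test \<open>Z \<in> Borel\<close>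
    by (intro exI[of _ \<phi>] exI[of _ Z] exI[of _ D] conjI allI) simp_all
qed

text \<open>Apply \<open>truncation_step\<close> along an approximating sequence of \<open>z\<close>; a subsequence converges almost everywhere, which is what the nonlinear factors \<open>step\<close> and \<open>step'\<close> need.\<close>
lemma approximable_truncation:
  fixes \<Omega> :: "(real^'n) set"
  assumes \<Omega>: "open \<Omega>" and p: "\<And>i. p i > 1" and z: "approximable \<Omega> p z d"
    and g: "integrable lborel g" "AE x in lborel. g x \<ge> 0"
    and e: "\<And>i. powr_integrable lborel (p i) (e i)" and w: "\<And>i. weak_pair \<Omega> (axis i 1) g (e i)" and \<delta>: "\<delta> > 0"
  shows "bounded_approximable \<Omega> p (\<lambda>x. step ((z x - g x) / \<delta>)) (\<lambda>i x. step' ((z x - g x) / \<delta>) / \<delta> * (d i x - e i x))"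
proof -
  obtain \<psi> where zi: "integrable lborel z" and dq: "\<And>i. powr_integrable lborel (p i) (d i)"
    and \<psi>: "\<And>k::nat. \<psi> k \<in> test_functions \<Omega>" and \<psi>z: "(\<lambda>k. LBINT x. \<bar>\<psi> k x - z x\<bar>) \<longlonglongrightarrow> 0"
    and \<psi>d: "\<And>i. (\<lambda>k. LBINT x. \<bar>dir_deriv (axis i 1) (\<psi> k) x - d i x\<bar> powr p i) \<longlonglongrightarrow> 0"
    using z unfolding approximable_def by blast
  define P where "P k \<phi> Z D \<longleftrightarrow> \<phi> \<in> test_functions \<Omega> \<and> (\<forall>x. \<bar>\<phi> x\<bar> \<le> 1) \<and> Z \<in> Borel \<and>
      (AE x in lborel. \<phi> x = step (Z x / \<delta>)) \<and>
      (\<forall>i. powr_integrable lborel (p i) (D i) \<and> (AE x in lborel. dir_deriv (axis i 1) \<phi> x = step' (Z x / \<delta>) / \<delta> * D i x) \<and>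
        (LBINT x. \<bar>D i x - (dir_deriv (axis i 1) (\<psi> k) x - e i x)\<bar> powr p i) < 1 / Suc k) \<and>
      integrable lborel (\<lambda>x. Z x - (\<psi> k x - g x)) \<and> (LBINT x. \<bar>Z x - (\<psi> k x - g x)\<bar>) < 1 / Suc k" for k \<phi> Z D
  have "\<forall>k. \<exists>\<phi> Z D. P k \<phi> Z D"
    unfolding P_def by (intro allI truncation_step[OF \<Omega> p \<psi> g e w _ \<delta>]) auto
  then obtain \<phi> Z D where P: "\<And>k. P k (\<phi> k) (Z k) (D k)" by metis
  note P' = P[unfolded P_def]
  have \<phi>: "\<phi> k \<in> test_functions \<Omega>" "\<bar>\<phi> k x\<bar> \<le> 1" "AE x in lborel. \<phi> k x = step (Z k x / \<delta>)" for k x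
    using P'[of k] by auto
  have Zm[measurable]: "Z k \<in> Borel" and Zi: "integrable lborel (\<lambda>x. Z k x - (\<psi> k x - g x))"
    and Zl: "(LBINT x. \<bar>Z k x - (\<psi> k x - g x)\<bar>) < 1 / Suc k" for k using P'[of k] by auto
  have D: "powr_integrable lborel (p i) (D k i)" "AE x in lborel. dir_deriv (axis i 1) (\<phi> k) x = step' (Z k x / \<delta>) / \<delta> * D k i x"
    "(LBINT x. \<bar>D k i x - (dir_deriv (axis i 1) (\<psi> k) x - e i x)\<bar> powr p i) < 1 / Suc k" for k i
    using P'[of k] by auto
  note [measurable] = borel_measurable_integrable[OF g(1)] borel_measurable_integrable[OF zi] powr_integrable_borel[OF e]
    powr_integrable_borel[OF dq] powr_integrable_borel[OF D(1)] test_function_borel[OF \<phi>(1)]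
    test_function_borel[OF test_function_dir_deriv[OF \<phi>(1)]] test_function_borel[OF \<psi>] test_function_borel[OF test_function_dir_deriv[OF \<psi>]]
  have l: "(\<lambda>k. 1 / real (Suc k)) \<longlonglongrightarrow> 0" using LIMSEQ_inverse_real_of_nat by (simp add: inverse_eq_divide)
  have \<psi>zi: "integrable lborel (\<lambda>x. \<psi> k x - z x)" for k using test_function_integrable[OF \<psi>] zi by auto
  have Zd: "integrable lborel (\<lambda>x. Z k x - (z x - g x))" for k
    using Bochner_Integration.integrable_add[OF Zi \<psi>zi, of k k] by (simp add: algebra_simps)
  have "(\<lambda>k. LBINT x. norm (Z k x - (z x - g x))) \<longlonglongrightarrow> 0"
  proof (rule tendsto_sandwich[OF _ _ tendsto_const tendsto_add_zero[OF l \<psi>z]])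
    show "\<forall>\<^sub>F k in sequentially. (LBINT x. norm (Z k x - (z x - g x))) \<le> 1 / real (Suc k) + (LBINT x. \<bar>\<psi> k x - z x\<bar>)"
    proof (intro always_eventually allI)
      fix k
      have "(LBINT x. norm (Z k x - (z x - g x))) \<le> (LBINT x. \<bar>Z k x - (\<psi> k x - g x)\<bar> + \<bar>\<psi> k x - z x\<bar>)"
        by (rule integral_mono) (use Zd[of k] Zi[of k] \<psi>zi[of k] in auto)
      also have "\<dots> = (LBINT x. \<bar>Z k x - (\<psi> k x - g x)\<bar>) + (LBINT x. \<bar>\<psi> k x - z x\<bar>)"
        using Zi[of k] \<psi>zi[of k] by simp
      finally show "(LBINT x. norm (Z k x - (z x - g x))) \<le> 1 / real (Suc k) + (LBINT x. \<bar>\<psi> k x - z x\<bar>)"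
        using Zl[of k] by linarith
    qed
  qed auto
  from tendsto_L1_AE_subseq[OF Zd this] obtain r :: "nat => nat" where r: "strict_mono r"
    and Zr0: "AE x in lborel. (\<lambda>k. Z (r k) x - (z x - g x)) \<longlonglongrightarrow> 0" by blast
  have Zr: "AE x in lborel. (\<lambda>k. Z (r k) x / \<delta>) \<longlonglongrightarrow> (z x - g x) / \<delta>"
    using Zr0 by eventually_elim (rule tendsto_divide[OF LIM_zero_cancel tendsto_const], use \<delta> in auto)
  obtain L where L: "L > 0" "\<And>s. \<bar>step' s\<bar> \<le> L" using step_lipschitz by metis
  have cont: "isCont step' s" "isCont step s" for s
    using step'_continuous Ck_step[of 0] by (auto simp: continuous_on_eq_continuous_at)
  have de: "powr_integrable lborel (p i) (\<lambda>x. d i x - e i x)" for i using p[of i] by (intro powr_integrable_diff dq e) auto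
  have Dl: "(\<lambda>k. LBINT x. \<bar>D k i x - (d i x - e i x)\<bar> powr p i) \<longlonglongrightarrow> 0" for i
  proof -
    let ?c = "2 powr p i"
    have "(\<lambda>k. ?c * (1 / real (Suc k) + (LBINT x. \<bar>dir_deriv (axis i 1) (\<psi> k) x - d i x\<bar> powr p i))) \<longlonglongrightarrow> ?c * (0 + 0)"
      by (intro tendsto_intros l \<psi>d)
    then have lim: "(\<lambda>k. ?c * (1 / real (Suc k) + (LBINT x. \<bar>dir_deriv (axis i 1) (\<psi> k) x - d i x\<bar> powr p i))) \<longlonglongrightarrow> 0" by simp
    show ?thesis
    proof (rule tendsto_sandwich[OF _ _ tendsto_const lim])
      show "\<forall>\<^sub>F k in sequentially. (LBINT x. \<bar>D k i x - (d i x - e i x)\<bar> powr p i)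
          \<le> ?c * (1 / real (Suc k) + (LBINT x. \<bar>dir_deriv (axis i 1) (\<psi> k) x - d i x\<bar> powr p i))"
      proof (intro always_eventually allI)
        fix k
        let ?a = "\<lambda>x. D k i x - (dir_deriv (axis i 1) (\<psi> k) x - e i x)" and ?b = "\<lambda>x. dir_deriv (axis i 1) (\<psi> k) x - d i x"
        have a: "powr_integrable lborel (p i) ?a" "powr_integrable lborel (p i) ?b"
          using p[of i] by (auto intro!: powr_integrable_diff D dq e test_function_powr_integrable[OF test_function_dir_deriv[OF \<psi>]])
        have "(LBINT x. \<bar>D k i x - (d i x - e i x)\<bar> powr p i) \<le> (LBINT x. ?c * (\<bar>?a x\<bar> powr p i + \<bar>?b x\<bar> powr p i))"
        proof (rule Bochner_Integration.integral_mono_AE')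
          show "integrable lborel (\<lambda>x. ?c * (\<bar>?a x\<bar> powr p i + \<bar>?b x\<bar> powr p i))"
            using a[THEN powr_integrable_integrable] by auto
          have eq: "D k i x - (d i x - e i x) = ?a x + ?b x" for x by simp
          show "AE x in lborel. \<bar>D k i x - (d i x - e i x)\<bar> powr p i \<le> ?c * (\<bar>?a x\<bar> powr p i + \<bar>?b x\<bar> powr p i)"
            unfolding eq using p[of i] by (intro AE_I2 powr_sum_le) auto
        qed auto
        also have "\<dots> = ?c * ((LBINT x. \<bar>?a x\<bar> powr p i) + (LBINT x. \<bar>?b x\<bar> powr p i))"
          using a[THEN powr_integrable_integrable] by simp
        also have "\<dots> \<le> ?c * (1 / real (Suc k) + (LBINT x. \<bar>?b x\<bar> powr p i))"
          using D(3)[of k i] by (intro mult_left_mono add_mono) auto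
        finally show "(LBINT x. \<bar>D k i x - (d i x - e i x)\<bar> powr p i)
          \<le> ?c * (1 / real (Suc k) + (LBINT x. \<bar>?b x\<bar> powr p i))" .
      qed
    qed auto
  qed
  have step'_le: "\<bar>step' s / \<delta>\<bar> \<le> L / \<delta>" for s using L(2)[of s] \<delta> by (simp add: abs_divide divide_right_mono)
  have conv: "(\<lambda>k. LBINT x. \<bar>dir_deriv (axis i 1) (\<phi> (r k)) x - step' ((z x - g x) / \<delta>) / \<delta> * (d i x - e i x)\<bar> powr p i) \<longlonglongrightarrow> 0" for i
  proof -
    have "(\<lambda>k. LBINT x. \<bar>step' (Z (r k) x / \<delta>) / \<delta> * D (r k) i x - step' ((z x - g x) / \<delta>) / \<delta> * (d i x - e i x)\<bar> powr p i) \<longlonglongrightarrow> 0"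
    proof (rule Lp_tendsto_product[OF p _ _ step'_le step'_le _ D(1) de])
      show "AE x in lborel. (\<lambda>k. step' (Z (r k) x / \<delta>) / \<delta>) \<longlonglongrightarrow> step' ((z x - g x) / \<delta>) / \<delta>"
        using Zr by eventually_elim (rule tendsto_divide[OF isCont_tendsto_compose[OF cont(1)] tendsto_const], use \<delta> in auto)
      show "(\<lambda>k. LBINT x. \<bar>D (r k) i x - (d i x - e i x)\<bar> powr p i) \<longlonglongrightarrow> 0"
        using LIMSEQ_subseq_LIMSEQ[OF Dl r] by (simp add: o_def)
    qed measurable
    moreover have "(LBINT x. \<bar>dir_deriv (axis i 1) (\<phi> (r k)) x - step' ((z x - g x) / \<delta>) / \<delta> * (d i x - e i x)\<bar> powr p i)
        = (LBINT x. \<bar>step' (Z (r k) x / \<delta>) / \<delta> * D (r k) i x - step' ((z x - g x) / \<delta>) / \<delta> * (d i x - e i x)\<bar> powr p i)" for k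
      using D(2)[where k="r k" and i=i] by (intro integral_cong_AE) (auto elim!: eventually_mono)
    ultimately show ?thesis by simp
  qed
  have "AE x in lborel. \<forall>k. \<phi> k x = step (Z k x / \<delta>)" using \<phi>(3) by (simp add: AE_all_countable)
  with Zr have conv0: "AE x in lborel. (\<lambda>k. \<phi> (r k) x) \<longlonglongrightarrow> step ((z x - g x) / \<delta>)"
    by eventually_elim (simp add: isCont_tendsto_compose[OF cont(2)])
  have "powr_integrable lborel (p i) (\<lambda>x. step' ((z x - g x) / \<delta>) / \<delta> * (d i x - e i x))" for i
    using p[of i] step'_le by (intro powr_integrable_bounded_mult[OF de]) auto
  then show ?thesis unfolding bounded_approximable_def
    using \<phi>(1,2) conv conv0 by (intro conjI allI exI[of _ "\<lambda>k. \<phi> (r k)"]) simp_all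
qed

section \<open>Products and permutations of coordinates\<close>

lemma
  fixes f :: "'a::euclidean_space => real" and g :: "'b::euclidean_space => real"
  assumes f: "integrable lborel f" and g: "integrable lborel g"
  shows integrable_product: "integrable lborel (\<lambda>z. f (fst z) * g (snd z))"
    and integral_product: "(LBINT z. f (fst z) * g (snd z)) = (LBINT x. f x) * (LBINT y. g y)"
proof -
  note [measurable] = borel_measurable_integrable[OF f] borel_measurable_integrable[OF g]
  have "integrable (lborel \<Otimes>\<^sub>M lborel) (\<lambda>z. f (fst z) * g (snd z))"
  proof (rule lborel_pair.Fubini_integrable)
    show "(\<lambda>z. f (fst z) * g (snd z)) \<in> borel_measurable (lborel \<Otimes>\<^sub>M lborel)" by measurable
    show "integrable lborel (\<lambda>x. LBINT y. norm (f (fst (x, y)) * g (snd (x, y))))"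
      using f by (simp add: abs_mult)
    show "AE x in lborel. integrable lborel (\<lambda>y. f (fst (x, y)) * g (snd (x, y)))" using g by simp
  qed
  then show i: "integrable lborel (\<lambda>z. f (fst z) * g (snd z))" by (simp only: lborel_prod)
  show "(LBINT z. f (fst z) * g (snd z)) = (LBINT x. f x) * (LBINT y. g y)"
    by (subst integral_sections'[OF i]) simp
qed

text \<open>Exchanges the two time variables of a point \<open>((x,t),s)\<close>; \<open>fst (swap23 z)\<close> is the point \<open>(x,s)\<close> seen by the second solution.\<close>
definition swap23 :: "('a \<times> 'b) \<times> 'c => ('a \<times> 'c) \<times> 'b" where
  "swap23 z = ((fst (fst z), snd z), snd (fst z))"

lemma swap23_simp [simp]: "swap23 ((x, y), z) = ((x, z), y)" by (simp add: swap23_def)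

lemma swap23_measurable [measurable]:
  "(swap23 :: ('a::euclidean_space \<times> 'b::euclidean_space) \<times> 'c::euclidean_space => _) \<in> Borel"
  unfolding swap23_def[abs_def] by (intro borel_measurable_continuous_onI continuous_intros)

text \<open>Both sides agree on every Borel set by Fubini.\<close>
lemma distr_swap23:
  "distr lborel lborel (swap23 :: ('a::euclidean_space \<times> 'b::euclidean_space) \<times> 'c::euclidean_space => _) = lborel"
proof (rule measure_eqI)
  fix A :: "(('a \<times> 'c) \<times> 'b) set"
  assume "A \<in> sets (distr lborel lborel (swap23 :: ('a \<times> 'b) \<times> 'c => _))"
  then have A[measurable]: "A \<in> sets borel" by simp
  have m1: "(\<lambda>z. indicator A (swap23 z) :: ennreal) \<in> borel_measurable (borel :: (('a \<times> 'b) \<times> 'c) measure)" by measurable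
  have m1': "(\<lambda>z. indicator A (swap23 z) :: ennreal) \<in> borel_measurable (lborel \<Otimes>\<^sub>M (lborel :: 'c measure) :: (('a \<times> 'b) \<times> 'c) measure)"
    using m1 by (simp only: lborel_prod measurable_lborel1 measurable_lborel2)
  have m2': "(indicator A :: _ => ennreal) \<in> borel_measurable ((lborel :: ('a \<times> 'c) measure) \<Otimes>\<^sub>M (lborel :: 'b measure))"
    by (simp only: lborel_prod measurable_lborel1 measurable_lborel2) measurable
  have m3: "(\<lambda>w. \<integral>\<^sup>+c. indicator A ((fst w, c), snd w) \<partial>lborel) \<in> borel_measurable ((lborel :: 'a measure) \<Otimes>\<^sub>M (lborel :: 'b measure))"
    using lborel.borel_measurable_nn_integral_fst[OF m1'] by (simp add: lborel_prod swap23_def)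
  have m4: "(\<lambda>w. \<integral>\<^sup>+b. indicator A (w, b) \<partial>lborel) \<in> borel_measurable ((lborel :: 'a measure) \<Otimes>\<^sub>M (lborel :: 'c measure))"
    using lborel.borel_measurable_nn_integral_fst[OF m2'] by (simp add: lborel_prod)
  have "emeasure (distr lborel lborel (swap23 :: ('a \<times> 'b) \<times> 'c => _)) A = emeasure lborel (swap23 -` A :: (('a \<times> 'b) \<times> 'c) set)"
    by (subst emeasure_distr) auto
  also have "\<dots> = (\<integral>\<^sup>+z. indicator (swap23 -` A) z \<partial>(lborel :: (('a \<times> 'b) \<times> 'c) measure))"
    using measurable_sets[OF swap23_measurable A] by (intro nn_integral_indicator[symmetric]) auto
  also have "\<dots> = (\<integral>\<^sup>+z. indicator A (swap23 z) \<partial>(lborel \<Otimes>\<^sub>M lborel :: (('a \<times> 'b) \<times> 'c) measure))"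
    by (simp add: lborel_prod indicator_def)
  also have "\<dots> = (\<integral>\<^sup>+w. \<integral>\<^sup>+c. indicator A ((fst w, c), snd w) \<partial>lborel \<partial>(lborel :: ('a \<times> 'b) measure))"
    by (subst lborel.nn_integral_fst[OF m1', symmetric]) (simp add: swap23_def)
  also have "\<dots> = (\<integral>\<^sup>+w. \<integral>\<^sup>+c. indicator A ((fst w, c), snd w) \<partial>lborel \<partial>(lborel \<Otimes>\<^sub>M lborel :: ('a \<times> 'b) measure))"
    by (simp only: lborel_prod)
  also have "\<dots> = (\<integral>\<^sup>+a. \<integral>\<^sup>+b. \<integral>\<^sup>+c. indicator A ((a, c), b) \<partial>lborel \<partial>lborel \<partial>lborel)"
    by (subst lborel.nn_integral_fst[OF m3, symmetric]) simp
  also have "\<dots> = (\<integral>\<^sup>+a. \<integral>\<^sup>+c. \<integral>\<^sup>+b. indicator A ((a, c), b) \<partial>lborel \<partial>lborel \<partial>lborel)"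
  proof (rule nn_integral_cong)
    fix a :: 'a
    have "(\<lambda>z::'c \<times> 'b. ((a, fst z), snd z)) \<in> Borel"
      by (intro borel_measurable_continuous_onI continuous_intros)
    then have "(\<lambda>z::'c \<times> 'b. indicator A ((a, fst z), snd z) :: ennreal) \<in> Borel" by measurable
    then have "(\<lambda>z::'c \<times> 'b. indicator A ((a, fst z), snd z) :: ennreal) \<in> borel_measurable (lborel \<Otimes>\<^sub>M lborel)"
      by (simp only: lborel_prod measurable_lborel1 measurable_lborel2)
    from lborel_pair.Fubini[OF this]
    show "(\<integral>\<^sup>+b. \<integral>\<^sup>+c. indicator A ((a, c), b) \<partial>lborel \<partial>lborel) = (\<integral>\<^sup>+c. \<integral>\<^sup>+b. indicator A ((a, c), b) \<partial>lborel \<partial>lborel)"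
      by simp
  qed
  also have "\<dots> = (\<integral>\<^sup>+w. \<integral>\<^sup>+b. indicator A (w, b) \<partial>lborel \<partial>(lborel \<Otimes>\<^sub>M lborel :: ('a \<times> 'c) measure))"
    by (subst lborel.nn_integral_fst[OF m4, symmetric]) simp
  also have "\<dots> = (\<integral>\<^sup>+w. \<integral>\<^sup>+b. indicator A (w, b) \<partial>lborel \<partial>(lborel :: ('a \<times> 'c) measure))" by (simp only: lborel_prod)
  also have "\<dots> = (\<integral>\<^sup>+z. indicator A z \<partial>((lborel :: ('a \<times> 'c) measure) \<Otimes>\<^sub>M (lborel :: 'b measure)))"
    by (rule lborel.nn_integral_fst[OF m2'])
  also have "\<dots> = emeasure lborel A" by (simp add: lborel_prod)
  finally show "emeasure (distr lborel lborel (swap23 :: ('a \<times> 'b) \<times> 'c => _)) A = emeasure lborel A" .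
qed simp

lemma
  fixes f :: "('a::euclidean_space \<times> 'b::euclidean_space) \<times> 'c::euclidean_space => real"
  assumes f: "f \<in> Borel"
  shows integrable_swap23: "integrable lborel (\<lambda>z. f (swap23 z)) \<longleftrightarrow> integrable lborel f"
    and integral_swap23: "(LBINT z. f (swap23 z)) = (LBINT z. f z)"
proof -
  have f': "f \<in> borel_measurable lborel" using f by simp
  have m: "swap23 \<in> lborel \<rightarrow>\<^sub>M (lborel :: (('a \<times> 'b) \<times> 'c) measure)" by measurable
  show "integrable lborel (\<lambda>z. f (swap23 z)) \<longleftrightarrow> integrable lborel f"
    using integrable_distr_eq[OF m f'] by (simp add: distr_swap23)
  show "(LBINT z. f (swap23 z)) = (LBINT z. f z)"
    using integral_distr[OF m f'] by (simp add: distr_swap23)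
qed

lemma AE_swap23:
  fixes P :: "('a::euclidean_space \<times> 'b::euclidean_space) \<times> 'c::euclidean_space => bool"
  assumes "AE z in lborel. P z" shows "AE z in lborel. P (swap23 z)"
proof -
  obtain N where N: "{z. \<not> P z} \<subseteq> N" "N \<in> null_sets lborel" using assms by (auto simp: eventually_ae_filter)
  have m: "swap23 \<in> lborel \<rightarrow>\<^sub>M (lborel :: (('a \<times> 'b) \<times> 'c) measure)" by measurable
  have "N \<in> null_sets (distr lborel lborel swap23)" using N(2) by (simp add: distr_swap23)
  then have "swap23 -` N \<in> null_sets lborel" by (subst (asm) null_sets_distr_iff[OF m]) simp
  then show ?thesis by (rule AE_I') (use N(1) in auto)
qed

lemma AE_fst:
  fixes P :: "'a::euclidean_space => bool"
  assumes "AE x in lborel. P x" shows "AE z in (lborel :: ('a \<times> 'b::euclidean_space) measure). P (fst z)"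
proof -
  obtain N where N: "{z. \<not> P z} \<subseteq> N" "N \<in> null_sets lborel" using assms by (auto simp: eventually_ae_filter)
  then have [measurable]: "N \<in> sets borel" by auto
  have "emeasure (lborel :: ('a \<times> 'b) measure) (N \<times> UNIV) = emeasure (lborel \<Otimes>\<^sub>M lborel) (N \<times> (UNIV :: 'b set))"
    by (simp only: lborel_prod)
  also have "\<dots> = emeasure lborel N * emeasure lborel (UNIV :: 'b set)" by (intro lborel.emeasure_pair_measure_Times) auto
  also have "\<dots> = 0" using N by auto
  finally have "N \<times> (UNIV :: 'b set) \<in> null_sets lborel" by (intro null_setsI) (auto intro: borel_Times)
  then show ?thesis by (rule AE_I') (use N(1) in auto)
qed

section \<open>The equation tested with functions of the space variable\<close>

text \<open>An approximate identity supported to the right of \<open>\<tau>\<close>, with the explicit primitive \<open>step ((t - \<tau>) / e)\<close>.\<close>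
definition kernel :: "real => real => real => real" where
  "kernel \<tau> e t = step' ((t - \<tau>) / e) / e"

lemma kernel_nonneg: "e > 0 ==> kernel \<tau> e t \<ge> 0"
  by (simp add: kernel_def step'_nonneg)

lemma kernel_eq_0: "e > 0 ==> t \<notin> {\<tau>..\<tau> + e} ==> kernel \<tau> e t = 0"
  unfolding kernel_def using step'_eq_0[of "(t - \<tau>) / e"] by (auto simp: field_simps)

lemma kernel_borel [measurable]: "kernel \<tau> e \<in> Borel"
  unfolding kernel_def[abs_def] by measurable

lemma kernel_antiderivative: "e > 0 ==> ((\<lambda>t. step ((t - \<tau>) / e)) has_real_derivative kernel \<tau> e t) (at t)"
  unfolding kernel_def
  by (rule DERIV_cong[OF DERIV_chain2[OF step_has_derivative]]) (auto intro!: derivative_eq_intros)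

lemma kernel_isCont: "e > 0 ==> isCont (kernel \<tau> e) t"
proof -
  assume "e > 0"
  have c: "isCont step' s" for s using step'_continuous by (simp add: continuous_on_eq_continuous_at)
  show ?thesis unfolding kernel_def[abs_def]
    by (intro continuous_intros isCont_o2[OF _ c]) (use \<open>e > 0\<close> in auto)
qed

lemma kernel_integral: assumes "e > 0"
  shows "(LBINT t. kernel \<tau> e t) = 1" "integrable lborel (kernel \<tau> e)"
proof -
  have eq: "(\<lambda>t. kernel \<tau> e t * indicator {\<tau>..\<tau> + e} t) = kernel \<tau> e"
    using kernel_eq_0[OF assms] by (auto simp: indicator_def fun_eq_iff)
  have "(LBINT t. kernel \<tau> e t * indicator {\<tau>..\<tau> + e} t) = step ((\<tau> + e - \<tau>) / e) - step ((\<tau> - \<tau>) / e)"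
    by (rule integral_FTC_Icc_real) (use assms kernel_antiderivative kernel_isCont in auto)
  then show "(LBINT t. kernel \<tau> e t) = 1" unfolding eq using assms by (simp add: step_eq_0 step_eq_1)
  show "integrable lborel (kernel \<tau> e)"
    by (rule continuous_compact_support_integrable[of _ "{\<tau>..\<tau> + e}"])
       (use assms kernel_isCont kernel_eq_0 in \<open>auto simp: continuous_on_eq_continuous_at\<close>)
qed

text \<open>\<open>m\<close> agrees almost everywhere with a function continuous at \<open>\<tau>\<close>, so averages over shrinking intervals converge to the value of that function.\<close>
lemma kernel_limit:
  fixes m :: "real => real"
  assumes m: "integrable lborel m" and M: "(M \<longlongrightarrow> M \<tau>) (at \<tau>)" and eq: "AE t\<in>{a<..<b} in lborel. m t = M t"
    and \<tau>: "\<tau> \<in> {a<..<b}" and e: "\<And>j. e j > 0" "e \<longlonglongrightarrow> 0"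
  shows "(\<lambda>j::nat. LBINT t. m t * kernel \<tau> (e j) t) \<longlonglongrightarrow> M \<tau>"
proof (rule tendstoI)
  fix \<theta> :: real assume \<theta>: "\<theta> > 0"
  have "\<forall>\<^sub>F t in at \<tau>. dist (M t) (M \<tau>) < \<theta> / 2" using M \<theta> by (intro tendstoD) auto
  then obtain d where d: "d > 0" "\<And>t. t \<noteq> \<tau> ==> dist t \<tau> < d ==> dist (M t) (M \<tau>) < \<theta> / 2"
    unfolding eventually_at by blast
  have "\<forall>\<^sub>F j in sequentially. e j < min d (b - \<tau>)" using \<tau> d by (intro order_tendstoD(2)[OF e(2)]) auto
  then show "\<forall>\<^sub>F j in sequentially. dist (LBINT t. m t * kernel \<tau> (e j) t) (M \<tau>) < \<theta>"
  proof eventually_elim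
    case (elim j)
    note k = kernel_integral[OF e(1)[of j], of \<tau>]
    have "continuous_on UNIV (kernel \<tau> (e j))" using kernel_isCont[OF e(1)] by (simp add: continuous_at_imp_continuous_on)
    then obtain B where B: "\<And>t. \<bar>kernel \<tau> (e j) t\<bar> \<le> B"
      using continuous_compact_support_bounded[of "kernel \<tau> (e j)" "{\<tau>..\<tau> + e j}"] kernel_eq_0[OF e(1)] by (metis compact_Icc)
    have mk: "integrable lborel (\<lambda>t. kernel \<tau> (e j) t * m t)"
      using powr_integrable_bounded_mult[of lborel 1 m "kernel \<tau> (e j)" B] m B by (simp add: powr_integrable_1)
    have "\<bar>(LBINT t. m t * kernel \<tau> (e j) t) - M \<tau>\<bar> = \<bar>LBINT t. kernel \<tau> (e j) t * m t - M \<tau> * kernel \<tau> (e j) t\<bar>"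
      using k mk by (simp add: mult.commute)
    also have "\<dots> \<le> (LBINT t. \<bar>kernel \<tau> (e j) t * m t - M \<tau> * kernel \<tau> (e j) t\<bar>)" by (rule integral_abs_bound)
    also have "\<dots> \<le> (LBINT t. \<theta> / 2 * kernel \<tau> (e j) t)"
    proof (rule integral_mono_AE)
      show "AE t in lborel. \<bar>kernel \<tau> (e j) t * m t - M \<tau> * kernel \<tau> (e j) t\<bar> \<le> \<theta> / 2 * kernel \<tau> (e j) t"
        using eq
      proof eventually_elim
        case t: (elim t)
        have kn: "kernel \<tau> (e j) t \<ge> 0" by (rule kernel_nonneg[OF e(1)])
        show ?case
        proof (cases "t \<in> {\<tau>..\<tau> + e j}")
          case True
          then have "t \<in> {a<..<b}" using elim \<tau> by auto
          then have "m t = M t" using t by simp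
          moreover have "\<bar>M t - M \<tau>\<bar> \<le> \<theta> / 2" using d(2)[of t] True elim \<theta> by (cases "t = \<tau>") (auto simp: dist_real_def)
          ultimately have "kernel \<tau> (e j) t * \<bar>m t - M \<tau>\<bar> \<le> kernel \<tau> (e j) t * (\<theta> / 2)" using kn by (intro mult_left_mono) auto
          moreover have "kernel \<tau> (e j) t * m t - M \<tau> * kernel \<tau> (e j) t = kernel \<tau> (e j) t * (m t - M \<tau>)" by (simp add: algebra_simps)
          ultimately show ?thesis using kn by (simp add: abs_mult mult.commute)
        qed (simp add: kernel_eq_0[OF e(1)])
      qed
    qed (use mk k in auto)
    also have "\<dots> = \<theta> / 2" using k by simp
    finally show ?case using \<theta> by (simp add: dist_real_def)
  qed
qed

lemma conjugate_exponent:
  fixes p :: real assumes "p > 1"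
  shows "p / (p - 1) > 1" "1 / p + 1 / (p / (p - 1)) = 1"
  using assms by (auto simp: field_simps)

text \<open>Test with \<open>\<phi>(x) \<eta>(t)\<close>, where \<open>\<eta>\<close> approximates the indicator of \<open>(t1,t2]\<close>: its derivative is a difference of two approximate identities, which pick out \<open>V t1\<close> and \<open>V t2\<close> by continuity of the curve.\<close>
lemma time_integrated_identity:
  fixes \<Omega> :: "(real^'n) set" and V :: "real => real^'n => real"
  assumes y: "integrable lborel y" and a: "\<And>i. integrable lborel (a i)" and f: "integrable lborel f"
    and eq: "\<And>\<phi>. \<phi> \<in> test_functions (cylinder \<Omega> T) ==>
      (LBINT z. (\<Sum>i\<in>UNIV. a i z * dir_deriv (axis i 1, 0) \<phi> z) - y z * dir_deriv (0, 1) \<phi> z)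
        = (LBINT z. f (fst z) * \<phi> z)"
    and V: "\<And>t. t \<in> {0<..<T} ==> integrable lborel (V t)"
      "\<And>t. t \<in> {0<..<T} ==> ((\<lambda>s. LBINT x. \<bar>V s x - V t x\<bar>) \<longlongrightarrow> 0) (at t)"
      "AE t\<in>{0<..<T} in lborel. (AE x in lborel. y (x, t) = V t x)"
    and \<phi>: "\<phi> \<in> test_functions \<Omega>" and t: "0 < t1" "t1 < t2" "t2 < T"
  shows "(LBINT x. (V t2 x - V t1 x) * \<phi> x) = (t2 - t1) * (LBINT x. f x * \<phi> x)
      - (\<Sum>i\<in>UNIV. LBINT z. indicator {t1<..t2} (snd z) * (a i z * dir_deriv (axis i 1) \<phi> (fst z)))"
proof -
  note [measurable] = borel_measurable_integrable[OF y] borel_measurable_integrable[OF a] borel_measurable_integrable[OF f]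
    test_function_borel[OF \<phi>] test_function_borel[OF test_function_dir_deriv[OF \<phi>]]
  have yb: "y \<in> Borel" using borel_measurable_integrable[OF y] by simp
  obtain B0 where B0: "\<And>x. \<bar>\<phi> x\<bar> \<le> B0" using test_function_bounded[OF \<phi>] by metis
  have Bd: "\<exists>B. \<forall>x. \<bar>dir_deriv b \<phi> x\<bar> \<le> B" for b using test_function_bounded[OF test_function_dir_deriv[OF \<phi>]] by metis
  have bounded_mult: "integrable M (\<lambda>z. h z * k z)"
    if "integrable M k" "h \<in> borel_measurable M" "\<And>z. \<bar>h z\<bar> \<le> B" for M and h k :: "'z => real" and B
    using powr_integrable_bounded_mult[of M 1 k h B] that by (simp add: powr_integrable_1)
  have y\<phi>: "integrable lborel (\<lambda>z. \<phi> (fst z) * y z)" by (rule bounded_mult[OF y _ B0]) measurable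
  have a\<phi>: "integrable lborel (\<lambda>z. dir_deriv (axis i 1) \<phi> (fst z) * a i z)" for i
  proof -
    obtain B where "\<And>x. \<bar>dir_deriv (axis i 1) \<phi> x\<bar> \<le> B" using Bd by blast
    then show ?thesis by (intro bounded_mult[OF a]) auto
  qed
  define A where "A z = (\<Sum>i\<in>UNIV. dir_deriv (axis i 1) \<phi> (fst z) * a i z)" for z
  have A: "integrable lborel A" unfolding A_def[abs_def] using a\<phi> by auto
  define m where "m t = (LBINT x. \<phi> x * y (x, t))" for t
  have m: "integrable lborel m" unfolding m_def[abs_def] using integrable_section_integral[OF y\<phi>] by simp
  define M where "M t = (LBINT x. \<phi> x * V t x)" for t
  have mM: "AE t\<in>{0<..<T} in lborel. m t = M t"
    using V(3)
  proof eventually_elim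
    case (elim t)
    show ?case
    proof
      assume t: "t \<in> {0<..<T}"
      note [measurable] = borel_measurable_integrable[OF V(1)[OF t]]
        borel_measurable_section(1)[OF yb, of t]
      show "m t = M t" unfolding m_def M_def
        by (rule integral_cong_AE) (use elim t in \<open>auto elim!: eventually_mono\<close>)
    qed
  qed
  have V\<phi>: "integrable lborel (\<lambda>x. \<phi> x * V t x)" if "t \<in> {0<..<T}" for t
    by (rule bounded_mult[OF V(1)[OF that] _ B0]) measurable
  have Mc: "(M \<longlongrightarrow> M t) (at t)" if t: "t \<in> {0<..<T}" for t
  proof -
    have "((\<lambda>s. B0 * (LBINT x. \<bar>V s x - V t x\<bar>)) \<longlongrightarrow> B0 * 0) (at t)" by (intro tendsto_intros V(2) t)
    then have lim: "((\<lambda>s. B0 * (LBINT x. \<bar>V s x - V t x\<bar>)) \<longlongrightarrow> 0) (at t)" by simp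
    have "\<forall>\<^sub>F s in at t. s \<in> {0<..<T}" using t by (intro eventually_at_in_open'[OF _ t]) auto
    then have "\<forall>\<^sub>F s in at t. norm (M s - M t) \<le> B0 * (LBINT x. \<bar>V s x - V t x\<bar>)"
    proof eventually_elim
      case (elim s)
      have d: "integrable lborel (\<lambda>x. V s x - V t x)" using V(1) elim t by auto
      have "M s - M t = (LBINT x. \<phi> x * (V s x - V t x))"
        unfolding M_def using V\<phi> elim t by (simp add: right_diff_distrib)
      also have "norm \<dots> \<le> (LBINT x. \<bar>\<phi> x * (V s x - V t x)\<bar>)" using integral_abs_bound by simp
      also have "\<dots> \<le> (LBINT x. B0 * \<bar>V s x - V t x\<bar>)"
        using d B0 order_trans[OF abs_ge_zero B0] by (intro Bochner_Integration.integral_mono_AE') (auto simp: abs_mult intro!: mult_right_mono)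
      finally show ?case by simp
    qed
    from Lim_null_comparison[OF this lim] show ?thesis by (rule LIM_zero_cancel)
  qed
  define N where "N z = A z - indicator {0<..<T} (snd z) * (f (fst z) * \<phi> (fst z))" for z
  have f\<phi>: "integrable lborel (\<lambda>x. f x * \<phi> x)"
  proof -
    have "integrable lborel (\<lambda>x. \<phi> x * f x)" by (rule bounded_mult[OF f _ B0]) measurable
    then show ?thesis by (simp add: mult.commute)
  qed
  have iT: "integrable lborel (indicator S :: real => real)" if "S \<in> sets borel" "bounded S" for S
    using that by (auto intro: emeasure_bounded_finite)
  have f\<phi>T: "integrable lborel (\<lambda>z. indicator S (snd z) * (f (fst z) * \<phi> (fst z)))"
    and f\<phi>TI: "(LBINT z. indicator S (snd z) * (f (fst z) * \<phi> (fst z))) = measure lborel S * (LBINT x. f x * \<phi> x)"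
    if "S \<in> sets borel" "bounded S" for S :: "real set"
    using integrable_product[OF f\<phi> iT[OF that]] integral_product[OF f\<phi> iT[OF that]] that by (simp_all add: mult.commute)
  have N: "integrable lborel N" unfolding N_def[abs_def] using A f\<phi>T[of "{0<..<T}"] by auto
  have eq\<eta>: "(LBINT z. \<eta> (snd z) * N z) = (LBINT t. m t * dir_deriv 1 \<eta> t)" if \<eta>: "\<eta> \<in> test_functions {0<..<T}" for \<eta>
  proof -
    note [measurable] = test_function_borel[OF \<eta>] test_function_borel[OF test_function_dir_deriv[OF \<eta>]]
    obtain B1 where B1: "\<And>x. \<bar>\<eta> x\<bar> \<le> B1" using test_function_bounded[OF \<eta>] by metis
    obtain B2 where B2: "\<And>x. \<bar>dir_deriv 1 \<eta> x\<bar> \<le> B2" using test_function_bounded[OF test_function_dir_deriv[OF \<eta>]] by metis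
    note p = test_function_product[OF \<phi> \<eta>]
    have \<eta>0: "\<eta> t = 0" if "t \<notin> {0<..<T}" for t using test_function_support[OF \<eta>] that by (metis subsetD)
    have i1: "integrable lborel (\<lambda>z. \<eta> (snd z) * A z)" by (rule bounded_mult[OF A _ B1]) measurable
    have i2: "integrable lborel (\<lambda>z. dir_deriv 1 \<eta> (snd z) * (\<phi> (fst z) * y z))" by (rule bounded_mult[OF y\<phi> _ B2]) measurable
    have i3: "integrable lborel (\<lambda>z. \<eta> (snd z) * (indicator {0<..<T} (snd z) * (f (fst z) * \<phi> (fst z))))"
      by (rule bounded_mult[OF f\<phi>T _ B1]) auto
    have d: "dir_deriv (axis i 1, 0) (\<lambda>z. \<phi> (fst z) * \<eta> (snd z)) z = dir_deriv (axis i 1) \<phi> (fst z) * \<eta> (snd z)"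
      "dir_deriv (0, 1) (\<lambda>z. \<phi> (fst z) * \<eta> (snd z)) z = \<phi> (fst z) * dir_deriv 1 \<eta> (snd z)" for i and z :: "(real^'n) \<times> real"
      using p(2)[of "axis i 1" "fst z" "snd z"] p(3)[of 1 "fst z" "snd z"] by simp_all
    have "(LBINT z. \<eta> (snd z) * A z - dir_deriv 1 \<eta> (snd z) * (\<phi> (fst z) * y z)) = (LBINT z. f (fst z) * (\<phi> (fst z) * \<eta> (snd z)))"
      using eq[OF p(1)] unfolding d by (simp add: A_def sum_distrib_left mult_ac)
    also have "\<dots> = (LBINT z. \<eta> (snd z) * (indicator {0<..<T} (snd z) * (f (fst z) * \<phi> (fst z))))"
    proof (intro Bochner_Integration.integral_cong refl)
      fix z :: "(real^'n) \<times> real"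
      show "f (fst z) * (\<phi> (fst z) * \<eta> (snd z)) = \<eta> (snd z) * (indicator {0<..<T} (snd z) * (f (fst z) * \<phi> (fst z)))"
        using \<eta>0[of "snd z"] by (cases "snd z \<in> {0<..<T}") auto
    qed
    finally have "(LBINT z. \<eta> (snd z) * N z) = (LBINT z. dir_deriv 1 \<eta> (snd z) * (\<phi> (fst z) * y z))"
      unfolding N_def using i1 i2 i3 by (simp add: right_diff_distrib)
    also have "\<dots> = (LBINT t. m t * dir_deriv 1 \<eta> t)"
      by (subst integral_sections[OF i2]) (simp add: m_def mult.commute)
    finally show ?thesis .
  qed
  define e where "e j = (T - t2) / (2 * real (Suc j))" for j :: nat
  have e: "e j > 0" "e j < T - t2" for j
  proof -
    show "e j > 0" using t by (simp add: e_def)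
    have "(T - t2) * 1 < (T - t2) * (2 * real (Suc j))" using t by (intro mult_strict_left_mono) auto
    then show "e j < T - t2" by (simp add: e_def divide_less_eq)
  qed
  have "(\<lambda>j. (T - t2) / 2 * (1 / real (Suc j))) \<longlonglongrightarrow> (T - t2) / 2 * 0"
    using LIMSEQ_inverse_real_of_nat by (intro tendsto_intros) (simp add: inverse_eq_divide)
  then have e0: "e \<longlonglongrightarrow> 0" by (simp add: e_def[abs_def])
  \<comment> \<open>The cut-off rises just after \<open>t1\<close> and falls just after \<open>t2\<close>, hence the half-open interval in the limit.\<close>
  define \<eta> where "\<eta> j t = step ((t - t1) / e j) - step ((t - t2) / e j)" for j t
  have \<eta>_Ck: "Ck k (\<eta> j)" for j k
    unfolding \<eta>_def[abs_def] divide_inverse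
    by (intro Ck_diff Ck_compose[OF Ck_step] Ck_mult Ck_const Ck_bounded_linear[OF bounded_linear_ident])
  have \<eta>_test: "\<eta> j \<in> test_functions {0<..<T}" for j
  proof (rule test_functionI[OF \<eta>_Ck])
    show "compact {t1..t2 + e j}" by simp
    show "{t1..t2 + e j} \<subseteq> {0<..<T}" using t e[of j] by auto
    show "\<eta> j s = 0" if "s \<notin> {t1..t2 + e j}" for s
    proof (cases "s < t1")
      case True
      then show ?thesis using t e[of j] by (simp add: \<eta>_def step_eq_0 divide_le_0_iff)
    next
      case False
      then have "s > t2 + e j" using that by auto
      then have "(s - t1) / e j \<ge> 1" "(s - t2) / e j \<ge> 1" using t e[of j] by (auto simp: le_divide_eq)
      then show ?thesis by (simp add: \<eta>_def step_eq_1)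
    qed
  qed
  have \<eta>_deriv: "dir_deriv 1 (\<eta> j) s = kernel t1 (e j) s - kernel t2 (e j) s" for j s
  proof -
    have "(\<eta> j has_real_derivative (kernel t1 (e j) s - kernel t2 (e j) s)) (at s)"
      unfolding \<eta>_def[abs_def] by (intro DERIV_diff kernel_antiderivative e)
    then show ?thesis using dir_deriv_eqI[of "\<eta> j" _ s 1] by (simp add: has_field_derivative_def)
  qed
  have step_lim: "(\<lambda>j. step ((s - \<tau>) / e j)) \<longlonglongrightarrow> indicator {\<tau><..} s" for s \<tau>
  proof (cases "s \<le> \<tau>")
    case True
    then have "step ((s - \<tau>) / e j) = 0" for j using e[of j] by (intro step_eq_0) (simp add: divide_le_0_iff)
    then show ?thesis using True by simp
  next
    case False
    then have "\<forall>\<^sub>F j in sequentially. e j < s - \<tau>" by (intro order_tendstoD(2)[OF e0]) auto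
    then have "\<forall>\<^sub>F j in sequentially. 1 = step ((s - \<tau>) / e j)"
    proof eventually_elim
      case (elim j)
      then have "(s - \<tau>) / e j \<ge> 1" using e[of j] by (simp add: le_divide_eq)
      then show ?case by (simp add: step_eq_1)
    qed
    then show ?thesis using False by (auto intro: Lim_transform_eventually[OF tendsto_const])
  qed
  have \<eta>_lim: "(\<lambda>j. \<eta> j s) \<longlonglongrightarrow> indicator {t1<..t2} s" for s
  proof -
    have "indicator {t1<..} s - indicator {t2<..} s = (indicator {t1<..t2} s :: real)" using t by (auto simp: indicator_def)
    then show ?thesis using tendsto_diff[OF step_lim[of s t1] step_lim[of s t2]] by (simp add: \<eta>_def)
  qed
  have "(\<lambda>j. LBINT z. \<eta> j (snd z) * N z) \<longlonglongrightarrow> (LBINT z. indicator {t1<..t2} (snd z) * N z)"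
  proof (rule integral_dominated_convergence[where w="\<lambda>z. \<bar>N z\<bar>"])
    note [measurable] = borel_measurable_integrable[OF N] test_function_borel[OF \<eta>_test]
    show "(\<lambda>z. indicator {t1<..t2} (snd z) * N z) \<in> borel_measurable lborel" by measurable
    show "(\<lambda>z. \<eta> j (snd z) * N z) \<in> borel_measurable lborel" for j by measurable
    show "AE z in lborel. (\<lambda>j. \<eta> j (snd z) * N z) \<longlonglongrightarrow> indicator {t1<..t2} (snd z) * N z"
      by (intro AE_I2 tendsto_intros \<eta>_lim)
    show "AE z in lborel. norm (\<eta> j (snd z) * N z) \<le> \<bar>N z\<bar>" for j
    proof (intro AE_I2)
      fix z :: "(real^'n) \<times> real"
      have "\<bar>\<eta> j (snd z)\<bar> \<le> 1" unfolding \<eta>_def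
        using step_nonneg step_le_1 by (smt (verit))
      then show "norm (\<eta> j (snd z) * N z) \<le> \<bar>N z\<bar>" by (simp add: abs_mult mult_left_le_one_le)
    qed
  qed (use N in auto)
  moreover have "(\<lambda>j. LBINT t. m t * dir_deriv 1 (\<eta> j) t) \<longlonglongrightarrow> M t1 - M t2"
  proof -
    have mk: "integrable lborel (\<lambda>t. m t * kernel \<tau> (e j) t)" for \<tau> j
    proof -
      have "continuous_on UNIV (kernel \<tau> (e j))" using kernel_isCont[OF e(1)] by (simp add: continuous_at_imp_continuous_on)
      then obtain B where "\<And>t. \<bar>kernel \<tau> (e j) t\<bar> \<le> B"
        using continuous_compact_support_bounded[of "kernel \<tau> (e j)" "{\<tau>..\<tau> + e j}"] kernel_eq_0[OF e(1)] by (metis compact_Icc)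
      then show ?thesis using bounded_mult[OF m, of "kernel \<tau> (e j)" B] by (simp add: mult.commute)
    qed
    have "(\<lambda>j. (LBINT t. m t * kernel t1 (e j) t) - (LBINT t. m t * kernel t2 (e j) t)) \<longlonglongrightarrow> M t1 - M t2"
      using t by (intro tendsto_diff kernel_limit[OF m Mc mM _ e(1) e0]) auto
    then show ?thesis using mk by (simp add: \<eta>_deriv right_diff_distrib)
  qed
  ultimately have "(LBINT z. indicator {t1<..t2} (snd z) * N z) = M t1 - M t2"
    using eq\<eta>[OF \<eta>_test] by (simp add: LIMSEQ_unique)
  moreover have "(LBINT z. indicator {t1<..t2} (snd z) * N z)
      = (\<Sum>i\<in>UNIV. LBINT z. indicator {t1<..t2} (snd z) * (a i z * dir_deriv (axis i 1) \<phi> (fst z))) - (t2 - t1) * (LBINT x. f x * \<phi> x)"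
  proof -
    have ai: "integrable lborel (\<lambda>z. indicator {t1<..t2} (snd z) * (a i z * dir_deriv (axis i 1) \<phi> (fst z)))" for i
      using bounded_mult[OF a\<phi>, of "\<lambda>z. indicator {t1<..t2} (snd z)" 1 i] by (simp add: mult_ac indicator_def)
    have "indicator {t1<..t2} (snd z) * N z = (\<Sum>i\<in>UNIV. indicator {t1<..t2} (snd z) * (a i z * dir_deriv (axis i 1) \<phi> (fst z)))
        - indicator {t1<..t2} (snd z) * (f (fst z) * \<phi> (fst z))" for z
      using t by (auto simp: N_def A_def indicator_def mult.commute)
    then have "(LBINT z. indicator {t1<..t2} (snd z) * N z)
        = (LBINT z. (\<Sum>i\<in>UNIV. indicator {t1<..t2} (snd z) * (a i z * dir_deriv (axis i 1) \<phi> (fst z)))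
          - indicator {t1<..t2} (snd z) * (f (fst z) * \<phi> (fst z)))" by (simp only:)
    also have "\<dots> = (LBINT z. (\<Sum>i\<in>UNIV. indicator {t1<..t2} (snd z) * (a i z * dir_deriv (axis i 1) \<phi> (fst z))))
          - (LBINT z. indicator {t1<..t2} (snd z) * (f (fst z) * \<phi> (fst z)))"
      by (rule Bochner_Integration.integral_diff, rule Bochner_Integration.integrable_sum, rule ai, rule f\<phi>T)
         (auto intro: bounded_subset[OF bounded_closed_interval[of t1 t2]])
    also have "(LBINT z. (\<Sum>i\<in>UNIV. indicator {t1<..t2} (snd z) * (a i z * dir_deriv (axis i 1) \<phi> (fst z))))
        = (\<Sum>i\<in>UNIV. LBINT z. indicator {t1<..t2} (snd z) * (a i z * dir_deriv (axis i 1) \<phi> (fst z)))"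
      by (rule Bochner_Integration.integral_sum[OF ai])
    also have "(LBINT z. indicator {t1<..t2} (snd z) * (f (fst z) * \<phi> (fst z))) = (t2 - t1) * (LBINT x. f x * \<phi> x)"
      using t by (subst f\<phi>TI) (auto intro: bounded_subset[OF bounded_closed_interval[of t1 t2]])
    finally show ?thesis .
  qed
  moreover have "(LBINT x. (V t2 x - V t1 x) * \<phi> x) = M t2 - M t1"
    using V\<phi>[of t1] V\<phi>[of t2] t by (simp add: M_def right_diff_distrib mult.commute)
  ultimately show ?thesis by simp
qed

text \<open>Every term passes to the limit: dominated convergence for the integrable factors, duality for the fluxes.\<close>
lemma tested_identity:
  fixes \<Omega> :: "(real^'n) set" and a :: "'n => (real^'n) \<times> real => real"
  assumes p: "\<And>i. p i > 1" and W: "integrable lborel W" and f: "integrable lborel f"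
    and a: "\<And>i. powr_integrable lborel (p i / (p i - 1)) (a i)"
    and eq: "\<And>\<phi>. \<phi> \<in> test_functions \<Omega> ==> (LBINT x. W x * \<phi> x) = l * (LBINT x. f x * \<phi> x)
      - (\<Sum>i\<in>UNIV. LBINT z. indicator {t1<..t2} (snd z) * (a i z * dir_deriv (axis i 1) \<phi> (fst z)))"
    and \<zeta>: "bounded_approximable \<Omega> p \<zeta> D"
  shows "(LBINT x. W x * \<zeta> x) = l * (LBINT x. f x * \<zeta> x)
      - (\<Sum>i\<in>UNIV. LBINT z. indicator {t1<..t2} (snd z) * (a i z * D i (fst z)))"
proof -
  obtain \<psi> where [measurable]: "\<zeta> \<in> Borel" and D: "\<And>i. powr_integrable lborel (p i) (D i)"
    and \<psi>: "\<And>k::nat. \<psi> k \<in> test_functions \<Omega>" "\<And>k x. \<bar>\<psi> k x\<bar> \<le> 1" and \<psi>l: "AE x in lborel. (\<lambda>k. \<psi> k x) \<longlonglongrightarrow> \<zeta> x"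
    and \<psi>d: "\<And>i. (\<lambda>k. LBINT x. \<bar>dir_deriv (axis i 1) (\<psi> k) x - D i x\<bar> powr p i) \<longlonglongrightarrow> 0"
    using \<zeta> unfolding bounded_approximable_def by blast
  note [measurable] = test_function_borel[OF \<psi>(1)]
  have lim: "(\<lambda>k. LBINT x. h x * \<psi> k x) \<longlonglongrightarrow> (LBINT x. h x * \<zeta> x)" if h: "integrable lborel h" for h :: "real^'n => real"
  proof (rule integral_dominated_convergence[where w="\<lambda>x. \<bar>h x\<bar>"])
    note [measurable] = borel_measurable_integrable[OF h]
    show "(\<lambda>x. h x * \<zeta> x) \<in> borel_measurable lborel" "\<And>k. (\<lambda>x. h x * \<psi> k x) \<in> borel_measurable lborel" by measurable
    show "AE x in lborel. (\<lambda>k. h x * \<psi> k x) \<longlonglongrightarrow> h x * \<zeta> x"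
      using \<psi>l by eventually_elim (intro tendsto_intros)
    show "AE x in lborel. norm (h x * \<psi> k x) \<le> \<bar>h x\<bar>" for k
      using \<psi>(2) by (auto simp: abs_mult mult_left_le)
  qed (use h in auto)
  have "(\<lambda>k. LBINT z. indicator {t1<..t2} (snd z) * (a i z * dir_deriv (axis i 1) (\<psi> k) (fst z)))
      \<longlonglongrightarrow> (LBINT z. indicator {t1<..t2} (snd z) * (a i z * D i (fst z)))" for i
  proof -
    note pq = p[of i] conjugate_exponent[OF p[of i]]
    let ?I = "indicator {t1<..t2} :: real => real"
    have iI: "integrable lborel ?I"
    proof (rule integrable_real_indicator)
      have "bounded {t1<..t2}" by (rule bounded_subset[OF bounded_closed_interval[of t1 t2]]) auto
      then show "emeasure lborel {t1<..t2} < \<infinity>" by (rule emeasure_bounded_finite)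
    qed simp
    have prod: "powr_integrable lborel (p i) (\<lambda>z. ?I (snd z) * h (fst z))"
      "(LBINT z. \<bar>?I (snd z) * h (fst z)\<bar> powr p i) = (LBINT x. \<bar>h x\<bar> powr p i) * measure lborel {t1<..t2}"
      if h: "powr_integrable lborel (p i) h" for h :: "real^'n => real"
    proof -
      have [measurable]: "h \<in> Borel" using powr_integrable_borel[OF h] by simp
      have eq: "\<bar>?I (snd z) * h (fst z)\<bar> powr p i = \<bar>h (fst z)\<bar> powr p i * ?I (snd z)" for z by (auto simp: indicator_def)
      show "powr_integrable lborel (p i) (\<lambda>z. ?I (snd z) * h (fst z))"
        unfolding powr_integrable_def eq using integrable_product[OF powr_integrable_integrable[OF h] iI] by auto
      show "(LBINT z. \<bar>?I (snd z) * h (fst z)\<bar> powr p i) = (LBINT x. \<bar>h x\<bar> powr p i) * measure lborel {t1<..t2}"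
        unfolding eq using integral_product[OF powr_integrable_integrable[OF h] iI] by simp
    qed
    have \<psi>p: "powr_integrable lborel (p i) (dir_deriv (axis i 1) (\<psi> k))" for k
      using p[of i] by (intro test_function_powr_integrable[OF test_function_dir_deriv[OF \<psi>(1)]]) auto
    have dp: "powr_integrable lborel (p i) (\<lambda>x. dir_deriv (axis i 1) (\<psi> k) x - D i x)" for k
      using p[of i] by (intro powr_integrable_diff \<psi>p D) auto
    have int: "integrable lborel (\<lambda>z. a i z * (?I (snd z) * h (fst z)))" if "powr_integrable lborel (p i) h" for h
      by (rule integrable_dual_product[OF pq a prod(1)[OF that]])
    have "(\<lambda>k. LBINT z. \<bar>a i z * (?I (snd z) * (dir_deriv (axis i 1) (\<psi> k) (fst z) - D i (fst z)))\<bar>) \<longlonglongrightarrow> 0"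
    proof (rule dual_product_tendsto_0[OF pq a])
      show "\<forall>\<^sub>F k in sequentially. powr_integrable lborel (p i) (\<lambda>z. ?I (snd z) * (dir_deriv (axis i 1) (\<psi> k) (fst z) - D i (fst z)))"
        using prod(1)[OF dp] by simp
      have "(\<lambda>k. (LBINT x. \<bar>dir_deriv (axis i 1) (\<psi> k) x - D i x\<bar> powr p i) * measure lborel {t1<..t2}) \<longlonglongrightarrow> 0"
        by (rule tendsto_mult_left_zero[OF \<psi>d])
      then show "(\<lambda>k. LBINT z. \<bar>?I (snd z) * (dir_deriv (axis i 1) (\<psi> k) (fst z) - D i (fst z))\<bar> powr p i) \<longlonglongrightarrow> 0"
        unfolding prod(2)[OF dp] .
    qed
    moreover have "norm ((LBINT z. ?I (snd z) * (a i z * dir_deriv (axis i 1) (\<psi> k) (fst z))) - (LBINT z. ?I (snd z) * (a i z * D i (fst z))))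
        \<le> (LBINT z. \<bar>a i z * (?I (snd z) * (dir_deriv (axis i 1) (\<psi> k) (fst z) - D i (fst z)))\<bar>)" for k
    proof -
      have "(LBINT z. ?I (snd z) * (a i z * dir_deriv (axis i 1) (\<psi> k) (fst z))) - (LBINT z. ?I (snd z) * (a i z * D i (fst z)))
          = (LBINT z. a i z * (?I (snd z) * (dir_deriv (axis i 1) (\<psi> k) (fst z) - D i (fst z))))"
        using int[OF \<psi>p[of k]] int[OF D[of i]] by (simp add: algebra_simps)
      then show ?thesis using integral_abs_bound by simp
    qed
    ultimately show ?thesis
      by (rule LIM_zero_cancel[OF Lim_null_comparison[OF always_eventually[OF allI]], rotated])
  qed
  then have "(\<lambda>k. l * (LBINT x. f x * \<psi> k x) - (\<Sum>i\<in>UNIV. LBINT z. indicator {t1<..t2} (snd z) * (a i z * dir_deriv (axis i 1) (\<psi> k) (fst z))))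
      \<longlonglongrightarrow> l * (LBINT x. f x * \<zeta> x) - (\<Sum>i\<in>UNIV. LBINT z. indicator {t1<..t2} (snd z) * (a i z * D i (fst z)))"
    by (intro tendsto_intros lim f)
  then have "(\<lambda>k. LBINT x. W x * \<psi> k x)
      \<longlonglongrightarrow> l * (LBINT x. f x * \<zeta> x) - (\<Sum>i\<in>UNIV. LBINT z. indicator {t1<..t2} (snd z) * (a i z * D i (fst z)))"
    using eq[OF \<psi>(1)] by simp
  with lim[OF W] show ?thesis by (rule LIMSEQ_unique)
qed

section \<open>The chain rule for one equation\<close>

lemma integrable_indicator_bounded:
  "S \<in> sets borel ==> bounded S ==> integrable lborel (indicator S :: 'a::euclidean_space => real)"
  by (rule integrable_real_indicator) (auto dest: emeasure_bounded_finite)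

text \<open>By Fubini, with \<open>\<tau> = t - s\<close>, the left-hand side is the average over \<open>0 \<le> s < h\<close> of \<open>\<integral> a(x,t-s) D(x,t)\<close>, which is continuous at \<open>s = 0\<close> since translations of \<open>a\<close> are.\<close>
lemma time_average:
  fixes a D :: "'a::euclidean_space \<times> real => real"
  assumes pq: "p > 1" "q > 1" "1 / p + 1 / q = 1"
    and a: "powr_integrable lborel q a" and D: "powr_integrable lborel p D"
    and D0: "\<And>z. snd z \<notin> {0<..<T} ==> D z = 0"
  defines "G \<equiv> \<lambda>h z. indicator {snd z - h<..snd z} (snd (fst z)) * (a (fst z) * D (fst (fst z), snd z))"
  shows "\<And>h. 0 < h ==> h < 1 ==> integrable lborel (G h)"
    and "((\<lambda>h. (LBINT z. G h z) / h) \<longlongrightarrow> (LBINT z. a z * D z)) (at_right 0)"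
proof -
  have [measurable]: "a \<in> Borel" "D \<in> Borel"
    using powr_integrable_borel[OF a] powr_integrable_borel[OF D] by auto
  have Gm[measurable]: "G h \<in> Borel" for h
  proof -
    have eq: "G h = (\<lambda>z. (if snd z - h < snd (fst z) \<and> snd (fst z) \<le> snd z then 1 else 0) * (a (fst z) * D (fst (swap23 z))))"
      by (auto simp: G_def indicator_def swap23_def fun_eq_iff)
    show ?thesis unfolding eq by measurable
  qed
  show Gi: "integrable lborel (G h)" if h: "0 < h" "h < 1" for h
  proof (rule Bochner_Integration.integrable_bound)
    have iT: "integrable lborel (indicator {0<..<T} :: real => real)" "integrable lborel (indicator {-1<..<T} :: real => real)"
      by (rule integrable_indicator_bounded; simp)+
    have i1: "integrable lborel (\<lambda>z::('a \<times> real) \<times> real. \<bar>a (fst z)\<bar> powr q * indicator {0<..<T} (snd z))"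
      by (rule integrable_product[OF powr_integrable_integrable[OF a] iT(1)])
    have "integrable lborel (\<lambda>z::('a \<times> real) \<times> real. \<bar>D (fst z)\<bar> powr p * indicator {-1<..<T} (snd z))"
      by (rule integrable_product[OF powr_integrable_integrable[OF D] iT(2)])
    from this[THEN integrable_swap23[THEN iffD2, rotated]]
    have i2: "integrable lborel (\<lambda>z::('a \<times> real) \<times> real. \<bar>D (fst (swap23 z))\<bar> powr p * indicator {-1<..<T} (snd (swap23 z)))"
      by simp
    show "integrable lborel (\<lambda>z::('a \<times> real) \<times> real. \<bar>a (fst z)\<bar> powr q * indicator {0<..<T} (snd z)
        + \<bar>D (fst (swap23 z))\<bar> powr p * indicator {-1<..<T} (snd (swap23 z)))"
      by (rule Bochner_Integration.integrable_add[OF i1 i2])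
    show "AE z in lborel. norm (G h z) \<le> norm (\<bar>a (fst z)\<bar> powr q * indicator {0<..<T} (snd z)
        + \<bar>D (fst (swap23 z))\<bar> powr p * indicator {-1<..<T} (snd (swap23 z)))"
    proof (intro AE_I2)
      fix z :: "('a \<times> real) \<times> real"
      obtain x \<tau> t where z: "z = ((x, \<tau>), t)" by (metis surj_pair)
      show "norm (G h z) \<le> norm (\<bar>a (fst z)\<bar> powr q * indicator {0<..<T} (snd z)
        + \<bar>D (fst (swap23 z))\<bar> powr p * indicator {-1<..<T} (snd (swap23 z)))"
        using young[OF pq, of "a (x, \<tau>)" "D (x, t)"] D0[of "(x, t)"] h
        by (auto simp: z G_def indicator_def)
    qed
  qed simp
  have aD: "integrable lborel (\<lambda>z. a z * D z)" by (rule integrable_dual_product[OF pq a D])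
  define e where "e s = (LBINT z. \<bar>D z * (a (z + (0, - s)) - a z)\<bar>)" for s
  have at: "powr_integrable lborel q (\<lambda>z. a (z + (0, - s)))" for s
    using a integrable_translate[of "\<lambda>z. \<bar>a z\<bar> powr q" "(0, - s)"] by (auto simp: powr_integrable_def)
  have ad: "powr_integrable lborel q (\<lambda>z. a (z + (0, - s)) - a z)" for s
    using pq by (intro powr_integrable_diff at a) auto
  have "(e \<longlongrightarrow> 0) (at 0)" unfolding e_def[abs_def]
  proof (rule dual_product_tendsto_0[OF pq(2,1) _ D])
    show "1 / q + 1 / p = 1" using pq by simp
    show "\<forall>\<^sub>F s in at 0. powr_integrable lborel q (\<lambda>z. a (z + (0, - s)) - a z)" using ad by simp
    have "filterlim (\<lambda>s. (0, - s) :: 'a \<times> real) (at 0) (at 0)"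
    proof -
      have "((\<lambda>s. (0, - s) :: 'a \<times> real) \<longlongrightarrow> (0, - 0)) (at 0)" by (intro tendsto_intros)
      then show ?thesis unfolding filterlim_at by (auto simp: zero_prod_def eventually_at_filter)
    qed
    from filterlim_compose[OF translation_powr[OF _ a] this]
    show "((\<lambda>s. LBINT z. \<bar>a (z + (0, - s)) - a z\<bar> powr q) \<longlongrightarrow> 0) (at 0)" using pq by simp
  qed
  note e_lim = this
  have e0: "e 0 = 0" by (simp add: e_def zero_prod_def[symmetric])
  show "((\<lambda>h. (LBINT z. G h z) / h) \<longlongrightarrow> (LBINT z. a z * D z)) (at_right 0)"
  proof (rule tendstoI)
    fix \<theta> :: real assume \<theta>: "\<theta> > 0"
    have "\<forall>\<^sub>F s in at 0. dist (e s) 0 < \<theta> / 2" using \<theta> by (intro tendstoD[OF e_lim]) auto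
    then obtain d where d: "d > 0" "\<And>s. s \<noteq> 0 ==> \<bar>s\<bar> < d ==> \<bar>e s\<bar> < \<theta> / 2"
      unfolding eventually_at by (auto simp: dist_real_def)
    have es: "e s \<le> \<theta> / 2" if "\<bar>s\<bar> < d" for s using d(2)[OF _ that] e0 \<theta> by (cases "s = 0") auto
    have main: "\<bar>(LBINT z. G h z) / h - (LBINT z. a z * D z)\<bar> \<le> \<theta> / 2" if h: "0 < h" "h < min d 1" for h
    proof -
      note Gh = Gi[of h]
      have Gs: "integrable lborel (\<lambda>z. G h (swap23 z))" using Gh h by (subst integrable_swap23) auto
      define H where "H z s = indicator {0..<h} s * ((a (z + (0, - s)) - a z) * D z)" for z s
      have Hm: "(\<lambda>w. H (fst w) (snd w)) \<in> Borel"
      proof -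
        have [measurable]: "(\<lambda>w :: ('a \<times> real) \<times> real. fst w + (0, - snd w)) \<in> Borel"
          by (intro borel_measurable_continuous_onI continuous_intros)
        show ?thesis unfolding H_def by measurable
      qed
      have sec: "AE z in lborel. (LBINT \<tau>. G h ((fst z, \<tau>), snd z)) - h * (a z * D z) = (LBINT s. H z s) \<and> integrable lborel (H z)"
        using AE_integrable_section'[OF Gs]
      proof eventually_elim
        case (elim z)
        obtain x t where z: "z = (x, t)" by (cases z)
        have i1: "integrable lborel (\<lambda>\<tau>. G h ((x, \<tau>), t))" using elim by (simp add: z)
        have m1[measurable]: "(\<lambda>\<tau>. G h ((x, \<tau>), t)) \<in> Borel" using borel_measurable_integrable[OF i1] by simp
        have i2: "integrable lborel (\<lambda>s. G h ((x, t - s), t))" using i1 integrable_reflect[OF m1, of t] by simp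
        have i3: "integrable lborel (indicator {0..<h} :: real => real)"
          by (rule integrable_real_indicator) (use h in auto)
        have eq: "H (x, t) s = G h ((x, t - s), t) - indicator {0..<h} s * (a (x, t) * D (x, t))" for s
          by (auto simp: H_def G_def indicator_def algebra_simps)
        have "(LBINT s. H (x, t) s) = (LBINT s. G h ((x, t - s), t)) - h * (a (x, t) * D (x, t))"
          unfolding eq using i2 i3 h by simp
        also have "(LBINT s. G h ((x, t - s), t)) = (LBINT \<tau>. G h ((x, \<tau>), t))"
          by (rule integral_reflect[OF m1])
        moreover have "integrable lborel (H (x, t))"
          unfolding eq[abs_def] using i2 i3 by auto
        ultimately show ?case by (simp add: z)
      qed
      have i4: "integrable lborel (\<lambda>z. LBINT \<tau>. G h ((fst z, \<tau>), snd z))"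
        using integrable_section_integral'[OF Gs] by (simp add: swap23_def)
      have "(LBINT z. G h z) = (LBINT z. (LBINT \<tau>. G h ((fst z, \<tau>), snd z)))"
        using integral_swap23[OF Gm, of h] integral_sections'[OF Gs] by (simp add: swap23_def)
      then have "(LBINT z. G h z) - h * (LBINT z. a z * D z)
          = (LBINT z. (LBINT \<tau>. G h ((fst z, \<tau>), snd z)) - h * (a z * D z))"
        using i4 aD by simp
      also have "ennreal \<bar>\<dots>\<bar> \<le> (\<integral>\<^sup>+z. ennreal \<bar>(LBINT \<tau>. G h ((fst z, \<tau>), snd z)) - h * (a z * D z)\<bar> \<partial>lborel)"
        using i4 aD integral_norm_bound_ennreal[of lborel "\<lambda>z. (LBINT \<tau>. G h ((fst z, \<tau>), snd z)) - h * (a z * D z)"] by simp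
      also have "\<dots> \<le> (\<integral>\<^sup>+z. (\<integral>\<^sup>+s. ennreal \<bar>H z s\<bar> \<partial>lborel) \<partial>lborel)"
      proof (rule nn_integral_mono_AE)
        show "AE z in lborel. ennreal \<bar>(LBINT \<tau>. G h ((fst z, \<tau>), snd z)) - h * (a z * D z)\<bar> \<le> (\<integral>\<^sup>+s. ennreal \<bar>H z s\<bar> \<partial>lborel)"
          using sec
        proof eventually_elim
          case (elim z)
          then show ?case using integral_norm_bound_ennreal[of lborel "H z"] by simp
        qed
      qed
      also have "\<dots> = (\<integral>\<^sup>+s. (\<integral>\<^sup>+z. ennreal \<bar>H z s\<bar> \<partial>lborel) \<partial>lborel)"
      proof -
        have "(\<lambda>w. ennreal \<bar>H (fst w) (snd w)\<bar>) \<in> borel_measurable (lborel \<Otimes>\<^sub>M lborel)"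
          using Hm by (simp only: lborel_prod measurable_lborel1) measurable
        from lborel_pair.Fubini[OF this] show ?thesis by simp
      qed
      also have "\<dots> \<le> (\<integral>\<^sup>+s. ennreal (\<theta> / 2) * indicator {0..<h} s \<partial>lborel)"
      proof (rule nn_integral_mono)
        fix s :: real
        show "(\<integral>\<^sup>+z. ennreal \<bar>H z s\<bar> \<partial>lborel) \<le> ennreal (\<theta> / 2) * indicator {0..<h} s"
        proof (cases "s \<in> {0..<h}")
          case True
          have "integrable lborel (\<lambda>z. \<bar>D z * (a (z + (0, - s)) - a z)\<bar>)"
            using pq by (intro integrable_abs integrable_dual_product[OF pq(2,1) _ D ad]) auto
          then have "(\<integral>\<^sup>+z. ennreal \<bar>D z * (a (z + (0, - s)) - a z)\<bar> \<partial>lborel) = ennreal (e s)"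
            unfolding e_def by (intro nn_integral_eq_integral) auto
          then show ?thesis using True es[of s] h by (simp add: H_def mult.commute ennreal_leI)
        qed (simp add: H_def)
      qed
      also have "\<dots> = ennreal (\<theta> / 2 * h)"
        using h \<theta> by (subst nn_integral_cmult_indicator) (auto simp: ennreal_mult[symmetric])
      finally have "\<bar>(LBINT z. G h z) - h * (LBINT z. a z * D z)\<bar> \<le> \<theta> / 2 * h"
        using h \<theta> by (simp add: ennreal_le_iff)
      moreover have "(LBINT z. G h z) / h - (LBINT z. a z * D z) = ((LBINT z. G h z) - h * (LBINT z. a z * D z)) / h"
        using h by (simp add: field_simps)
      ultimately show ?thesis using h by (simp add: abs_divide divide_le_eq)
    qed
    show "\<forall>\<^sub>F h in at_right 0. dist ((LBINT z. G h z) / h) (LBINT z. a z * D z) < \<theta>"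
      by (rule eventually_at_rightI[of 0 "min d 1"]) (use main d(1) \<theta> in \<open>force simp: dist_real_def\<close>)+
  qed
qed

lemma AE_translate:
  fixes P :: "'a::euclidean_space => bool"
  assumes "AE x in lborel. P x" shows "AE x in lborel. P (x + y)"
proof -
  obtain N where N: "{z. \<not> P z} \<subseteq> N" "N \<in> null_sets lborel" using assms by (auto simp: eventually_ae_filter)
  have m: "(\<lambda>x. x + y) \<in> lborel \<rightarrow>\<^sub>M (lborel :: 'a measure)" by measurable
  have "distr lborel lborel (\<lambda>x. x + y) = (lborel :: 'a measure)"
    using lborel_distr_plus[of y] by (simp add: add.commute[of _ y] cong: distr_cong)
  then have "N \<in> null_sets (distr lborel lborel (\<lambda>x. x + y))" using N(2) by simp
  then have "(\<lambda>x. x + y) -` N \<in> null_sets lborel" by (subst (asm) null_sets_distr_iff[OF m]) simp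
  then show ?thesis by (rule AE_I') (use N(1) in auto)
qed

text \<open>What the comparison argument uses of a solution: \<open>y\<close> is the quantity under the time derivative, \<open>V\<close> its curve of slices and \<open>a\<close> the flux. The equation is integrated over \<open>(t1,t2]\<close> and holds for truncations that depend on space alone.\<close>
definition evolution_data ::
    "(real^'n) set => real => ('n => real) => ((real^'n) \<times> real => real) => ('n => (real^'n) \<times> real => real) =>
     (real^'n => real) => (real => real^'n => real) => bool" where
  "evolution_data \<Omega> T p y a f V \<longleftrightarrow> integrable lborel y \<and> integrable lborel f \<and>
     (\<forall>i. powr_integrable lborel (p i / (p i - 1)) (a i)) \<and>
     (AE t\<in>{0<..<T} in lborel. (AE x in lborel. y (x, t) = V t x)) \<and>
     (\<forall>t. t \<in> {0<..<T} --> V t \<in> Borel) \<and>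
     (\<forall>t1 t2 \<zeta> D. 0 < t1 --> t1 < t2 --> t2 < T --> bounded_approximable \<Omega> p \<zeta> D -->
      (LBINT x. (V t2 x - V t1 x) * \<zeta> x) = (t2 - t1) * (LBINT x. f x * \<zeta> x)
        - (\<Sum>i\<in>UNIV. LBINT z. indicator {t1<..t2} (snd z) * (a i z * D i (fst z))))"

text \<open>The equation of \<open>w\<close> is used with reversed sign, so that both solutions fall under the same inequality.\<close>
lemma evolution_data_minus:
  assumes "evolution_data \<Omega> T p y a f V"
  shows "evolution_data \<Omega> T p (\<lambda>z. - y z) (\<lambda>i z. - a i z) (\<lambda>x. - f x) (\<lambda>t x. - V t x)"
proof -
  have id: "(LBINT x. (- V t2 x - - V t1 x) * \<zeta> x) = (t2 - t1) * (LBINT x. - f x * \<zeta> x)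
        - (\<Sum>i\<in>UNIV. LBINT z. indicator {t1<..t2} (snd z) * (- a i z * D i (fst z)))"
    if "0 < t1" "t1 < t2" "t2 < T" "bounded_approximable \<Omega> p \<zeta> D" for t1 t2 \<zeta> D
  proof -
    have e: "(- V t2 x - - V t1 x) * \<zeta> x = - ((V t2 x - V t1 x) * \<zeta> x)" for x by (simp add: algebra_simps)
    show ?thesis using assms that unfolding e evolution_data_def by (simp add: sum_negf)
  qed
  have ae: "AE t\<in>{0<..<T} in lborel. (AE x in lborel. - y (x, t) = - V t x)"
    using assms by (auto simp: evolution_data_def)
  show ?thesis unfolding evolution_data_def
    using assms id ae by (auto simp: evolution_data_def powr_integrable_uminus)
qed

lemma evolution_dataD:
  assumes "evolution_data \<Omega> T p y a f V"
  shows "integrable lborel y" "integrable lborel f" "\<And>i. powr_integrable lborel (p i / (p i - 1)) (a i)"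
    "AE t\<in>{0<..<T} in lborel. (AE x in lborel. y (x, t) = V t x)"
    "\<And>t. t \<in> {0<..<T} ==> V t \<in> Borel"
    "\<And>t1 t2 \<zeta> D. 0 < t1 ==> t1 < t2 ==> t2 < T ==> bounded_approximable \<Omega> p \<zeta> D ==>
      (LBINT x. (V t2 x - V t1 x) * \<zeta> x) = (t2 - t1) * (LBINT x. f x * \<zeta> x)
        - (\<Sum>i\<in>UNIV. LBINT z. indicator {t1<..t2} (snd z) * (a i z * D i (fst z)))"
  using assms unfolding evolution_data_def by blast+

lemma fst_swap23: "fst (swap23 z) = (fst (fst z), snd z)" and snd_swap23: "snd (swap23 z) = snd (fst z)"
  and swap23_swap23: "swap23 (swap23 z) = z"
  by (simp_all add: swap23_def)

lemma powr_integrable_times_test: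
  fixes h :: "'a::euclidean_space => real" and \<kappa> :: "'b::euclidean_space => real"
  assumes h: "powr_integrable lborel p h" and \<kappa>: "\<kappa> \<in> test_functions U" and p: "p > 0"
  shows "powr_integrable lborel p (\<lambda>z. h (fst z) * \<kappa> (snd z))"
proof -
  have [measurable]: "h \<in> Borel" "\<kappa> \<in> Borel"
    using powr_integrable_borel[OF h] test_function_borel[OF \<kappa>] by auto
  have "integrable lborel (\<lambda>z. \<bar>h (fst z)\<bar> powr p * \<bar>\<kappa> (snd z)\<bar> powr p)"
    by (intro integrable_product powr_integrable_integrable[OF h] powr_integrable_integrable[OF test_function_powr_integrable[OF \<kappa> p]])
  then show ?thesis unfolding powr_integrable_def abs_mult powr_mult by simp
qed

lemma powr_integrable_swap23:
  "powr_integrable lborel p h ==> powr_integrable lborel p (\<lambda>z. h (swap23 z))"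
  unfolding powr_integrable_def using integrable_swap23[of "\<lambda>z. \<bar>h z\<bar> powr p"] by auto

lemma integrable_dual_product_times:
  fixes G :: "(real^'n) \<times> real => real"
  assumes p: "p > 1" and G: "powr_integrable lborel (p / (p - 1)) G" and E: "powr_integrable lborel p E"
    and E0: "\<And>z. snd z \<notin> {0<..<T::real} ==> E z = 0"
  shows "integrable lborel (\<lambda>z. G (fst z) * E z)"
proof -
  have [measurable]: "G \<in> Borel" using powr_integrable_borel[OF G] by auto
  have "integrable lborel (\<lambda>z :: ((real^'n) \<times> real) \<times> real. \<bar>G (fst z)\<bar> powr (p / (p - 1)) * indicator {0<..<T} (snd z))"
    by (intro integrable_product powr_integrable_integrable[OF G] integrable_indicator_bounded) auto
  moreover have "\<bar>G (fst z) * indicator {0<..<T} (snd z)\<bar> powr (p / (p - 1)) = \<bar>G (fst z)\<bar> powr (p / (p - 1)) * indicator {0<..<T} (snd z)"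
    for z :: "((real^'n) \<times> real) \<times> real" by (auto simp: indicator_def)
  ultimately have GI: "powr_integrable lborel (p / (p - 1)) (\<lambda>z :: ((real^'n) \<times> real) \<times> real. G (fst z) * indicator {0<..<T} (snd z))"
    unfolding powr_integrable_def by simp
  have "integrable lborel (\<lambda>z. (G (fst z) * indicator {0<..<T} (snd z)) * E z)"
    by (rule integrable_dual_product[OF p conjugate_exponent[OF p] GI E])
  moreover have "(G (fst z) * indicator {0<..<T} (snd z)) * E z = G (fst z) * E z" for z
    using E0[of z] by (cases "snd z \<in> {0<..<T}") auto
  ultimately show ?thesis by simp
qed

text \<open>Here \<open>b\<close> is a convex function of \<open>y\<close> and \<open>\<zeta>\<close> a subgradient of it. Multiply \<open>b (y(t)) - b (y(t-h)) \<le> (y(t) - y(t-h)) \<zeta>(t)\<close> by \<open>\<kappa>(t)\<close>: on the left the difference quotient moves to \<open>\<kappa>\<close>, on the right the equation integrated over \<open>(t-h,t]\<close> is inserted. Division by \<open>h\<close> and \<open>h \<rightarrow> 0\<close> give the claim.\<close>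
lemma chain_rule_inequality:
  fixes \<Omega> :: "(real^'n) set" and y \<zeta> :: "(real^'n) \<times> real => real" and a D :: "'n => (real^'n) \<times> real => real"
    and V :: "real => real^'n => real" and f c :: "real^'n => real" and b :: "real => real^'n => real" and \<kappa> :: "real => real"
  assumes p: "\<And>i. p i > 1" and data: "evolution_data \<Omega> T p y a f V"
    and \<kappa>: "\<kappa> \<in> test_functions {0<..<T}" "\<And>t. \<kappa> t \<ge> 0"
    and \<zeta>m: "\<zeta> \<in> Borel" and \<zeta>b: "\<And>z. \<bar>\<zeta> z\<bar> \<le> 1"
    and D: "\<And>i. powr_integrable lborel (p i) (\<lambda>z. \<kappa> (snd z) * D i z)"
    and appr: "AE t\<in>{0<..<T} in lborel. bounded_approximable \<Omega> p (\<lambda>x. \<zeta> (x, t)) (\<lambda>i x. D i (x, t))"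
    and bm: "(\<lambda>w. b (fst w) (snd w)) \<in> Borel" and b0: "\<And>y x. b y x \<ge> 0"
    and bc: "\<And>y x. b y x \<le> \<bar>y\<bar> + c x" and c: "integrable lborel c"
    and convex: "\<And>x t y'. t \<in> {0<..<T} ==> b (y (x, t)) x - b y' x \<le> (y (x, t) - y') * \<zeta> (x, t)"
  shows "- (LBINT z. b (y z) (fst z) * dir_deriv 1 \<kappa> (snd z))
      \<le> (LBINT z. \<kappa> (snd z) * (f (fst z) * \<zeta> z)) - (\<Sum>i\<in>UNIV. LBINT z. a i z * (\<kappa> (snd z) * D i z))"
proof -
  note y = evolution_dataD(1)[OF data] and f = evolution_dataD(2)[OF data] and a = evolution_dataD(3)[OF data]
    and V = evolution_dataD(4)[OF data] and Vm = evolution_dataD(5)[OF data] and tested = evolution_dataD(6)[OF data]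
  have [measurable]: "y \<in> Borel" "f \<in> Borel" "c \<in> Borel"
    using borel_measurable_integrable[OF y] borel_measurable_integrable[OF f] borel_measurable_integrable[OF c] by auto
  have [measurable]: "a i \<in> Borel" "(\<lambda>z. \<kappa> (snd z) * D i z) \<in> Borel" for i
    using powr_integrable_borel[OF a[of i]] powr_integrable_borel[OF D[of i]] by auto
  note [measurable] = \<zeta>m test_function_borel[OF \<kappa>(1)] test_function_borel[OF test_function_dir_deriv[OF \<kappa>(1)]]
  obtain K where K: "compact K" "K \<subseteq> {0<..<T}" "\<And>t. t \<notin> K ==> \<kappa> t = 0" "\<And>b t. t \<notin> K ==> dir_deriv b \<kappa> t = 0"
    using test_function_support[OF \<kappa>(1)] by metis
  \<comment> \<open>For shifts below \<open>e\<close> the support of \<open>\<kappa>\<close> stays inside the time interval.\<close>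
  obtain e where e: "e > 0" "(\<Union>x\<in>K. cball x e) \<subseteq> {0<..<T}"
    using compact_subset_open_imp_cball_epsilon_subset[OF K(1) open_greaterThanLessThan K(2)] by blast
  have K_shift: "t - s \<in> {0<..<T}" if "t \<in> K" "\<bar>s\<bar> \<le> e" for t s
  proof -
    have "t - s \<in> cball t e" using that by (simp add: dist_real_def)
    then show ?thesis using e(2) that(1) by blast
  qed
  obtain B0 where B0: "\<And>t. \<bar>\<kappa> t\<bar> \<le> B0" using test_function_bounded[OF \<kappa>(1)] by metis
  obtain L where L: "L > 0" "\<And>s t. \<bar>\<kappa> s - \<kappa> t\<bar> \<le> L * norm (s - t)" using test_function_lipschitz[OF \<kappa>(1)] by metis
  have B0': "B0 \<ge> 0" using order_trans[OF abs_ge_zero B0] .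
  have bounded_mult: "integrable M (\<lambda>z. h z * k z)"
    if "integrable M k" "h \<in> borel_measurable M" "\<And>z. \<bar>h z\<bar> \<le> B" for M and h k :: "'z => real" and B
    using powr_integrable_bounded_mult[of M 1 k h B] that by (simp add: powr_integrable_1)
  define B where "B z = indicator {0<..<T} (snd z) * b (y z) (fst z)" for z
  have [measurable]: "(\<lambda>z. b (y z) (fst z)) \<in> Borel"
    using measurable_compose[OF borel_measurable_Pair[of y borel fst] bm] by simp
  have [measurable]: "B \<in> Borel" unfolding B_def[abs_def] by measurable
  have Bi: "integrable lborel B"
  proof (rule Bochner_Integration.integrable_bound)
    show "integrable lborel (\<lambda>z. \<bar>y z\<bar> + c (fst z) * indicator {0<..<T} (snd z))"
      using y by (intro Bochner_Integration.integrable_add integrable_abs integrable_product c integrable_indicator_bounded) auto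
    show "AE z in lborel. norm (B z) \<le> norm (\<bar>y z\<bar> + c (fst z) * indicator {0<..<T} (snd z))"
    proof (intro AE_I2)
      fix z show "norm (B z) \<le> norm (\<bar>y z\<bar> + c (fst z) * indicator {0<..<T} (snd z))"
        using b0[of "y z" "fst z"] bc[of "y z" "fst z"] by (cases "snd z \<in> {0<..<T}") (auto simp: B_def)
    qed
  qed simp
  have \<kappa>f: "integrable lborel (\<lambda>z. \<kappa> (snd z) * (f (fst z) * \<zeta> z))"
  proof -
    have "integrable lborel (\<lambda>z. f (fst z) * \<kappa> (snd z))"
      by (intro integrable_product f test_function_integrable[OF \<kappa>(1)])
    then have "integrable lborel (\<lambda>z. \<zeta> z * (f (fst z) * \<kappa> (snd z)))" by (rule bounded_mult[OF _ _ \<zeta>b]) measurable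
    then show ?thesis by (simp add: mult_ac)
  qed
  define \<Phi> where "\<Phi> h z = \<kappa> (snd z) * ((y z - y (z + (0, - h))) * \<zeta> z)" for h z
  have shift[measurable]: "(\<lambda>z. g (z + w)) \<in> Borel" if "g \<in> Borel" for g :: "(real^'n) \<times> real => real" and w
    using that by measurable
  have \<Phi>i: "integrable lborel (\<Phi> h)" for h
  proof -
    have d: "integrable lborel (\<lambda>z. y z - y (z + (0, - h)))"
      using y by (simp add: integrable_translate)
    have bd: "\<bar>\<kappa> (snd z) * \<zeta> z\<bar> \<le> B0" for z :: "(real^'n) \<times> real"
      using mult_mono[OF B0[of "snd z"] \<zeta>b[of z]] B0' by (simp add: abs_mult)
    have "integrable lborel (\<lambda>z. (\<kappa> (snd z) * \<zeta> z) * (y z - y (z + (0, - h))))"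
      by (rule bounded_mult[OF d _ bd]) measurable
    then show ?thesis by (simp add: \<Phi>_def[abs_def] mult_ac)
  qed
  \<comment> \<open>The shift is moved from \<open>B\<close> to \<open>\<kappa>\<close> by translation invariance.\<close>
  have stepA: "(LBINT z. (\<kappa> (snd z) - \<kappa> (snd z + h)) * B z) \<le> (LBINT z. \<Phi> h z)" if h: "0 < h" "h < e" for h
  proof -
    have i1: "integrable lborel (\<lambda>z. \<kappa> (snd z) * B z)" by (rule bounded_mult[OF Bi _ B0]) measurable
    have i2: "integrable lborel (\<lambda>z. \<kappa> (snd z + h) * B z)" by (rule bounded_mult[OF Bi _ B0]) measurable
    have m2: "(\<lambda>z. \<kappa> (snd z + h) * B z) \<in> Borel" by measurable
    have i3: "integrable lborel (\<lambda>z. \<kappa> (snd z) * B (z + (0, - h)))"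
      using i2 integrable_translate[OF m2, of "(0, - h)"] by simp
    have e3: "(LBINT z. \<kappa> (snd z) * B (z + (0, - h))) = (LBINT z. \<kappa> (snd z + h) * B z)"
      using integral_translate[OF m2, of "(0, - h)"] by simp
    have "(LBINT z. (\<kappa> (snd z) - \<kappa> (snd z + h)) * B z) = (LBINT z. \<kappa> (snd z) * B z - \<kappa> (snd z) * B (z + (0, - h)))"
      using i1 i2 i3 e3 by (simp add: left_diff_distrib)
    also have "\<dots> \<le> (LBINT z. \<Phi> h z)"
    proof (rule integral_mono)
      show "integrable lborel (\<lambda>z. \<kappa> (snd z) * B z - \<kappa> (snd z) * B (z + (0, - h)))" using i1 i3 by auto
      fix z :: "(real^'n) \<times> real"
      show "\<kappa> (snd z) * B z - \<kappa> (snd z) * B (z + (0, - h)) \<le> \<Phi> h z"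
      proof (cases "snd z \<in> K")
        case True
        then have t: "snd z \<in> {0<..<T}" "snd z - h \<in> {0<..<T}" using K_shift[of "snd z" h] K(2) h by auto
        have "b (y (fst z, snd z)) (fst z) - b (y (z + (0, - h))) (fst z) \<le> (y (fst z, snd z) - y (z + (0, - h))) * \<zeta> (fst z, snd z)"
          by (rule convex[OF t(1)])
        from mult_left_mono[OF this \<kappa>(2)[of "snd z"]] show ?thesis
          using t by (simp add: B_def \<Phi>_def right_diff_distrib)
      qed (simp add: \<Phi>_def K)
    qed (rule \<Phi>i)
    finally show ?thesis .
  qed
  define G where "G i h z = indicator {snd z - h<..snd z} (snd (fst z)) * (a i (fst z) * (\<kappa> (snd (fst (fst z), snd z)) * D i (fst (fst z), snd z)))"
    for i h and z :: "((real^'n) \<times> real) \<times> real"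
  have \<kappa>0: "\<kappa> (snd z) * D i z = 0" if "snd z \<notin> {0<..<T}" for i z
  proof -
    have "snd z \<notin> K" using that K(2) by blast
    then show ?thesis by (simp add: K(3))
  qed
  note avg = time_average[OF p conjugate_exponent[OF p] a D \<kappa>0, folded G_def[abs_def]]
  have Gi: "integrable lborel (G i h)" if "0 < h" "h < 1" for i h
    unfolding G_def[abs_def] by (rule avg(1)[unfolded G_def[abs_def]]) (use that in auto)
  have Gl: "((\<lambda>h. (LBINT z. G i h z) / h) \<longlongrightarrow> (LBINT z. a i z * (\<kappa> (snd z) * D i z))) (at_right 0)" for i
    unfolding G_def[abs_def] by (rule avg(2)[unfolded G_def[abs_def]])
  \<comment> \<open>Slice by slice, \<open>y(t) - y(t-h)\<close> is replaced through the integrated equation.\<close>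
  have stepB: "(LBINT z. \<Phi> h z) = h * (LBINT z. \<kappa> (snd z) * (f (fst z) * \<zeta> z)) - (\<Sum>i\<in>UNIV. LBINT z. G i h z)"
    if h: "0 < h" "h < min e 1" for h
  proof -
    have V': "AE t in lborel. t + - h \<in> {0<..<T} --> (AE x in lborel. y (x, t + - h) = V (t + - h) x)" by (rule AE_translate[OF V])
    have ae: "AE t in lborel. (LBINT x. \<Phi> h (x, t)) = h * (LBINT x. \<kappa> t * (f x * \<zeta> (x, t))) - (\<Sum>i\<in>UNIV. LBINT w. G i h (w, t))"
      using V V' appr
    proof eventually_elim
      case (elim t)
      show ?case
      proof (cases "t \<in> K")
        case True
        then have t: "0 < t - h" "t - h < t" "t < T" using K_shift[of t h] K(2) h by auto
        have e1: "AE x in lborel. y (x, t) = V t x" "AE x in lborel. y (x, t - h) = V (t - h) x"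
          using elim(1,2) t h by auto
        have ba: "bounded_approximable \<Omega> p (\<lambda>x. \<zeta> (x, t)) (\<lambda>i x. D i (x, t))" using elim(3) t h by auto
        have "(LBINT x. \<Phi> h (x, t)) = \<kappa> t * (LBINT x. (y (x, t) - y (x, t - h)) * \<zeta> (x, t))"
          by (simp add: \<Phi>_def)
        also have "(LBINT x. (y (x, t) - y (x, t - h)) * \<zeta> (x, t)) = (LBINT x. (V t x - V (t - h) x) * \<zeta> (x, t))"
        proof (rule integral_cong_AE)
          have m: "(\<lambda>x. (y (x, t) - y (x, t - h)) * \<zeta> (x, t)) \<in> Borel"
            using borel_measurable_section(1)[of y] borel_measurable_section(1)[OF \<zeta>m] by measurable
          then show "(\<lambda>x. (y (x, t) - y (x, t - h)) * \<zeta> (x, t)) \<in> borel_measurable lborel" by simp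
          show "AE x in lborel. (y (x, t) - y (x, t - h)) * \<zeta> (x, t) = (V t x - V (t - h) x) * \<zeta> (x, t)"
            using e1 by eventually_elim simp
          show "(\<lambda>x. (V t x - V (t - h) x) * \<zeta> (x, t)) \<in> borel_measurable lborel"
            using Vm[of t] Vm[of "t - h"] borel_measurable_section(1)[OF \<zeta>m] t h by auto
        qed
        also have "\<dots> = (t - (t - h)) * (LBINT x. f x * \<zeta> (x, t))
            - (\<Sum>i\<in>UNIV. LBINT z. indicator {t - h<..t} (snd z) * (a i z * D i (fst z, t)))"
          by (rule tested[OF t ba])
        finally have "(LBINT x. \<Phi> h (x, t)) = h * (\<kappa> t * (LBINT x. f x * \<zeta> (x, t)))
            - (\<Sum>i\<in>UNIV. \<kappa> t * (LBINT z. indicator {t - h<..t} (snd z) * (a i z * D i (fst z, t))))"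
          by (simp add: algebra_simps sum_distrib_left)
        moreover have "(LBINT w. G i h (w, t)) = \<kappa> t * (LBINT z. indicator {t - h<..t} (snd z) * (a i z * D i (fst z, t)))" for i
        proof -
          have "G i h (w, t) = \<kappa> t * (indicator {t - h<..t} (snd w) * (a i w * D i (fst w, t)))" for w
            by (simp add: G_def)
          then show ?thesis by simp
        qed
        ultimately show ?thesis by simp
      qed (simp add: \<Phi>_def G_def K)
    qed
    have S1: "integrable lborel (\<lambda>t. LBINT x. \<kappa> t * (f x * \<zeta> (x, t)))"
      and S2: "(LBINT z. \<kappa> (snd z) * (f (fst z) * \<zeta> z)) = (LBINT t. LBINT x. \<kappa> t * (f x * \<zeta> (x, t)))"
      using integrable_section_integral[OF \<kappa>f] integral_sections[OF \<kappa>f] by simp_all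
    have U1: "integrable lborel (\<lambda>t. LBINT w. G i h (w, t))"
      and U2: "(LBINT z. G i h z) = (LBINT t. LBINT w. G i h (w, t))" for i
      using integrable_section_integral[OF Gi] integral_sections[OF Gi] h by simp_all
    have "(LBINT z. \<Phi> h z) = (LBINT t. LBINT x. \<Phi> h (x, t))" by (rule integral_sections[OF \<Phi>i])
    also have "\<dots> = (LBINT t. h * (LBINT x. \<kappa> t * (f x * \<zeta> (x, t))) - (\<Sum>i\<in>UNIV. LBINT w. G i h (w, t)))"
    proof (rule integral_cong_AE[OF _ _ ae])
      show "(\<lambda>t. LBINT x. \<Phi> h (x, t)) \<in> borel_measurable lborel" using integrable_section_integral[OF \<Phi>i] by auto
      show "(\<lambda>t. h * (LBINT x. \<kappa> t * (f x * \<zeta> (x, t))) - (\<Sum>i\<in>UNIV. LBINT w. G i h (w, t))) \<in> borel_measurable lborel"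
        by (intro borel_measurable_diff borel_measurable_times borel_measurable_sum borel_measurable_const
          borel_measurable_integrable[OF S1] borel_measurable_integrable[OF U1])
    qed
    also have "\<dots> = h * (LBINT z. \<kappa> (snd z) * (f (fst z) * \<zeta> z)) - (\<Sum>i\<in>UNIV. LBINT z. G i h z)"
      unfolding S2 U2 using S1 U1 by simp
    finally show ?thesis .
  qed
  define \<eta> where "\<eta> j = min e 1 / real (Suc (Suc j))" for j :: nat
  have \<eta>: "0 < \<eta> j" "\<eta> j < min e 1" for j
  proof -
    have m: "min e 1 > 0" using e by simp
    then show "0 < \<eta> j" by (simp add: \<eta>_def)
    have "min e 1 * 1 < min e 1 * real (Suc (Suc j))" using m by (intro mult_strict_left_mono) auto
    then show "\<eta> j < min e 1" unfolding \<eta>_def by (subst divide_less_eq) auto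
  qed
  have \<eta>0: "\<eta> \<longlonglongrightarrow> 0"
  proof -
    have "(\<lambda>j. min e 1 * (1 / real (Suc (Suc j)))) \<longlonglongrightarrow> min e 1 * 0"
      using LIMSEQ_Suc[OF LIMSEQ_inverse_real_of_nat] by (intro tendsto_intros) (simp add: inverse_eq_divide)
    then show ?thesis by (simp add: \<eta>_def[abs_def])
  qed
  have \<eta>r: "filterlim \<eta> (at_right 0) sequentially"
    using \<eta>0 \<eta>(1) by (intro tendsto_imp_filterlim_at_right) auto
  have lhs: "(\<lambda>j. LBINT z. (\<kappa> (snd z) - \<kappa> (snd z + \<eta> j)) / \<eta> j * B z) \<longlonglongrightarrow> (LBINT z. - dir_deriv 1 \<kappa> (snd z) * B z)"
  proof (rule integral_dominated_convergence[where w="\<lambda>z. L * \<bar>B z\<bar>"])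
    show "AE z in lborel. (\<lambda>j. (\<kappa> (snd z) - \<kappa> (snd z + \<eta> j)) / \<eta> j * B z) \<longlonglongrightarrow> - dir_deriv 1 \<kappa> (snd z) * B z"
    proof (intro AE_I2 tendsto_mult tendsto_const)
      fix z :: "(real^'n) \<times> real"
      have "((\<lambda>h. (\<kappa> (snd z + h) - \<kappa> (snd z)) / h) \<longlongrightarrow> dir_deriv 1 \<kappa> (snd z)) (at 0)"
        using dir_deriv_real[OF test_function_Ck[OF \<kappa>(1)]] by (simp add: DERIV_def)
      moreover have "filterlim \<eta> (at 0) sequentially"
        using \<eta>r by (rule filterlim_mono) (auto simp: at_le)
      ultimately have "(\<lambda>j. (\<kappa> (snd z + \<eta> j) - \<kappa> (snd z)) / \<eta> j) \<longlonglongrightarrow> dir_deriv 1 \<kappa> (snd z)" by (rule filterlim_compose)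
      from tendsto_minus[OF this] show "(\<lambda>j. (\<kappa> (snd z) - \<kappa> (snd z + \<eta> j)) / \<eta> j) \<longlonglongrightarrow> - dir_deriv 1 \<kappa> (snd z)"
        by (simp add: minus_divide_left)
    qed
    show "AE z in lborel. norm ((\<kappa> (snd z) - \<kappa> (snd z + \<eta> j)) / \<eta> j * B z) \<le> L * \<bar>B z\<bar>" for j
    proof (intro AE_I2)
      fix z :: "(real^'n) \<times> real"
      have "\<bar>(\<kappa> (snd z) - \<kappa> (snd z + \<eta> j)) / \<eta> j\<bar> \<le> L"
        using L(2)[of "snd z" "snd z + \<eta> j"] \<eta>(1)[of j] by (simp add: abs_divide divide_le_eq)
      from mult_right_mono[OF this abs_ge_zero[of "B z"]]
      show "norm ((\<kappa> (snd z) - \<kappa> (snd z + \<eta> j)) / \<eta> j * B z) \<le> L * \<bar>B z\<bar>"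
        by (simp add: abs_mult)
    qed
  qed (use Bi in auto)
  have rhs: "(\<lambda>j. (LBINT z. \<kappa> (snd z) * (f (fst z) * \<zeta> z)) - (\<Sum>i\<in>UNIV. (LBINT z. G i (\<eta> j) z) / \<eta> j))
      \<longlonglongrightarrow> (LBINT z. \<kappa> (snd z) * (f (fst z) * \<zeta> z)) - (\<Sum>i\<in>UNIV. LBINT z. a i z * (\<kappa> (snd z) * D i z))"
    by (intro tendsto_intros filterlim_compose[OF Gl \<eta>r])
  have "(LBINT z. - dir_deriv 1 \<kappa> (snd z) * B z)
      \<le> (LBINT z. \<kappa> (snd z) * (f (fst z) * \<zeta> z)) - (\<Sum>i\<in>UNIV. LBINT z. a i z * (\<kappa> (snd z) * D i z))"
  proof (rule LIMSEQ_le[OF lhs rhs], intro exI allI impI)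
    fix j
    have "(LBINT z. (\<kappa> (snd z) - \<kappa> (snd z + \<eta> j)) / \<eta> j * B z) = (LBINT z. (\<kappa> (snd z) - \<kappa> (snd z + \<eta> j)) * B z) / \<eta> j"
      by simp
    also have "\<dots> \<le> (LBINT z. \<Phi> (\<eta> j) z) / \<eta> j" using \<eta>[of j] by (intro divide_right_mono stepA) auto
    also have "\<dots> = (LBINT z. \<kappa> (snd z) * (f (fst z) * \<zeta> z)) - (\<Sum>i\<in>UNIV. (LBINT z. G i (\<eta> j) z) / \<eta> j)"
      using \<eta>[of j] by (simp add: stepB diff_divide_distrib sum_divide_distrib)
    finally show "(LBINT z. (\<kappa> (snd z) - \<kappa> (snd z + \<eta> j)) / \<eta> j * B z)
      \<le> (LBINT z. \<kappa> (snd z) * (f (fst z) * \<zeta> z)) - (\<Sum>i\<in>UNIV. (LBINT z. G i (\<eta> j) z) / \<eta> j)" .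
  qed
  moreover have "(LBINT z. - dir_deriv 1 \<kappa> (snd z) * B z) = - (LBINT z. b (y z) (fst z) * dir_deriv 1 \<kappa> (snd z))"
  proof -
    have "- dir_deriv 1 \<kappa> (snd z) * B z = - (b (y z) (fst z) * dir_deriv 1 \<kappa> (snd z))" for z
    proof (cases "snd z \<in> {0<..<T}")
      case False
      then have "snd z \<notin> K" using K(2) by blast
      then show ?thesis by (simp add: K(4))
    qed (simp add: B_def)
    then have "(LBINT z. - dir_deriv 1 \<kappa> (snd z) * B z) = (LBINT z. - (b (y z) (fst z) * dir_deriv 1 \<kappa> (snd z)))"
      by (simp only:)
    then show ?thesis by simp
  qed
  ultimately show ?thesis by simp
qed

text \<open>The previous inequality for almost every frozen time \<open>s\<close>, multiplied by \<open>\<kappa>(s)\<close> and integrated.\<close>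
lemma chain_rule_integrated:
  fixes \<Omega> :: "(real^'n) set" and y :: "(real^'n) \<times> real => real" and a :: "'n => (real^'n) \<times> real => real"
    and \<zeta> :: "((real^'n) \<times> real) \<times> real => real" and D :: "'n => ((real^'n) \<times> real) \<times> real => real"
    and V :: "real => real^'n => real" and f :: "real^'n => real" and b :: "real => (real^'n) \<times> real => real" and \<kappa> :: "real => real"
  assumes p: "\<And>i. p i > 1" and data: "evolution_data \<Omega> T p y a f V"
    and \<kappa>: "\<kappa> \<in> test_functions {0<..<T}" "\<And>t. \<kappa> t \<ge> 0"
    and \<zeta>m: "\<zeta> \<in> Borel" and \<zeta>b: "\<And>z. \<bar>\<zeta> z\<bar> \<le> 1" and Dm: "\<And>i. D i \<in> Borel"
    and D: "\<And>i. powr_integrable lborel (p i) (\<lambda>z. \<kappa> (snd (fst z)) * \<kappa> (snd z) * D i z)"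
    and appr: "AE s\<in>{0<..<T} in lborel. (AE t in lborel. t \<in> {0<..<T} -->
      bounded_approximable \<Omega> p (\<lambda>x. \<zeta> ((x, t), s)) (\<lambda>i x. D i ((x, t), s)))"
    and bm: "(\<lambda>w. b (fst w) (snd w)) \<in> Borel" and b0: "\<And>y w. b y w \<ge> 0"
    and bc: "\<And>y w. b y w \<le> \<bar>y\<bar> + c w" and c: "integrable lborel c"
    and convex: "\<And>x t s y'. t \<in> {0<..<T} ==> s \<in> {0<..<T} ==> b (y (x, t)) (x, s) - b y' (x, s) \<le> (y (x, t) - y') * \<zeta> ((x, t), s)"
  shows "- (LBINT z. b (y (fst z)) (fst (fst z), snd z) * (dir_deriv 1 \<kappa> (snd (fst z)) * \<kappa> (snd z)))
      \<le> (LBINT z. \<kappa> (snd (fst z)) * \<kappa> (snd z) * (f (fst (fst z)) * \<zeta> z))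
        - (\<Sum>i\<in>UNIV. LBINT z. a i (fst z) * (\<kappa> (snd (fst z)) * \<kappa> (snd z) * D i z))"
    and "integrable lborel (\<lambda>z. b (y (fst z)) (fst (fst z), snd z) * (dir_deriv 1 \<kappa> (snd (fst z)) * \<kappa> (snd z)))"
    and "integrable lborel (\<lambda>z. \<kappa> (snd (fst z)) * \<kappa> (snd z) * (f (fst (fst z)) * \<zeta> z))"
    and "\<And>i. integrable lborel (\<lambda>z. a i (fst z) * (\<kappa> (snd (fst z)) * \<kappa> (snd z) * D i z))"
proof -
  note y = evolution_dataD(1)[OF data] and f = evolution_dataD(2)[OF data] and a = evolution_dataD(3)[OF data]
  have [measurable]: "y \<in> Borel" "f \<in> Borel" "c \<in> Borel"
    using borel_measurable_integrable[OF y] borel_measurable_integrable[OF f] borel_measurable_integrable[OF c] by auto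
  have [measurable]: "a i \<in> Borel" for i using powr_integrable_borel[OF a[of i]] by auto
  note [measurable] = \<zeta>m Dm test_function_borel[OF \<kappa>(1)] test_function_borel[OF test_function_dir_deriv[OF \<kappa>(1)]]
  have \<kappa>0: "\<kappa> t = 0" "dir_deriv 1 \<kappa> t = 0" if "t \<notin> {0<..<T}" for t
  proof -
    obtain K where "K \<subseteq> {0<..<T}" "\<And>t. t \<notin> K ==> \<kappa> t = 0" "\<And>b t. t \<notin> K ==> dir_deriv b \<kappa> t = 0"
      using test_function_support[OF \<kappa>(1)] by metis
    then show "\<kappa> t = 0" "dir_deriv 1 \<kappa> t = 0" using that by blast+
  qed
  note \<kappa>i = test_function_integrable[OF \<kappa>(1)] test_function_integrable[OF test_function_dir_deriv[OF \<kappa>(1), of 1]]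
  have sec_meas: "(\<lambda>z :: ((real^'n) \<times> real) \<times> real. (fst (fst z), snd z)) \<in> Borel"
    by (intro borel_measurable_continuous_onI continuous_intros)
  have bm'[measurable]: "(\<lambda>z. b (y (fst z)) (fst (fst z), snd z)) \<in> Borel"
    using measurable_compose[OF borel_measurable_Pair[of "\<lambda>z. y (fst z)" borel "\<lambda>z. (fst (fst z), snd z)"] bm] sec_meas by simp
  obtain B where B: "\<And>t. \<bar>dir_deriv 1 \<kappa> t\<bar> \<le> B" using test_function_bounded[OF test_function_dir_deriv[OF \<kappa>(1)]] by metis
  obtain B' where B': "\<And>t. \<bar>\<kappa> t\<bar> \<le> B'" using test_function_bounded[OF \<kappa>(1)] by metis
  show T1: "integrable lborel (\<lambda>z. b (y (fst z)) (fst (fst z), snd z) * (dir_deriv 1 \<kappa> (snd (fst z)) * \<kappa> (snd z)))"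
  proof (rule Bochner_Integration.integrable_bound)
    have i1: "integrable lborel (\<lambda>z :: ((real^'n) \<times> real) \<times> real. \<bar>y (fst z)\<bar> * \<bar>\<kappa> (snd z)\<bar>)"
      by (rule integrable_product) (use y \<kappa>i in auto)
    have "integrable lborel (\<lambda>z :: ((real^'n) \<times> real) \<times> real. \<bar>c (fst z)\<bar> * \<bar>dir_deriv 1 \<kappa> (snd z)\<bar>)"
      by (rule integrable_product) (use c \<kappa>i in auto)
    from this[THEN integrable_swap23[THEN iffD2, rotated]]
    have i2: "integrable lborel (\<lambda>z :: ((real^'n) \<times> real) \<times> real. \<bar>c (fst (swap23 z))\<bar> * \<bar>dir_deriv 1 \<kappa> (snd (swap23 z))\<bar>)"
      by simp
    show "integrable lborel (\<lambda>z. B * (\<bar>y (fst z)\<bar> * \<bar>\<kappa> (snd z)\<bar>) + B' * (\<bar>c (fst (swap23 z))\<bar> * \<bar>dir_deriv 1 \<kappa> (snd (swap23 z))\<bar>))"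
      using i1 i2 by auto
    show "AE z in lborel. norm (b (y (fst z)) (fst (fst z), snd z) * (dir_deriv 1 \<kappa> (snd (fst z)) * \<kappa> (snd z)))
        \<le> norm (B * (\<bar>y (fst z)\<bar> * \<bar>\<kappa> (snd z)\<bar>) + B' * (\<bar>c (fst (swap23 z))\<bar> * \<bar>dir_deriv 1 \<kappa> (snd (swap23 z))\<bar>))"
    proof (intro AE_I2)
      fix z :: "((real^'n) \<times> real) \<times> real"
      obtain x t s where z: "z = ((x, t), s)" by (metis surj_pair)
      have "\<bar>b (y (x, t)) (x, s)\<bar> \<le> \<bar>y (x, t)\<bar> + \<bar>c (x, s)\<bar>" using b0[of "y (x, t)" "(x, s)"] bc[of "y (x, t)" "(x, s)"] by linarith
      then have "\<bar>b (y (x, t)) (x, s)\<bar> * (\<bar>dir_deriv 1 \<kappa> t\<bar> * \<bar>\<kappa> s\<bar>) \<le> (\<bar>y (x, t)\<bar> + \<bar>c (x, s)\<bar>) * (\<bar>dir_deriv 1 \<kappa> t\<bar> * \<bar>\<kappa> s\<bar>)"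
        by (intro mult_right_mono) auto
      also have "\<dots> = \<bar>dir_deriv 1 \<kappa> t\<bar> * (\<bar>y (x, t)\<bar> * \<bar>\<kappa> s\<bar>) + \<bar>\<kappa> s\<bar> * (\<bar>c (x, s)\<bar> * \<bar>dir_deriv 1 \<kappa> t\<bar>)" by (simp add: algebra_simps)
      also have "\<dots> \<le> B * (\<bar>y (x, t)\<bar> * \<bar>\<kappa> s\<bar>) + B' * (\<bar>c (x, s)\<bar> * \<bar>dir_deriv 1 \<kappa> t\<bar>)"
        by (intro add_mono mult_right_mono B B') auto
      finally have le: "\<bar>b (y (x, t)) (x, s)\<bar> * (\<bar>dir_deriv 1 \<kappa> t\<bar> * \<bar>\<kappa> s\<bar>)
          \<le> B * (\<bar>y (x, t)\<bar> * \<bar>\<kappa> s\<bar>) + B' * (\<bar>c (x, s)\<bar> * \<bar>dir_deriv 1 \<kappa> t\<bar>)" .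
      from order_trans[OF le abs_ge_self] show "norm (b (y (fst z)) (fst (fst z), snd z) * (dir_deriv 1 \<kappa> (snd (fst z)) * \<kappa> (snd z)))
        \<le> norm (B * (\<bar>y (fst z)\<bar> * \<bar>\<kappa> (snd z)\<bar>) + B' * (\<bar>c (fst (swap23 z))\<bar> * \<bar>dir_deriv 1 \<kappa> (snd (swap23 z))\<bar>))"
        by (simp add: z abs_mult)
    qed
  qed simp
  show T2: "integrable lborel (\<lambda>z. \<kappa> (snd (fst z)) * \<kappa> (snd z) * (f (fst (fst z)) * \<zeta> z))"
  proof (rule Bochner_Integration.integrable_bound)
    show "integrable lborel (\<lambda>z :: ((real^'n) \<times> real) \<times> real. (f (fst (fst z)) * \<kappa> (snd (fst z))) * \<kappa> (snd z))"
      using integrable_product[OF integrable_product[OF f \<kappa>i(1)] \<kappa>i(1)] by simp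
    show "AE z in lborel. norm (\<kappa> (snd (fst z)) * \<kappa> (snd z) * (f (fst (fst z)) * \<zeta> z)) \<le> norm ((f (fst (fst z)) * \<kappa> (snd (fst z))) * \<kappa> (snd z))"
    proof (intro AE_I2)
      fix z
      have "\<bar>f (fst (fst z)) * \<kappa> (snd (fst z)) * \<kappa> (snd z)\<bar> * \<bar>\<zeta> z\<bar> \<le> \<bar>f (fst (fst z)) * \<kappa> (snd (fst z)) * \<kappa> (snd z)\<bar>"
        using \<zeta>b[of z] by (intro mult_left_le) auto
      then show "norm (\<kappa> (snd (fst z)) * \<kappa> (snd z) * (f (fst (fst z)) * \<zeta> z)) \<le> norm ((f (fst (fst z)) * \<kappa> (snd (fst z))) * \<kappa> (snd z))"
        by (simp add: abs_mult mult_ac)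
    qed
  qed simp
  show T3: "integrable lborel (\<lambda>z. a i (fst z) * (\<kappa> (snd (fst z)) * \<kappa> (snd z) * D i z))" for i
    by (rule integrable_dual_product_times[where T=T, OF p a D]) (simp add: \<kappa>0)
  have main: "AE s in lborel. - (LBINT w. b (y w) (fst w, s) * (dir_deriv 1 \<kappa> (snd w) * \<kappa> s))
      \<le> (LBINT w. \<kappa> (snd w) * \<kappa> s * (f (fst w) * \<zeta> (w, s))) - (\<Sum>i\<in>UNIV. LBINT w. a i w * (\<kappa> (snd w) * \<kappa> s * D i (w, s)))"
  proof -
    have Ds: "AE s in lborel. \<forall>i\<in>UNIV. integrable lborel (\<lambda>w. \<bar>\<kappa> (snd w) * \<kappa> s * D i (w, s)\<bar> powr p i)"
      using AE_integrable_section[OF powr_integrable_integrable[OF D]] by (intro AE_finite_allI) auto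
    show ?thesis using appr Ds AE_integrable_section[OF c]
    proof eventually_elim
      case (elim s)
      show ?case
      proof (cases "\<kappa> s = 0")
        case False
        then have s: "s \<in> {0<..<T}" using \<kappa>0 by blast
        have \<kappa>s: "\<kappa> s > 0" using False \<kappa>(2)[of s] by simp
        have m: "(\<lambda>w :: (real^'n) \<times> real. (w, s)) \<in> Borel"
          by (intro borel_measurable_continuous_onI continuous_intros)
        have b_meas: "(\<lambda>w :: real \<times> (real^'n). b (fst w) (snd w, s)) \<in> Borel"
        proof -
          have "(\<lambda>w :: real \<times> (real^'n). (fst w, snd w, s)) \<in> Borel"
            by (intro borel_measurable_continuous_onI continuous_intros)
          from measurable_compose[OF this bm] show ?thesis by simp
        qed
        have Dp: "powr_integrable lborel (p i) (\<lambda>w. \<kappa> (snd w) * D i (w, s))" for i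
        proof -
          have [measurable]: "(\<lambda>w. D i (w, s)) \<in> Borel" using measurable_compose[OF m Dm[of i]] by simp
          have "powr_integrable lborel (p i) (\<lambda>w. \<kappa> (snd w) * \<kappa> s * D i (w, s))"
            unfolding powr_integrable_def using elim(2) by auto
          from powr_integrable_cmult[OF this, of "1 / \<kappa> s"] show ?thesis using False by (simp add: mult_ac)
        qed
        have "- (LBINT w. b (y w) (fst w, s) * dir_deriv 1 \<kappa> (snd w))
            \<le> (LBINT w. \<kappa> (snd w) * (f (fst w) * \<zeta> (w, s))) - (\<Sum>i\<in>UNIV. LBINT w. a i w * (\<kappa> (snd w) * D i (w, s)))"
        proof (rule chain_rule_inequality[where T=T and \<Omega>=\<Omega> and p=p and V=V and b="\<lambda>y x. b y (x, s)" and c="\<lambda>x. c (x, s)"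
            and \<zeta>="\<lambda>w. \<zeta> (w, s)" and D="\<lambda>i w. D i (w, s)" and y=y and f=f and a=a and \<kappa>=\<kappa>, OF p data \<kappa>])
          show "(\<lambda>w. \<zeta> (w, s)) \<in> Borel" using measurable_compose[OF m \<zeta>m] by simp
        qed (use \<zeta>b Dp elim s b_meas b0 bc convex in auto)
        from mult_left_mono[OF this, of "\<kappa> s"] \<kappa>s
        have "\<kappa> s * - (LBINT w. b (y w) (fst w, s) * dir_deriv 1 \<kappa> (snd w))
            \<le> \<kappa> s * ((LBINT w. \<kappa> (snd w) * (f (fst w) * \<zeta> (w, s))) - (\<Sum>i\<in>UNIV. LBINT w. a i w * (\<kappa> (snd w) * D i (w, s))))"
          by simp
        moreover have "\<kappa> s * (LBINT w. b (y w) (fst w, s) * dir_deriv 1 \<kappa> (snd w)) = (LBINT w. b (y w) (fst w, s) * (dir_deriv 1 \<kappa> (snd w) * \<kappa> s))"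
          "\<kappa> s * (LBINT w. \<kappa> (snd w) * (f (fst w) * \<zeta> (w, s))) = (LBINT w. \<kappa> (snd w) * \<kappa> s * (f (fst w) * \<zeta> (w, s)))"
          "\<kappa> s * (LBINT w. a i w * (\<kappa> (snd w) * D i (w, s))) = (LBINT w. a i w * (\<kappa> (snd w) * \<kappa> s * D i (w, s)))" for i
          by (subst integral_mult_right_zero[symmetric], simp add: mult_ac)+
        ultimately show ?thesis by (simp add: right_diff_distrib sum_distrib_left)
      qed simp
    qed
  qed
  note S = integrable_section_integral[OF T1] integrable_section_integral[OF T2] integrable_section_integral[OF T3]
  have "(LBINT s. - (LBINT w. b (y w) (fst w, s) * (dir_deriv 1 \<kappa> (snd w) * \<kappa> s)))
      \<le> (LBINT s. (LBINT w. \<kappa> (snd w) * \<kappa> s * (f (fst w) * \<zeta> (w, s))) - (\<Sum>i\<in>UNIV. LBINT w. a i w * (\<kappa> (snd w) * \<kappa> s * D i (w, s))))"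
    using S by (intro integral_mono_AE main) auto
  also have "\<dots> = (LBINT s. (LBINT w. \<kappa> (snd w) * \<kappa> s * (f (fst w) * \<zeta> (w, s)))) - (\<Sum>i\<in>UNIV. LBINT s. LBINT w. a i w * (\<kappa> (snd w) * \<kappa> s * D i (w, s)))"
    using S by simp
  finally show "- (LBINT z. b (y (fst z)) (fst (fst z), snd z) * (dir_deriv 1 \<kappa> (snd (fst z)) * \<kappa> (snd z)))
      \<le> (LBINT z. \<kappa> (snd (fst z)) * \<kappa> (snd z) * (f (fst (fst z)) * \<zeta> z))
        - (\<Sum>i\<in>UNIV. LBINT z. a i (fst z) * (\<kappa> (snd (fst z)) * \<kappa> (snd z) * D i z))"
    using integral_sections[OF T1] integral_sections[OF T2] integral_sections[OF T3] by simp
qed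

section \<open>Truncated primitives\<close>

text \<open>A convex approximation of \<open>max (y - k) 0\<close> whose derivative in \<open>y\<close> is \<open>step ((\<gamma> y - \<gamma> k) / \<delta>)\<close>; with \<open>\<gamma>\<close> the inverse of the signed power this is the function with which the equation is tested.\<close>
definition truncated_part :: "(real => real) => real => real => real => real" where
  "truncated_part \<gamma> \<delta> y k = (LBINT \<sigma>. indicator {k<..y} \<sigma> * step ((\<gamma> \<sigma> - \<gamma> k) / \<delta>))"

lemma truncated_part_integrable:
  fixes \<gamma> :: "real => real"
  assumes [measurable]: "\<gamma> \<in> Borel"
  shows "integrable lborel (\<lambda>\<sigma>. indicator {k<..y} \<sigma> * step ((\<gamma> \<sigma> - \<gamma> k) / \<delta>))"
proof (rule Bochner_Integration.integrable_bound)
  show "integrable lborel (indicator {k<..y} :: real => real)"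
    by (rule integrable_indicator_bounded) (auto intro: bounded_subset[OF bounded_closed_interval[of k y]])
qed (use step_nonneg step_le_1 in \<open>auto simp: indicator_def\<close>)

lemma integral_indicator_Ioc: "(LBINT \<sigma>. indicator {k<..y::real} \<sigma> * m) = max (y - k) 0 * (m::real)"
  by (cases "k \<le> y") auto

lemma truncated_part_bounds:
  assumes [measurable]: "\<gamma> \<in> Borel"
  shows "truncated_part \<gamma> \<delta> y k \<ge> 0" "truncated_part \<gamma> \<delta> y k \<le> max (y - k) 0"
proof -
  show "truncated_part \<gamma> \<delta> y k \<ge> 0" unfolding truncated_part_def
    by (intro Bochner_Integration.integral_nonneg) (auto simp: indicator_def step_nonneg)
  have "truncated_part \<gamma> \<delta> y k \<le> (LBINT \<sigma>. indicator {k<..y} \<sigma> * 1)" unfolding truncated_part_def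
  proof (intro integral_mono truncated_part_integrable assms integrable_mult_left integrable_indicator_bounded)
    show "bounded {k<..y}" by (rule bounded_subset[OF bounded_closed_interval[of k y]]) auto
  qed (auto simp: indicator_def step_le_1)
  then show "truncated_part \<gamma> \<delta> y k \<le> max (y - k) 0" unfolding integral_indicator_Ioc by simp
qed

text \<open>The integrand is nondecreasing in \<open>\<sigma>\<close>, so on the interval between \<open>y'\<close> and \<open>y\<close> it can be compared with its value at \<open>y\<close>.\<close>
lemma truncated_part_convex:
  assumes \<gamma>m[measurable]: "\<gamma> \<in> Borel" and \<gamma>: "mono \<gamma>" and \<delta>: "\<delta> > 0"
  shows "truncated_part \<gamma> \<delta> y k - truncated_part \<gamma> \<delta> y' k \<le> (y - y') * step ((\<gamma> y - \<gamma> k) / \<delta>)"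
proof -
  let ?s = "\<lambda>\<sigma>. step ((\<gamma> \<sigma> - \<gamma> k) / \<delta>)"
  have s0: "?s \<sigma> = 0" if "\<sigma> \<le> k" for \<sigma> using monoD[OF \<gamma> that] \<delta> by (intro step_eq_0) (simp add: divide_le_0_iff)
  have smono: "?s \<sigma> \<le> ?s \<tau>" if "\<sigma> \<le> \<tau>" for \<sigma> \<tau> using monoD[OF \<gamma> that] \<delta> by (intro step_mono divide_right_mono) auto
  note i = truncated_part_integrable[OF \<gamma>m]
  have iI: "integrable lborel (\<lambda>\<sigma>. indicator {u<..v} \<sigma> * m)" for u v m :: real
    by (intro integrable_mult_left integrable_indicator_bounded) (auto intro: bounded_subset[OF bounded_closed_interval[of u v]])
  have "truncated_part \<gamma> \<delta> y k - truncated_part \<gamma> \<delta> y' k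
      = (LBINT \<sigma>. indicator {k<..y} \<sigma> * ?s \<sigma> - indicator {k<..y'} \<sigma> * ?s \<sigma>)"
    unfolding truncated_part_def using i by simp
  also have "\<dots> \<le> (LBINT \<sigma>. indicator {y'<..y} \<sigma> * ?s y - indicator {y<..y'} \<sigma> * ?s y)"
  proof (intro integral_mono Bochner_Integration.integrable_diff i iI)
    fix \<sigma>
    show "indicator {k<..y} \<sigma> * ?s \<sigma> - indicator {k<..y'} \<sigma> * ?s \<sigma> \<le> indicator {y'<..y} \<sigma> * ?s y - indicator {y<..y'} \<sigma> * ?s y"
      using smono[of \<sigma> y] smono[of y \<sigma>] s0[of \<sigma>] s0[of y] step_nonneg[of "(\<gamma> y - \<gamma> k) / \<delta>"] by (auto simp: indicator_def)
  qed
  also have "\<dots> = (max (y - y') 0 - max (y' - y) 0) * ?s y"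
    using iI by (simp add: integral_indicator_Ioc left_diff_distrib del: integral_mult_left_zero)
  also have "max (y - y') 0 - max (y' - y) 0 = y - y'" by simp
  finally show ?thesis .
qed

lemma truncated_part_tendsto:
  assumes [measurable]: "\<gamma> \<in> Borel" and \<gamma>: "strict_mono \<gamma>" and \<delta>: "\<And>j. \<delta> j > 0" "\<delta> \<longlonglongrightarrow> 0"
  shows "(\<lambda>j::nat. truncated_part \<gamma> (\<delta> j) y k) \<longlonglongrightarrow> max (y - k) 0"
proof -
  have "(\<lambda>j. truncated_part \<gamma> (\<delta> j) y k) \<longlonglongrightarrow> (LBINT \<sigma>. indicator {k<..y} \<sigma> * 1)"
    unfolding truncated_part_def
  proof (rule integral_dominated_convergence[where w="indicator {k<..y}"])
    show "integrable lborel (indicator {k<..y} :: real => real)"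
      by (rule integrable_indicator_bounded) (auto intro: bounded_subset[OF bounded_closed_interval[of k y]])
    show "AE \<sigma> in lborel. (\<lambda>j. indicator {k<..y} \<sigma> * step ((\<gamma> \<sigma> - \<gamma> k) / \<delta> j)) \<longlonglongrightarrow> indicator {k<..y} \<sigma> * 1"
    proof (intro AE_I2)
      fix \<sigma>
      show "(\<lambda>j. indicator {k<..y} \<sigma> * step ((\<gamma> \<sigma> - \<gamma> k) / \<delta> j)) \<longlonglongrightarrow> indicator {k<..y} \<sigma> * 1"
      proof (cases "\<sigma> > k")
        case True
        then have "\<gamma> \<sigma> - \<gamma> k > 0" using \<gamma> by (simp add: strict_mono_less)
        then have "\<forall>\<^sub>F j in sequentially. \<delta> j < \<gamma> \<sigma> - \<gamma> k" by (intro order_tendstoD(2)[OF \<delta>(2)]) auto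
        then have "\<forall>\<^sub>F j in sequentially. indicator {k<..y} \<sigma> * 1 = indicator {k<..y} \<sigma> * step ((\<gamma> \<sigma> - \<gamma> k) / \<delta> j)"
        proof eventually_elim
          case (elim j)
          then have "(\<gamma> \<sigma> - \<gamma> k) / \<delta> j \<ge> 1" using \<delta>(1)[of j] by (simp add: le_divide_eq)
          then show ?case by (simp add: step_eq_1)
        qed
        then show ?thesis by (rule Lim_transform_eventually[OF tendsto_const])
      qed auto
    qed
  qed (use step_nonneg step_le_1 in \<open>auto simp: indicator_def\<close>)
  then show ?thesis unfolding integral_indicator_Ioc by simp
qed

lemma truncated_part_measurable:
  assumes [measurable]: "\<gamma> \<in> Borel"
  shows "(\<lambda>w. truncated_part \<gamma> \<delta> (fst w) (snd w)) \<in> Borel"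
proof -
  have eq: "indicator {snd (fst v)<..fst (fst v)} (snd v) * step ((\<gamma> (snd v) - \<gamma> (snd (fst v))) / \<delta>)
      = (if snd (fst v) < snd v \<and> snd v \<le> fst (fst v) then 1 else 0) * step ((\<gamma> (snd v) - \<gamma> (snd (fst v))) / \<delta>)"
    for v :: "(real \<times> real) \<times> real" by (auto simp: indicator_def)
  have "(\<lambda>v :: (real \<times> real) \<times> real. indicator {snd (fst v)<..fst (fst v)} (snd v) * step ((\<gamma> (snd v) - \<gamma> (snd (fst v))) / \<delta>)) \<in> Borel"
    unfolding eq by measurable
  then have "(\<lambda>(w, \<sigma>). indicator {snd w<..fst w} \<sigma> * step ((\<gamma> \<sigma> - \<gamma> (snd w)) / \<delta>)) \<in> borel_measurable (lborel \<Otimes>\<^sub>M (lborel :: real measure) :: ((real \<times> real) \<times> real) measure)"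
    by (simp only: lborel_prod measurable_lborel1 measurable_lborel2 case_prod_beta')
  from lborel.borel_measurable_lebesgue_integral[OF this] show ?thesis by (simp add: truncated_part_def)
qed

section \<open>Signed powers\<close>

definition signed_power :: "real => real => real" where
  "signed_power a s = sgn s * \<bar>s\<bar> powr a"

lemma signed_power_alt: "\<bar>s\<bar> powr (a - 1) * s = signed_power a s"
  by (cases "s = 0") (auto simp: signed_power_def powr_diff sgn_if)

lemma signed_power_minus: "signed_power a (- s) = - signed_power a s"
  by (simp add: signed_power_def sgn_minus)

lemma signed_power_inverse: "a \<noteq> 0 ==> signed_power (1 / a) (signed_power a s) = s"
  by (cases "s = 0") (auto simp: signed_power_def abs_mult sgn_mult powr_powr abs_sgn_eq sgn_mult_abs)

lemma signed_power_strict_mono: assumes "a > 0" shows "strict_mono (signed_power a)"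
proof (rule strict_monoI)
  fix s t :: real assume st: "s < t"
  consider "0 \<le> s" | "s < 0" "t > 0" | "s < 0" "t \<le> 0" by linarith
  then show "signed_power a s < signed_power a t"
  proof cases
    case 1
    then have "s powr a < t powr a" using st assms by (intro powr_less_mono2) auto
    then show ?thesis using 1 st by (cases "s = 0") (auto simp: signed_power_def)
  next
    case 2
    have "signed_power a s \<le> 0" using 2 by (simp add: signed_power_def)
    moreover have "signed_power a t > 0" using 2 by (simp add: signed_power_def)
    ultimately show ?thesis by linarith
  next
    case 3
    then have "(- t) powr a < (- s) powr a" using st assms by (intro powr_less_mono2) auto
    then show ?thesis using 3 st by (cases "t = 0") (auto simp: signed_power_def)
  qed
qed

lemma signed_power_borel [measurable]: "signed_power a \<in> Borel"
  unfolding signed_power_def[abs_def] sgn_if by measurable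

lemma abs_signed_power: "\<bar>signed_power a s\<bar> = \<bar>s\<bar> powr a"
  by (simp add: signed_power_def abs_mult abs_sgn_eq)

section \<open>Doubling the time variable\<close>

text \<open>The statement keeps the two truncation hypotheses apart because \<open>almost every s, then almost every t\<close> and the reverse order are both needed, one for each equation. Reversing the sign turns \<open>v - w\<close> into \<open>(-w) - (-v)\<close>, so the second application uses the same truncation with \<open>swap23\<close>.\<close>
lemma doubling_limit:
  fixes \<Omega> :: "(real^'n) set" and vb wb yv yw :: "(real^'n) \<times> real => real"
    and av aw dv dw G :: "'n => (real^'n) \<times> real => real"
  assumes p: "\<And>i. p i > 1" and v: "evolution_data \<Omega> T p yv av f1 V" and w: "evolution_data \<Omega> T p yw aw f2 W"
    and \<alpha>: "\<alpha> > 0" and yv: "\<And>z. yv z = signed_power \<alpha> (vb z)" and yw: "\<And>z. yw z = signed_power \<alpha> (wb z)"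
    and vb: "vb \<in> Borel" and wb: "wb \<in> Borel"
    and dv: "\<And>i. powr_integrable lborel (p i) (dv i)" and dw: "\<And>i. powr_integrable lborel (p i) (dw i)"
    and f12: "AE x in lborel. f1 x \<le> f2 x"
    and appr: "\<And>\<delta>. \<delta> > 0 ==> AE s\<in>{0<..<T} in lborel. (AE t in lborel. t \<in> {0<..<T} -->
       bounded_approximable \<Omega> p (\<lambda>x. step ((vb (x, t) - wb (x, s)) / \<delta>))
         (\<lambda>i x. step' ((vb (x, t) - wb (x, s)) / \<delta>) / \<delta> * (dv i (x, t) - dw i (x, s))))"
    and appr': "\<And>\<delta>. \<delta> > 0 ==> AE t\<in>{0<..<T} in lborel. (AE s in lborel. s \<in> {0<..<T} -->
       bounded_approximable \<Omega> p (\<lambda>x. step ((vb (x, t) - wb (x, s)) / \<delta>))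
         (\<lambda>i x. step' ((vb (x, t) - wb (x, s)) / \<delta>) / \<delta> * (dv i (x, t) - dw i (x, s))))"
    and G: "\<And>i. powr_integrable lborel (p i / (p i - 1)) (G i)" "\<And>i z. G i z \<ge> 0" and C: "C \<ge> 0"
    and str: "AE z in lborel. snd (fst z) \<in> {0<..<T} --> snd z \<in> {0<..<T} -->
       - (C * \<bar>vb (fst z) - wb (fst (swap23 z))\<bar> * (\<Sum>i\<in>UNIV. G i (fst z) * \<bar>dv i (fst z) - dw i (fst (swap23 z))\<bar>))
       \<le> (\<Sum>i\<in>UNIV. (av i (fst z) - aw i (fst (swap23 z))) * (dv i (fst z) - dw i (fst (swap23 z))))"
    and \<kappa>: "\<kappa> \<in> test_functions {0<..<T}" "\<And>t. \<kappa> t \<ge> 0"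
  shows "0 \<le> (LBINT z. max (yv (fst z) - yw (fst (swap23 z))) 0 *
      (dir_deriv 1 \<kappa> (snd (fst z)) * \<kappa> (snd z) + \<kappa> (snd (fst z)) * dir_deriv 1 \<kappa> (snd z)))"
proof -
  note vD = evolution_dataD[OF v] and wD = evolution_dataD[OF w]
  note mD = evolution_dataD[OF evolution_data_minus[OF w]]
  define \<gamma> where "\<gamma> = signed_power (1 / \<alpha>)"
  have \<gamma>m[measurable]: "\<gamma> \<in> Borel" unfolding \<gamma>_def by simp
  have \<gamma>s: "strict_mono \<gamma>" unfolding \<gamma>_def using \<alpha> by (intro signed_power_strict_mono) auto
  then have \<gamma>mono: "mono \<gamma>" by (rule strict_mono_mono)
  have \<gamma>v: "\<gamma> (yv z) = vb z" "\<gamma> (- yv z) = - vb z" and \<gamma>w: "\<gamma> (yw z) = wb z" "\<gamma> (- yw z) = - wb z" for z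
    unfolding \<gamma>_def yv yw using \<alpha> by (simp_all add: signed_power_minus signed_power_inverse)
  have [measurable]: "yv \<in> Borel" "yw \<in> Borel" "f1 \<in> Borel" "f2 \<in> Borel"
    using borel_measurable_integrable[OF vD(1)] borel_measurable_integrable[OF wD(1)] borel_measurable_integrable[OF vD(2)]
      borel_measurable_integrable[OF wD(2)] by auto
  have [measurable]: "dv i \<in> Borel" "dw i \<in> Borel" "G i \<in> Borel"
    "av i \<in> Borel" "aw i \<in> Borel" for i
    using powr_integrable_borel[OF dv[of i]] powr_integrable_borel[OF dw[of i]] powr_integrable_borel[OF G(1)[of i]]
      powr_integrable_borel[OF vD(3)[of i]] powr_integrable_borel[OF wD(3)[of i]] by auto
  note [measurable] = vb wb test_function_borel[OF \<kappa>(1)] test_function_borel[OF test_function_dir_deriv[OF \<kappa>(1)]]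
  obtain L where L: "L > 0" "\<And>s. \<bar>step' s\<bar> \<le> L" using step_lipschitz by metis
  obtain B0 where B0: "\<And>t. \<bar>\<kappa> t\<bar> \<le> B0" using test_function_bounded[OF \<kappa>(1)] by metis
  obtain K where K: "K \<subseteq> {0<..<T}" "\<And>t. t \<notin> K ==> \<kappa> t = 0" using test_function_support[OF \<kappa>(1)] by metis
  have \<kappa>0: "\<kappa> t = 0" if "t \<notin> {0<..<T}" for t using K that by blast
  define u where "u z = vb (fst z) - wb (fst (swap23 z))" for z
  define kk where "kk z = \<kappa> (snd (fst z)) * \<kappa> (snd z)" for z :: "((real^'n) \<times> real) \<times> real"
  have kk: "kk z \<ge> 0" for z unfolding kk_def using \<kappa>(2) by simp
  define E where "E i z = kk z * (dv i (fst z) - dw i (fst (swap23 z)))" for i z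
  have [measurable]: "u \<in> Borel" "kk \<in> Borel" "E i \<in> Borel" for i
    unfolding u_def[abs_def] kk_def[abs_def] E_def[abs_def] by measurable
  have Ei: "powr_integrable lborel (p i) (E i)" for i
  proof -
    have pi: "p i > 0" "p i \<ge> 0" using p[of i] by auto
    have 1: "powr_integrable lborel (p i) (\<lambda>z. \<kappa> (snd (fst z)) * (dv i (fst z) * \<kappa> (snd z)))"
      by (rule powr_integrable_bounded_mult[OF powr_integrable_times_test[OF dv \<kappa>(1) pi(1)] _ B0 pi(2)]) measurable
    have 2: "powr_integrable lborel (p i) (\<lambda>z. \<kappa> (snd z) * (dw i (fst (swap23 z)) * \<kappa> (snd (swap23 z))))"
      by (rule powr_integrable_bounded_mult[OF powr_integrable_swap23[OF powr_integrable_times_test[OF dw \<kappa>(1) pi(1)]] _ B0 pi(2)]) measurable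
    show ?thesis using powr_integrable_diff[OF 1 2 pi(2)] by (simp add: E_def[abs_def] kk_def snd_swap23 algebra_simps)
  qed
  define H where "H z = (\<Sum>i\<in>UNIV. G i (fst z) * \<bar>E i z\<bar>)" for z
  have Hi: "integrable lborel H"
  proof -
    have "integrable lborel (\<lambda>z. G i (fst z) * \<bar>E i z\<bar>)" for i
    proof (rule integrable_dual_product_times[OF p G(1)])
      show "powr_integrable lborel (p i) (\<lambda>z. \<bar>E i z\<bar>)" using Ei[of i] by (auto simp: powr_integrable_def)
      show "\<bar>E i z\<bar> = 0" if "snd z \<notin> {0<..<T}" for z using \<kappa>0[OF that] by (simp add: E_def kk_def)
    qed
    then show ?thesis unfolding H_def[abs_def] by auto
  qed
  have [measurable]: "H \<in> Borel" using borel_measurable_integrable[OF Hi] by simp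
  \<comment> \<open>Where \<open>step'\<close> does not vanish, \<open>|u| \<le> \<delta>\<close>; this makes the bound independent of \<open>\<delta>\<close>.\<close>
  have flux_bound: "norm (C * (step' (u z / \<delta>) * (\<bar>u z\<bar> / \<delta>)) * H z) \<le> C * L * \<bar>H z\<bar>" if \<delta>: "\<delta> > 0" for \<delta> z
  proof -
    have "\<bar>step' (u z / \<delta>) * (\<bar>u z\<bar> / \<delta>)\<bar> \<le> L"
    proof (cases "\<bar>u z\<bar> / \<delta> \<le> 1")
      case True
      then show ?thesis using mult_mono[OF L(2)[of "u z / \<delta>"] True] L(1) \<delta> by (simp add: abs_mult)
    next
      case False
      then have "u z / \<delta> \<le> 0 \<or> u z / \<delta> \<ge> 1" using \<delta> by (auto simp: abs_if divide_le_0_iff split: if_splits)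
      then show ?thesis using step'_eq_0 L(1) by simp
    qed
    then have "C * \<bar>step' (u z / \<delta>) * (\<bar>u z\<bar> / \<delta>)\<bar> * \<bar>H z\<bar> \<le> C * L * \<bar>H z\<bar>"
      using C by (intro mult_right_mono mult_left_mono) auto
    then show ?thesis using C L(1) by (simp add: abs_mult)
  qed
  define dk1 where "dk1 z = dir_deriv 1 \<kappa> (snd (fst z)) * \<kappa> (snd z)" for z :: "((real^'n) \<times> real) \<times> real"
  define dk2 where "dk2 z = \<kappa> (snd (fst z)) * dir_deriv 1 \<kappa> (snd z)" for z :: "((real^'n) \<times> real) \<times> real"
  define b1 where "b1 \<delta> z = truncated_part \<gamma> \<delta> (yv (fst z)) (yw (fst (swap23 z)))" for \<delta> z
  define b2 where "b2 \<delta> z = truncated_part \<gamma> \<delta> (- yw (fst (swap23 z))) (- yv (fst z))" for \<delta> z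
  have main: "- (LBINT z. b1 \<delta> z * dk1 z + b2 \<delta> z * dk2 z) \<le> (LBINT z. C * (step' (u z / \<delta>) * (\<bar>u z\<bar> / \<delta>)) * H z)"
    and b1i: "integrable lborel (\<lambda>z. b1 \<delta> z * dk1 z)" and b2i: "integrable lborel (\<lambda>z. b2 \<delta> z * dk2 z)"
    if \<delta>: "\<delta> > 0" for \<delta>
  proof -
    define \<zeta> where "\<zeta> z = step (u z / \<delta>)" for z
    define D where "D i z = step' (u z / \<delta>) / \<delta> * (dv i (fst z) - dw i (fst (swap23 z)))" for i z
    have \<zeta>m[measurable]: "\<zeta> \<in> Borel" and Dm[measurable]: "D i \<in> Borel" for i
      unfolding \<zeta>_def[abs_def] D_def[abs_def] by measurable
    have \<zeta>b: "\<bar>\<zeta> z\<bar> \<le> 1" "\<zeta> z \<ge> 0" for z unfolding \<zeta>_def using step_nonneg step_le_1 by auto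
    have step'_le: "\<bar>step' s / \<delta>\<bar> \<le> L / \<delta>" for s using L(2)[of s] \<delta> by (simp add: abs_divide divide_right_mono)
    have kD: "powr_integrable lborel (p i) (\<lambda>z. kk z * D i z)" for i
    proof -
      have "powr_integrable lborel (p i) (\<lambda>z. (step' (u z / \<delta>) / \<delta>) * E i z)"
        using p[of i] by (intro powr_integrable_bounded_mult[OF Ei _ step'_le]) auto
      then show ?thesis by (simp add: D_def E_def mult_ac)
    qed
    have \<zeta>eq: "\<zeta> ((x, t), s) = step ((vb (x, t) - wb (x, s)) / \<delta>)"
      and Deq: "D i ((x, t), s) = step' ((vb (x, t) - wb (x, s)) / \<delta>) / \<delta> * (dv i (x, t) - dw i (x, s))" for x t s i
      by (simp_all add: \<zeta>_def D_def u_def)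
    have tp: "truncated_part \<gamma> \<delta> y k \<le> \<bar>y\<bar> + \<bar>k\<bar>" for y k
      using truncated_part_bounds(2)[OF \<gamma>m, of \<delta> y k] by linarith
    have tpm: "(\<lambda>w :: real \<times> ((real^'n) \<times> real). truncated_part \<gamma> \<delta> (fst w) (g (snd w))) \<in> Borel"
      if [measurable]: "g \<in> Borel" for g
      using measurable_compose[OF borel_measurable_Pair[of fst borel "\<lambda>w. g (snd w)"] truncated_part_measurable[OF \<gamma>m, of \<delta>]] by simp
    have conv: "truncated_part \<gamma> \<delta> (yv (x, t)) (yw (x, s)) - truncated_part \<gamma> \<delta> y' (yw (x, s)) \<le> (yv (x, t) - y') * \<zeta> ((x, t), s)" for x t s y'
      using truncated_part_convex[OF \<gamma>m \<gamma>mono \<delta>, of "yv (x, t)" "yw (x, s)" y'] by (simp add: \<gamma>v \<gamma>w \<zeta>eq)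
    have conv': "truncated_part \<gamma> \<delta> (- yw (x, s)) (- yv (x, t)) - truncated_part \<gamma> \<delta> y' (- yv (x, t)) \<le> (- yw (x, s) - y') * \<zeta> (swap23 ((x, s), t))" for x s t y'
      using truncated_part_convex[OF \<gamma>m \<gamma>mono \<delta>, of "- yw (x, s)" "- yv (x, t)" y'] by (simp add: \<gamma>v \<gamma>w \<zeta>eq)
    have appr1: "AE s\<in>{0<..<T} in lborel. (AE t\<in>{0<..<T} in lborel. bounded_approximable \<Omega> p (\<lambda>x. \<zeta> ((x, t), s)) (\<lambda>i x. D i ((x, t), s)))"
      unfolding \<zeta>eq Deq by (rule appr[OF \<delta>])
    have appr2: "AE s\<in>{0<..<T} in lborel. (AE t\<in>{0<..<T} in lborel. bounded_approximable \<Omega> p (\<lambda>x. \<zeta> (swap23 ((x, t), s))) (\<lambda>i x. D i (swap23 ((x, t), s))))"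
      unfolding swap23_simp \<zeta>eq Deq by (rule appr'[OF \<delta>])
    have kD': "powr_integrable lborel (p i) (\<lambda>z. \<kappa> (snd (fst z)) * \<kappa> (snd z) * D i (swap23 z))" for i
      using powr_integrable_swap23[OF kD[of i]] by (simp add: kk_def snd_swap23 fst_swap23 mult_ac)
    have \<zeta>m': "(\<lambda>z. \<zeta> (swap23 z)) \<in> Borel" and Dm': "(\<lambda>z. D i (swap23 z)) \<in> Borel" for i
      by measurable
    have V_int: "integrable lborel (\<lambda>w. \<bar>- yv w\<bar>)" using vD(1) by simp
    have ywm: "yw \<in> Borel" "(\<lambda>w. - yv w) \<in> Borel" by measurable
    \<comment> \<open>The equation of the first solution, with \<open>yw\<close> at time \<open>s\<close> as the frozen value.\<close>
    note cv' = chain_rule_integrated[where b="\<lambda>y w. truncated_part \<gamma> \<delta> y (yw w)" and c="\<lambda>w. \<bar>yw w\<bar>" and \<zeta>=\<zeta> and D=D and y=yv and V=V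
        and \<Omega>=\<Omega> and T=T and p=p and f=f1 and a=av and \<kappa>=\<kappa>, OF p v \<kappa> \<zeta>m \<zeta>b(1) Dm kD[unfolded kk_def] appr1
        tpm[OF ywm(1)] truncated_part_bounds(1)[OF \<gamma>m] tp integrable_abs[OF wD(1)] conv, folded fst_swap23 b1_def dk1_def kk_def]
    \<comment> \<open>The negated equation of the second solution, with the roles of the two times exchanged.\<close>
    note cw = chain_rule_integrated[where b="\<lambda>y w. truncated_part \<gamma> \<delta> y (- yv w)" and c="\<lambda>w. \<bar>- yv w\<bar>" and \<zeta>="\<lambda>z. \<zeta> (swap23 z)"
        and D="\<lambda>i z. D i (swap23 z)" and y="\<lambda>z. - yw z" and V="\<lambda>t x. - W t x"
        and \<Omega>=\<Omega> and T=T and p=p and f="\<lambda>x. - f2 x" and a="\<lambda>i z. - aw i z" and \<kappa>=\<kappa>, OF p evolution_data_minus[OF w] \<kappa> \<zeta>m' \<zeta>b(1) Dm' kD' appr2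
        tpm[OF ywm(2)] truncated_part_bounds(1)[OF \<gamma>m] tp V_int conv', folded fst_swap23]
    have sw: "(\<lambda>z. F (swap23 z)) = F' ==> F \<in> Borel ==> (LBINT z. F' z) = (LBINT z. F z) \<and> (integrable lborel F' \<longleftrightarrow> integrable lborel F)"
      for F F' :: "((real^'n) \<times> real) \<times> real => real"
      using integral_swap23[of F] integrable_swap23[of F] by auto
    have b2m: "b2 \<delta> \<in> Borel"
    proof -
      have "(\<lambda>z. (- yw (fst (swap23 z)), - yv (fst z))) \<in> Borel" by (intro borel_measurable_Pair) measurable
      from measurable_compose[OF this truncated_part_measurable[OF \<gamma>m, of \<delta>]] show ?thesis by (simp add: b2_def[abs_def])
    qed
    have [measurable]: "dk2 \<in> Borel" unfolding dk2_def[abs_def] by measurable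
    note [measurable] = b2m
    have s1: "(\<lambda>z. b2 \<delta> (swap23 z) * dk2 (swap23 z)) = (\<lambda>z. truncated_part \<gamma> \<delta> (- yw (fst z)) (- yv (fst (swap23 z))) * (dir_deriv 1 \<kappa> (snd (fst z)) * \<kappa> (snd z)))"
      by (simp add: b2_def dk2_def swap23_swap23 fst_swap23 snd_swap23 mult_ac)
    have s2: "(\<lambda>z. kk (swap23 z) * (- f2 (fst (fst (swap23 z))) * \<zeta> (swap23 z))) = (\<lambda>z. \<kappa> (snd (fst z)) * \<kappa> (snd z) * (- f2 (fst (fst z)) * \<zeta> (swap23 z)))"
      by (simp add: kk_def fst_swap23 snd_swap23 mult_ac)
    have s3: "(\<lambda>z. - aw i (fst (swap23 (swap23 z))) * (kk (swap23 z) * D i (swap23 z))) = (\<lambda>z. - aw i (fst z) * (\<kappa> (snd (fst z)) * \<kappa> (snd z) * D i (swap23 z)))" for i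
      by (simp add: kk_def swap23_swap23 fst_swap23 snd_swap23 mult_ac)
    have m1: "(\<lambda>z. b2 \<delta> z * dk2 z) \<in> Borel" "(\<lambda>z. kk z * (- f2 (fst (fst z)) * \<zeta> z)) \<in> Borel"
      "(\<lambda>z. - aw i (fst (swap23 z)) * (kk z * D i z)) \<in> Borel" for i by measurable
    note t = sw[OF s1 m1(1)] sw[OF s2 m1(2)] sw[OF s3 m1(3)]
    note te = t[THEN conjunct1] and ti = t[THEN conjunct2]
    have cw': "- (LBINT z. b2 \<delta> z * dk2 z) \<le> (LBINT z. kk z * (- f2 (fst (fst z)) * \<zeta> z)) - (\<Sum>i\<in>UNIV. LBINT z. - aw i (fst (swap23 z)) * (kk z * D i z))"
      using cw(1) unfolding te .
    have i2: "integrable lborel (\<lambda>z. b2 \<delta> z * dk2 z)" "integrable lborel (\<lambda>z. kk z * (- f2 (fst (fst z)) * \<zeta> z))"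
        "\<And>i. integrable lborel (\<lambda>z. - aw i (fst (swap23 z)) * (kk z * D i z))"
      using cw(2,3,4) unfolding ti .
    show "integrable lborel (\<lambda>z. b1 \<delta> z * dk1 z)" "integrable lborel (\<lambda>z. b2 \<delta> z * dk2 z)" using cv'(2) i2(1) by auto
    have "- (LBINT z. b1 \<delta> z * dk1 z + b2 \<delta> z * dk2 z)
        \<le> (LBINT z. kk z * (f1 (fst (fst z)) * \<zeta> z)) - (\<Sum>i\<in>UNIV. LBINT z. av i (fst z) * (kk z * D i z))
          + ((LBINT z. kk z * (- f2 (fst (fst z)) * \<zeta> z)) - (\<Sum>i\<in>UNIV. LBINT z. - aw i (fst (swap23 z)) * (kk z * D i z)))"
      using cv'(1,2) cw' i2(1) by simp
    also have "\<dots> = (LBINT z. kk z * (f1 (fst (fst z)) * \<zeta> z) + kk z * (- f2 (fst (fst z)) * \<zeta> z)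
        - ((\<Sum>i\<in>UNIV. av i (fst z) * (kk z * D i z)) + (\<Sum>i\<in>UNIV. - aw i (fst (swap23 z)) * (kk z * D i z))))"
      using cv'(3,4) i2(2,3) by simp
    also have "\<dots> \<le> (LBINT z. C * (step' (u z / \<delta>) * (\<bar>u z\<bar> / \<delta>)) * H z)"
    proof (rule integral_mono_AE)
      show "integrable lborel (\<lambda>z. kk z * (f1 (fst (fst z)) * \<zeta> z) + kk z * (- f2 (fst (fst z)) * \<zeta> z)
        - ((\<Sum>i\<in>UNIV. av i (fst z) * (kk z * D i z)) + (\<Sum>i\<in>UNIV. - aw i (fst (swap23 z)) * (kk z * D i z))))"
        using cv'(3,4) i2(2,3) by (intro Bochner_Integration.integrable_diff Bochner_Integration.integrable_add Bochner_Integration.integrable_sum)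
      show "integrable lborel (\<lambda>z. C * (step' (u z / \<delta>) * (\<bar>u z\<bar> / \<delta>)) * H z)"
      proof (rule Bochner_Integration.integrable_bound)
        show "integrable lborel (\<lambda>z. C * L * \<bar>H z\<bar>)" using Hi by auto
        show "AE z in lborel. norm (C * (step' (u z / \<delta>) * (\<bar>u z\<bar> / \<delta>)) * H z) \<le> norm (C * L * \<bar>H z\<bar>)"
          using flux_bound[OF \<delta>] C L(1) by auto
      qed measurable
      have f12': "AE z in (lborel :: (((real^'n) \<times> real) \<times> real) measure). f1 (fst (fst z)) \<le> f2 (fst (fst z))"
        using AE_fst[OF AE_fst[OF f12]] .
      show "AE z in lborel. kk z * (f1 (fst (fst z)) * \<zeta> z) + kk z * (- f2 (fst (fst z)) * \<zeta> z)
          - ((\<Sum>i\<in>UNIV. av i (fst z) * (kk z * D i z)) + (\<Sum>i\<in>UNIV. - aw i (fst (swap23 z)) * (kk z * D i z)))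
        \<le> C * (step' (u z / \<delta>) * (\<bar>u z\<bar> / \<delta>)) * H z"
        using f12' str
      proof eventually_elim
        case (elim z)
        show ?case
        proof (cases "snd (fst z) \<in> {0<..<T} \<and> snd z \<in> {0<..<T}")
          case False
          then have "kk z = 0" using \<kappa>0 unfolding kk_def by auto
          then show ?thesis by (simp add: H_def E_def)
        next
          case True
          let ?S = "\<Sum>i\<in>UNIV. (av i (fst z) - aw i (fst (swap23 z))) * (dv i (fst z) - dw i (fst (swap23 z)))"
          let ?P = "\<Sum>i\<in>UNIV. G i (fst z) * \<bar>dv i (fst z) - dw i (fst (swap23 z))\<bar>"
          let ?m = "kk z * (step' (u z / \<delta>) / \<delta>)"
          have m: "?m \<ge> 0" using kk[of z] step'_nonneg \<delta> by simp
          have "kk z * \<zeta> z * (f1 (fst (fst z)) - f2 (fst (fst z))) \<le> 0"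
            using kk[of z] \<zeta>b(2)[of z] elim(1) by (intro mult_nonneg_nonpos) auto
          then have 1: "kk z * (f1 (fst (fst z)) * \<zeta> z) + kk z * (- f2 (fst (fst z)) * \<zeta> z) \<le> 0" by (simp add: algebra_simps)
          have 2: "(\<Sum>i\<in>UNIV. av i (fst z) * (kk z * D i z)) + (\<Sum>i\<in>UNIV. - aw i (fst (swap23 z)) * (kk z * D i z)) = ?m * ?S"
            unfolding D_def by (simp add: sum_distrib_left sum.distrib[symmetric] algebra_simps)
          have 3: "- (C * \<bar>u z\<bar> * ?P) \<le> ?S" using elim(2) True unfolding u_def by auto
          have 4: "?m * - (C * \<bar>u z\<bar> * ?P) \<le> ?m * ?S" by (rule mult_left_mono[OF 3 m])
          have 5: "C * (step' (u z / \<delta>) * (\<bar>u z\<bar> / \<delta>)) * H z = ?m * (C * \<bar>u z\<bar> * ?P)"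
          proof -
            have "H z = kk z * ?P" unfolding H_def E_def using kk[of z] by (simp add: abs_mult sum_distrib_left mult_ac)
            then show ?thesis by (simp add: mult_ac)
          qed
          show ?thesis using 1 4 unfolding 2 5 by simp
        qed
      qed
    qed
    finally show "- (LBINT z. b1 \<delta> z * dk1 z + b2 \<delta> z * dk2 z) \<le> (LBINT z. C * (step' (u z / \<delta>) * (\<bar>u z\<bar> / \<delta>)) * H z)" .
  qed
  define \<delta> where "\<delta> j = 1 / real (Suc j)" for j :: nat
  have \<delta>: "\<delta> j > 0" for j by (simp add: \<delta>_def)
  have \<delta>0: "\<delta> \<longlonglongrightarrow> 0" using LIMSEQ_inverse_real_of_nat by (simp add: \<delta>_def[abs_def] inverse_eq_divide)
  define m where "m z = max (yv (fst z) - yw (fst (swap23 z))) 0" for z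
  have [measurable]: "m \<in> Borel" "dk1 \<in> Borel" "dk2 \<in> Borel"
    unfolding m_def[abs_def] dk1_def[abs_def] dk2_def[abs_def] by measurable
  have m_le: "0 \<le> m z" "m z \<le> \<bar>yv (fst z)\<bar> + \<bar>yw (fst (swap23 z))\<bar>" for z by (auto simp: m_def)
  obtain B1 where B1: "\<And>t. \<bar>dir_deriv 1 \<kappa> t\<bar> \<le> B1" using test_function_bounded[OF test_function_dir_deriv[OF \<kappa>(1)]] by metis
  note \<kappa>i = test_function_integrable[OF \<kappa>(1)] test_function_integrable[OF test_function_dir_deriv[OF \<kappa>(1), of 1]]
  have prod: "integrable lborel (\<lambda>z :: ((real^'n) \<times> real) \<times> real. \<bar>h (fst z)\<bar> * \<bar>k (snd z)\<bar>)"
    and prod': "integrable lborel (\<lambda>z :: ((real^'n) \<times> real) \<times> real. \<bar>h (fst (swap23 z))\<bar> * \<bar>k (snd (swap23 z))\<bar>)"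
    if "integrable lborel h" "integrable lborel k" for h :: "(real^'n) \<times> real => real" and k :: "real => real"
  proof -
    show i: "integrable lborel (\<lambda>z :: ((real^'n) \<times> real) \<times> real. \<bar>h (fst z)\<bar> * \<bar>k (snd z)\<bar>)"
      by (rule integrable_product) (use that in auto)
    then have "(\<lambda>z :: ((real^'n) \<times> real) \<times> real. \<bar>h (fst z)\<bar> * \<bar>k (snd z)\<bar>) \<in> Borel"
      using borel_measurable_integrable by fastforce
    from integrable_swap23[OF this] i
    show "integrable lborel (\<lambda>z :: ((real^'n) \<times> real) \<times> real. \<bar>h (fst (swap23 z))\<bar> * \<bar>k (snd (swap23 z))\<bar>)" by simp
  qed
  define W1 where "W1 z = B1 * (\<bar>yv (fst z)\<bar> * \<bar>\<kappa> (snd z)\<bar>) + B0 * (\<bar>yw (fst (swap23 z))\<bar> * \<bar>dir_deriv 1 \<kappa> (snd (swap23 z))\<bar>)" for z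
  define W2 where "W2 z = B0 * (\<bar>yv (fst z)\<bar> * \<bar>dir_deriv 1 \<kappa> (snd z)\<bar>) + B1 * (\<bar>yw (fst (swap23 z))\<bar> * \<bar>\<kappa> (snd (swap23 z))\<bar>)" for z
  have W: "integrable lborel (\<lambda>z. W1 z + W2 z)"
    unfolding W1_def[abs_def] W2_def[abs_def]
    by (intro Bochner_Integration.integrable_add integrable_mult_right prod prod' vD(1) wD(1) \<kappa>i)
  have m1: "m z * \<bar>dk1 z\<bar> \<le> W1 z" and m2: "m z * \<bar>dk2 z\<bar> \<le> W2 z" for z
  proof -
    have "m z * \<bar>dk1 z\<bar> \<le> (\<bar>yv (fst z)\<bar> + \<bar>yw (fst (swap23 z))\<bar>) * \<bar>dk1 z\<bar>" by (intro mult_right_mono m_le) auto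
    also have "\<dots> = \<bar>dir_deriv 1 \<kappa> (snd (fst z))\<bar> * (\<bar>yv (fst z)\<bar> * \<bar>\<kappa> (snd z)\<bar>)
        + \<bar>\<kappa> (snd z)\<bar> * (\<bar>yw (fst (swap23 z))\<bar> * \<bar>dir_deriv 1 \<kappa> (snd (swap23 z))\<bar>)"
      by (simp add: dk1_def snd_swap23 abs_mult algebra_simps)
    also have "\<dots> \<le> W1 z" unfolding W1_def by (intro add_mono mult_right_mono B0 B1) auto
    finally show "m z * \<bar>dk1 z\<bar> \<le> W1 z" .
    have "m z * \<bar>dk2 z\<bar> \<le> (\<bar>yv (fst z)\<bar> + \<bar>yw (fst (swap23 z))\<bar>) * \<bar>dk2 z\<bar>" by (intro mult_right_mono m_le) auto
    also have "\<dots> = \<bar>\<kappa> (snd (fst z))\<bar> * (\<bar>yv (fst z)\<bar> * \<bar>dir_deriv 1 \<kappa> (snd z)\<bar>)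
        + \<bar>dir_deriv 1 \<kappa> (snd z)\<bar> * (\<bar>yw (fst (swap23 z))\<bar> * \<bar>\<kappa> (snd (swap23 z))\<bar>)"
      by (simp add: dk2_def snd_swap23 abs_mult algebra_simps)
    also have "\<dots> \<le> W2 z" unfolding W2_def by (intro add_mono mult_right_mono B0 B1) auto
    finally show "m z * \<bar>dk2 z\<bar> \<le> W2 z" .
  qed
  have b_le: "0 \<le> b1 d z" "b1 d z \<le> m z" "0 \<le> b2 d z" "b2 d z \<le> m z" for d z
    using truncated_part_bounds[OF \<gamma>m, of d "yv (fst z)" "yw (fst (swap23 z))"]
      truncated_part_bounds[OF \<gamma>m, of d "- yw (fst (swap23 z))" "- yv (fst z)"]
    by (auto simp: b1_def b2_def m_def)
  have lhs: "(\<lambda>j. LBINT z. b1 (\<delta> j) z * dk1 z + b2 (\<delta> j) z * dk2 z) \<longlonglongrightarrow> (LBINT z. m z * dk1 z + m z * dk2 z)"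
  proof (rule integral_dominated_convergence[OF _ _ W])
    show "(\<lambda>z. m z * dk1 z + m z * dk2 z) \<in> borel_measurable lborel" by measurable
    show "(\<lambda>z. b1 (\<delta> j) z * dk1 z + b2 (\<delta> j) z * dk2 z) \<in> borel_measurable lborel" for j
      by (rule borel_measurable_integrable[OF Bochner_Integration.integrable_add[OF b1i[OF \<delta>] b2i[OF \<delta>]]])
    have b1l: "(\<lambda>j. b1 (\<delta> j) z) \<longlonglongrightarrow> m z" for z
      unfolding b1_def m_def by (rule truncated_part_tendsto[OF \<gamma>m \<gamma>s \<delta> \<delta>0])
    have b2l: "(\<lambda>j. b2 (\<delta> j) z) \<longlonglongrightarrow> m z" for z
      using truncated_part_tendsto[OF \<gamma>m \<gamma>s \<delta> \<delta>0, of "- yw (fst (swap23 z))" "- yv (fst z)"]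
      by (simp add: b2_def m_def)
    show "AE z in lborel. (\<lambda>j. b1 (\<delta> j) z * dk1 z + b2 (\<delta> j) z * dk2 z) \<longlonglongrightarrow> m z * dk1 z + m z * dk2 z"
      by (intro AE_I2 tendsto_intros b1l b2l)
    show "AE z in lborel. norm (b1 (\<delta> j) z * dk1 z + b2 (\<delta> j) z * dk2 z) \<le> W1 z + W2 z" for j
    proof (intro AE_I2)
      fix z
      have "\<bar>b1 (\<delta> j) z * dk1 z\<bar> \<le> m z * \<bar>dk1 z\<bar>" "\<bar>b2 (\<delta> j) z * dk2 z\<bar> \<le> m z * \<bar>dk2 z\<bar>"
        using b_le[of "\<delta> j" z] by (auto simp: abs_mult intro!: mult_right_mono)
      then show "norm (b1 (\<delta> j) z * dk1 z + b2 (\<delta> j) z * dk2 z) \<le> W1 z + W2 z"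
        using m1[of z] m2[of z] unfolding real_norm_def by linarith
    qed
  qed
  \<comment> \<open>For each point the integrand is zero once \<open>\<delta> j\<close> is below the positive difference.\<close>
  have rhs: "(\<lambda>j. LBINT z. C * (step' (u z / \<delta> j) * (\<bar>u z\<bar> / \<delta> j)) * H z) \<longlonglongrightarrow> (\<integral>z. 0 \<partial>(lborel :: (((real^'n) \<times> real) \<times> real) measure))"
  proof (rule integral_dominated_convergence[where w="\<lambda>z. C * L * \<bar>H z\<bar>"])
    show "integrable lborel (\<lambda>z. C * L * \<bar>H z\<bar>)" using Hi by auto
    show "AE z in lborel. (\<lambda>j. C * (step' (u z / \<delta> j) * (\<bar>u z\<bar> / \<delta> j)) * H z) \<longlonglongrightarrow> 0"
    proof (intro AE_I2)
      fix z
      have "\<forall>\<^sub>F j in sequentially. 0 = C * (step' (u z / \<delta> j) * (\<bar>u z\<bar> / \<delta> j)) * H z"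
      proof (cases "u z \<le> 0")
        case True
        then show ?thesis using step'_eq_0 \<delta> by (intro always_eventually) (auto simp: divide_le_0_iff less_imp_le)
      next
        case False
        then have "\<forall>\<^sub>F j in sequentially. \<delta> j < u z" by (intro order_tendstoD(2)[OF \<delta>0]) auto
        then show ?thesis
        proof eventually_elim
          case (elim j)
          then have "u z / \<delta> j \<ge> 1" using \<delta>[of j] by (simp add: le_divide_eq)
          then show ?case using step'_eq_0 by simp
        qed
      qed
      then show "(\<lambda>j. C * (step' (u z / \<delta> j) * (\<bar>u z\<bar> / \<delta> j)) * H z) \<longlonglongrightarrow> 0"
        by (rule Lim_transform_eventually[OF tendsto_const])
    qed
    show "AE z in lborel. norm (C * (step' (u z / \<delta> j) * (\<bar>u z\<bar> / \<delta> j)) * H z) \<le> C * L * \<bar>H z\<bar>" for j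
      by (intro AE_I2 flux_bound \<delta>)
  qed measurable
  have "- (LBINT z. m z * dk1 z + m z * dk2 z) \<le> (\<integral>z. 0 \<partial>(lborel :: (((real^'n) \<times> real) \<times> real) measure))"
    by (rule LIMSEQ_le[OF tendsto_minus[OF lhs] rhs]) (use main[OF \<delta>] in auto)
  then show ?thesis by (simp add: m_def dk1_def dk2_def distrib_left)
qed

section \<open>From the doubled inequality to a decreasing quantity\<close>

lemma kernel_test: "\<eta> > 0 ==> kernel r \<eta> \<in> test_functions UNIV"
  and kernel_test_interval: "\<eta> > 0 ==> 0 < r ==> r + \<eta> < T ==> kernel r \<eta> \<in> test_functions {0<..<T}"
proof -
  assume \<eta>: "\<eta> > 0"
  have Ck: "Ck k (kernel r \<eta>)" for k
    unfolding kernel_def[abs_def] divide_inverse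
    by (intro Ck_mult Ck_const Ck_compose[OF Ck_dir_deriv[OF Ck_step]] Ck_diff Ck_bounded_linear[OF bounded_linear_ident])
  show "kernel r \<eta> \<in> test_functions UNIV"
    by (rule test_functionI[OF Ck, of "{r..r + \<eta>}"]) (use kernel_eq_0[OF \<eta>] in auto)
  assume r: "0 < r" "r + \<eta> < T"
  show "kernel r \<eta> \<in> test_functions {0<..<T}"
    by (rule test_functionI[OF Ck, of "{r..r + \<eta>}"]) (use kernel_eq_0[OF \<eta>] r in auto)
qed

lemma kernel_shift: "kernel r \<eta> t = kernel 0 \<eta> (t - r)"
  by (simp add: kernel_def)

text \<open>The kernel at \<open>r\<close> is a translate, so the derivative in \<open>r\<close> of the average is minus the expression assumed to be nonnegative.\<close>
lemma doubled_average_decreasing: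
  fixes m :: "((real^'n) \<times> real) \<times> real => real"
  assumes m: "integrable lborel (\<lambda>z. m z * (indicator {0<..<T} (snd (fst z)) * indicator {0<..<T} (snd z)))"
    and ineq: "\<And>\<kappa>. \<kappa> \<in> test_functions {0<..<T} ==> (\<And>t. \<kappa> t \<ge> 0) ==>
      0 \<le> (LBINT z. m z * (dir_deriv 1 \<kappa> (snd (fst z)) * \<kappa> (snd z) + \<kappa> (snd (fst z)) * dir_deriv 1 \<kappa> (snd z)))"
    and \<eta>: "\<eta> > 0" and r: "0 < r1" "r1 \<le> r2" "r2 + \<eta> < T"
  defines "J \<equiv> \<lambda>r. LBINT z. m z * (indicator {0<..<T} (snd (fst z)) * indicator {0<..<T} (snd z)) * (kernel r \<eta> (snd (fst z)) * kernel r \<eta> (snd z))"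
  shows "J r2 \<le> J r1"
proof (rule DERIV_nonpos_imp_nonincreasing[OF r(2)])
  fix r assume r': "r1 \<le> r" "r \<le> r2"
  define M where "M z = m z * (indicator {0<..<T} (snd (fst z)) * indicator {0<..<T} (snd z))" for z
  have Mi: "integrable lborel M" using m by (simp add: M_def[abs_def])
  note [measurable] = borel_measurable_integrable[OF Mi]
  let ?k = "kernel 0 \<eta>" and ?k' = "dir_deriv 1 (kernel 0 \<eta>)"
  note kt = kernel_test[OF \<eta>, of 0]
  note [measurable] = test_function_borel[OF kt] test_function_borel[OF test_function_dir_deriv[OF kt]]
  obtain B where B: "B > 0" "\<And>t. \<bar>?k t\<bar> \<le> B" using test_function_bounded[OF kt] by metis
  obtain B' where B': "\<And>t. \<bar>?k' t\<bar> \<le> B'" using test_function_bounded[OF test_function_dir_deriv[OF kt]] by metis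
  obtain L where L: "L > 0" "\<And>s t. \<bar>?k s - ?k t\<bar> \<le> L * norm (s - t)" using test_function_lipschitz[OF kt] by metis
  define P where "P r z = ?k (snd (fst z) - r) * ?k (snd z - r)" for r and z :: "((real^'n) \<times> real) \<times> real"
  define P' where "P' r z = - (?k' (snd (fst z) - r) * ?k (snd z - r) + ?k (snd (fst z) - r) * ?k' (snd z - r))" for r and z :: "((real^'n) \<times> real) \<times> real"
  have kd: "((\<lambda>r. ?k (t - r)) has_real_derivative - ?k' (t - r)) (at r)" for t r
    by (rule DERIV_cong[OF DERIV_chain2[OF dir_deriv_real[OF test_function_Ck[OF kt]]]]) (auto intro!: derivative_eq_intros)
  have Pd: "((\<lambda>r. P r z) has_real_derivative P' r z) (at r)" for r z
    unfolding P_def P'_def by (rule DERIV_cong[OF DERIV_mult[OF kd kd]]) simp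
  have bounded_mult: "integrable lborel (\<lambda>z. h z * M z)"
    if "h \<in> Borel" "\<And>z. \<bar>h z\<bar> \<le> c" for h :: "((real^'n) \<times> real) \<times> real => real" and c
    using powr_integrable_bounded_mult[of lborel 1 M h c] Mi that by (simp add: powr_integrable_1)
  have PB: "\<bar>P r z\<bar> \<le> B * B" for r z
    unfolding P_def abs_mult using B by (intro mult_mono) auto
  have P'B: "\<bar>P' r z\<bar> \<le> B' * B + B * B'" for r z
  proof -
    have "\<bar>?k' (snd (fst z) - r) * ?k (snd z - r)\<bar> \<le> B' * B" "\<bar>?k (snd (fst z) - r) * ?k' (snd z - r)\<bar> \<le> B * B'"
      unfolding abs_mult using B B' order_trans[OF abs_ge_zero B'] by (auto intro!: mult_mono)
    then show ?thesis unfolding P'_def by linarith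
  qed
  have "((\<lambda>r. LBINT z. P r z * M z) has_derivative (\<lambda>h. \<Sum>b\<in>Basis. (h \<bullet> b) * (LBINT z. P' r z * M z))) (at r)"
  proof (rule has_derivative_integral[where K="\<lambda>r z. P r z * M z" and k="\<lambda>b z. P' r z * M z" and G="\<lambda>z. 2 * B * L * \<bar>M z\<bar>"])
    have "(\<lambda>z. P r z) \<in> Borel" for r unfolding P_def by measurable
    then show "integrable lborel (\<lambda>z. P r z * M z)" for r by (rule bounded_mult[OF _ PB])
    have "(\<lambda>z. P' r z) \<in> Borel" unfolding P'_def by measurable
    then show "integrable lborel (\<lambda>z. P' r z * M z)" by (rule bounded_mult[OF _ P'B])
    fix z
    have "((\<lambda>r. P r z * M z) has_real_derivative P' r z * M z) (at r)" by (rule DERIV_cmult_right[OF Pd])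
    then show "((\<lambda>r. P r z * M z) has_derivative (\<lambda>h. \<Sum>b\<in>Basis. (h \<bullet> b) * (P' r z * M z))) (at r)"
      unfolding has_field_derivative_def by (rule has_derivative_eq_rhs) (auto simp: fun_eq_iff mult.commute)
    fix r' :: real
    have "P r' z - P r z = (?k (snd (fst z) - r') - ?k (snd (fst z) - r)) * ?k (snd z - r') + ?k (snd (fst z) - r) * (?k (snd z - r') - ?k (snd z - r))"
      by (simp add: P_def algebra_simps)
    also have "\<bar>\<dots>\<bar> \<le> (L * norm (r' - r)) * B + B * (L * norm (r' - r))"
    proof -
      have "\<bar>?k (t - r') - ?k (t - r)\<bar> \<le> L * norm (r' - r)" for t
        using L(2)[of "t - r'" "t - r"] by (simp add: abs_minus_commute)
      then have "\<bar>(?k (snd (fst z) - r') - ?k (snd (fst z) - r)) * ?k (snd z - r')\<bar> \<le> (L * norm (r' - r)) * B"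
        "\<bar>?k (snd (fst z) - r) * (?k (snd z - r') - ?k (snd z - r))\<bar> \<le> B * (L * norm (r' - r))"
        unfolding abs_mult using B L(1) by (auto intro!: mult_mono)
      then show ?thesis by linarith
    qed
    also have "\<dots> = 2 * B * L * norm (r' - r)" by simp
    finally have "\<bar>P r' z - P r z\<bar> \<le> 2 * B * L * norm (r' - r)" .
    from mult_right_mono[OF this abs_ge_zero[of "M z"]]
    have "\<bar>(P r' z - P r z) * M z\<bar> \<le> 2 * B * L * \<bar>M z\<bar> * norm (r' - r)"
      unfolding abs_mult by (simp add: mult_ac)
    then show "\<bar>P r' z * M z - P r z * M z\<bar> \<le> 2 * B * L * \<bar>M z\<bar> * norm (r' - r)"
      unfolding left_diff_distrib[of "P r' z"] .
  qed (use Mi in auto)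
  moreover have "J = (\<lambda>r. LBINT z. P r z * M z)"
  proof
    fix r show "J r = (LBINT z. P r z * M z)"
      unfolding J_def P_def M_def by (simp only: kernel_shift[of r \<eta>] mult_ac)
  qed
  ultimately have "(J has_derivative (\<lambda>h. h * (LBINT z. P' r z * M z))) (at r)" by simp
  then have "(J has_real_derivative (LBINT z. P' r z * M z)) (at r)"
    unfolding has_field_derivative_def by (rule has_derivative_eq_rhs) (auto simp: fun_eq_iff)
  moreover have "(LBINT z. P' r z * M z) \<le> 0"
  proof -
    have rr: "0 < r" "r + \<eta> < T" using r r' by auto
    note kr = kernel_test_interval[OF \<eta> rr]
    have k0: "kernel r \<eta> t = 0" "dir_deriv 1 (kernel r \<eta>) t = 0" if "t \<notin> {0<..<T}" for t
    proof -
      obtain K where "K \<subseteq> {0<..<T}" "\<And>t. t \<notin> K ==> kernel r \<eta> t = 0" "\<And>b t. t \<notin> K ==> dir_deriv b (kernel r \<eta>) t = 0"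
        using test_function_support[OF kr] by metis
      then show "kernel r \<eta> t = 0" "dir_deriv 1 (kernel r \<eta>) t = 0" using that by blast+
    qed
    have dk: "dir_deriv 1 (kernel r \<eta>) t = ?k' (t - r)" for t
    proof -
      have "(kernel r \<eta> has_real_derivative ?k' (t - r)) (at t)"
        unfolding kernel_shift[of r, abs_def]
        by (rule DERIV_cong[OF DERIV_chain2[OF dir_deriv_real[OF test_function_Ck[OF kt]]]]) (auto intro!: derivative_eq_intros)
      then show ?thesis using dir_deriv_eqI[of "kernel r \<eta>" _ t 1] by (simp add: has_field_derivative_def)
    qed
    have eq: "P' r z * M z = - (m z * (dir_deriv 1 (kernel r \<eta>) (snd (fst z)) * kernel r \<eta> (snd z) + kernel r \<eta> (snd (fst z)) * dir_deriv 1 (kernel r \<eta>) (snd z)))" for z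
    proof (cases "snd (fst z) \<in> {0<..<T} \<and> snd z \<in> {0<..<T}")
      case True
      then show ?thesis by (simp add: P'_def M_def dk kernel_shift[of r] algebra_simps)
    next
      case False
      then have "M z = 0" by (auto simp: M_def)
      have "dir_deriv 1 (kernel r \<eta>) (snd (fst z)) * kernel r \<eta> (snd z) = 0" "kernel r \<eta> (snd (fst z)) * dir_deriv 1 (kernel r \<eta>) (snd z) = 0"
        using k0 False by auto
      then show ?thesis by (simp only: \<open>M z = 0\<close> mult_zero_right add_0 minus_zero)
    qed
    show ?thesis unfolding eq using ineq[OF kr kernel_nonneg[OF \<eta>]] by simp
  qed
  ultimately show "\<exists>y. DERIV J r :> y \<and> y \<le> 0" by blast
qed

lemma abs_max_diff: "\<bar>max (a - b) 0 - max (c - d) 0\<bar> \<le> \<bar>a - c\<bar> + \<bar>b - d\<bar>" for a b c d :: real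
  by (auto simp: max_def abs_if)

text \<open>The curve is continuous in the mean on the open interval and attains the initial value; \<open>y\<close> is the function on the cylinder that it describes.\<close>
definition L1_curve :: "real => ((real^'n) \<times> real => real) => (real => real^'n => real) => (real^'n => real) => bool" where
  "L1_curve T y V V0 \<longleftrightarrow> integrable lborel y \<and> integrable lborel V0 \<and>
     (\<forall>t\<in>{0<..<T}. integrable lborel (V t) \<and> ((\<lambda>s. LBINT x. \<bar>V s x - V t x\<bar>) \<longlongrightarrow> 0) (at t)) \<and>
     (AE t\<in>{0<..<T} in lborel. (AE x in lborel. y (x, t) = V t x)) \<and>
     ((\<lambda>t. LBINT x. \<bar>V t x - V0 x\<bar>) \<longlongrightarrow> 0) (at_right 0)"

lemma curve_average:
  fixes y :: "(real^'n) \<times> real => real"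
  assumes c: "L1_curve T y V V0" and r: "r \<in> {0<..<T}" and e: "\<And>j. e j > 0" "e \<longlonglongrightarrow> 0"
  shows "integrable lborel (\<lambda>z. indicator {0<..<T} (snd z) * \<bar>y z - V r (fst z)\<bar>)"
    and "(\<lambda>j::nat. LBINT z. indicator {0<..<T} (snd z) * \<bar>y z - V r (fst z)\<bar> * kernel r (e j) (snd z)) \<longlonglongrightarrow> 0"
proof -
  have y: "integrable lborel y" and Vi: "\<And>t. t \<in> {0<..<T} ==> integrable lborel (V t)"
    and Vc: "\<And>t. t \<in> {0<..<T} ==> ((\<lambda>s. LBINT x. \<bar>V s x - V t x\<bar>) \<longlongrightarrow> 0) (at t)"
    and ae: "AE t\<in>{0<..<T} in lborel. (AE x in lborel. y (x, t) = V t x)"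
    using c by (auto simp: L1_curve_def)
  have ym: "y \<in> Borel" and [measurable]: "V r \<in> Borel"
    using borel_measurable_integrable[OF y] borel_measurable_integrable[OF Vi[OF r]] by auto
  note [measurable] = ym
  define h where "h z = indicator {0<..<T} (snd z) * \<bar>y z - V r (fst z)\<bar>" for z
  have h: "integrable lborel h"
  proof (rule Bochner_Integration.integrable_bound)
    show "integrable lborel (\<lambda>z. \<bar>y z\<bar> + \<bar>V r (fst z)\<bar> * indicator {0<..<T} (snd z))"
      using y Vi[OF r] by (intro Bochner_Integration.integrable_add integrable_abs integrable_product integrable_indicator_bounded) auto
    show "AE z in lborel. norm (h z) \<le> norm (\<bar>y z\<bar> + \<bar>V r (fst z)\<bar> * indicator {0<..<T} (snd z))"
      by (intro AE_I2) (auto simp: h_def indicator_def)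
  qed (simp add: h_def[abs_def])
  then show "integrable lborel (\<lambda>z. indicator {0<..<T} (snd z) * \<bar>y z - V r (fst z)\<bar>)" by (simp add: h_def[abs_def])
  define M where "M t = (LBINT x. \<bar>V t x - V r x\<bar>)" for t
  have "(\<lambda>j. LBINT t. (LBINT x. h (x, t)) * kernel r (e j) t) \<longlonglongrightarrow> M r"
  proof (rule kernel_limit[OF integrable_section_integral[OF h] _ _ r e])
    show "(M \<longlongrightarrow> M r) (at r)" using Vc[OF r] by (simp add: M_def[abs_def])
    show "AE t\<in>{0<..<T} in lborel. (LBINT x. h (x, t)) = M t"
      using ae
    proof eventually_elim
      case (elim t)
      show ?case
      proof
        assume t: "t \<in> {0<..<T}"
        note [measurable] = borel_measurable_integrable[OF Vi[OF t]] borel_measurable_section(1)[OF ym, of t]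
        have "AE x in lborel. y (x, t) = V t x" using elim t by auto
        then show "(LBINT x. h (x, t)) = M t"
          unfolding M_def h_def using t by (intro integral_cong_AE) (auto elim!: eventually_mono)
      qed
    qed
  qed
  moreover have "(LBINT t. (LBINT x. h (x, t)) * kernel r (e j) t) = (LBINT z. h z * kernel r (e j) (snd z))" for j
  proof -
    obtain B where B: "\<And>t. \<bar>kernel r (e j) t\<bar> \<le> B" using test_function_bounded[OF kernel_test[OF e(1)]] by metis
    have "powr_integrable lborel 1 (\<lambda>z. kernel r (e j) (snd z) * h z)"
      by (rule powr_integrable_bounded_mult[OF _ _ B]) (use h in \<open>auto simp: powr_integrable_1\<close>)
    then have "integrable lborel (\<lambda>z. h z * kernel r (e j) (snd z))" by (simp add: powr_integrable_1 mult.commute)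
    from integral_sections[OF this] show ?thesis by simp
  qed
  ultimately show "(\<lambda>j::nat. LBINT z. indicator {0<..<T} (snd z) * \<bar>y z - V r (fst z)\<bar> * kernel r (e j) (snd z)) \<longlonglongrightarrow> 0"
    by (simp add: h_def M_def)
qed

text \<open>Replacing \<open>y\<close> and \<open>y'\<close> by the slices at \<open>r\<close> costs two averages that tend to zero by continuity, and the kernels have integral one.\<close>
lemma doubled_average_limit:
  fixes y y' :: "(real^'n) \<times> real => real"
  assumes v: "L1_curve T y V V0" and w: "L1_curve T y' W W0" and r: "r \<in> {0<..<T}" and \<epsilon>: "\<And>j. \<epsilon> j > 0" "\<epsilon> \<longlonglongrightarrow> 0"
  defines "m \<equiv> \<lambda>z. max (y (fst z) - y' (fst (swap23 z))) 0"
  shows "integrable lborel (\<lambda>z. m z * (indicator {0<..<T} (snd (fst z)) * indicator {0<..<T} (snd z)))"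
    and "(\<lambda>j::nat. LBINT z. m z * (indicator {0<..<T} (snd (fst z)) * indicator {0<..<T} (snd z)) *
        (kernel r (\<epsilon> j) (snd (fst z)) * kernel r (\<epsilon> j) (snd z))) \<longlonglongrightarrow> (LBINT x. max (V r x - W r x) 0)"
proof -
  have y: "integrable lborel y" "integrable lborel y'" and Vi: "integrable lborel (V r)" "integrable lborel (W r)"
    using v w r by (auto simp: L1_curve_def)
  have [measurable]: "y \<in> Borel" "y' \<in> Borel" "V r \<in> Borel" "W r \<in> Borel"
    using borel_measurable_integrable[OF y(1)] borel_measurable_integrable[OF y(2)] borel_measurable_integrable[OF Vi(1)] borel_measurable_integrable[OF Vi(2)] by auto
  let ?I = "indicator {0<..<T} :: real => real"
  have II: "integrable lborel ?I" by (rule integrable_indicator_bounded) auto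
  have [measurable]: "m \<in> Borel" unfolding m_def by measurable
  have prod: "integrable lborel (\<lambda>z :: ((real^'n) \<times> real) \<times> real. h (fst z) * k (snd z))"
    and prod': "integrable lborel (\<lambda>z :: ((real^'n) \<times> real) \<times> real. h (fst (swap23 z)) * k (snd (swap23 z)))"
    and prodi: "(LBINT z. h (fst z) * k (snd z)) = (LBINT w. h w) * (LBINT s. k s)"
    and prodi': "(LBINT z. h (fst (swap23 z)) * k (snd (swap23 z))) = (LBINT w. h w) * (LBINT s. k s)"
    if "integrable lborel h" "integrable lborel k" for h :: "(real^'n) \<times> real => real" and k :: "real => real"
  proof -
    show i: "integrable lborel (\<lambda>z :: ((real^'n) \<times> real) \<times> real. h (fst z) * k (snd z))"
      and e: "(LBINT z. h (fst z) * k (snd z)) = (LBINT w. h w) * (LBINT s. k s)"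
      by (rule integrable_product[OF that], rule integral_product[OF that])
    then have m: "(\<lambda>z :: ((real^'n) \<times> real) \<times> real. h (fst z) * k (snd z)) \<in> Borel"
      using borel_measurable_integrable by fastforce
    show "integrable lborel (\<lambda>z :: ((real^'n) \<times> real) \<times> real. h (fst (swap23 z)) * k (snd (swap23 z)))"
      using integrable_swap23[OF m] i by simp
    show "(LBINT z. h (fst (swap23 z)) * k (snd (swap23 z))) = (LBINT w. h w) * (LBINT s. k s)"
      using integral_swap23[OF m] e by simp
  qed
  define M where "M z = m z * (?I (snd (fst z)) * ?I (snd z))" for z
  show Mi: "integrable lborel (\<lambda>z. m z * (?I (snd (fst z)) * ?I (snd z)))"
  proof (rule Bochner_Integration.integrable_bound)
    show "integrable lborel (\<lambda>z. \<bar>y (fst z)\<bar> * ?I (snd z) + \<bar>y' (fst (swap23 z))\<bar> * ?I (snd (swap23 z)))"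
      using y II by (intro Bochner_Integration.integrable_add prod prod') auto
    show "AE z in lborel. norm (m z * (?I (snd (fst z)) * ?I (snd z))) \<le> norm (\<bar>y (fst z)\<bar> * ?I (snd z) + \<bar>y' (fst (swap23 z))\<bar> * ?I (snd (swap23 z)))"
      by (intro AE_I2) (auto simp: m_def indicator_def snd_swap23)
  qed measurable
  define F where "F = (LBINT x. max (V r x - W r x) 0)"
  have Fi: "integrable lborel (\<lambda>x. max (V r x - W r x) 0)" using Vi by (intro integrable_max) auto
  define h1 where "h1 z = ?I (snd z) * \<bar>y z - V r (fst z)\<bar>" for z
  define h2 where "h2 z = ?I (snd z) * \<bar>y' z - W r (fst z)\<bar>" for z
  note c1 = curve_average[OF v r \<epsilon>, folded h1_def] and c2 = curve_average[OF w r \<epsilon>, folded h2_def]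
  have ev: "\<forall>\<^sub>F j in sequentially. \<epsilon> j < T - r" using r by (intro order_tendstoD(2)[OF \<epsilon>(2)]) auto
  have "\<forall>\<^sub>F j in sequentially. norm ((LBINT z. M z * (kernel r (\<epsilon> j) (snd (fst z)) * kernel r (\<epsilon> j) (snd z))) - F)
      \<le> (LBINT z. h1 z * kernel r (\<epsilon> j) (snd z)) + (LBINT z. h2 z * kernel r (\<epsilon> j) (snd z))"
    using ev
  proof eventually_elim
    case (elim j)
    let ?k = "kernel r (\<epsilon> j)"
    note k1 = kernel_integral[OF \<epsilon>(1)[of j], of r]
    have kn: "?k t \<ge> 0" for t by (rule kernel_nonneg[OF \<epsilon>(1)])
    have k0: "?k t = 0" if "t \<notin> {0<..<T}" for t
      using that r elim by (intro kernel_eq_0[OF \<epsilon>(1)]) auto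
    obtain B where B: "\<And>t. \<bar>?k t\<bar> \<le> B" using test_function_bounded[OF kernel_test[OF \<epsilon>(1)]] by metis
    have B0: "B \<ge> 0" using order_trans[OF abs_ge_zero B] .
    have bm: "integrable lborel (\<lambda>z. h z * ?k (snd z))" if "integrable lborel h" for h :: "(real^'n) \<times> real => real"
    proof -
      have "powr_integrable lborel 1 (\<lambda>z. ?k (snd z) * h z)"
        by (rule powr_integrable_bounded_mult[OF _ _ B]) (use that in \<open>auto simp: powr_integrable_1\<close>)
      then show ?thesis by (simp add: powr_integrable_1 mult.commute)
    qed
    have Mk: "integrable lborel (\<lambda>z. M z * (?k (snd (fst z)) * ?k (snd z)))"
    proof -
      have "powr_integrable lborel 1 (\<lambda>z. (?k (snd (fst z)) * ?k (snd z)) * M z)"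
      proof (rule powr_integrable_bounded_mult[where B="B * B"])
        show "powr_integrable lborel 1 M" using Mi by (simp add: powr_integrable_1 M_def[abs_def])
        show "\<bar>?k (snd (fst z)) * ?k (snd z)\<bar> \<le> B * B" for z :: "((real^'n) \<times> real) \<times> real"
          unfolding abs_mult using B B0 by (intro mult_mono) auto
      qed auto
      then show ?thesis by (simp add: powr_integrable_1 mult.commute)
    qed
    let ?Fz = "\<lambda>z :: ((real^'n) \<times> real) \<times> real. (max (V r (fst (fst z)) - W r (fst (fst z))) 0 * ?k (snd (fst z))) * ?k (snd z)"
    have Fk: "integrable lborel ?Fz" and FkI: "(LBINT z. ?Fz z) = F"
      using prod[OF integrable_product[OF Fi k1(2)] k1(2)] prodi[OF integrable_product[OF Fi k1(2)] k1(2)] integral_product[OF Fi k1(2)] k1(1)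
      by (simp_all add: F_def)
    let ?R = "\<lambda>z. (h1 (fst z) * ?k (snd (fst z))) * ?k (snd z) + (h2 (fst (swap23 z)) * ?k (snd (fst (swap23 z)))) * ?k (snd (swap23 z))"
    have Ri: "integrable lborel (\<lambda>z. (h1 (fst z) * ?k (snd (fst z))) * ?k (snd z))"
        "integrable lborel (\<lambda>z. (h2 (fst (swap23 z)) * ?k (snd (fst (swap23 z)))) * ?k (snd (swap23 z)))"
      and RI: "(LBINT z. (h1 (fst z) * ?k (snd (fst z))) * ?k (snd z)) = (LBINT z. h1 z * ?k (snd z))"
        "(LBINT z. (h2 (fst (swap23 z)) * ?k (snd (fst (swap23 z)))) * ?k (snd (swap23 z))) = (LBINT z. h2 z * ?k (snd z))"
      using prod[OF bm[OF c1(1)] k1(2)] prod'[OF bm[OF c2(1)] k1(2)] prodi[OF bm[OF c1(1)] k1(2)] prodi'[OF bm[OF c2(1)] k1(2)] k1(1) by simp_all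
    have "norm ((LBINT z. M z * (?k (snd (fst z)) * ?k (snd z))) - F) = \<bar>LBINT z. M z * (?k (snd (fst z)) * ?k (snd z)) - ?Fz z\<bar>"
      using Mk Fk FkI by simp
    also have "\<dots> \<le> (LBINT z. \<bar>M z * (?k (snd (fst z)) * ?k (snd z)) - ?Fz z\<bar>)" by (rule integral_abs_bound)
    also have "\<dots> \<le> (LBINT z. ?R z)"
    proof (rule integral_mono)
      show "integrable lborel (\<lambda>z. \<bar>M z * (?k (snd (fst z)) * ?k (snd z)) - ?Fz z\<bar>)" using Mk Fk by auto
      show "integrable lborel ?R" using Ri by (rule Bochner_Integration.integrable_add)
      fix z :: "((real^'n) \<times> real) \<times> real"
      show "\<bar>M z * (?k (snd (fst z)) * ?k (snd z)) - ?Fz z\<bar> \<le> ?R z"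
      proof (cases "snd (fst z) \<in> {0<..<T} \<and> snd z \<in> {0<..<T}")
        case True
        let ?kk = "?k (snd (fst z)) * ?k (snd z)"
        have kk: "?kk \<ge> 0" using kn by simp
        have "M z * ?kk - ?Fz z = (m z - max (V r (fst (fst z)) - W r (fst (fst z))) 0) * ?kk"
          using True by (simp add: M_def algebra_simps)
        also have "\<bar>\<dots>\<bar> \<le> (\<bar>y (fst z) - V r (fst (fst z))\<bar> + \<bar>y' (fst (swap23 z)) - W r (fst (fst z))\<bar>) * ?kk"
          unfolding abs_mult[of _ ?kk] abs_of_nonneg[OF kk] m_def using kk by (intro mult_right_mono abs_max_diff)
        also have "\<dots> = ?R z" using True by (simp add: h1_def h2_def fst_swap23 snd_swap23 algebra_simps)
        finally show ?thesis .
      next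
        case False
        then have "?k (snd (fst z)) * ?k (snd z) = 0" using k0 by auto
        then show ?thesis by (auto simp: fst_swap23 snd_swap23)
      qed
    qed
    also have "\<dots> = (LBINT z. h1 z * ?k (snd z)) + (LBINT z. h2 z * ?k (snd z))"
      using Ri RI by simp
    finally show ?case .
  qed
  from LIM_zero_cancel[OF Lim_null_comparison[OF this tendsto_add_zero[OF c1(2) c2(2)]]]
  show "(\<lambda>j::nat. LBINT z. m z * (?I (snd (fst z)) * ?I (snd z)) *
        (kernel r (\<epsilon> j) (snd (fst z)) * kernel r (\<epsilon> j) (snd z))) \<longlonglongrightarrow> (LBINT x. max (V r x - W r x) 0)"
    by (simp add: M_def F_def)
qed

text \<open>The integral of \<open>max (V r - W r) 0\<close> is nonincreasing in \<open>r\<close> and tends to zero as \<open>r \<rightarrow> 0\<close>.\<close>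
lemma comparison_from_doubling:
  fixes y y' :: "(real^'n) \<times> real => real"
  assumes v: "L1_curve T y V V0" and w: "L1_curve T y' W W0" and init: "AE x in lborel. V0 x \<le> W0 x"
    and ineq: "\<And>\<kappa>. \<kappa> \<in> test_functions {0<..<T} ==> (\<And>t. \<kappa> t \<ge> 0) ==>
      0 \<le> (LBINT z. max (y (fst z) - y' (fst (swap23 z))) 0 *
        (dir_deriv 1 \<kappa> (snd (fst z)) * \<kappa> (snd z) + \<kappa> (snd (fst z)) * dir_deriv 1 \<kappa> (snd z)))"
  shows "AE t\<in>{0<..<T} in lborel. (AE x in lborel. y (x, t) \<le> y' (x, t))"
proof -
  define F where "F r = (LBINT x. max (V r x - W r x) 0)" for r
  have Vi: "integrable lborel (V t)" "integrable lborel (W t)" if "t \<in> {0<..<T}" for t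
    using v w that by (auto simp: L1_curve_def)
  have V0: "integrable lborel V0" "integrable lborel W0" using v w by (auto simp: L1_curve_def)
  have mono: "F r2 \<le> F r1" if r: "0 < r1" "r1 \<le> r2" "r2 < T" for r1 r2
  proof -
    \<comment> \<open>Kernels look to the right of \<open>r\<close>, so the widths must keep \<open>r2 + e j\<close> below \<open>T\<close>.\<close>
    define e where "e j = (T - r2) / real (Suc (Suc j))" for j :: nat
    have e: "e j > 0" "r2 + e j < T" for j
    proof -
      show "e j > 0" using r by (simp add: e_def)
      have "(T - r2) * 1 < (T - r2) * real (Suc (Suc j))" using r by (intro mult_strict_left_mono) auto
      then have "e j < T - r2" unfolding e_def by (subst divide_less_eq) auto
      then show "r2 + e j < T" by simp
    qed
    have "(\<lambda>j. (T - r2) * (1 / real (Suc (Suc j)))) \<longlonglongrightarrow> (T - r2) * 0"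
      using LIMSEQ_Suc[OF LIMSEQ_inverse_real_of_nat] by (intro tendsto_intros) (simp add: inverse_eq_divide)
    then have e0: "e \<longlonglongrightarrow> 0" by (simp add: e_def[abs_def])
    have r': "r1 \<in> {0<..<T}" "r2 \<in> {0<..<T}" using r by auto
    show ?thesis unfolding F_def
      by (rule LIMSEQ_le[OF doubled_average_limit(2)[OF v w r'(2) e(1) e0] doubled_average_limit(2)[OF v w r'(1) e(1) e0]],
          intro exI allI impI, rule doubled_average_decreasing[OF doubled_average_limit(1)[OF v w r'(1) e(1) e0] ineq e(1) r(1,2) e(2)])
  qed
  have F0: "F r \<le> 0" if r: "r \<in> {0<..<T}" for r
  proof (rule tendsto_lowerbound)
    have "((\<lambda>t. (LBINT x. \<bar>V t x - V0 x\<bar>) + (LBINT x. \<bar>W t x - W0 x\<bar>)) \<longlongrightarrow> 0 + 0) (at_right 0)"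
      using v w by (intro tendsto_add) (auto simp: L1_curve_def)
    then show "((\<lambda>t. (LBINT x. \<bar>V t x - V0 x\<bar>) + (LBINT x. \<bar>W t x - W0 x\<bar>)) \<longlongrightarrow> 0) (at_right 0)" by simp
    show "\<forall>\<^sub>F t in at_right 0. F r \<le> (LBINT x. \<bar>V t x - V0 x\<bar>) + (LBINT x. \<bar>W t x - W0 x\<bar>)"
    proof (rule eventually_mono[OF eventually_at_right_real[of 0 r]])
      fix t assume t: "t \<in> {0<..<r}"
      then have t': "t \<in> {0<..<T}" using r by auto
      have i: "integrable lborel (\<lambda>x. \<bar>V t x - V0 x\<bar>)" "integrable lborel (\<lambda>x. \<bar>W t x - W0 x\<bar>)" using Vi[OF t'] V0 by auto
      have "F r \<le> F t" using mono[of t r] t r by auto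
      also have "F t \<le> (LBINT x. \<bar>V t x - V0 x\<bar> + \<bar>W t x - W0 x\<bar>)" unfolding F_def
      proof (rule integral_mono_AE)
        show "integrable lborel (\<lambda>x. max (V t x - W t x) 0)" using Vi[OF t'] by (intro integrable_max) auto
        show "AE x in lborel. max (V t x - W t x) 0 \<le> \<bar>V t x - V0 x\<bar> + \<bar>W t x - W0 x\<bar>"
          using init by eventually_elim auto
      qed (use i in auto)
      also have "\<dots> = (LBINT x. \<bar>V t x - V0 x\<bar>) + (LBINT x. \<bar>W t x - W0 x\<bar>)" using i by simp
      finally show "F r \<le> (LBINT x. \<bar>V t x - V0 x\<bar>) + (LBINT x. \<bar>W t x - W0 x\<bar>)" .
    qed (use r in auto)
  qed auto
  have le: "AE x in lborel. V r x \<le> W r x" if r: "r \<in> {0<..<T}" for r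
  proof -
    have i: "integrable lborel (\<lambda>x. max (V r x - W r x) 0)" using Vi[OF r] by (intro integrable_max) auto
    have "(LBINT x. max (V r x - W r x) 0) = 0"
      using F0[OF r] unfolding F_def by (rule order_antisym) (simp add: Bochner_Integration.integral_nonneg)
    then have "AE x in lborel. max (V r x - W r x) 0 = 0" using integral_nonneg_eq_0_iff_AE[OF i] by simp
    then show ?thesis by eventually_elim (auto simp: max_def split: if_splits)
  qed
  have "AE t\<in>{0<..<T} in lborel. (AE x in lborel. y (x, t) = V t x)"
    "AE t\<in>{0<..<T} in lborel. (AE x in lborel. y' (x, t) = W t x)"
    using v w by (auto simp: L1_curve_def)
  then show ?thesis
  proof eventually_elim
    case (elim t)
    show ?case
    proof
      assume t: "t \<in> {0<..<T}"
      have "AE x in lborel. y (x, t) = V t x" "AE x in lborel. y' (x, t) = W t x" using elim t by auto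
      with le[OF t] show "AE x in lborel. y (x, t) \<le> y' (x, t)" by eventually_elim simp
    qed
  qed
qed

section \<open>Continuity of powers in the mean\<close>

lemma signed_power_continuous: "a > 0 ==> continuous_on UNIV (signed_power a)"
proof -
  assume a: "a > 0"
  have eq: "signed_power a = (\<lambda>s. max s 0 powr a - max (- s) 0 powr a)"
    by (auto simp: signed_power_def fun_eq_iff max_def sgn_if)
  show ?thesis unfolding eq by (intro continuous_intros continuous_on_powr') (use a in auto)
qed

lemma signed_power_scale: "M > 0 ==> signed_power a (M * s) = M powr a * signed_power a s"
  by (simp add: signed_power_def sgn_mult abs_mult powr_mult)

text \<open>For \<open>|s - t|\<close> small relative to \<open>max |t| 1\<close>, homogeneity reduces to uniform continuity on a compact interval; otherwise \<open>|s|\<close> and \<open>|t|\<close> are dominated by \<open>|s - t|\<close>. Since the exponent may be smaller or larger than one, no Lipschitz or Hoelder bound would cover all cases.\<close>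
lemma signed_power_modulus:
  assumes a: "a > 0" and e: "e > 0"
  obtains C where "C > 0" "\<And>s t. \<bar>signed_power a s - signed_power a t\<bar> \<le> e * (1 + \<bar>t\<bar> powr (a + 1)) + C * \<bar>s - t\<bar> powr (a + 1)"
proof -
  have "uniformly_continuous_on {-2..2} (signed_power a)"
    by (rule compact_uniformly_continuous[OF continuous_on_subset[OF signed_power_continuous[OF a]]]) auto
  then obtain d where d: "d > 0" "\<And>s t. s \<in> {-2..2} ==> t \<in> {-2..2} ==> \<bar>s - t\<bar> < d ==> \<bar>signed_power a s - signed_power a t\<bar> < e"
    unfolding uniformly_continuous_on_def dist_real_def using e by metis
  define k where "k = min (d / 2) 1"
  have k: "k > 0" "k < d" "k \<le> 1" using d by (auto simp: k_def)
  define C where "C = 2 * (1 + 1 / k) powr a / k"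
  show ?thesis
  proof (rule that[of C])
    have "0 < 1 + 1 / k" using k by (intro add_pos_pos) auto
    then have "0 < (1 + 1 / k) powr a" unfolding powr_gt_zero by linarith
    then show "C > 0" unfolding C_def using k by (intro divide_pos_pos mult_pos_pos) auto
    fix s t :: real
    \<comment> \<open>Dividing by \<open>M\<close> moves both arguments into a fixed compact interval.\<close>
    define M where "M = max \<bar>t\<bar> 1"
    have M: "M \<ge> 1" "\<bar>t\<bar> \<le> M" by (auto simp: M_def)
    show "\<bar>signed_power a s - signed_power a t\<bar> \<le> e * (1 + \<bar>t\<bar> powr (a + 1)) + C * \<bar>s - t\<bar> powr (a + 1)"
    proof (cases "\<bar>s - t\<bar> \<le> k * M")
      case True
      have st: "s / M - t / M = (s - t) / M" by (simp add: diff_divide_distrib)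
      have 1: "\<bar>s / M - t / M\<bar> \<le> k" unfolding st using True M by (simp add: abs_divide divide_le_eq)
      have 2: "\<bar>t / M\<bar> \<le> 1" using M by (simp add: abs_divide)
      have "s / M \<in> {-2..2}" "t / M \<in> {-2..2}" "\<bar>s / M - t / M\<bar> < d"
        unfolding atLeastAtMost_iff using 1 2 k by linarith+
      from d(2)[OF this] have "\<bar>signed_power a (s / M) - signed_power a (t / M)\<bar> < e" .
      then have "M powr a * \<bar>signed_power a (s / M) - signed_power a (t / M)\<bar> \<le> M powr a * e"
        by (intro mult_left_mono) auto
      moreover have "signed_power a s - signed_power a t = M powr a * (signed_power a (s / M) - signed_power a (t / M))"
        using M signed_power_scale[of M a "s / M"] signed_power_scale[of M a "t / M"] by (simp add: right_diff_distrib)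
      ultimately have "\<bar>signed_power a s - signed_power a t\<bar> \<le> M powr a * e" by (simp add: abs_mult)
      also have "M powr a \<le> M powr (a + 1)" using M by (intro powr_mono) auto
      also have "M powr (a + 1) \<le> 1 + \<bar>t\<bar> powr (a + 1)" unfolding M_def max_def by auto
      finally have "\<bar>signed_power a s - signed_power a t\<bar> \<le> (1 + \<bar>t\<bar> powr (a + 1)) * e" using e by simp
      moreover have "C * \<bar>s - t\<bar> powr (a + 1) \<ge> 0" using \<open>C > 0\<close> by simp
      ultimately show ?thesis by (simp add: mult.commute)
    next
      case False
      let ?x = "\<bar>s - t\<bar>"
      have x: "?x > k * M" "?x > 0" using False k M by (auto intro: order.strict_trans[of 0 "k * M"])
      have Mx: "M \<le> ?x / k" using x k by (simp add: le_divide_eq mult.commute)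
      have xk: "?x \<ge> k" using x M k mult_left_mono[of 1 M k] by linarith
      have b: "\<bar>s\<bar> \<le> (1 + 1 / k) * ?x" "\<bar>t\<bar> \<le> (1 + 1 / k) * ?x"
        using Mx M x by (auto simp: distrib_right)
      have "\<bar>s\<bar> powr a \<le> ((1 + 1 / k) * ?x) powr a" "\<bar>t\<bar> powr a \<le> ((1 + 1 / k) * ?x) powr a"
        using b a by (auto intro!: powr_mono2)
      then have "\<bar>signed_power a s - signed_power a t\<bar> \<le> 2 * ((1 + 1 / k) * ?x) powr a"
        using abs_signed_power[of a s] abs_signed_power[of a t] by linarith
      also have "\<dots> = 2 * (1 + 1 / k) powr a * ?x powr a" by (simp only: powr_mult mult.assoc)
      also have "\<dots> \<le> 2 * (1 + 1 / k) powr a * (?x powr (a + 1) / k)"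
      proof (intro mult_left_mono)
        have "?x powr a = ?x powr (a + 1) / ?x" using x by (simp add: powr_add)
        also have "\<dots> \<le> ?x powr (a + 1) / k" using xk k by (intro divide_left_mono) auto
        finally show "?x powr a \<le> ?x powr (a + 1) / k" .
      qed simp
      finally have "\<bar>signed_power a s - signed_power a t\<bar> \<le> C * ?x powr (a + 1)"
        by (simp add: C_def)
      moreover have "e * (1 + \<bar>t\<bar> powr (a + 1)) \<ge> 0" using e by simp
      ultimately show ?thesis by linarith
    qed
  qed
qed

lemma signed_power_integrable:
  fixes h :: "'a::euclidean_space => real"
  assumes a: "a > 0" and h: "powr_integrable lborel (a + 1) h" and S: "bounded S" "S \<in> sets borel" "\<And>x. x \<notin> S ==> h x = 0"
  shows "integrable lborel (\<lambda>x. signed_power a (h x))"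
proof (rule Bochner_Integration.integrable_bound)
  have [measurable]: "h \<in> Borel" using powr_integrable_borel[OF h] by simp
  show "integrable lborel (\<lambda>x. indicator S x + \<bar>h x\<bar> powr (a + 1))"
    using S by (intro Bochner_Integration.integrable_add integrable_indicator_bounded powr_integrable_integrable[OF h])
  show "(\<lambda>x. signed_power a (h x)) \<in> borel_measurable lborel" by measurable
  show "AE x in lborel. norm (signed_power a (h x)) \<le> norm (indicator S x + \<bar>h x\<bar> powr (a + 1))"
  proof (intro AE_I2)
    fix x
    show "norm (signed_power a (h x)) \<le> norm (indicator S x + \<bar>h x\<bar> powr (a + 1))"
    proof (cases "x \<in> S")
      case True
      have "\<bar>h x\<bar> powr a \<le> 1 + \<bar>h x\<bar> powr (a + 1)"
      proof (cases "\<bar>h x\<bar> \<le> 1")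
        case True
        then have "\<bar>h x\<bar> powr a \<le> 1" using a by (intro powr_le1) auto
        then show ?thesis using powr_ge_zero[of "\<bar>h x\<bar>" "a + 1"] by linarith
      next
        case False
        then have "\<bar>h x\<bar> powr a \<le> \<bar>h x\<bar> powr (a + 1)" by (intro powr_mono) auto
        then show ?thesis by linarith
      qed
      then show ?thesis using True by (simp add: abs_signed_power)
    qed (simp add: S(3) signed_power_def)
  qed
qed

text \<open>Continuity in \<open>L\<^sup>\<alpha>\<^sup>+\<^sup>1\<close> of the solution becomes continuity in the mean of the quantity under the time derivative.\<close>
lemma signed_power_L1_converges:
  fixes h :: "'i => 'a::euclidean_space => real"
  assumes a: "a > 0" and h: "\<forall>\<^sub>F n in F. powr_integrable lborel (a + 1) (h n) \<and> (\<forall>x. x \<notin> S --> h n x = 0)"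
    and h0: "powr_integrable lborel (a + 1) h0" "\<And>x. x \<notin> S ==> h0 x = 0" and S: "bounded S" "S \<in> sets borel"
    and lim: "((\<lambda>n. LBINT x. \<bar>h n x - h0 x\<bar> powr (a + 1)) \<longlongrightarrow> 0) F"
  shows "((\<lambda>n. LBINT x. \<bar>signed_power a (h n x) - signed_power a (h0 x)\<bar>) \<longlongrightarrow> 0) F"
proof (rule tendstoI)
  fix \<theta> :: real assume \<theta>: "\<theta> > 0"
  have wi: "integrable lborel (\<lambda>x. indicator S x + \<bar>h0 x\<bar> powr (a + 1))"
    using S by (intro Bochner_Integration.integrable_add integrable_indicator_bounded powr_integrable_integrable[OF h0(1)])
  define K where "K = (LBINT x. indicator S x + \<bar>h0 x\<bar> powr (a + 1))"
  have K: "K \<ge> 0" unfolding K_def by (intro Bochner_Integration.integral_nonneg) auto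
  define e where "e = \<theta> / (2 * (K + 1))"
  have e: "e > 0" "e * K < \<theta> / 2" using \<theta> K by (auto simp: e_def field_simps)
  obtain C where C: "C > 0" "\<And>s t. \<bar>signed_power a s - signed_power a t\<bar> \<le> e * (1 + \<bar>t\<bar> powr (a + 1)) + C * \<bar>s - t\<bar> powr (a + 1)"
    using signed_power_modulus[OF a e(1)] by blast
  have "\<forall>\<^sub>F n in F. (LBINT x. \<bar>h n x - h0 x\<bar> powr (a + 1)) < \<theta> / (2 * C)"
    using \<theta> C by (intro order_tendstoD(2)[OF lim]) auto
  with h show "\<forall>\<^sub>F n in F. dist (LBINT x. \<bar>signed_power a (h n x) - signed_power a (h0 x)\<bar>) 0 < \<theta>"
  proof eventually_elim
    case (elim n)
    have d: "powr_integrable lborel (a + 1) (\<lambda>x. h n x - h0 x)"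
      using elim a by (intro powr_integrable_diff h0) auto
    have "(LBINT x. \<bar>signed_power a (h n x) - signed_power a (h0 x)\<bar>)
        \<le> (LBINT x. e * (indicator S x + \<bar>h0 x\<bar> powr (a + 1)) + C * \<bar>h n x - h0 x\<bar> powr (a + 1))"
    proof (rule integral_mono)
      show "integrable lborel (\<lambda>x. \<bar>signed_power a (h n x) - signed_power a (h0 x)\<bar>)"
        using elim h0 S by (intro integrable_abs Bochner_Integration.integrable_diff signed_power_integrable[OF a, where S=S]) auto
      show "integrable lborel (\<lambda>x. e * (indicator S x + \<bar>h0 x\<bar> powr (a + 1)) + C * \<bar>h n x - h0 x\<bar> powr (a + 1))"
        by (intro Bochner_Integration.integrable_add integrable_mult_right wi powr_integrable_integrable[OF d])
      fix x
      show "\<bar>signed_power a (h n x) - signed_power a (h0 x)\<bar> \<le> e * (indicator S x + \<bar>h0 x\<bar> powr (a + 1)) + C * \<bar>h n x - h0 x\<bar> powr (a + 1)"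
        using C(2)[of "h n x" "h0 x"] elim h0(2)[of x] by (cases "x \<in> S") (auto simp: signed_power_def)
    qed
    also have "\<dots> = e * K + C * (LBINT x. \<bar>h n x - h0 x\<bar> powr (a + 1))"
      unfolding K_def using wi powr_integrable_integrable[OF d] by (subst Bochner_Integration.integral_add) auto
    also have "\<dots> < \<theta> / 2 + \<theta> / 2"
      using elim C(1) by (intro add_strict_mono e(2)) (simp add: field_simps)
    finally show ?case by simp
  qed
qed

section \<open>Caratheodory functions\<close>

text \<open>Approximate the arguments by simple functions: for constant arguments \<open>A\<close> is measurable in \<open>x\<close>, and the limit exists by continuity.\<close>
lemma caratheodory_representative:
  fixes \<Omega> :: "(real^'n) set" and A :: "real^'n => real => real^'n => real^'n"
    and u :: "(real^'n) \<times> real => real" and d :: "'n => (real^'n) \<times> real => real"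
  assumes \<Omega>: "open \<Omega>" and A: "caratheodory \<Omega> A" and u[measurable]: "u \<in> Borel"
    and d[measurable]: "\<And>i. d i \<in> Borel"
  obtains h where "h \<in> Borel"
    "AE z in lborel. fst z \<in> \<Omega> --> A (fst z) (u z) (\<chi> k. d k z) $ i = h z"
proof -
  have [measurable]: "\<Omega> \<in> sets borel" using \<Omega> by simp
  define f where "f z = (u z, (\<chi> k. d k z) :: real^'n)" for z
  have vm: "(\<lambda>z. (\<chi> k. d k z) :: real^'n) \<in> Borel"
  proof (subst borel_measurable_euclidean_space, intro ballI)
    fix b :: "real^'n" assume "b \<in> Basis"
    then obtain k where "b = axis k 1" by (auto simp: Basis_vec_def)
    then have "(\<lambda>z. (\<chi> k. d k z) \<bullet> b) = d k" by (auto simp: inner_axis)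
    then show "(\<lambda>z. (\<chi> k. d k z) \<bullet> b) \<in> Borel" by simp
  qed
  have fm: "f \<in> Borel" unfolding f_def[abs_def] by (intro borel_measurable_Pair u vm)
  have fm': "f \<in> borel_measurable lborel" using fm by simp
  from borel_measurable_implies_sequence_metric[OF this, of "(0, 0)"]
  obtain s where s: "\<And>j. simple_function lborel (s j)" "\<And>z. (\<lambda>j. s j z) \<longlonglongrightarrow> f z" by auto
  have "\<exists>h. h \<in> Borel \<and> (AE x\<in>\<Omega> in lborel. A x (fst c) (snd c) $ i = h x)" for c
  proof -
    have "(\<lambda>x. A x (fst c) (snd c)) \<in> borel_measurable (lebesgue_on \<Omega>)" using A by (simp add: caratheodory_def)
    then have "(\<lambda>x. A x (fst c) (snd c) \<bullet> axis i 1) \<in> borel_measurable (lebesgue_on \<Omega>)" by measurable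
    then have "(\<lambda>x. A x (fst c) (snd c) $ i) \<in> borel_measurable (lebesgue_on \<Omega>)" by (simp add: inner_axis)
    from borel_representative[OF this] obtain h where
      "h \<in> Borel" "AE x\<in>\<Omega> in lborel. A x (fst c) (snd c) $ i = h x" by auto
    then show ?thesis by (intro exI[of _ h]) simp
  qed
  then have "\<exists>H. \<forall>c. H c \<in> Borel \<and> (AE x\<in>\<Omega> in lborel. A x (fst c) (snd c) $ i = H c x)"
    by (intro choice allI)
  then obtain H where H: "\<And>c. H c \<in> Borel" "\<And>c. AE x\<in>\<Omega> in lborel. A x (fst c) (snd c) $ i = H c x" by blast
  define h where "h j z = (\<Sum>c\<in>range (s j). indicator (s j -` {c}) z * H c (fst z))" for j z
  have fin: "finite (range (s j))" for j using simple_functionD(1)[OF s(1)[of j]] by simp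
  have h_eq: "h j z = H (s j z) (fst z)" for j z
  proof -
    have "h j z = (\<Sum>c\<in>range (s j). if c = s j z then H c (fst z) else 0)"
      unfolding h_def by (intro sum.cong) (auto simp: indicator_def)
    then show ?thesis using fin[of j] by simp
  qed
  have hm[measurable]: "h j \<in> Borel" for j
  proof -
    have [measurable]: "s j -` {c} \<in> sets borel" for c using simple_functionD(2)[OF s(1)[of j], of "{c}"] by simp
    have [measurable]: "(\<lambda>z :: (real^'n) \<times> real. H c (fst z)) \<in> Borel" for c using H(1)[of c] by measurable
    show ?thesis unfolding h_def[abs_def] by measurable
  qed
  have ae: "AE z in lborel. fst z \<in> \<Omega> --> A (fst z) (fst (s j z)) (snd (s j z)) $ i = h j z" for j
  proof -
    have "AE x in lborel. \<forall>c\<in>range (s j). x \<in> \<Omega> --> A x (fst c) (snd c) $ i = H c x"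
      by (rule AE_finite_allI[OF fin H(2)])
    from AE_fst[OF this, where 'b=real] show ?thesis by eventually_elim (auto simp: h_eq)
  qed
  have ae': "AE z in lborel. \<forall>j. fst z \<in> \<Omega> --> A (fst z) (fst (s j z)) (snd (s j z)) $ i = h j z"
    unfolding AE_all_countable by (intro allI ae)
  have cont: "AE x\<in>\<Omega> in lborel. continuous_on UNIV (\<lambda>(u, \<xi>). A x u \<xi>)"
    using A by (simp add: caratheodory_def AE_lebesgue_on)
  show thesis
  proof (rule that[of "\<lambda>z. lim (\<lambda>j. h j z)"])
    show "(\<lambda>z. lim (\<lambda>j. h j z)) \<in> Borel" by (rule borel_measurable_lim_metric) simp
    show "AE z in lborel. fst z \<in> \<Omega> --> A (fst z) (u z) (\<chi> k. d k z) $ i = lim (\<lambda>j. h j z)"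
      using ae' AE_fst[OF cont, where 'b=real]
    proof eventually_elim
      case (elim z)
      show ?case
      proof
        assume z: "fst z \<in> \<Omega>"
        have c: "continuous_on UNIV (\<lambda>w. A (fst z) (fst w) (snd w))" using elim(2) z by (simp add: case_prod_beta')
        have "(\<lambda>j. A (fst z) (fst (s j z)) (snd (s j z))) \<longlonglongrightarrow> A (fst z) (fst (f z)) (snd (f z))"
          using continuous_on_tendsto_compose[OF c s(2)[of z]] by simp
        from tendsto_vec_nth[OF this, of i] have "(\<lambda>j. h j z) \<longlonglongrightarrow> A (fst z) (u z) (\<chi> k. d k z) $ i"
          using elim(1) z by (simp add: f_def)
        then show "A (fst z) (u z) (\<chi> k. d k z) $ i = lim (\<lambda>j. h j z)" by (rule limI[symmetric])
      qed
    qed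
  qed
qed

section \<open>From solutions to evolution data\<close>

text \<open>The common form of the growth bound and of the Lipschitz constant of the flux; its \<open>p i / (p i - 1)\<close>-th power is integrable.\<close>
definition dual_weight ::
    "real => ('n::finite => real) => (real^'n => real) => ('n => (real^'n) \<times> real => real) => 'n => (real^'n) \<times> real => real" where
  "dual_weight T p c d i z =
     indicator {0<..<T} (snd z) * (\<bar>c (fst z)\<bar> + (\<Sum>k\<in>UNIV. \<bar>d k z\<bar> powr p k)) powr ((p i - 1) / p i)"

lemma dual_weight_nonneg: "dual_weight T p c d i z \<ge> 0"
  by (simp add: dual_weight_def)

lemma dual_weight_powr_integrable:
  assumes p: "\<And>i. p i > 1" and c: "integrable lborel c" and d: "\<And>i. powr_integrable lborel (p i) (d i)"
  shows "powr_integrable lborel (p i / (p i - 1)) (dual_weight T p c d i)"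
proof -
  have [measurable]: "c \<in> Borel" "d k \<in> Borel" for k
    using borel_measurable_integrable[OF c] powr_integrable_borel[OF d] by auto
  let ?s = "\<lambda>z. \<bar>c (fst z)\<bar> + (\<Sum>k\<in>UNIV. \<bar>d k z\<bar> powr p k)"
  have s: "?s z \<ge> 0" for z by (intro add_nonneg_nonneg sum_nonneg) auto
  have m: "dual_weight T p c d i \<in> Borel" unfolding dual_weight_def[abs_def] by measurable
  have eq: "\<bar>dual_weight T p c d i z\<bar> powr (p i / (p i - 1))
      = indicator {0<..<T} (snd z) * \<bar>c (fst z)\<bar> + indicator {0<..<T} (snd z) * (\<Sum>k\<in>UNIV. \<bar>d k z\<bar> powr p k)" for z
  proof (cases "snd z \<in> {0<..<T}")
    case True
    have "\<bar>dual_weight T p c d i z\<bar> powr (p i / (p i - 1)) = ?s z powr ((p i - 1) / p i * (p i / (p i - 1)))"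
      using True by (simp add: dual_weight_def powr_powr)
    also have "(p i - 1) / p i * (p i / (p i - 1)) = 1" using p[of i] by simp
    finally show ?thesis using True s[of z] by simp
  qed (simp add: dual_weight_def)
  have "integrable lborel (\<lambda>z. \<bar>c (fst z)\<bar> * indicator {0<..<T} (snd z))"
    using c by (intro integrable_product integrable_abs integrable_indicator_bounded) auto
  then have 1: "integrable lborel (\<lambda>z. indicator {0<..<T} (snd z) * \<bar>c (fst z)\<bar>)" by (simp add: mult.commute)
  have 2: "integrable lborel (\<lambda>z. indicator {0<..<T} (snd z) * (\<Sum>k\<in>UNIV. \<bar>d k z\<bar> powr p k))"
  proof (rule Bochner_Integration.integrable_bound)
    show "integrable lborel (\<lambda>z. \<Sum>k\<in>UNIV. \<bar>d k z\<bar> powr p k)"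
      by (intro Bochner_Integration.integrable_sum powr_integrable_integrable d)
    show "AE z in lborel. norm (indicator {0<..<T} (snd z) * (\<Sum>k\<in>UNIV. \<bar>d k z\<bar> powr p k)) \<le> norm (\<Sum>k\<in>UNIV. \<bar>d k z\<bar> powr p k)"
      by (intro AE_I2) (auto simp: indicator_def)
    show "(\<lambda>z. indicator {0<..<T} (snd z) * (\<Sum>k\<in>UNIV. \<bar>d k z\<bar> powr p k)) \<in> borel_measurable lborel" by measurable
  qed
  show ?thesis unfolding powr_integrable_def eq using m Bochner_Integration.integrable_add[OF 1 2] by simp
qed

text \<open>Tonelli's theorem with the time variable outside.\<close>
lemma integrable_by_slices:
  fixes y :: "'a::euclidean_space \<times> real => real"
  assumes y[measurable]: "y \<in> Borel" and z: "\<And>x t. t \<notin> {0<..<T} ==> y (x, t) = 0"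
    and b: "AE t\<in>{0<..<T} in lborel. integrable lborel (\<lambda>x. y (x, t)) \<and> (LBINT x. \<bar>y (x, t)\<bar>) \<le> B"
  shows "integrable lborel y"
proof -
  have ym: "(\<lambda>(t, x). y (x, t)) \<in> borel_measurable (lborel \<Otimes>\<^sub>M lborel)"
  proof -
    have "(\<lambda>z. y (snd z, fst z)) \<in> Borel"
      by (rule measurable_compose[OF borel_measurable_Pair y]) measurable
    then show ?thesis by (simp add: case_prod_beta' lborel_prod)
  qed
  have "integrable (lborel \<Otimes>\<^sub>M lborel) (\<lambda>(t, x). y (x, t))"
  proof (rule lborel_pair.Fubini_integrable[OF ym])
    have "integrable lborel (\<lambda>t. LBINT x. \<bar>y (x, t)\<bar>)"
    proof (rule Bochner_Integration.integrable_bound)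
      show "integrable lborel (\<lambda>t. B * indicator {0<..<T} t :: real)"
        by (intro integrable_mult_right integrable_indicator_bounded) auto
      have "(\<lambda>(t, x). \<bar>y (x, t)\<bar>) \<in> borel_measurable (lborel \<Otimes>\<^sub>M lborel)"
        using borel_measurable_abs[OF ym] by (simp add: case_prod_beta')
      then show "(\<lambda>t. LBINT x. \<bar>y (x, t)\<bar>) \<in> borel_measurable lborel"
        by (rule lborel.borel_measurable_lebesgue_integral)
      show "AE t in lborel. norm (LBINT x. \<bar>y (x, t)\<bar>) \<le> norm (B * indicator {0<..<T} t)"
        using b
      proof eventually_elim
        case (elim t)
        have "(LBINT x. \<bar>y (x, t)\<bar>) \<ge> 0" by (intro Bochner_Integration.integral_nonneg) auto
        then show ?case using elim z[of t] by (cases "t \<in> {0<..<T}") auto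
      qed
    qed
    then show "integrable lborel (\<lambda>t. LBINT x. norm (case (t, x) of (t, x) => y (x, t)))" by simp
    show "AE t in lborel. integrable lborel (\<lambda>x. case (t, x) of (t, x) => y (x, t))"
      using b
    proof eventually_elim
      case (elim t) then show ?case using z[of t] by (cases "t \<in> {0<..<T}") auto
    qed
  qed
  from lborel_pair.integrable_product_swap[OF this] show ?thesis by (simp add: case_prod_beta' lborel_prod)
qed

text \<open>A continuous curve on a compact interval is bounded, which makes the power integrable over the cylinder.\<close>
lemma powers_of_curve:
  fixes \<Omega> :: "(real^'n) set" and u :: "(real^'n) \<times> real => real"
  assumes \<Omega>: "open \<Omega>" "bounded \<Omega>" and \<alpha>: "\<alpha> > 0" and T: "T > 0" and U: "U \<in> C_Lp \<Omega> T (\<alpha> + 1)"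
    and u0: "u0 \<in> Lp \<Omega> (\<alpha> + 1)" and init: "((\<lambda>t. Lp_norm \<Omega> (\<alpha> + 1) (\<lambda>x. U t x - u0 x)) \<longlongrightarrow> 0) (at_right 0)"
    and u[measurable]: "u \<in> Borel" and uz: "\<And>z. z \<notin> cylinder \<Omega> T ==> u z = 0"
    and uU: "AE t\<in>{0<..<T} in lborel. (AE x\<in>\<Omega> in lborel. u (x, t) = U t x)"
  obtains V V0 where "L1_curve T (\<lambda>z. signed_power \<alpha> (u z)) V V0"
    "AE x in lborel. V0 x = (if x \<in> \<Omega> then signed_power \<alpha> (u0 x) else 0)"
proof -
  have [measurable]: "\<Omega> \<in> sets borel" using \<Omega> by simp
  have "\<exists>h. t \<in> {0..T} --> h \<in> Borel \<and> (\<forall>x. x \<notin> \<Omega> --> h x = 0) \<and> (AE x\<in>\<Omega> in lborel. U t x = h x)" for t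
  proof (cases "t \<in> {0..T}")
    case True
    then have "U t \<in> borel_measurable (lebesgue_on \<Omega>)" using U by (auto simp: C_Lp_def Lp_def)
    then obtain h where "h \<in> Borel" "\<And>x. x \<notin> \<Omega> ==> h x = 0" "AE x\<in>\<Omega> in lborel. U t x = h x"
      by (rule borel_representative) auto
    then show ?thesis by (intro exI[of _ h]) simp
  qed auto
  then have "\<exists>U'. \<forall>t. t \<in> {0..T} --> U' t \<in> Borel \<and> (\<forall>x. x \<notin> \<Omega> --> U' t x = 0) \<and> (AE x\<in>\<Omega> in lborel. U t x = U' t x)"
    by (intro choice allI)
  then obtain U' where U'': "\<forall>t. t \<in> {0..T} --> U' t \<in> Borel \<and> (\<forall>x. x \<notin> \<Omega> --> U' t x = 0) \<and> (AE x\<in>\<Omega> in lborel. U t x = U' t x)"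
    by (rule exE)
  then have U': "\<And>t. t \<in> {0..T} ==> U' t \<in> Borel" "\<And>t x. t \<in> {0..T} ==> x \<notin> \<Omega> ==> U' t x = 0"
    "\<And>t. t \<in> {0..T} ==> AE x\<in>\<Omega> in lborel. U t x = U' t x" by blast+
  have Up: "powr_integrable lborel (\<alpha> + 1) (U' t)" if "t \<in> {0..T}" for t
    using Lp_iff[OF U'(1)[OF that] _ U'(2)[OF that] U'(3)[OF that], of "\<alpha> + 1"] U that by (auto simp: C_Lp_def)
  have "u0 \<in> borel_measurable (lebesgue_on \<Omega>)" using u0 by (simp add: Lp_def)
  then obtain b0 where b0: "b0 \<in> Borel" "\<And>x. x \<notin> \<Omega> ==> b0 x = 0" "AE x\<in>\<Omega> in lborel. u0 x = b0 x"
    by (rule borel_representative) auto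
  have b0p: "powr_integrable lborel (\<alpha> + 1) b0" using Lp_iff[OF b0(1) _ b0(2,3), of "\<alpha> + 1"] u0 by simp
  have lim: "((\<lambda>s. LBINT x. \<bar>signed_power \<alpha> (U' s x) - signed_power \<alpha> (h x)\<bar>) \<longlongrightarrow> 0) F"
    if h: "powr_integrable lborel (\<alpha> + 1) h" "\<And>x. x \<notin> \<Omega> ==> h x = 0" "AE x\<in>\<Omega> in lborel. k x = h x"
      and F: "\<forall>\<^sub>F s in F. s \<in> {0..T}" and l: "((\<lambda>s. Lp_norm \<Omega> (\<alpha> + 1) (\<lambda>x. U s x - k x)) \<longlongrightarrow> 0) F" for h k F
  proof (rule signed_power_L1_converges[OF \<alpha> _ h(1,2) \<Omega>(2)])
    have hm: "h \<in> Borel" using powr_integrable_borel[OF h(1)] by simp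
    show "\<forall>\<^sub>F s in F. powr_integrable lborel (\<alpha> + 1) (U' s) \<and> (\<forall>x. x \<notin> \<Omega> --> U' s x = 0)"
      using F by eventually_elim (use Up U'(2) in blast)
    let ?I = "\<lambda>s. LBINT x. \<bar>U' s x - h x\<bar> powr (\<alpha> + 1)"
    have "((\<lambda>s. Lp_norm \<Omega> (\<alpha> + 1) (\<lambda>x. U s x - k x) powr (\<alpha> + 1)) \<longlongrightarrow> 0) F"
      by (rule tendsto_zero_powrI[OF l tendsto_const]) (use \<alpha> in \<open>auto simp: Lp_norm_def\<close>)
    moreover have "\<forall>\<^sub>F s in F. Lp_norm \<Omega> (\<alpha> + 1) (\<lambda>x. U s x - k x) powr (\<alpha> + 1) = ?I s"
      using F
    proof eventually_elim
      case (elim s)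
      have e: "AE x\<in>\<Omega> in lborel. U s x - k x = U' s x - h x"
        using U'(3)[OF elim] h(3) by eventually_elim auto
      have "Lp_norm \<Omega> (\<alpha> + 1) (\<lambda>x. U s x - k x) = ?I s powr (1 / (\<alpha> + 1))"
        by (rule Lp_norm_eq[OF _ _ _ e]) (use U'(1,2)[OF elim] hm h(2) in auto)
      moreover have "?I s \<ge> 0" by (intro Bochner_Integration.integral_nonneg) auto
      ultimately show ?case using \<alpha> by (simp add: powr_powr)
    qed
    ultimately show "(?I \<longlongrightarrow> 0) F" by (rule Lim_transform_eventually)
    show "\<Omega> \<in> sets borel" by (rule borel_open[OF \<Omega>(1)])
  qed
  define V where "V t x = signed_power \<alpha> (U' t x)" for t x
  define V0 where "V0 x = signed_power \<alpha> (b0 x)" for x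
  have Vi: "integrable lborel (V t)" if "t \<in> {0..T}" for t
    unfolding V_def[abs_def] using \<Omega> U'(2)[OF that] by (intro signed_power_integrable[OF \<alpha> Up[OF that]]) auto
  have V0i: "integrable lborel V0"
    unfolding V0_def[abs_def] using \<Omega> b0(2) by (intro signed_power_integrable[OF \<alpha> b0p]) auto
  have Vc: "((\<lambda>s. LBINT x. \<bar>V s x - V t x\<bar>) \<longlongrightarrow> 0) (at t within {0..T})" if "t \<in> {0..T}" for t
    unfolding V_def using U that
    by (intro lim[OF Up[OF that] U'(2)[OF that] U'(3)[OF that]]) (auto simp: C_Lp_def eventually_at_filter)
  have Vc': "((\<lambda>s. LBINT x. \<bar>V s x - V t x\<bar>) \<longlongrightarrow> 0) (at t)" if "t \<in> {0<..<T}" for t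
    using Vc[of t] at_within_interior[of t "{0..T}"] that by (simp add: interior_atLeastAtMost_real)
  have V0c: "((\<lambda>t. LBINT x. \<bar>V t x - V0 x\<bar>) \<longlongrightarrow> 0) (at_right 0)"
    unfolding V_def V0_def
  proof (rule lim[OF b0p b0(2,3) _ init])
    show "\<forall>\<^sub>F s in at_right 0. s \<in> {0..T}"
      using eventually_at_right_real[OF T] by eventually_elim auto
  qed
  have "continuous_on {0..T} (\<lambda>t. LBINT x. \<bar>V t x\<bar>)"
    unfolding continuous_on_def
  proof
    fix t assume t: "t \<in> {0..T}"
    have "((\<lambda>s. (LBINT x. \<bar>V s x\<bar>) - (LBINT x. \<bar>V t x\<bar>)) \<longlongrightarrow> 0) (at t within {0..T})"
    proof (rule Lim_null_comparison[OF _ Vc[OF t]])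
      have "\<forall>\<^sub>F s in at t within {0..T}. s \<in> {0..T}" by (simp add: eventually_at_filter)
      then show "\<forall>\<^sub>F s in at t within {0..T}. norm ((LBINT x. \<bar>V s x\<bar>) - (LBINT x. \<bar>V t x\<bar>)) \<le> (LBINT x. \<bar>V s x - V t x\<bar>)"
      proof eventually_elim
        case (elim s)
        note i = Vi[OF elim] Vi[OF t]
        have "(LBINT x. \<bar>V s x\<bar>) - (LBINT x. \<bar>V t x\<bar>) = (LBINT x. \<bar>V s x\<bar> - \<bar>V t x\<bar>)"
          using i by (intro Bochner_Integration.integral_diff[symmetric] integrable_abs)
        also have "norm \<dots> \<le> (LBINT x. \<bar>V s x - V t x\<bar>)"
          using i by (intro Bochner_Integration.integral_norm_bound_integral integrable_abs Bochner_Integration.integrable_diff) auto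
        finally show ?case .
      qed
    qed
    then show "((\<lambda>t. LBINT x. \<bar>V t x\<bar>) \<longlongrightarrow> (LBINT x. \<bar>V t x\<bar>)) (at t within {0..T})"
      by (simp add: LIM_zero_cancel)
  qed
  then have "bounded ((\<lambda>t. LBINT x. \<bar>V t x\<bar>) ` {0..T})"
    by (intro compact_imp_bounded compact_continuous_image compact_Icc)
  then obtain B where "\<forall>r\<in>(\<lambda>t. LBINT x. \<bar>V t x\<bar>) ` {0..T}. norm r \<le> B" unfolding bounded_iff by blast
  then have B: "(LBINT x. \<bar>V t x\<bar>) \<le> B" if "t \<in> {0..T}" for t using that by fastforce
  let ?y = "\<lambda>z. signed_power \<alpha> (u z)"
  have sl: "AE t\<in>{0<..<T} in lborel. (AE x in lborel. ?y (x, t) = V t x)"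
    using uU
  proof eventually_elim
    case (elim t)
    show ?case
    proof
      assume t: "t \<in> {0<..<T}"
      then have t': "t \<in> {0..T}" by auto
      have "AE x\<in>\<Omega> in lborel. u (x, t) = U t x" using elim t by blast
      then show "AE x in lborel. ?y (x, t) = V t x"
        using U'(3)[OF t']
      proof eventually_elim
        case (elim x)
        show ?case using elim U'(2)[OF t', of x] uz[of "(x, t)"] by (cases "x \<in> \<Omega>") (auto simp: V_def)
      qed
    qed
  qed
  have ym: "?y \<in> Borel" by measurable
  have yi: "integrable lborel ?y"
  proof (rule integrable_by_slices[OF ym, of T B])
    show "t \<notin> {0<..<T} ==> ?y (x, t) = 0" for x t using uz[of "(x, t)"] by (simp add: signed_power_def)
    show "AE t\<in>{0<..<T} in lborel. integrable lborel (\<lambda>x. ?y (x, t)) \<and> (LBINT x. \<bar>?y (x, t)\<bar>) \<le> B"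
      using sl
    proof eventually_elim
      case (elim t)
      show ?case
      proof
        assume t: "t \<in> {0<..<T}"
        then have t': "t \<in> {0..T}" and e: "AE x in lborel. ?y (x, t) = V t x" using elim by auto
        note ys[measurable] = borel_measurable_section(1)[OF ym, of t]
        note [measurable] = borel_measurable_integrable[OF Vi[OF t'], simplified]
        have "integrable lborel (\<lambda>x. ?y (x, t)) = integrable lborel (V t)"
          by (rule integrable_cong_AE[OF _ _ e]) measurable
        moreover have "(LBINT x. \<bar>?y (x, t)\<bar>) = (LBINT x. \<bar>V t x\<bar>)"
          by (rule integral_cong_AE) (measurable, use e in eventually_elim, simp)
        ultimately show "integrable lborel (\<lambda>x. ?y (x, t)) \<and> (LBINT x. \<bar>?y (x, t)\<bar>) \<le> B"
          using Vi[OF t'] B[OF t'] by simp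
      qed
    qed
  qed
  have int: "\<forall>t\<in>{0<..<T}. integrable lborel (V t) \<and> ((\<lambda>s. LBINT x. \<bar>V s x - V t x\<bar>) \<longlongrightarrow> 0) (at t)"
    by (intro ballI conjI Vi Vc') auto
  show thesis
  proof (rule that[of V V0])
    show "L1_curve T ?y V V0" unfolding L1_curve_def by (intro conjI yi V0i int sl V0c)
    show "AE x in lborel. V0 x = (if x \<in> \<Omega> then signed_power \<alpha> (u0 x) else 0)"
      using b0(3)
    proof eventually_elim
      case (elim x) then show ?case using b0(2)[of x] by (auto simp: V0_def signed_power_def)
    qed
  qed
qed

text \<open>The growth condition says that the flux is dominated by \<open>dual_weight\<close>.\<close>
lemma flux_representative:
  fixes \<Omega> :: "(real^'n) set" and A :: "real^'n => real => real^'n => real^'n"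
  assumes \<Omega>: "open \<Omega>" and p: "\<And>i. p i > 1" and A: "caratheodory \<Omega> A" and \<Lambda>: "\<Lambda> \<ge> 0"
    and b: "integrable (lebesgue_on \<Omega>) b"
    and growth: "AE x in lebesgue_on \<Omega>. \<forall>u \<xi> i.
           \<bar>A x u \<xi> $ i\<bar> \<le> \<Lambda> * ((\<Sum>k\<in>UNIV. \<bar>\<xi> $ k\<bar> powr p k) + b x) powr ((p i - 1) / p i)"
    and b0: "AE x in lebesgue_on \<Omega>. b x \<ge> 0"
    and u[measurable]: "u \<in> Borel" and d: "\<And>i. powr_integrable lborel (p i) (d i)"
  obtains a where "\<forall>i. powr_integrable lborel (p i / (p i - 1)) (a i)" "\<forall>i z. z \<notin> cylinder \<Omega> T --> a i z = 0"
    "AE z\<in>cylinder \<Omega> T in lborel. (\<forall>i. A (fst z) (u z) (\<chi> k. d k z) $ i = a i z)"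
proof -
  let ?Q = "cylinder \<Omega> T"
  have \<Omega>m[measurable]: "\<Omega> \<in> sets borel" using \<Omega> by simp
  have [measurable]: "?Q \<in> sets borel" using \<Omega> by (simp add: open_Times borel_open)
  have dm[measurable]: "d i \<in> Borel" for i using powr_integrable_borel[OF d] by simp
  have "\<exists>h. h \<in> Borel \<and> (AE z in lborel. fst z \<in> \<Omega> --> A (fst z) (u z) (\<chi> k. d k z) $ i = h z)" for i
  proof -
    obtain h where "h \<in> Borel" "AE z in lborel. fst z \<in> \<Omega> --> A (fst z) (u z) (\<chi> k. d k z) $ i = h z"
      by (rule caratheodory_representative[OF \<Omega> A u dm])
    then show ?thesis by (intro exI[of _ h]) simp
  qed
  then have "\<exists>h. \<forall>i. h i \<in> Borel \<and> (AE z in lborel. fst z \<in> \<Omega> --> A (fst z) (u z) (\<chi> k. d k z) $ i = h i z)"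
    by (intro choice allI)
  then obtain h where "\<forall>i. h i \<in> Borel \<and> (AE z in lborel. fst z \<in> \<Omega> --> A (fst z) (u z) (\<chi> k. d k z) $ i = h i z)"
    by (rule exE)
  then have h[measurable]: "\<And>i. h i \<in> Borel"
    and he: "\<And>i. AE z in lborel. fst z \<in> \<Omega> --> A (fst z) (u z) (\<chi> k. d k z) $ i = h i z" by blast+
  define a where "a i z = indicator ?Q z * h i z" for i z
  have am: "a i \<in> Borel" for i unfolding a_def[abs_def] by measurable
  have eq: "AE z in lborel. \<forall>i\<in>UNIV. z \<in> ?Q --> A (fst z) (u z) (\<chi> k. d k z) $ i = a i z"
  proof (rule AE_finite_allI)
    show "AE z\<in>?Q in lborel. A (fst z) (u z) (\<chi> k. d k z) $ i = a i z" for i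
      using he[of i] by eventually_elim (auto simp: a_def)
  qed simp
  have "b \<in> borel_measurable (lebesgue_on \<Omega>)" using b by simp
  then obtain b' where b': "b' \<in> Borel" "\<And>x. x \<notin> \<Omega> ==> b' x = 0" "AE x\<in>\<Omega> in lborel. b x = b' x"
    by (rule borel_representative) auto
  have ind: "(\<lambda>x. indicator \<Omega> x * b' x) = b'" using b'(2) by (auto simp: indicator_def fun_eq_iff)
  have b'i: "integrable lborel b'" using integrable_lebesgue_on_AE[OF b'(1) \<Omega>m b'(3)] b by (simp add: ind)
  have ap: "powr_integrable lborel (p i / (p i - 1)) (a i)" for i
  proof (rule powr_integrable_le[OF dual_weight_powr_integrable[OF p b'i d, where T=T]])
    have "AE x\<in>\<Omega> in lborel. b x \<ge> 0 \<and> b x = b' x \<and> (\<forall>u \<xi> i. \<bar>A x u \<xi> $ i\<bar> \<le> \<Lambda> * ((\<Sum>k\<in>UNIV. \<bar>\<xi> $ k\<bar> powr p k) + b x) powr ((p i - 1) / p i))"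
      using growth[unfolded AE_lebesgue_on[OF \<Omega>m]] b0[unfolded AE_lebesgue_on[OF \<Omega>m]] b'(3) by eventually_elim blast
    from AE_fst[OF this, where 'b=real] eq
    show "AE z in lborel. \<bar>a i z\<bar> \<le> \<Lambda> * \<bar>dual_weight T p b' d i z\<bar>"
    proof eventually_elim
      case (elim z)
      show ?case
      proof (cases "z \<in> ?Q")
        case True
        then have x: "fst z \<in> \<Omega>" "snd z \<in> {0<..<T}" by (auto simp: mem_Times_iff)
        have "a i z = A (fst z) (u z) (\<chi> k. d k z) $ i" using elim(2) True by simp
        moreover have "\<bar>A (fst z) (u z) (\<chi> k. d k z) $ i\<bar>
            \<le> \<Lambda> * ((\<Sum>k\<in>UNIV. \<bar>(\<chi> k. d k z) $ k\<bar> powr p k) + b (fst z)) powr ((p i - 1) / p i)"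
          using elim(1) x by blast
        moreover have "b' (fst z) \<ge> 0" "b (fst z) = b' (fst z)" using elim(1) x by auto
        ultimately show ?thesis using x by (simp add: dual_weight_def add.commute)
      next
        case False
        then show ?thesis using \<Lambda> by (simp add: a_def)
      qed
    qed
    show "a i \<in> borel_measurable lborel" using am by simp
    show "0 \<le> p i / (p i - 1)" using p[of i] by simp
  qed (rule \<Lambda>)
  show thesis
  proof (rule that[of a])
    show "AE z\<in>?Q in lborel. (\<forall>i. A (fst z) (u z) (\<chi> k. d k z) $ i = a i z)"
      using eq by eventually_elim blast
  qed (auto simp: ap a_def)
qed

lemma solution_weak_equation:
  fixes \<Omega> :: "(real^'n) set"
  assumes \<Omega>: "open \<Omega>" and u: "slice_representative \<Omega> T p u ub du"
    and am: "\<And>i. a i \<in> Borel" and az: "\<And>i z. z \<notin> cylinder \<Omega> T ==> a i z = 0"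
    and ae: "AE z\<in>cylinder \<Omega> T in lborel. (\<forall>i. A (fst z) (ub z) (\<chi> k. du k z) $ i = a i z)"
    and f': "f' \<in> Borel" "AE x\<in>\<Omega> in lborel. f x = f' x"
    and \<phi>: "\<phi> \<in> test_functions (cylinder \<Omega> T)"
    and eq: "integral\<^sup>L (lebesgue_on (cylinder \<Omega> T))
          (\<lambda>z. A (fst z) (u z) (weak_grad \<Omega> T u z) \<bullet> space_grad \<phi> z
               - \<bar>u z\<bar> powr (\<alpha> - 1) * u z * time_deriv \<phi> z) =
        integral\<^sup>L (lebesgue_on (cylinder \<Omega> T)) (\<lambda>z. f (fst z) * \<phi> z)"
  shows "(LBINT z. (\<Sum>i\<in>UNIV. a i z * dir_deriv (axis i 1, 0) \<phi> z) - signed_power \<alpha> (ub z) * dir_deriv (0, 1) \<phi> z)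
        = (LBINT z. f' (fst z) * \<phi> z)"
proof -
  let ?Q = "cylinder \<Omega> T"
  have Qm[measurable]: "?Q \<in> sets borel" using \<Omega> by (simp add: open_Times borel_open)
  have ub[measurable]: "ub \<in> Borel" and uz: "\<And>z. z \<notin> ?Q ==> ub z = 0"
    and ue: "AE z\<in>?Q in lborel. u z = ub z"
    and de: "\<And>i. AE z\<in>?Q in lborel. weak_partial \<Omega> T i u z = du i z"
    using u unfolding slice_representative_def by blast+
  note [measurable] = am f'(1) test_function_borel[OF \<phi>] test_function_borel[OF test_function_dir_deriv[OF \<phi>]]
  obtain K where K: "K \<subseteq> ?Q" "\<And>z. z \<notin> K ==> \<phi> z = 0" using test_function_support[OF \<phi>] by metis
  let ?h = "\<lambda>z. (\<Sum>i\<in>UNIV. a i z * dir_deriv (axis i 1, 0) \<phi> z) - signed_power \<alpha> (ub z) * dir_deriv (0, 1) \<phi> z"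
  have de': "AE z in lborel. \<forall>i\<in>UNIV. z \<in> ?Q --> weak_partial \<Omega> T i u z = du i z"
    by (rule AE_finite_allI[OF _ de]) simp
  have "AE z\<in>?Q in lborel. A (fst z) (u z) (weak_grad \<Omega> T u z) \<bullet> space_grad \<phi> z
               - \<bar>u z\<bar> powr (\<alpha> - 1) * u z * time_deriv \<phi> z = ?h z"
    using de' ue ae
  proof eventually_elim
    case (elim z)
    show ?case
    proof
      assume z: "z \<in> ?Q"
      have "weak_grad \<Omega> T u z = (\<chi> k. du k z)" using elim(1) z by (simp add: weak_grad_def)
      moreover have "u z = ub z" using elim(2) z by blast
      ultimately have "A (fst z) (u z) (weak_grad \<Omega> T u z) \<bullet> space_grad \<phi> z = (\<Sum>i\<in>UNIV. a i z * dir_deriv (axis i 1, 0) \<phi> z)"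
        using elim(3) z by (simp add: inner_vec_def space_grad_def)
      moreover have "\<bar>u z\<bar> powr (\<alpha> - 1) * u z = signed_power \<alpha> (ub z)"
        unfolding \<open>u z = ub z\<close> by (rule signed_power_alt)
      ultimately show "A (fst z) (u z) (weak_grad \<Omega> T u z) \<bullet> space_grad \<phi> z
               - \<bar>u z\<bar> powr (\<alpha> - 1) * u z * time_deriv \<phi> z = ?h z" by (simp add: time_deriv_def)
    qed
  qed
  from integral_lebesgue_on_AE[OF _ Qm this]
  have 1: "integral\<^sup>L (lebesgue_on ?Q) (\<lambda>z. A (fst z) (u z) (weak_grad \<Omega> T u z) \<bullet> space_grad \<phi> z
               - \<bar>u z\<bar> powr (\<alpha> - 1) * u z * time_deriv \<phi> z) = (LBINT z. indicator ?Q z * ?h z)"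
    by measurable
  have "(\<lambda>z. indicator ?Q z * ?h z) = ?h"
  proof
    show "indicator ?Q z * ?h z = ?h z" for z by (cases "z \<in> ?Q") (auto simp: az uz signed_power_def)
  qed
  note 1 = 1[unfolded this]
  have "AE z\<in>?Q in lborel. f (fst z) * \<phi> z = f' (fst z) * \<phi> z"
    using AE_fst[OF f'(2), where 'b=real] by eventually_elim (auto simp: mem_Times_iff)
  from integral_lebesgue_on_AE[OF _ Qm this]
  have 2: "integral\<^sup>L (lebesgue_on ?Q) (\<lambda>z. f (fst z) * \<phi> z) = (LBINT z. indicator ?Q z * (f' (fst z) * \<phi> z))"
    by measurable
  have "(\<lambda>z. indicator ?Q z * (f' (fst z) * \<phi> z)) = (\<lambda>z. f' (fst z) * \<phi> z)"
  proof
    fix z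
    show "indicator ?Q z * (f' (fst z) * \<phi> z) = f' (fst z) * \<phi> z"
    proof (cases "z \<in> ?Q")
      case False
      then have "\<phi> z = 0" using K by blast
      then show ?thesis by simp
    qed simp
  qed
  note 2 = 2[unfolded this]
  show ?thesis using eq unfolding 1 2 .
qed

lemma solution_data:
  fixes \<Omega> :: "(real^'n) set" and A :: "real^'n => real => real^'n => real^'n"
  assumes \<Omega>: "open \<Omega>" "bounded \<Omega>" and T: "T > 0" and \<alpha>: "\<alpha> > 0" and p: "\<And>i. p i > 1"
    and A: "caratheodory \<Omega> A" and \<Lambda>: "\<Lambda> \<ge> 0" and b: "integrable (lebesgue_on \<Omega>) b"
    and growth: "AE x in lebesgue_on \<Omega>. \<forall>u \<xi> i.
           \<bar>A x u \<xi> $ i\<bar> \<le> \<Lambda> * ((\<Sum>k\<in>UNIV. \<bar>\<xi> $ k\<bar> powr p k) + b x) powr ((p i - 1) / p i)"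
    and b0: "AE x in lebesgue_on \<Omega>. b x \<ge> 0"
    and f': "powr_integrable lborel q f'" "q \<ge> 1" "\<And>x. x \<notin> \<Omega> ==> f' x = 0" "AE x\<in>\<Omega> in lborel. f x = f' x"
    and u0: "u0 \<in> Lp \<Omega> (\<alpha> + 1)" and u: "cd_solution \<Omega> T \<alpha> p A f g u0 u"
  obtains ub du a V V0 where "slice_representative \<Omega> T p u ub du"
    "evolution_data \<Omega> T p (\<lambda>z. signed_power \<alpha> (ub z)) a f' V" "L1_curve T (\<lambda>z. signed_power \<alpha> (ub z)) V V0"
    "AE z\<in>cylinder \<Omega> T in lborel. (\<forall>i. A (fst z) (ub z) (\<chi> k. du k z) $ i = a i z)"
    "AE x in lborel. V0 x = (if x \<in> \<Omega> then signed_power \<alpha> (u0 x) else 0)"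
proof -
  let ?Q = "cylinder \<Omega> T"
  have \<Omega>m: "\<Omega> \<in> sets borel" using \<Omega> by simp
  have "u \<in> Lp_W1p \<Omega> T p" using u by (simp add: cd_solution_def)
  then obtain ub du where r: "slice_representative \<Omega> T p u ub du" by (rule Lp_W1p_representative[OF \<Omega> p])
  then have ub: "ub \<in> Borel" and uz: "\<And>z. z \<notin> ?Q ==> ub z = 0"
    and d: "\<And>i. powr_integrable lborel (p i) (du i)"
    and sl: "AE t\<in>{0<..<T} in lborel. (AE x\<in>\<Omega> in lborel. u (x, t) = ub (x, t)) \<and>
        (\<forall>i. weak_pair \<Omega> (axis i 1) (\<lambda>x. ub (x, t)) (\<lambda>x. du i (x, t)))"
    unfolding slice_representative_def by blast+
  obtain U where U: "U \<in> C_Lp \<Omega> T (\<alpha> + 1)" "AE t in lebesgue_on {0<..<T}. AE x in lebesgue_on \<Omega>. u (x, t) = U t x"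
     "((\<lambda>t. Lp_norm \<Omega> (\<alpha> + 1) (\<lambda>x. U t x - u0 x)) \<longlongrightarrow> 0) (at_right 0)"
    using u by (auto simp: cd_solution_def)
  have "AE t\<in>{0<..<T} in lborel. (AE x\<in>\<Omega> in lborel. u (x, t) = U t x)"
    using U(2) by (simp add: AE_lebesgue_on \<Omega>m)
  with sl have uU: "AE t\<in>{0<..<T} in lborel. (AE x\<in>\<Omega> in lborel. ub (x, t) = U t x)"
  proof eventually_elim
    case (elim t)
    show ?case
    proof
      assume "t \<in> {0<..<T}"
      then have "AE x\<in>\<Omega> in lborel. u (x, t) = ub (x, t)" "AE x\<in>\<Omega> in lborel. u (x, t) = U t x"
        using elim by auto
      then show "AE x\<in>\<Omega> in lborel. ub (x, t) = U t x" by eventually_elim auto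
    qed
  qed
  obtain V V0 where V: "L1_curve T (\<lambda>z. signed_power \<alpha> (ub z)) V V0"
    "AE x in lborel. V0 x = (if x \<in> \<Omega> then signed_power \<alpha> (u0 x) else 0)"
    by (rule powers_of_curve[OF \<Omega> \<alpha> T U(1) u0 U(3) ub uz uU])
  obtain a where a': "\<forall>i. powr_integrable lborel (p i / (p i - 1)) (a i)" "\<forall>i z. z \<notin> ?Q --> a i z = 0"
    "AE z\<in>?Q in lborel. (\<forall>i. A (fst z) (ub z) (\<chi> k. du k z) $ i = a i z)"
    by (rule flux_representative[OF \<Omega>(1) p A \<Lambda> b growth b0 ub d])
  have a: "\<And>i. powr_integrable lborel (p i / (p i - 1)) (a i)" "\<And>i z. z \<notin> ?Q ==> a i z = 0"
    "AE z\<in>?Q in lborel. (\<forall>i. A (fst z) (ub z) (\<chi> k. du k z) $ i = a i z)"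
    using a' by blast+
  have fi: "integrable lborel f'" by (rule bounded_support_integrable[OF f'(1,2) \<Omega>(2) f'(3)])
  have ai: "integrable lborel (a i)" for i
    by (rule bounded_support_integrable[OF a(1) _ _ a(2)]) (use conjugate_exponent(1)[OF p[of i]] \<Omega> in \<open>auto intro: bounded_Times\<close>)
  have weak: "(LBINT z. (\<Sum>i\<in>UNIV. a i z * dir_deriv (axis i 1, 0) \<phi> z) - signed_power \<alpha> (ub z) * dir_deriv (0, 1) \<phi> z)
        = (LBINT z. f' (fst z) * \<phi> z)" if \<phi>: "\<phi> \<in> test_functions ?Q" for \<phi>
  proof (rule solution_weak_equation[OF \<Omega>(1) r _ a(2,3) _ f'(4) \<phi>])
    show "a i \<in> Borel" for i using powr_integrable_borel[OF a(1)] by simp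
    show "f' \<in> Borel" using powr_integrable_borel[OF f'(1)] by simp
    show "integral\<^sup>L (lebesgue_on (cylinder \<Omega> T))
          (\<lambda>z. A (fst z) (u z) (weak_grad \<Omega> T u z) \<bullet> space_grad \<phi> z
               - \<bar>u z\<bar> powr (\<alpha> - 1) * u z * time_deriv \<phi> z) =
        integral\<^sup>L (lebesgue_on (cylinder \<Omega> T)) (\<lambda>z. f (fst z) * \<phi> z)"
      using u \<phi> unfolding cd_solution_def by blast
  qed
  have Vd: "integrable lborel (\<lambda>z. signed_power \<alpha> (ub z))" "AE t\<in>{0<..<T} in lborel. (AE x in lborel. signed_power \<alpha> (ub (x, t)) = V t x)"
    using V(1) unfolding L1_curve_def by blast+
  have Vi: "integrable lborel (V t)" "((\<lambda>s. LBINT x. \<bar>V s x - V t x\<bar>) \<longlongrightarrow> 0) (at t)" if "t \<in> {0<..<T}" for t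
    using V(1) that unfolding L1_curve_def by blast+
  have id: "(LBINT x. (V t2 x - V t1 x) * \<zeta> x) = (t2 - t1) * (LBINT x. f' x * \<zeta> x)
        - (\<Sum>i\<in>UNIV. LBINT z. indicator {t1<..t2} (snd z) * (a i z * D i (fst z)))"
    if t: "0 < t1" "t1 < t2" "t2 < T" and \<zeta>: "bounded_approximable \<Omega> p \<zeta> D" for t1 t2 \<zeta> D
  proof (rule tested_identity[OF p _ fi a(1) _ \<zeta>])
    show "integrable lborel (\<lambda>x. V t2 x - V t1 x)" using t by (intro Bochner_Integration.integrable_diff Vi) auto
    show "(LBINT x. (V t2 x - V t1 x) * \<phi> x) = (t2 - t1) * (LBINT x. f' x * \<phi> x)
      - (\<Sum>i\<in>UNIV. LBINT z. indicator {t1<..t2} (snd z) * (a i z * dir_deriv (axis i 1) \<phi> (fst z)))"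
      if "\<phi> \<in> test_functions \<Omega>" for \<phi>
      by (rule time_integrated_identity[OF Vd(1) ai fi weak Vi Vd(2) that t])
  qed
  have "V t \<in> Borel" if "t \<in> {0<..<T}" for t
    using borel_measurable_integrable[OF Vi(1)[OF that]] by simp
  then have "evolution_data \<Omega> T p (\<lambda>z. signed_power \<alpha> (ub z)) a f' V"
    unfolding evolution_data_def using Vd fi a(1) id by blast
  then show thesis by (rule that[OF r _ V(1) a(3) V(2)])
qed

section \<open>Comparison\<close>

lemma approximable_diff:
  assumes p: "\<And>i. p i > 1" and z: "approximable \<Omega> p z d" and w: "approximable \<Omega> p w e"
  shows "approximable \<Omega> p (\<lambda>x. z x - w x) (\<lambda>i x. d i x - e i x)"
proof -
  obtain \<psi> where zi: "integrable lborel z" "\<And>i. powr_integrable lborel (p i) (d i)"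
    and \<psi>: "\<And>k. \<psi> k \<in> test_functions \<Omega>" "(\<lambda>k. LBINT x. \<bar>\<psi> k x - z x\<bar>) \<longlonglongrightarrow> 0"
      "\<And>i. (\<lambda>k. LBINT x. \<bar>dir_deriv (axis i 1) (\<psi> k) x - d i x\<bar> powr p i) \<longlonglongrightarrow> 0"
    using z unfolding approximable_def by blast
  obtain \<theta> where wi: "integrable lborel w" "\<And>i. powr_integrable lborel (p i) (e i)"
    and \<theta>: "\<And>k. \<theta> k \<in> test_functions \<Omega>" "(\<lambda>k. LBINT x. \<bar>\<theta> k x - w x\<bar>) \<longlonglongrightarrow> 0"
      "\<And>i. (\<lambda>k. LBINT x. \<bar>dir_deriv (axis i 1) (\<theta> k) x - e i x\<bar> powr p i) \<longlonglongrightarrow> 0"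
    using w unfolding approximable_def by blast
  have 1: "(\<lambda>k. LBINT x. \<bar>\<psi> k x - \<theta> k x - (z x - w x)\<bar>) \<longlonglongrightarrow> 0"
  proof (rule Lim_null_comparison[OF _ tendsto_add_zero[OF \<psi>(2) \<theta>(2)]], intro always_eventually allI)
    fix k
    note i = test_function_integrable[OF \<psi>(1)[of k]] test_function_integrable[OF \<theta>(1)[of k]] zi(1) wi(1)
    have "norm (LBINT x. \<bar>\<psi> k x - \<theta> k x - (z x - w x)\<bar>) \<le> (LBINT x. \<bar>\<psi> k x - z x\<bar> + \<bar>\<theta> k x - w x\<bar>)"
      using i by (intro Bochner_Integration.integral_norm_bound_integral integrable_abs Bochner_Integration.integrable_add Bochner_Integration.integrable_diff) auto
    also have "\<dots> = (LBINT x. \<bar>\<psi> k x - z x\<bar>) + (LBINT x. \<bar>\<theta> k x - w x\<bar>)"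
      using i by (intro Bochner_Integration.integral_add integrable_abs Bochner_Integration.integrable_diff)
    finally show "norm (LBINT x. \<bar>\<psi> k x - \<theta> k x - (z x - w x)\<bar>) \<le> (LBINT x. \<bar>\<psi> k x - z x\<bar>) + (LBINT x. \<bar>\<theta> k x - w x\<bar>)" .
  qed
  have 2: "(\<lambda>k. LBINT x. \<bar>dir_deriv (axis i 1) (\<lambda>x. \<psi> k x - \<theta> k x) x - (d i x - e i x)\<bar> powr p i) \<longlonglongrightarrow> 0" for i
  proof (rule Lim_null_comparison[OF _ tendsto_mult_right_zero[OF tendsto_add_zero[OF \<psi>(3)[of i] \<theta>(3)[of i]], of "2 powr p i"]],
      intro always_eventually allI)
    fix k
    let ?a = "\<lambda>x. dir_deriv (axis i 1) (\<psi> k) x - d i x" and ?b = "\<lambda>x. dir_deriv (axis i 1) (\<theta> k) x - e i x"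
    have pi: "p i \<ge> 0" "p i > 0" using p[of i] by auto
    have a: "powr_integrable lborel (p i) ?a"
      by (intro powr_integrable_diff test_function_powr_integrable[OF test_function_dir_deriv[OF \<psi>(1)]] zi pi)
    have b: "powr_integrable lborel (p i) ?b"
      by (intro powr_integrable_diff test_function_powr_integrable[OF test_function_dir_deriv[OF \<theta>(1)]] wi pi)
    have pd: "\<bar>s - t\<bar> powr p i \<le> 2 powr p i * (\<bar>s\<bar> powr p i + \<bar>t\<bar> powr p i)" for s t :: real
      using powr_sum_le[OF pi(1), of s "- t"] by simp
    have eq: "dir_deriv (axis i 1) (\<lambda>x. \<psi> k x - \<theta> k x) x - (d i x - e i x) = ?a x - ?b x" for x
      using dir_deriv_diff[OF test_function_Ck[OF \<psi>(1)] test_function_Ck[OF \<theta>(1)], of "axis i 1" k k x] by simp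
    have "norm (LBINT x. \<bar>?a x - ?b x\<bar> powr p i) \<le> (LBINT x. 2 powr p i * (\<bar>?a x\<bar> powr p i + \<bar>?b x\<bar> powr p i))"
    proof (rule Bochner_Integration.integral_norm_bound_integral)
      show "integrable lborel (\<lambda>x. \<bar>?a x - ?b x\<bar> powr p i)"
        by (rule powr_integrable_integrable[OF powr_integrable_diff[OF a b pi(1)]])
      show "integrable lborel (\<lambda>x. 2 powr p i * (\<bar>?a x\<bar> powr p i + \<bar>?b x\<bar> powr p i))"
        by (intro integrable_mult_right Bochner_Integration.integrable_add powr_integrable_integrable[OF a] powr_integrable_integrable[OF b])
      show "norm (\<bar>?a x - ?b x\<bar> powr p i) \<le> 2 powr p i * (\<bar>?a x\<bar> powr p i + \<bar>?b x\<bar> powr p i)" for x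
        using pd[of "?a x" "?b x"] by simp
    qed
    also have "\<dots> = 2 powr p i * ((LBINT x. \<bar>?a x\<bar> powr p i) + (LBINT x. \<bar>?b x\<bar> powr p i))"
      using powr_integrable_integrable[OF a] powr_integrable_integrable[OF b] by simp
    finally show "norm (LBINT x. \<bar>dir_deriv (axis i 1) (\<lambda>x. \<psi> k x - \<theta> k x) x - (d i x - e i x)\<bar> powr p i)
      \<le> 2 powr p i * ((LBINT x. \<bar>?a x\<bar> powr p i) + (LBINT x. \<bar>?b x\<bar> powr p i))" unfolding eq .
  qed
  have d: "powr_integrable lborel (p i) (\<lambda>x. d i x - e i x)" for i
    using p[of i] by (intro powr_integrable_diff zi wi) auto
  show ?thesis unfolding approximable_def
    by (intro conjI allI exI[of _ "\<lambda>k x. \<psi> k x - \<theta> k x"] Bochner_Integration.integrable_diff zi wi d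
        test_function_diff \<psi>(1) \<theta>(1) 1 2)
qed

text \<open>Vanishing boundary data are the case \<open>g = 0\<close>.\<close>
lemma zero_slice_representative:
  fixes \<Omega> :: "(real^'n) set"
  assumes \<Omega>: "open \<Omega>"
  shows "slice_representative \<Omega> T p (\<lambda>_. 0) (\<lambda>_. 0) (\<lambda>_ _. 0)"
proof -
  have w: "weak_pair U b (\<lambda>_. 0) (\<lambda>_. 0)" for U and b :: "'a::euclidean_space"
    by (auto simp: weak_pair_def locally_integrable_on_def)
  have "AE z\<in>cylinder \<Omega> T in lborel. weak_partial \<Omega> T i (\<lambda>_. 0) z = 0" for i
    by (rule weak_deriv_AE[OF _ _ _ _ w]) (use \<Omega> in \<open>auto intro: open_Times\<close>)
  then show ?thesis unfolding slice_representative_def using w by (auto simp: powr_integrable_def)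
qed

text \<open>For almost every time the slice of the boundary datum meets the hypotheses of \<open>approximable_truncation\<close>.\<close>
lemma boundary_slices:
  fixes \<Omega> :: "(real^'n) set"
  assumes \<Omega>: "open \<Omega>" and g: "g \<in> Lp_W1p \<Omega> T p" and r: "slice_representative \<Omega> T p g gb dg"
    and pos: "AE z in lebesgue_on (cylinder \<Omega> T). g z \<ge> 0"
  shows "AE s\<in>{0<..<T} in lborel. integrable lborel (\<lambda>x. gb (x, s)) \<and> (AE x in lborel. gb (x, s) \<ge> 0) \<and>
     (\<forall>i. powr_integrable lborel (p i) (\<lambda>x. dg i (x, s)) \<and> weak_pair \<Omega> (axis i 1) (\<lambda>x. gb (x, s)) (\<lambda>x. dg i (x, s)))"
proof -
  let ?Q = "cylinder \<Omega> T"
  have Qm: "?Q \<in> sets borel" and \<Omega>m: "\<Omega> \<in> sets borel" using \<Omega> by (simp_all add: open_Times borel_open)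
  have gb: "gb \<in> Borel" and gz: "\<And>z. z \<notin> ?Q ==> gb z = 0"
    and ge: "AE z\<in>?Q in lborel. g z = gb z"
    and d: "\<And>i. powr_integrable lborel (p i) (dg i)"
    and sl: "AE t\<in>{0<..<T} in lborel. (AE x\<in>\<Omega> in lborel. g (x, t) = gb (x, t)) \<and>
        (\<forall>i. weak_pair \<Omega> (axis i 1) (\<lambda>x. gb (x, t)) (\<lambda>x. dg i (x, t)))"
    using r unfolding slice_representative_def by blast+
  have dm: "dg i \<in> Borel" for i using powr_integrable_borel[OF d] by simp
  have "AE z in lborel. gb z \<ge> 0"
    using ge pos[unfolded AE_lebesgue_on[OF Qm]]
  proof eventually_elim
    case (elim z) then show ?case using gz[of z] by (cases "z \<in> ?Q") auto
  qed
  from AE_section(1)[OF this] have 1: "AE s in lborel. AE x in lborel. gb (x, s) \<ge> 0" .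
  have "AE s in lborel. \<forall>i\<in>UNIV. integrable lborel (\<lambda>x. \<bar>dg i (x, s)\<bar> powr p i)"
    by (rule AE_finite_allI[OF _ AE_integrable_section[OF powr_integrable_integrable[OF d]]]) simp
  moreover have "AE s in lebesgue_on {0<..<T}. slice g s \<in> W11 \<Omega>"
    using g by (auto simp: Lp_W1p_def bochner_Lp_def strongly_measurable_def)
  then have "AE s\<in>{0<..<T} in lborel. slice g s \<in> W11 \<Omega>" by (simp add: AE_lebesgue_on)
  ultimately show ?thesis using sl 1
  proof eventually_elim
    case (elim s)
    show ?case
    proof (intro impI conjI allI)
      assume s: "s \<in> {0<..<T}"
      note gs = borel_measurable_section(1)[OF gb, of s]
      have "AE x\<in>\<Omega> in lborel. slice g s x = gb (x, s)" using elim(3) s by (auto simp: slice_def)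
      moreover have "slice g s \<in> Lp \<Omega> 1" using elim(2) s by (simp add: W11_def)
      moreover have "x \<notin> \<Omega> ==> gb (x, s) = 0" for x using gz[of "(x, s)"] by auto
      ultimately show "integrable lborel (\<lambda>x. gb (x, s))"
        using Lp_iff[OF gs \<Omega>m, of "slice g s" 1] by (simp add: powr_integrable_1)
      show "AE x in lborel. gb (x, s) \<ge> 0" by (rule elim(4))
      fix i
      show "powr_integrable lborel (p i) (\<lambda>x. dg i (x, s))"
        using elim(1) borel_measurable_section(1)[OF dm[of i], of s] by (simp add: powr_integrable_def)
      show "weak_pair \<Omega> (axis i 1) (\<lambda>x. gb (x, s)) (\<lambda>x. dg i (x, s))" using elim(3) s by blast
    qed
  qed
qed

text \<open>Change \<open>u\<close> first and the gradient afterwards: the Lipschitz condition controls the first step and monotonicity the second.\<close>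
lemma structural_inequality:
  fixes A :: "real^'n => real => real^'n => real^'n" and p :: "'n => real"
  assumes lip: "\<And>u1 u2 \<xi> i. \<bar>A x u1 \<xi> $ i - A x u2 \<xi> $ i\<bar> \<le> C * \<bar>u1 - u2\<bar> * (c + (\<Sum>k\<in>UNIV. \<bar>\<xi> $ k\<bar> powr p k)) powr ((p i - 1) / p i)"
    and mon: "\<And>u \<xi> \<eta>. (A x u \<xi> - A x u \<eta>) \<bullet> (\<xi> - \<eta>) \<ge> 0"
  shows "- (C * \<bar>u - u'\<bar> * (\<Sum>i\<in>UNIV. (c + (\<Sum>k\<in>UNIV. \<bar>\<xi> $ k\<bar> powr p k)) powr ((p i - 1) / p i) * \<bar>\<xi> $ i - \<eta> $ i\<bar>))
       \<le> (\<Sum>i\<in>UNIV. (A x u \<xi> $ i - A x u' \<eta> $ i) * (\<xi> $ i - \<eta> $ i))"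
proof -
  have "- (C * \<bar>u - u'\<bar> * (\<Sum>i\<in>UNIV. (c + (\<Sum>k\<in>UNIV. \<bar>\<xi> $ k\<bar> powr p k)) powr ((p i - 1) / p i) * \<bar>\<xi> $ i - \<eta> $ i\<bar>))
      = (\<Sum>i\<in>UNIV. - (C * \<bar>u - u'\<bar> * (c + (\<Sum>k\<in>UNIV. \<bar>\<xi> $ k\<bar> powr p k)) powr ((p i - 1) / p i) * \<bar>\<xi> $ i - \<eta> $ i\<bar>))"
    by (simp only: sum_negf sum_distrib_left mult.assoc)
  also have "\<dots> \<le> (\<Sum>i\<in>UNIV. (A x u \<xi> $ i - A x u' \<xi> $ i) * (\<xi> $ i - \<eta> $ i))"
  proof (rule sum_mono)
    fix i
    have "\<bar>(A x u \<xi> $ i - A x u' \<xi> $ i) * (\<xi> $ i - \<eta> $ i)\<bar>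
        \<le> C * \<bar>u - u'\<bar> * (c + (\<Sum>k\<in>UNIV. \<bar>\<xi> $ k\<bar> powr p k)) powr ((p i - 1) / p i) * \<bar>\<xi> $ i - \<eta> $ i\<bar>"
      unfolding abs_mult by (rule mult_right_mono[OF lip]) simp
    then show "- (C * \<bar>u - u'\<bar> * (c + (\<Sum>k\<in>UNIV. \<bar>\<xi> $ k\<bar> powr p k)) powr ((p i - 1) / p i) * \<bar>\<xi> $ i - \<eta> $ i\<bar>)
        \<le> (A x u \<xi> $ i - A x u' \<xi> $ i) * (\<xi> $ i - \<eta> $ i)" by linarith
  qed
  also have "\<dots> \<le> (\<Sum>i\<in>UNIV. (A x u \<xi> $ i - A x u' \<xi> $ i) * (\<xi> $ i - \<eta> $ i)) + (A x u' \<xi> - A x u' \<eta>) \<bullet> (\<xi> - \<eta>)"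
    using mon by simp
  also have "\<dots> = (\<Sum>i\<in>UNIV. (A x u \<xi> $ i - A x u' \<eta> $ i) * (\<xi> $ i - \<eta> $ i))"
    unfolding inner_vec_def sum.distrib[symmetric] by (intro sum.cong) (auto simp: algebra_simps)
  finally show ?thesis .
qed

lemma AE_of_slices:
  fixes y y' :: "'a::euclidean_space \<times> real => real"
  assumes [measurable]: "y \<in> Borel" "y' \<in> Borel"
    and ae: "AE t in lborel. AE x in lborel. y (x, t) \<le> y' (x, t)"
  shows "AE z in lborel. y z \<le> y' z"
proof -
  have m: "{z. y z \<le> y' z} \<in> sets (lborel \<Otimes>\<^sub>M lborel)"
    unfolding lborel_prod sets_lborel using borel_measurable_le[OF assms(1,2)] by simp
  have "AE x in lborel. AE t in lborel. y (x, t) \<le> y' (x, t)"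
    using ae m by (subst lborel_pair.AE_commute) (auto simp: space_pair_measure)
  then have "AE z in lborel \<Otimes>\<^sub>M lborel. y z \<le> y' z"
    using m by (intro lborel_pair.AE_pair_measure) (auto simp: space_pair_measure)
  then show ?thesis by (simp only: lborel_prod)
qed

theorem theorem2p7:
  fixes \<Omega> :: "(real^'n) set"
    and T \<alpha> \<Lambda> C :: real
    and p :: "'n \<Rightarrow> real"
    and A :: "real^'n \<Rightarrow> real \<Rightarrow> real^'n \<Rightarrow> real^'n"
    and b c f\<^sub>1 f\<^sub>2 v\<^sub>0 w\<^sub>0 :: "real^'n \<Rightarrow> real"
    and g v w :: "(real^'n) \<times> real \<Rightarrow> real"
  assumes "T > 0" and "\<alpha> > 0" and "\<And>j. p j > 1"
    and "open \<Omega>" and "bounded \<Omega>"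
    and "caratheodory \<Omega> A"
    and "\<Lambda> > 0" and "C > 0"
    and "integrable (lebesgue_on \<Omega>) b" and "AE x in lebesgue_on \<Omega>. b x \<ge> 0"
    and "integrable (lebesgue_on \<Omega>) c" and "AE x in lebesgue_on \<Omega>. c x \<ge> 0"
    and growth: "AE x in lebesgue_on \<Omega>. \<forall>u \<xi> i.
           \<bar>A x u \<xi> $ i\<bar> \<le> \<Lambda> * ((\<Sum>k\<in>UNIV. \<bar>\<xi> $ k\<bar> powr p k) + b x) powr ((p i - 1) / p i)"
    and lipschitz: "AE x in lebesgue_on \<Omega>. \<forall>u\<^sub>1 u\<^sub>2 \<xi> i.
           \<bar>A x u\<^sub>1 \<xi> $ i - A x u\<^sub>2 \<xi> $ i\<bar>
             \<le> C * \<bar>u\<^sub>1 - u\<^sub>2\<bar> * (c x + (\<Sum>k\<in>UNIV. \<bar>\<xi> $ k\<bar> powr p k)) powr ((p i - 1) / p i)"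
    and monotone: "AE x in lebesgue_on \<Omega>. \<forall>u \<xi> \<eta>.
           (A x u \<xi> - A x u \<eta>) \<bullet> (\<xi> - \<eta>) \<ge> 0"
    and "f\<^sub>1 \<in> Lp \<Omega> ((\<alpha> + 1) / \<alpha>)" and "f\<^sub>2 \<in> Lp \<Omega> ((\<alpha> + 1) / \<alpha>)"
    and "AE x in lebesgue_on \<Omega>. f\<^sub>1 x \<le> f\<^sub>2 x"
    and "v\<^sub>0 \<in> Lp \<Omega> (\<alpha> + 1)" and "w\<^sub>0 \<in> Lp \<Omega> (\<alpha> + 1)"
    and "AE x in lebesgue_on \<Omega>. v\<^sub>0 x \<le> w\<^sub>0 x"
    and "g \<in> Lp_W1p \<Omega> T p" and "AE z in lebesgue_on (cylinder \<Omega> T). g z \<ge> 0"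
    and "cd_solution \<Omega> T \<alpha> p A f\<^sub>2 g w\<^sub>0 w"
    and "cd_solution \<Omega> T \<alpha> p A f\<^sub>1 (\<lambda>_. 0) v\<^sub>0 v"
  shows "AE z in lebesgue_on (cylinder \<Omega> T). v z \<le> w z"
proof -
  note T = \<open>T > 0\<close> and \<alpha> = \<open>\<alpha> > 0\<close> and p = \<open>\<And>j. p j > 1\<close> and \<Omega> = \<open>open \<Omega>\<close> \<open>bounded \<Omega>\<close>
  let ?Q = "cylinder \<Omega> T"
  have Qm: "?Q \<in> sets borel" and \<Omega>m: "\<Omega> \<in> sets borel" using \<Omega> by (simp_all add: open_Times borel_open)
  have \<Lambda>: "\<Lambda> \<ge> 0" using \<open>\<Lambda> > 0\<close> by simp
  have q: "(\<alpha> + 1) / \<alpha> \<ge> 1" using \<alpha> by simp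
  have rep: "\<exists>f'. powr_integrable lborel ((\<alpha> + 1) / \<alpha>) f' \<and> (\<forall>x. x \<notin> \<Omega> --> f' x = 0) \<and> (AE x\<in>\<Omega> in lborel. f x = f' x)"
    if f: "f \<in> Lp \<Omega> ((\<alpha> + 1) / \<alpha>)" for f
  proof -
    have "f \<in> borel_measurable (lebesgue_on \<Omega>)" using f by (simp add: Lp_def)
    then obtain f' where f': "f' \<in> Borel" "\<And>x. x \<notin> \<Omega> ==> f' x = 0" "AE x\<in>\<Omega> in lborel. f x = f' x"
      by (rule borel_representative) (use \<Omega>m in auto)
    then show ?thesis using Lp_iff[OF f'(1) \<Omega>m f'(2,3), of "(\<alpha> + 1) / \<alpha>"] f by (intro exI[of _ f']) simp
  qed
  obtain f1 where f1: "powr_integrable lborel ((\<alpha> + 1) / \<alpha>) f1" "\<And>x. x \<notin> \<Omega> ==> f1 x = 0" "AE x\<in>\<Omega> in lborel. f\<^sub>1 x = f1 x"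
    using rep[OF \<open>f\<^sub>1 \<in> Lp \<Omega> ((\<alpha> + 1) / \<alpha>)\<close>] by (elim exE conjE) simp
  obtain f2 where f2: "powr_integrable lborel ((\<alpha> + 1) / \<alpha>) f2" "\<And>x. x \<notin> \<Omega> ==> f2 x = 0" "AE x\<in>\<Omega> in lborel. f\<^sub>2 x = f2 x"
    using rep[OF \<open>f\<^sub>2 \<in> Lp \<Omega> ((\<alpha> + 1) / \<alpha>)\<close>] by (elim exE conjE) simp
  have f12: "AE x in lborel. f1 x \<le> f2 x"
    using f1(3) f2(3) \<open>AE x in lebesgue_on \<Omega>. f\<^sub>1 x \<le> f\<^sub>2 x\<close>[unfolded AE_lebesgue_on[OF \<Omega>m]]
  proof eventually_elim
    case (elim x) then show ?case using f1(2)[of x] f2(2)[of x] by (cases "x \<in> \<Omega>") auto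
  qed
  obtain vb dv av V V0 where v: "slice_representative \<Omega> T p v vb dv"
    "evolution_data \<Omega> T p (\<lambda>z. signed_power \<alpha> (vb z)) av f1 V" "L1_curve T (\<lambda>z. signed_power \<alpha> (vb z)) V V0"
    "AE z\<in>?Q in lborel. (\<forall>i. A (fst z) (vb z) (\<chi> k. dv k z) $ i = av i z)"
    "AE x in lborel. V0 x = (if x \<in> \<Omega> then signed_power \<alpha> (v\<^sub>0 x) else 0)"
    by (rule solution_data[OF \<Omega> T \<alpha> p \<open>caratheodory \<Omega> A\<close> \<Lambda> \<open>integrable (lebesgue_on \<Omega>) b\<close> growth
        \<open>AE x in lebesgue_on \<Omega>. b x \<ge> 0\<close> f1(1) q f1(2,3) \<open>v\<^sub>0 \<in> Lp \<Omega> (\<alpha> + 1)\<close> \<open>cd_solution \<Omega> T \<alpha> p A f\<^sub>1 (\<lambda>_. 0) v\<^sub>0 v\<close>])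
  obtain wb dw aw W W0 where w: "slice_representative \<Omega> T p w wb dw"
    "evolution_data \<Omega> T p (\<lambda>z. signed_power \<alpha> (wb z)) aw f2 W" "L1_curve T (\<lambda>z. signed_power \<alpha> (wb z)) W W0"
    "AE z\<in>?Q in lborel. (\<forall>i. A (fst z) (wb z) (\<chi> k. dw k z) $ i = aw i z)"
    "AE x in lborel. W0 x = (if x \<in> \<Omega> then signed_power \<alpha> (w\<^sub>0 x) else 0)"
    by (rule solution_data[OF \<Omega> T \<alpha> p \<open>caratheodory \<Omega> A\<close> \<Lambda> \<open>integrable (lebesgue_on \<Omega>) b\<close> growth
        \<open>AE x in lebesgue_on \<Omega>. b x \<ge> 0\<close> f2(1) q f2(2,3) \<open>w\<^sub>0 \<in> Lp \<Omega> (\<alpha> + 1)\<close> \<open>cd_solution \<Omega> T \<alpha> p A f\<^sub>2 g w\<^sub>0 w\<close>])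
  obtain gb dg where g: "slice_representative \<Omega> T p g gb dg"
    by (rule Lp_W1p_representative[OF \<Omega> p \<open>g \<in> Lp_W1p \<Omega> T p\<close>])
  have vb: "vb \<in> Borel" and dv: "\<And>i. powr_integrable lborel (p i) (dv i)"
    and vz: "\<And>i z. z \<notin> ?Q ==> dv i z = 0" and ve: "AE z\<in>?Q in lborel. v z = vb z"
    using v(1) unfolding slice_representative_def by blast+
  have wb: "wb \<in> Borel" and dw: "\<And>i. powr_integrable lborel (p i) (dw i)"
    and wz: "\<And>i z. z \<notin> ?Q ==> dw i z = 0" and we: "AE z\<in>?Q in lborel. w z = wb z"
    using w(1) unfolding slice_representative_def by blast+
  have mono: "signed_power \<alpha> s \<le> signed_power \<alpha> t \<longleftrightarrow> s \<le> t" for s t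
    by (rule strict_mono_less_eq[OF signed_power_strict_mono[OF \<alpha>]])

  have "c \<in> borel_measurable (lebesgue_on \<Omega>)" using \<open>integrable (lebesgue_on \<Omega>) c\<close> by simp
  then obtain c' where c': "c' \<in> Borel" "\<And>x. x \<notin> \<Omega> ==> c' x = 0" "AE x\<in>\<Omega> in lborel. c x = c' x"
    by (rule borel_representative) (use \<Omega>m in auto)
  have ind: "(\<lambda>x. indicator \<Omega> x * c' x) = c'" using c'(2) by (auto simp: indicator_def fun_eq_iff)
  have c'i: "integrable lborel c'"
    using integrable_lebesgue_on_AE[OF c'(1) \<Omega>m c'(3)] \<open>integrable (lebesgue_on \<Omega>) c\<close> by (simp add: ind)
  let ?G = "dual_weight T p c' dv"

  have pv: "AE t\<in>{0<..<T} in lborel. approximable \<Omega> p (\<lambda>x. vb (x, t)) (\<lambda>i x. dv i (x, t))"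
    using slice_representative_approximable[OF \<Omega>(1) p v(1) zero_slice_representative[OF \<Omega>(1)]]
      \<open>cd_solution \<Omega> T \<alpha> p A f\<^sub>1 (\<lambda>_. 0) v\<^sub>0 v\<close> by (simp add: cd_solution_def)
  have "(\<lambda>z. w z - g z) \<in> Lp_W1p_o \<Omega> T p" using \<open>cd_solution \<Omega> T \<alpha> p A f\<^sub>2 g w\<^sub>0 w\<close> by (simp add: cd_solution_def)
  note pw = slice_representative_approximable[OF \<Omega>(1) p w(1) g this]
  note pg = boundary_slices[OF \<Omega>(1) \<open>g \<in> Lp_W1p \<Omega> T p\<close> g \<open>AE z in lebesgue_on ?Q. g z \<ge> 0\<close>]
  \<comment> \<open>\<open>N s\<close> collects what holds for the second solution and its boundary datum at almost every time.\<close>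
  define N where "N s \<longleftrightarrow> approximable \<Omega> p (\<lambda>x. wb (x, s) - gb (x, s)) (\<lambda>i x. dw i (x, s) - dg i (x, s)) \<and>
     integrable lborel (\<lambda>x. gb (x, s)) \<and> (AE x in lborel. gb (x, s) \<ge> 0) \<and>
     (\<forall>i. powr_integrable lborel (p i) (\<lambda>x. dg i (x, s)) \<and> weak_pair \<Omega> (axis i 1) (\<lambda>x. gb (x, s)) (\<lambda>x. dg i (x, s)))" for s
  have pN: "AE s\<in>{0<..<T} in lborel. N s" using pw pg by eventually_elim (simp add: N_def)
  have trunc: "bounded_approximable \<Omega> p (\<lambda>x. step ((vb (x, t) - wb (x, s)) / \<delta>))
         (\<lambda>i x. step' ((vb (x, t) - wb (x, s)) / \<delta>) / \<delta> * (dv i (x, t) - dw i (x, s)))"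
    if \<delta>: "\<delta> > 0" and t: "approximable \<Omega> p (\<lambda>x. vb (x, t)) (\<lambda>i x. dv i (x, t))" and s: "N s" for \<delta> s t
  proof -
    have N: "approximable \<Omega> p (\<lambda>x. wb (x, s) - gb (x, s)) (\<lambda>i x. dw i (x, s) - dg i (x, s))"
      "integrable lborel (\<lambda>x. gb (x, s))" "AE x in lborel. gb (x, s) \<ge> 0"
      "\<And>i. powr_integrable lborel (p i) (\<lambda>x. dg i (x, s))" "\<And>i. weak_pair \<Omega> (axis i 1) (\<lambda>x. gb (x, s)) (\<lambda>x. dg i (x, s))"
      using s unfolding N_def by blast+
    \<comment> \<open>The function \<open>v - (w - g)\<close> has zero boundary values, and subtracting \<open>g\<close> again gives \<open>v - w\<close>.\<close>
    show ?thesis using approximable_truncation[OF \<Omega>(1) p approximable_diff[OF p t N(1)] N(2-5) \<delta>] by simp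
  qed
  have appr: "AE s\<in>{0<..<T} in lborel. (AE t in lborel. t \<in> {0<..<T} -->
       bounded_approximable \<Omega> p (\<lambda>x. step ((vb (x, t) - wb (x, s)) / \<delta>))
         (\<lambda>i x. step' ((vb (x, t) - wb (x, s)) / \<delta>) / \<delta> * (dv i (x, t) - dw i (x, s))))" if \<delta>: "\<delta> > 0" for \<delta>
    using pN
  proof eventually_elim
    case (elim s)
    show ?case
    proof
      assume "s \<in> {0<..<T}"
      with elim have s: "N s" by blast
      show "AE t\<in>{0<..<T} in lborel. bounded_approximable \<Omega> p (\<lambda>x. step ((vb (x, t) - wb (x, s)) / \<delta>))
         (\<lambda>i x. step' ((vb (x, t) - wb (x, s)) / \<delta>) / \<delta> * (dv i (x, t) - dw i (x, s)))"
        using pv by eventually_elim (use trunc[OF \<delta> _ s] in blast)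
    qed
  qed
  have appr': "AE t\<in>{0<..<T} in lborel. (AE s in lborel. s \<in> {0<..<T} -->
       bounded_approximable \<Omega> p (\<lambda>x. step ((vb (x, t) - wb (x, s)) / \<delta>))
         (\<lambda>i x. step' ((vb (x, t) - wb (x, s)) / \<delta>) / \<delta> * (dv i (x, t) - dw i (x, s))))" if \<delta>: "\<delta> > 0" for \<delta>
    using pv
  proof eventually_elim
    case (elim t)
    show ?case
    proof
      assume "t \<in> {0<..<T}"
      with elim have t: "approximable \<Omega> p (\<lambda>x. vb (x, t)) (\<lambda>i x. dv i (x, t))" by blast
      show "AE s\<in>{0<..<T} in lborel. bounded_approximable \<Omega> p (\<lambda>x. step ((vb (x, t) - wb (x, s)) / \<delta>))
         (\<lambda>i x. step' ((vb (x, t) - wb (x, s)) / \<delta>) / \<delta> * (dv i (x, t) - dw i (x, s)))"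
        using pN by eventually_elim (use trunc[OF \<delta> t] in blast)
    qed
  qed

  have "AE x\<in>\<Omega> in lborel. c' x \<ge> 0 \<and>
       (\<forall>u\<^sub>1 u\<^sub>2 \<xi> i. \<bar>A x u\<^sub>1 \<xi> $ i - A x u\<^sub>2 \<xi> $ i\<bar>
             \<le> C * \<bar>u\<^sub>1 - u\<^sub>2\<bar> * (c' x + (\<Sum>k\<in>UNIV. \<bar>\<xi> $ k\<bar> powr p k)) powr ((p i - 1) / p i)) \<and>
       (\<forall>u \<xi> \<eta>. (A x u \<xi> - A x u \<eta>) \<bullet> (\<xi> - \<eta>) \<ge> 0)"
    using lipschitz[unfolded AE_lebesgue_on[OF \<Omega>m]] monotone[unfolded AE_lebesgue_on[OF \<Omega>m]]
      \<open>AE x in lebesgue_on \<Omega>. c x \<ge> 0\<close>[unfolded AE_lebesgue_on[OF \<Omega>m]] c'(3)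
    by eventually_elim auto
  from AE_fst[OF AE_fst[OF this, where 'b=real], where 'b=real] AE_fst[OF v(4), where 'b=real]
    AE_swap23[OF AE_fst[OF w(4), where 'b=real]]
  have str: "AE z in lborel. snd (fst z) \<in> {0<..<T} --> snd z \<in> {0<..<T} -->
       - (C * \<bar>vb (fst z) - wb (fst (swap23 z))\<bar> * (\<Sum>i\<in>UNIV. ?G i (fst z) * \<bar>dv i (fst z) - dw i (fst (swap23 z))\<bar>))
       \<le> (\<Sum>i\<in>UNIV. (av i (fst z) - aw i (fst (swap23 z))) * (dv i (fst z) - dw i (fst (swap23 z))))"
  proof eventually_elim
    case (elim z)
    let ?z = "fst z" and ?z' = "fst (swap23 z)"
    show ?case
    proof (intro impI)
      assume ts: "snd ?z \<in> {0<..<T}" "snd z \<in> {0<..<T}"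
      show "- (C * \<bar>vb ?z - wb ?z'\<bar> * (\<Sum>i\<in>UNIV. ?G i ?z * \<bar>dv i ?z - dw i ?z'\<bar>))
          \<le> (\<Sum>i\<in>UNIV. (av i ?z - aw i ?z') * (dv i ?z - dw i ?z'))"
      proof (cases "fst ?z \<in> \<Omega>")
        case True
        let ?x = "fst ?z"
        have x': "fst ?z' = ?x" and Q: "?z \<in> ?Q" "?z' \<in> ?Q" using True ts by (auto simp: mem_Times_iff fst_swap23)
        have av: "av i ?z = A ?x (vb ?z) (\<chi> k. dv k ?z) $ i" and aw: "aw i ?z' = A ?x (wb ?z') (\<chi> k. dw k ?z') $ i" for i
          using elim(2,3) Q x' by auto
        have lip: "\<bar>A ?x u1 \<xi> $ i - A ?x u2 \<xi> $ i\<bar> \<le> C * \<bar>u1 - u2\<bar> * (c' ?x + (\<Sum>k\<in>UNIV. \<bar>\<xi> $ k\<bar> powr p k)) powr ((p i - 1) / p i)"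
          and mon: "(A ?x u1 \<xi> - A ?x u1 \<eta>) \<bullet> (\<xi> - \<eta>) \<ge> 0" for u1 u2 \<xi> \<eta> i
          using elim(1) True by blast+
        have G: "?G i ?z = (c' ?x + (\<Sum>k\<in>UNIV. \<bar>(\<chi> k. dv k ?z) $ k\<bar> powr p k)) powr ((p i - 1) / p i)" for i
          using elim(1) True ts by (simp add: dual_weight_def)
        show ?thesis
          using structural_inequality[where A=A and x="?x" and C=C and c="c' ?x" and p=p and u="vb ?z" and u'="wb ?z'"
              and \<xi>="\<chi> k. dv k ?z" and \<eta>="\<chi> k. dw k ?z'", OF lip mon]
          unfolding av aw G by simp
      next
        case False
        then have "dv i ?z = 0" "dw i ?z' = 0" for i
          using vz[of ?z i] wz[of ?z' i] by (auto simp: mem_Times_iff fst_swap23)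
        then show ?thesis by simp
      qed
    qed
  qed
  have C: "C \<ge> 0" using \<open>C > 0\<close> by simp

  have init: "AE x in lborel. V0 x \<le> W0 x"
    using v(5) w(5) \<open>AE x in lebesgue_on \<Omega>. v\<^sub>0 x \<le> w\<^sub>0 x\<close>[unfolded AE_lebesgue_on[OF \<Omega>m]]
    by eventually_elim (auto simp: mono)
  have "AE t\<in>{0<..<T} in lborel. (AE x in lborel. signed_power \<alpha> (vb (x, t)) \<le> signed_power \<alpha> (wb (x, t)))"
    by (rule comparison_from_doubling[OF v(3) w(3) init
        doubling_limit[OF p v(2) w(2) \<alpha> refl refl vb wb dv dw f12 appr appr' dual_weight_powr_integrable[OF p c'i dv] dual_weight_nonneg C str]])
  then have sl: "AE t\<in>{0<..<T} in lborel. (AE x in lborel. vb (x, t) \<le> wb (x, t))" by (simp add: mono)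
  have z: "vb z = 0" "wb z = 0" if "z \<notin> ?Q" for z
    using v(1) w(1) that unfolding slice_representative_def by blast+
  have "AE t in lborel. AE x in lborel. vb (x, t) \<le> wb (x, t)"
    using sl
  proof eventually_elim
    case (elim t)
    show ?case
    proof (cases "t \<in> {0<..<T}")
      case False
      then have "vb (x, t) = 0" "wb (x, t) = 0" for x using z[of "(x, t)"] by auto
      then show ?thesis by simp
    qed (use elim in blast)
  qed
  from AE_of_slices[OF vb wb this] ve we have "AE z\<in>?Q in lborel. v z \<le> w z"
    by eventually_elim auto
  then show ?thesis by (simp add: AE_lebesgue_on[OF Qm])
qed

end
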